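(* Let $G$ be a countable group admitting a normal series $G=G_0\rhd G_1\rhd\cdots\rhd G_n=\{1_G\}$ such that each quotient of consecutive terms $G_k/G_{k+1}$ is a finite group, an increasing union of finite characteristic subgroups, or a torsion-free abelian group with finite $\mathbb{Q}$-rank, except that the top quotient $G_0/G_1$ can alternatively be any group of uniform local polynomial volume-growth or the lamplighter group $\mathbb{Z}_2\wr\mathbb{Z}$. If $X$ is a standard Borel space and $G\curvearrowright X$ is a free Borel action, then the orbit equivalence relation $E_G^X$ is hyperfinite.
   Context: A normal series of $G$ is a finite sequence as displayed of subgroups each of which is normal in $G$. The $\mathbb{Q}$-rank of an abelian group $A$ is $\dim_{\mathbb{Q}}(\mathbb{Q}\otimes A)$. A finitely generated group has polynomial volume-growth of degree $d$ if $d\in\mathbb{N}$ is least such that for any (equivalently every) finite symmetric generating set $B$ containing the identity there is $c>0$ with $|B^r|\le cr^d$ for all $r\ge1$. A group has uniform local polynomial volume-growth if there is $d\in\mathbb{N}$ such that every finitely generated subgroup has polynomial volume-growth of degree at most $d$. An action is free if $g\cdot x\ne x$ for all $x$ and all $g\ne1_G$. $E_G^X=\{(x,y)\in X\times X:\exists g\in G\ g\cdot x=y\}$. An equivalence relation on $X$ is Borel if it is a Borel subset of $X\times X$, finite if all its classes are finite, and hyperfinite if it is the union of an increasing sequence of finite Borel equivalence relations. *)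

theory Defs
  imports
    "HOL-Analysis.Analysis"
    "HOL-Algebra.Group_Action"
    "HOL-Algebra.Elementary_Groups"
    "HOL-Algebra.Free_Abelian_Groups"
    "HOL-Algebra.Product_Groups"
    "Jordan_Normal_Form.Missing_VectorSpace"
begin

hide_const (open) Multiset.mult

section \<open>Groups\<close>

text \<open>Inclusions need not be strict; the values \<open>N k\<close> for \<open>k > n\<close> are irrelevant.\<close>

definition normal_series :: "('g, 'm) monoid_scheme \<Rightarrow> nat \<Rightarrow> (nat \<Rightarrow> 'g set) \<Rightarrow> bool" where
  "normal_series G n N \<longleftrightarrow>
     N 0 = carrier G \<and> N n = {\<one>\<^bsub>G\<^esub>} \<and>
     (\<forall>k\<le>n. N k \<lhd> G) \<and> (\<forall>k<n. N (Suc k) \<subseteq> N k)"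

abbreviation series_factor ::
    "('g, 'm) monoid_scheme \<Rightarrow> (nat \<Rightarrow> 'g set) \<Rightarrow> nat \<Rightarrow> 'g set monoid" where
  "series_factor G N k \<equiv> (G\<lparr>carrier := N k\<rparr>) Mod (N (Suc k))"

definition characteristic_subgroup :: "'g set \<Rightarrow> ('g, 'm) monoid_scheme \<Rightarrow> bool" where
  "characteristic_subgroup K G \<longleftrightarrow> subgroup K G \<and> (\<forall>f\<in>iso G G. f ` K = K)"

definition incr_union_finite_characteristic :: "('g, 'm) monoid_scheme \<Rightarrow> bool" where
  "incr_union_finite_characteristic G \<longleftrightarrow>
     (\<exists>K :: nat \<Rightarrow> 'g set. incseq K \<and>
        (\<forall>i. finite (K i) \<and> characteristic_subgroup (K i) G) \<and> (\<Union>i. K i) = carrier G)"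

definition torsion_free :: "('g, 'm) monoid_scheme \<Rightarrow> bool" where
  "torsion_free G \<longleftrightarrow>
     (\<forall>g\<in>carrier G. \<forall>k::nat. k > 0 \<and> g [^]\<^bsub>G\<^esub> k = \<one>\<^bsub>G\<^esub> \<longrightarrow> g = \<one>\<^bsub>G\<^esub>)"

subsection \<open>Rational rank\<close>

text \<open>
  For an abelian group \<open>A\<close>, written multiplicatively, the rational vector space
  \<open>\<rat> \<otimes> A\<close> is the free abelian group on \<open>\<rat> \<times> A\<close> modulo the relations making the pairs
  bilinear; a rational \<open>q\<close> acts by \<open>(p, a) \<mapsto> (q p, a)\<close>.
\<close>

abbreviation rat_ring :: "rat ring" where
  "rat_ring \<equiv> \<lparr>carrier = UNIV, monoid.mult = (*), one = 1, zero = 0, add = (+)\<rparr>"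

abbreviation rat_tensor_free :: "('a, 'm) monoid_scheme \<Rightarrow> (rat \<times> 'a \<Rightarrow>\<^sub>0 int) monoid" where
  "rat_tensor_free A \<equiv> free_Abelian_group (UNIV \<times> carrier A)"

definition rat_tensor_rels :: "('a, 'm) monoid_scheme \<Rightarrow> (rat \<times> 'a \<Rightarrow>\<^sub>0 int) set" where
  "rat_tensor_rels A = generate (rat_tensor_free A)
     ({frag_of (p + q, a) - frag_of (p, a) - frag_of (q, a) | p q a. a \<in> carrier A} \<union>
      {frag_of (q, a \<otimes>\<^bsub>A\<^esub> b) - frag_of (q, a) - frag_of (q, b) | q a b.
         a \<in> carrier A \<and> b \<in> carrier A})"

definition rat_tensor_scale :: "rat \<Rightarrow> (rat \<times> 'a \<Rightarrow>\<^sub>0 int) \<Rightarrow> (rat \<times> 'a \<Rightarrow>\<^sub>0 int)" where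
  "rat_tensor_scale q = frag_extend (\<lambda>(p, a). frag_of (q * p, a))"

text \<open>A module record extends a ring record, but a module has no multiplication or unit.\<close>

definition rat_tensor ::
    "('a, 'm) monoid_scheme \<Rightarrow> (rat, (rat \<times> 'a \<Rightarrow>\<^sub>0 int) set) module" where
  "rat_tensor A =
     \<lparr>carrier = carrier (rat_tensor_free A Mod rat_tensor_rels A),
      monoid.mult = undefined, one = undefined,
      zero = \<one>\<^bsub>rat_tensor_free A Mod rat_tensor_rels A\<^esub>,
      add = (\<lambda>C D. C \<otimes>\<^bsub>rat_tensor_free A Mod rat_tensor_rels A\<^esub> D),
      smult = (\<lambda>q C. \<Union>x\<in>C. rat_tensor_rels A #>\<^bsub>rat_tensor_free A\<^esub> rat_tensor_scale q x)\<rparr>"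

definition finite_rat_rank :: "('a, 'm) monoid_scheme \<Rightarrow> bool" where
  "finite_rat_rank A \<longleftrightarrow> vectorspace.fin_dim rat_ring (rat_tensor A)"

lemma field_rat_ring: "field rat_ring"
proof (rule cring.cring_fieldI2)
  have "\<exists>y. y + x = 0" for x :: rat
    by (rule exI[of _ "- x"]) simp
  then show "cring rat_ring"
    by unfold_locales (auto simp: algebra_simps Units_def add_eq_0_iff)
next
  fix a assume "a \<in> carrier rat_ring" "a \<noteq> \<zero>\<^bsub>rat_ring\<^esub>"
  then show "\<exists>b\<in>carrier rat_ring. a \<otimes>\<^bsub>rat_ring\<^esub> b = \<one>\<^bsub>rat_ring\<^esub>"
    by (auto intro!: exI[of _ "inverse a"])
qed auto

lemma keys_rat_tensor_scale:
  assumes "Poly_Mapping.keys x \<subseteq> UNIV \<times> S"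
  shows "Poly_Mapping.keys (rat_tensor_scale q x) \<subseteq> UNIV \<times> S"
  using assms keys_frag_extend[of "\<lambda>(p, a). frag_of (q * p, a)" x]
  unfolding rat_tensor_scale_def by fastforce

lemma rat_tensor_scale_add: "rat_tensor_scale q (x + y) = rat_tensor_scale q x + rat_tensor_scale q y"
  by (simp add: rat_tensor_scale_def frag_extend_add)

lemma rat_tensor_scale_diff: "rat_tensor_scale q (x - y) = rat_tensor_scale q x - rat_tensor_scale q y"
  by (simp add: rat_tensor_scale_def frag_extend_diff)

lemma rat_tensor_scale_minus: "rat_tensor_scale q (- x) = - rat_tensor_scale q x"
  by (simp add: rat_tensor_scale_def frag_extend_minus)

lemma rat_tensor_scale_frag_of [simp]: "rat_tensor_scale q (frag_of (p, a)) = frag_of (q * p, a)"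
  by (simp add: rat_tensor_scale_def)

lemma rat_tensor_scale_one: "rat_tensor_scale 1 x = x"
  unfolding rat_tensor_scale_def by (simp add: frag_expansion[symmetric] case_prod_unfold)

lemma rat_tensor_scale_scale: "rat_tensor_scale p (rat_tensor_scale q x) = rat_tensor_scale (p * q) x"
proof (induction x rule: frag_induction[OF subset_UNIV])
  case 1 then show ?case by (simp add: rat_tensor_scale_def)
next
  case (2 x) then show ?case by (cases x rule: prod.exhaust) (simp add: mult.assoc)
next
  case (3 a b) then show ?case by (simp add: rat_tensor_scale_diff)
qed

context
  fixes A :: "('a, 'm) monoid_scheme"
  assumes A: "comm_group A"
begin

interpretation A: comm_group A by (rule A)

interpretation F: comm_group "rat_tensor_free A" by (rule abelian_free_Abelian_group)

lemma rat_tensor_rels_gens: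
  "{frag_of (p + q, a) - frag_of (p, a) - frag_of (q, a) | p q a. a \<in> carrier A} \<union>
   {frag_of (q, a \<otimes>\<^bsub>A\<^esub> b) - frag_of (q, a) - frag_of (q, b) | q a b. a \<in> carrier A \<and> b \<in> carrier A}
   \<subseteq> carrier (rat_tensor_free A)" (is "?G \<subseteq> _")
proof
  fix x assume "x \<in> ?G"
  moreover have "Poly_Mapping.keys (frag_of u - frag_of v - frag_of w) \<subseteq> {u, v, w}" for u v w :: "rat \<times> 'a"
    using keys_diff[of "frag_of u - frag_of v" "frag_of w"] keys_diff[of "frag_of u" "frag_of v"]
    by (auto simp: keys_frag_of)
  ultimately show "x \<in> carrier (rat_tensor_free A)"
    by (fastforce dest: subsetD)
qed

lemma rat_tensor_rels_subgroup: "subgroup (rat_tensor_rels A) (rat_tensor_free A)"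
  unfolding rat_tensor_rels_def by (rule F.generate_is_subgroup[OF rat_tensor_rels_gens])

lemma rat_tensor_rels_normal: "rat_tensor_rels A \<lhd> rat_tensor_free A"
  using rat_tensor_rels_subgroup by (rule F.subgroup_imp_normal)

interpretation R: normal "rat_tensor_rels A" "rat_tensor_free A" by (rule rat_tensor_rels_normal)

lemma rat_tensor_rels_simps:
  "0 \<in> rat_tensor_rels A"
  "x \<in> rat_tensor_rels A \<Longrightarrow> y \<in> rat_tensor_rels A \<Longrightarrow> x + y \<in> rat_tensor_rels A"
  "x \<in> rat_tensor_rels A \<Longrightarrow> - x \<in> rat_tensor_rels A"
  "x \<in> rat_tensor_rels A \<Longrightarrow> y \<in> rat_tensor_rels A \<Longrightarrow> x - y \<in> rat_tensor_rels A"
proof -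
  show 0: "0 \<in> rat_tensor_rels A" using R.one_closed by simp
  show 1: "x \<in> rat_tensor_rels A \<Longrightarrow> y \<in> rat_tensor_rels A \<Longrightarrow> x + y \<in> rat_tensor_rels A" for x y
    using R.m_closed[of x y] by simp
  show 2: "- x \<in> rat_tensor_rels A" if "x \<in> rat_tensor_rels A" for x
    using R.m_inv_closed[OF that] R.subset[THEN subsetD, OF that] by simp
  show "x \<in> rat_tensor_rels A \<Longrightarrow> y \<in> rat_tensor_rels A \<Longrightarrow> x - y \<in> rat_tensor_rels A"
    using 1[of x "- y"] 2[of y] by simp
qed

lemma rat_tensor_scale_rels:
  assumes "x \<in> rat_tensor_rels A"
  shows "rat_tensor_scale q x \<in> rat_tensor_rels A"
proof -
  have gen: "rat_tensor_scale s g \<in> rat_tensor_rels A" if g: "g \<in>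
     {frag_of (p + q, a) - frag_of (p, a) - frag_of (q, a) | p q a. a \<in> carrier A} \<union>
     {frag_of (q, a \<otimes>\<^bsub>A\<^esub> b) - frag_of (q, a) - frag_of (q, b) | q a b. a \<in> carrier A \<and> b \<in> carrier A}" for g s
  proof -
    from g consider
        p q a where "g = frag_of (p + q, a) - frag_of (p, a) - frag_of (q, a)" "a \<in> carrier A"
      | q a b where "g = frag_of (q, a \<otimes>\<^bsub>A\<^esub> b) - frag_of (q, a) - frag_of (q, b)"
          "a \<in> carrier A" "b \<in> carrier A"
      by blast
    then show ?thesis
    proof cases
      case (1 p q a)
      then have "rat_tensor_scale s g = frag_of (s * p + s * q, a) - frag_of (s * p, a) - frag_of (s * q, a)"
        by (simp only: rat_tensor_scale_diff rat_tensor_scale_frag_of distrib_left)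
      then show ?thesis unfolding rat_tensor_rels_def using 1(2) by (intro generate.incl) blast
    next
      case (2 q a b)
      then have "rat_tensor_scale s g = frag_of (s * q, a \<otimes>\<^bsub>A\<^esub> b) - frag_of (s * q, a) - frag_of (s * q, b)"
        by (simp only: rat_tensor_scale_diff rat_tensor_scale_frag_of)
      then show ?thesis unfolding rat_tensor_rels_def using 2(2,3) by (intro generate.incl) blast
    qed
  qed
  from assms show ?thesis
    unfolding rat_tensor_rels_def[of A]
  proof (induction rule: generate.induct)
    case one
    have "rat_tensor_scale q 0 = (0 :: rat \<times> 'a \<Rightarrow>\<^sub>0 int)" by (simp add: rat_tensor_scale_def)
    then show ?case
      using rat_tensor_rels_simps(1) by (simp only: rat_tensor_rels_def one_free_Abelian_group)
  next
    case (incl h)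
    from gen[OF this] show ?case unfolding rat_tensor_rels_def .
  next
    case (inv h)
    then have "h \<in> carrier (rat_tensor_free A)" by (rule rat_tensor_rels_gens[THEN subsetD])
    then have "inv\<^bsub>rat_tensor_free A\<^esub> h = - h" by simp
    moreover have "- rat_tensor_scale q h \<in> rat_tensor_rels A"
      by (rule rat_tensor_rels_simps(3)[OF gen[OF inv]])
    ultimately show ?case
      by (simp only: rat_tensor_scale_minus rat_tensor_rels_def)
  next
    case (eng x y)
    then show ?case
      using rat_tensor_rels_simps(2)[of "rat_tensor_scale q x" "rat_tensor_scale q y"]
      by (simp only: rat_tensor_scale_add rat_tensor_rels_def mult_free_Abelian_group)
  qed
qed

lemma rat_tensor_coset:
  "rat_tensor_rels A #>\<^bsub>rat_tensor_free A\<^esub> x = {h + x | h. h \<in> rat_tensor_rels A}"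
  by (auto simp: r_coset_def)

lemma rat_tensor_coset_eq:
  assumes "x - y \<in> rat_tensor_rels A"
  shows "rat_tensor_rels A #>\<^bsub>rat_tensor_free A\<^esub> x = rat_tensor_rels A #>\<^bsub>rat_tensor_free A\<^esub> y"
  unfolding rat_tensor_coset
proof safe
  fix h assume h: "h \<in> rat_tensor_rels A"
  show "\<exists>k. h + x = k + y \<and> k \<in> rat_tensor_rels A"
    using rat_tensor_rels_simps(2)[OF h assms] by (intro exI[of _ "h + (x - y)"]) simp
  show "\<exists>k. h + y = k + x \<and> k \<in> rat_tensor_rels A"
    using rat_tensor_rels_simps(4)[OF h assms] by (intro exI[of _ "h - (x - y)"]) simp
qed

lemma smult_rat_tensor_coset:
  "q \<odot>\<^bsub>rat_tensor A\<^esub> (rat_tensor_rels A #>\<^bsub>rat_tensor_free A\<^esub> x)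
     = rat_tensor_rels A #>\<^bsub>rat_tensor_free A\<^esub> rat_tensor_scale q x"
proof -
  have eq: "rat_tensor_rels A #>\<^bsub>rat_tensor_free A\<^esub> rat_tensor_scale q y
      = rat_tensor_rels A #>\<^bsub>rat_tensor_free A\<^esub> rat_tensor_scale q x"
    if "y \<in> rat_tensor_rels A #>\<^bsub>rat_tensor_free A\<^esub> x" for y
    using that rat_tensor_scale_rels
    by (intro rat_tensor_coset_eq) (auto simp: rat_tensor_coset rat_tensor_scale_add)
  have "x \<in> rat_tensor_rels A #>\<^bsub>rat_tensor_free A\<^esub> x"
    using rat_tensor_rels_simps(1) by (auto simp: rat_tensor_coset intro!: exI[of _ 0])
  then have "(\<Union>y\<in>rat_tensor_rels A #>\<^bsub>rat_tensor_free A\<^esub> x.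
       rat_tensor_rels A #>\<^bsub>rat_tensor_free A\<^esub> rat_tensor_scale q y)
     = rat_tensor_rels A #>\<^bsub>rat_tensor_free A\<^esub> rat_tensor_scale q x"
    using eq by blast
  then show ?thesis by (simp add: rat_tensor_def)
qed

lemma rat_tensor_scale_plus:
  assumes "Poly_Mapping.keys x \<subseteq> UNIV \<times> carrier A"
  shows "rat_tensor_scale (p + q) x - (rat_tensor_scale p x + rat_tensor_scale q x) \<in> rat_tensor_rels A"
  using assms
proof (induction x rule: frag_induction)
  case zero
  then show ?case by (simp add: rat_tensor_scale_def rat_tensor_rels_simps)
next
  case (one x)
  then obtain r a where x: "x = (r, a)" "a \<in> carrier A" by auto
  have "frag_of (p * r + q * r, a) - frag_of (p * r, a) - frag_of (q * r, a) \<in> rat_tensor_rels A"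
    unfolding rat_tensor_rels_def using x by (intro generate.incl) auto
  then show ?case using x by (simp add: distrib_right diff_diff_eq)
next
  case (diff x y)
  from rat_tensor_rels_simps(4)[OF this]
  show ?case by (simp add: rat_tensor_scale_diff algebra_simps)
qed

lemma rat_tensor_carrier:
  "C \<in> carrier (rat_tensor A) \<longleftrightarrow>
     (\<exists>x. Poly_Mapping.keys x \<subseteq> UNIV \<times> carrier A \<and> C = rat_tensor_rels A #>\<^bsub>rat_tensor_free A\<^esub> x)"
proof -
  have "carrier (rat_tensor A)
      = {C. \<exists>x\<in>carrier (rat_tensor_free A). C = rat_tensor_rels A #>\<^bsub>rat_tensor_free A\<^esub> x}"
    by (simp add: rat_tensor_def FactGroup_def RCOSETS_def set_eq_iff)
  then show ?thesis by (simp only: mem_Collect_eq Bex_def carrier_free_Abelian_group_iff)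
qed

lemma rat_tensor_add:
  assumes "Poly_Mapping.keys x \<subseteq> UNIV \<times> carrier A" "Poly_Mapping.keys y \<subseteq> UNIV \<times> carrier A"
  shows "(rat_tensor_rels A #>\<^bsub>rat_tensor_free A\<^esub> x) \<oplus>\<^bsub>rat_tensor A\<^esub> (rat_tensor_rels A #>\<^bsub>rat_tensor_free A\<^esub> y)
    = rat_tensor_rels A #>\<^bsub>rat_tensor_free A\<^esub> (x + y)"
  using R.rcos_sum[of x y] assms by (simp add: rat_tensor_def FactGroup_def)

lemma abelian_group_rat_tensor: "abelian_group (rat_tensor A)"
proof -
  interpret Q: comm_group "rat_tensor_free A Mod rat_tensor_rels A"
    using F.abelian_FactGroup[OF rat_tensor_rels_subgroup] .
  show ?thesis
  proof (rule abelian_groupI)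
    fix x assume "x \<in> carrier (rat_tensor A)"
    then show "\<exists>y\<in>carrier (rat_tensor A). y \<oplus>\<^bsub>rat_tensor A\<^esub> x = \<zero>\<^bsub>rat_tensor A\<^esub>"
      unfolding rat_tensor_def using Q.l_inv Q.inv_closed by fastforce
  qed (unfold rat_tensor_def, simp_all only: ring.simps partial_object.simps monoid.simps
        Q.m_closed Q.one_closed Q.m_ac Q.l_one Q.r_one)
qed

lemma vectorspace_rat_tensor: "vectorspace rat_ring (rat_tensor A)"
proof -
  have "cring rat_ring" using field_rat_ring by (simp add: field_def domain_def)
  then have "Module.module rat_ring (rat_tensor A)"
  proof (rule moduleI[OF _ abelian_group_rat_tensor])
    fix p q C assume C: "C \<in> carrier (rat_tensor A)"
    then obtain x where x: "Poly_Mapping.keys x \<subseteq> UNIV \<times> carrier A"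
      and Cx: "C = rat_tensor_rels A #>\<^bsub>rat_tensor_free A\<^esub> x"
      by (auto simp: rat_tensor_carrier)
    note k = keys_rat_tensor_scale[OF x]
    show "q \<odot>\<^bsub>rat_tensor A\<^esub> C \<in> carrier (rat_tensor A)"
      using k by (auto simp: Cx smult_rat_tensor_coset rat_tensor_carrier)
    show "(p \<oplus>\<^bsub>rat_ring\<^esub> q) \<odot>\<^bsub>rat_tensor A\<^esub> C = p \<odot>\<^bsub>rat_tensor A\<^esub> C \<oplus>\<^bsub>rat_tensor A\<^esub> q \<odot>\<^bsub>rat_tensor A\<^esub> C"
      using rat_tensor_coset_eq[OF rat_tensor_scale_plus[OF x]] k
      by (simp add: Cx smult_rat_tensor_coset rat_tensor_add)
    show "(p \<otimes>\<^bsub>rat_ring\<^esub> q) \<odot>\<^bsub>rat_tensor A\<^esub> C = p \<odot>\<^bsub>rat_tensor A\<^esub> (q \<odot>\<^bsub>rat_tensor A\<^esub> C)"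
      by (simp add: Cx smult_rat_tensor_coset rat_tensor_scale_scale)
    show "\<one>\<^bsub>rat_ring\<^esub> \<odot>\<^bsub>rat_tensor A\<^esub> C = C"
      by (simp add: Cx smult_rat_tensor_coset rat_tensor_scale_one)
    fix D assume "D \<in> carrier (rat_tensor A)"
    then obtain y where y: "Poly_Mapping.keys y \<subseteq> UNIV \<times> carrier A"
      and Dy: "D = rat_tensor_rels A #>\<^bsub>rat_tensor_free A\<^esub> y"
      by (auto simp: rat_tensor_carrier)
    show "q \<odot>\<^bsub>rat_tensor A\<^esub> (C \<oplus>\<^bsub>rat_tensor A\<^esub> D) = q \<odot>\<^bsub>rat_tensor A\<^esub> C \<oplus>\<^bsub>rat_tensor A\<^esub> q \<odot>\<^bsub>rat_tensor A\<^esub> D"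
      using k keys_rat_tensor_scale[OF y] x y
      by (simp add: Cx Dy smult_rat_tensor_coset rat_tensor_add rat_tensor_scale_add)
  qed
  then show ?thesis using field_rat_ring by (simp add: vectorspace_def)
qed

end

subsection \<open>Growth\<close>

primrec set_power :: "('g, 'm) monoid_scheme \<Rightarrow> 'g set \<Rightarrow> nat \<Rightarrow> 'g set" where
  "set_power G B 0 = {\<one>\<^bsub>G\<^esub>}"
| "set_power G B (Suc r) = set_power G B r <#>\<^bsub>G\<^esub> B"

definition finitely_generated :: "('g, 'm) monoid_scheme \<Rightarrow> bool" where
  "finitely_generated G \<longleftrightarrow> (\<exists>B. finite B \<and> B \<subseteq> carrier G \<and> generate G B = carrier G)"

text \<open>
  \<open>growth_bound G d\<close> asks for the bound for every finite symmetric generating set containing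
  the identity; for finitely generated \<open>G\<close> this is equivalent to asking it for one such set.
\<close>

definition growth_bound :: "('g, 'm) monoid_scheme \<Rightarrow> nat \<Rightarrow> bool" where
  "growth_bound G d \<longleftrightarrow>
     (\<forall>B. finite B \<and> B \<subseteq> carrier G \<and> \<one>\<^bsub>G\<^esub> \<in> B \<and> (\<forall>b\<in>B. inv\<^bsub>G\<^esub> b \<in> B) \<and> generate G B = carrier G \<longrightarrow>
        (\<exists>c::real. c > 0 \<and> (\<forall>r\<ge>1. real (card (set_power G B r)) \<le> c * real r ^ d)))"

definition polynomial_growth_degree :: "('g, 'm) monoid_scheme \<Rightarrow> nat \<Rightarrow> bool" where
  "polynomial_growth_degree G d \<longleftrightarrow>
     finitely_generated G \<and> growth_bound G d \<and> (\<forall>e. growth_bound G e \<longrightarrow> d \<le> e)"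

definition uniform_local_polynomial_growth :: "('g, 'm) monoid_scheme \<Rightarrow> bool" where
  "uniform_local_polynomial_growth G \<longleftrightarrow>
     (\<exists>d. \<forall>K. subgroup K G \<and> finitely_generated (G\<lparr>carrier := K\<rparr>) \<longrightarrow>
        (\<exists>e\<le>d. polynomial_growth_degree (G\<lparr>carrier := K\<rparr>) e))"

subsection \<open>The lamplighter group\<close>

text \<open>
  Elements are pairs of a finitely supported function \<open>f\<close> from \<open>B\<close> to \<open>A\<close> and an element of \<open>B\<close>,
  which acts on such functions by \<open>(b f) x = f (b\<^sup>-\<^sup>1 x)\<close>.
\<close>

definition restricted_wreath_product ::
    "('a, 'm) monoid_scheme \<Rightarrow> ('b, 'n) monoid_scheme \<Rightarrow> (('b \<Rightarrow> 'a) \<times> 'b) monoid" where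
  "restricted_wreath_product A B =
     \<lparr>carrier = carrier (sum_group (carrier B) (\<lambda>_. A)) \<times> carrier B,
      monoid.mult = (\<lambda>(f, b) (f', b').
        (f \<otimes>\<^bsub>sum_group (carrier B) (\<lambda>_. A)\<^esub> (\<lambda>x\<in>carrier B. f' (inv\<^bsub>B\<^esub> b \<otimes>\<^bsub>B\<^esub> x)), b \<otimes>\<^bsub>B\<^esub> b')),
      one = (\<one>\<^bsub>sum_group (carrier B) (\<lambda>_. A)\<^esub>, \<one>\<^bsub>B\<^esub>)\<rparr>"

definition lamplighter_group :: "((int \<Rightarrow> int) \<times> int) monoid" where
  "lamplighter_group = restricted_wreath_product (integer_mod_group 2) integer_group"

lemma group_restricted_wreath_product:
  fixes A :: "('a, 'm) monoid_scheme" and B :: "('b, 'n) monoid_scheme"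
  assumes A: "group A" and B: "group B"
  shows "group (restricted_wreath_product A B)"
proof -
  interpret A: group A by (rule A)
  interpret B: group B by (rule B)
  let ?S = "sum_group (carrier B) (\<lambda>_. A)"
  interpret S: group ?S using A by simp
  define sh where "sh b f = (\<lambda>x\<in>carrier B. f (inv\<^bsub>B\<^esub> b \<otimes>\<^bsub>B\<^esub> x))" for b and f :: "'b \<Rightarrow> 'a"
  have carr: "f \<in> carrier ?S \<longleftrightarrow> f \<in> carrier B \<rightarrow>\<^sub>E carrier A \<and> finite {x \<in> carrier B. f x \<noteq> \<one>\<^bsub>A\<^esub>}" for f
    by (simp add: carrier_sum_group A)
  have sh_closed: "sh b f \<in> carrier ?S" if b: "b \<in> carrier B" and f: "f \<in> carrier ?S" for b f
  proof -
    have "{x \<in> carrier B. sh b f x \<noteq> \<one>\<^bsub>A\<^esub>} \<subseteq> (\<lambda>y. b \<otimes>\<^bsub>B\<^esub> y) ` {x \<in> carrier B. f x \<noteq> \<one>\<^bsub>A\<^esub>}"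
    proof
      fix x assume "x \<in> {x \<in> carrier B. sh b f x \<noteq> \<one>\<^bsub>A\<^esub>}"
      then show "x \<in> (\<lambda>y. b \<otimes>\<^bsub>B\<^esub> y) ` {x \<in> carrier B. f x \<noteq> \<one>\<^bsub>A\<^esub>}"
        using b by (intro image_eqI[of _ _ "inv\<^bsub>B\<^esub> b \<otimes>\<^bsub>B\<^esub> x"]) (auto simp: sh_def B.m_assoc[symmetric])
    qed
    then have "finite {x \<in> carrier B. sh b f x \<noteq> \<one>\<^bsub>A\<^esub>}"
      by (rule finite_subset) (use f in \<open>simp add: carr\<close>)
    then show ?thesis using b f by (auto simp: carr sh_def)
  qed
  have sh_mult: "sh b (f \<otimes>\<^bsub>?S\<^esub> g) = sh b f \<otimes>\<^bsub>?S\<^esub> sh b g" if "b \<in> carrier B" for b f g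
    using that by (auto simp: sh_def)
  have sh_sh: "sh a (sh b f) = sh (a \<otimes>\<^bsub>B\<^esub> b) f" if "a \<in> carrier B" "b \<in> carrier B" for a b f
    using that by (auto simp: sh_def B.inv_mult_group B.m_assoc)
  have sh_one: "sh \<one>\<^bsub>B\<^esub> f = f" if "f \<in> carrier ?S" for f
    using that by (auto simp: sh_def carr intro!: ext)
  have sh_one': "sh b \<one>\<^bsub>?S\<^esub> = \<one>\<^bsub>?S\<^esub>" if "b \<in> carrier B" for b
    using that by (auto simp: sh_def)
  have W: "restricted_wreath_product A B = \<lparr>carrier = carrier ?S \<times> carrier B,
      monoid.mult = (\<lambda>(f, b) (f', b'). (f \<otimes>\<^bsub>?S\<^esub> sh b f', b \<otimes>\<^bsub>B\<^esub> b')), one = (\<one>\<^bsub>?S\<^esub>, \<one>\<^bsub>B\<^esub>)\<rparr>"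
    by (simp add: restricted_wreath_product_def sh_def)
  have m: "u \<otimes>\<^bsub>restricted_wreath_product A B\<^esub> v = (fst u \<otimes>\<^bsub>?S\<^esub> sh (snd u) (fst v), snd u \<otimes>\<^bsub>B\<^esub> snd v)" for u v
    by (simp add: W case_prod_unfold)
  have c: "u \<in> carrier (restricted_wreath_product A B) \<longleftrightarrow> fst u \<in> carrier ?S \<and> snd u \<in> carrier B" for u
    by (cases u) (simp add: W)
  have o: "\<one>\<^bsub>restricted_wreath_product A B\<^esub> = (\<one>\<^bsub>?S\<^esub>, \<one>\<^bsub>B\<^esub>)"
    by (simp add: W)
  note closed = S.m_closed sh_closed B.m_closed
  show ?thesis
  proof (rule groupI)
    fix u assume "u \<in> carrier (restricted_wreath_product A B)"
    then have u: "fst u \<in> carrier ?S" "snd u \<in> carrier B" by (simp_all only: c)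
    let ?v = "(sh (inv\<^bsub>B\<^esub> snd u) (inv\<^bsub>?S\<^esub> fst u), inv\<^bsub>B\<^esub> snd u)"
    have "sh (inv\<^bsub>B\<^esub> snd u) (inv\<^bsub>?S\<^esub> fst u) \<otimes>\<^bsub>?S\<^esub> sh (inv\<^bsub>B\<^esub> snd u) (fst u) = \<one>\<^bsub>?S\<^esub>"
      using u by (simp only: sh_mult[symmetric] S.l_inv sh_one' B.inv_closed)
    then have "?v \<otimes>\<^bsub>restricted_wreath_product A B\<^esub> u = \<one>\<^bsub>restricted_wreath_product A B\<^esub>"
      using u by (simp only: m o fst_conv snd_conv B.l_inv)
    moreover have "?v \<in> carrier (restricted_wreath_product A B)"
      using u by (simp only: c fst_conv snd_conv closed S.inv_closed B.inv_closed)
    ultimately show "\<exists>v\<in>carrier (restricted_wreath_product A B).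
        v \<otimes>\<^bsub>restricted_wreath_product A B\<^esub> u = \<one>\<^bsub>restricted_wreath_product A B\<^esub>"
      by blast
  qed (simp_all only: c m o fst_conv snd_conv closed S.one_closed B.one_closed S.m_assoc B.m_assoc
        sh_mult sh_sh sh_one S.l_one B.l_one prod.collapse simp_thms)
qed

lemma group_lamplighter_group: "group lamplighter_group"
  unfolding lamplighter_group_def by (rule group_restricted_wreath_product) auto

subsection \<open>Admissible factors\<close>

definition admissible_factor :: "('g, 'm) monoid_scheme \<Rightarrow> bool" where
  "admissible_factor Q \<longleftrightarrow>
     finite (carrier Q) \<or>
     incr_union_finite_characteristic Q \<or>
     (comm_group Q \<and> torsion_free Q \<and> finite_rat_rank Q)"

definition admissible_top_alternative :: "('g, 'm) monoid_scheme \<Rightarrow> bool" where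
  "admissible_top_alternative Q \<longleftrightarrow>
     uniform_local_polynomial_growth Q \<or> Q \<cong> lamplighter_group"

section \<open>Borel actions\<close>

text \<open>
  A measurable space is represented by a value of type \<open>measure\<close>; only its underlying set and
  its \<open>\<sigma>\<close>-algebra matter.
\<close>

definition standard_borel_space :: "'x measure \<Rightarrow> bool" where
  "standard_borel_space X \<longleftrightarrow>
     (\<exists>T. completely_metrizable_space T \<and> separable_space T \<and> topspace T = space X \<and>
        sets X = sigma_sets (topspace T) {U. openin T U})"

text \<open>The acting group carries the discrete \<open>\<sigma>\<close>-algebra.\<close>

definition borel_action ::
    "('g, 'm) monoid_scheme \<Rightarrow> 'x measure \<Rightarrow> ('g \<Rightarrow> 'x \<Rightarrow> 'x) \<Rightarrow> bool" where
  "borel_action G X \<phi> \<longleftrightarrow>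
     group_action G (space X) \<phi> \<and>
     (\<lambda>(g, x). \<phi> g x) \<in> count_space (carrier G) \<Otimes>\<^sub>M X \<rightarrow>\<^sub>M X"

definition free_action ::
    "('g, 'm) monoid_scheme \<Rightarrow> 'x set \<Rightarrow> ('g \<Rightarrow> 'x \<Rightarrow> 'x) \<Rightarrow> bool" where
  "free_action G S \<phi> \<longleftrightarrow> (\<forall>x\<in>S. \<forall>g\<in>carrier G. g \<noteq> \<one>\<^bsub>G\<^esub> \<longrightarrow> \<phi> g x \<noteq> x)"

definition orbit_equiv_rel ::
    "('g, 'm) monoid_scheme \<Rightarrow> 'x set \<Rightarrow> ('g \<Rightarrow> 'x \<Rightarrow> 'x) \<Rightarrow> ('x \<times> 'x) set" where
  "orbit_equiv_rel G S \<phi> = {(x, y) \<in> S \<times> S. \<exists>g\<in>carrier G. \<phi> g x = y}"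

definition finite_borel_equiv :: "'x measure \<Rightarrow> ('x \<times> 'x) set \<Rightarrow> bool" where
  "finite_borel_equiv X E \<longleftrightarrow>
     equiv (space X) E \<and> E \<in> sets (X \<Otimes>\<^sub>M X) \<and> (\<forall>C\<in>space X // E. finite C)"

definition hyperfinite :: "'x measure \<Rightarrow> ('x \<times> 'x) set \<Rightarrow> bool" where
  "hyperfinite X E \<longleftrightarrow>
     (\<exists>F :: nat \<Rightarrow> ('x \<times> 'x) set. incseq F \<and> (\<forall>i. finite_borel_equiv X (F i)) \<and> E = (\<Union>i. F i))"

end

theory Submission
  imports Defs
begin

text \<open>
  The orbit equivalence relation of a free Borel action is hyperfinite as soon as, for a constant
  \<open>C\<close> and for every finite \<open>B\<close>, there is a Borel map \<open>p\<close> that moves points inside their orbits by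
  boundedly many group elements and takes at most \<open>C\<close> values on each set \<open>B x\<close>. Composing such maps
  for rapidly growing \<open>B\<close> gives maps \<open>g n\<close> whose fibers are finite and grow with \<open>n\<close>, and every
  orbit splits into at most \<open>C\<close> classes of the relation ``\<open>g n x = g n y\<close> for some \<open>n\<close>''. A relation
  each class of which consists of finitely many classes of an increasing union of finite Borel relations of
  this kind is again such a union (\<open>hyperfinite_of_finite_rule_dimension\<close>).

  The maps \<open>p\<close> come from the group alone. A free Borel action carries, for each finite \<open>K\<close>, a Borel
  coloring with finitely many colors in which \<open>x\<close> and \<open>k x\<close> differ for \<open>1 \<noteq> k \<in> K\<close>. So it is enough to
  describe \<open>p\<close> as a rule that computes \<open>p x\<close> from the colors seen in a finite window around \<open>x\<close>; the
  rule is then a statement about proper colorings of the group acting on itself by translations, and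
  no measurability is left in it. A group that has such rules for all \<open>B\<close>, with one \<open>C\<close>, is said to
  have finite rule dimension.

  Finite rule dimension lifts from a quotient \<open>Q = G/H\<close> to \<open>G\<close> if the kernel \<open>H\<close> is the
  union of a directed family of lattices of one dimension \<open>d\<close>, or of finite groups, in a way
  compatible with conjugation by \<open>G\<close> (the locale \<open>tame_subgroup\<close>). Choose a maximal separated set of
  centers in \<open>G\<close> and around each center a box inside its \<open>H\<close>-coset; send \<open>w\<close> to the center \<open>cen w\<close>
  of one of the boxes that contain \<open>w\<close>. For a finite set \<open>T\<close> of representatives of cosets of \<open>H\<close> and
  a point \<open>z\<close>, the centers \<open>cen (t z)\<close>, \<open>t \<in> T\<close>, show what \<open>Q\<close> looks like from \<open>z\<close>: coloring the centers
  turns the pattern \<open>t \<mapsto> cen (t z)\<close> into a coloring of a window of \<open>Q\<close>, and the rule for \<open>Q\<close> picks one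
  of the cosets, hence one of the centers. Patterns change when \<open>z\<close> moves across the face of a box.
  Any \<open>d + 1\<close> of the functionals that define faces are linearly dependent, so the side lengths of the
  boxes can be chosen with no point close to more than \<open>d\<close> faces (\<open>general_position\<close>). Therefore at
  most \<open>2 ^ d\<close> patterns occur near each point, and a bounded move inside \<open>H\<close> leads to a point \<open>z\<close> away
  from all faces, whose pattern is unaffected by bounded motions. If \<open>C\<close> is the constant of \<open>Q\<close>,
  then \<open>2 ^ d * C\<close> works for \<open>G\<close> (\<open>cells\<close> and \<open>finite_rule_dimension_extension\<close>).

  Along the normal series this is applied to \<open>G/N (k + 1) \<rightarrow> G/N k\<close>. A torsion-free abelian group of
  finite rational rank is tame because finitely many rational coordinates embed it into a rational
  vector space, and an increasing union of finite characteristic subgroups is tame with \<open>d = 0\<close>.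
  The induction starts at the trivial group, at a group of uniform local polynomial growth, where a
  maximal separated set at a scale at which balls do not grow too much does everything, or at the
  lamplighter group, whose kernel over the integers is locally finite and tame although its finite
  subgroups are not invariant.
\<close>

section \<open>Local rules on colored groups\<close>

definition coloring :: "('g, 'm) monoid_scheme \<Rightarrow> 'g set \<Rightarrow> nat \<Rightarrow> ('g \<Rightarrow> nat) \<Rightarrow> bool" where
  "coloring G K J c \<longleftrightarrow>
     (\<forall>g\<in>carrier G. c g < J \<and> (\<forall>k\<in>K. k \<noteq> \<one>\<^bsub>G\<^esub> \<longrightarrow> c (k \<otimes>\<^bsub>G\<^esub> g) \<noteq> c g))"

text \<open>
  The value at \<open>x\<close> depends on the colors of the points \<open>t x\<close>, \<open>t\<close> in a fixed finite window, and
  neither on the coloring nor on \<open>x\<close> in any other way. Comparing two colorings at two points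
  expresses locality and equivariance at once, so a local map makes sense on every orbit of a free
  action that carries a coloring. The window may depend on \<open>K\<close> and \<open>J\<close>.
\<close>

definition local_map ::
    "('g, 'm) monoid_scheme \<Rightarrow> 'g set \<Rightarrow> nat \<Rightarrow> (('g \<Rightarrow> nat) \<Rightarrow> 'g \<Rightarrow> 'b) \<Rightarrow> bool" where
  "local_map G K J F \<longleftrightarrow>
     (\<exists>T. finite T \<and> T \<subseteq> carrier G \<and>
        (\<forall>c c' x x'. coloring G K J c \<longrightarrow> coloring G K J c' \<longrightarrow> x \<in> carrier G \<longrightarrow> x' \<in> carrier G \<longrightarrow>
           (\<forall>t\<in>T. c (t \<otimes>\<^bsub>G\<^esub> x) = c' (t \<otimes>\<^bsub>G\<^esub> x')) \<longrightarrow> F c x = F c' x'))"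

text \<open>
  The point \<open>P c x\<close> moves along with \<open>x\<close>, so it is the displacement \<open>P c x x\<^sup>-\<^sup>1\<close> that has to be
  local.
\<close>

definition coarse_rule ::
    "('g, 'm) monoid_scheme \<Rightarrow> 'g set \<Rightarrow> nat \<Rightarrow> 'g set \<Rightarrow> nat \<Rightarrow> (('g \<Rightarrow> nat) \<Rightarrow> 'g \<Rightarrow> 'g) \<Rightarrow> 'g set \<Rightarrow> bool" where
  "coarse_rule G B C K J P D \<longleftrightarrow>
     local_map G K J (\<lambda>c x. P c x \<otimes>\<^bsub>G\<^esub> inv\<^bsub>G\<^esub> x) \<and> finite D \<and> D \<subseteq> carrier G \<and>
     (\<forall>c x. coloring G K J c \<longrightarrow> x \<in> carrier G \<longrightarrow>
        P c x \<in> carrier G \<and> P c x \<otimes>\<^bsub>G\<^esub> inv\<^bsub>G\<^esub> x \<in> D \<and>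
        card (P c ` (\<lambda>b. b \<otimes>\<^bsub>G\<^esub> x) ` B) \<le> C)"

text \<open>
  The order of the quantifiers carries the content: \<open>C\<close> does not depend on the scale \<open>B\<close>, and the
  set \<open>K\<close> along which colorings have to be proper depends on \<open>B\<close> but not on the number \<open>J\<close> of
  colors, because a coloring of an action is found only after \<open>K\<close> is known.
\<close>

definition finite_rule_dimension :: "('g, 'm) monoid_scheme \<Rightarrow> bool" where
  "finite_rule_dimension G \<longleftrightarrow>
     (\<exists>C. \<forall>B. finite B \<longrightarrow> B \<subseteq> carrier G \<longrightarrow>
        (\<exists>K. finite K \<and> K \<subseteq> carrier G \<and> (\<forall>J. \<exists>P D. coarse_rule G B C K J P D)))"

lemma finite_rule_dimensionE:
  assumes "finite_rule_dimension G"
  obtains C where "\<And>B. finite B \<Longrightarrow> B \<subseteq> carrier G \<Longrightarrow>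
        \<exists>K. finite K \<and> K \<subseteq> carrier G \<and> (\<forall>J. \<exists>P D. coarse_rule G B C K J P D)"
  using assms unfolding finite_rule_dimension_def by blast

lemma coarse_ruleD:
  assumes "coarse_rule G B C K J P D"
  shows "local_map G K J (\<lambda>c x. P c x \<otimes>\<^bsub>G\<^esub> inv\<^bsub>G\<^esub> x)" "finite D" "D \<subseteq> carrier G"
    and "coloring G K J c \<Longrightarrow> x \<in> carrier G \<Longrightarrow> P c x \<in> carrier G"
    and "coloring G K J c \<Longrightarrow> x \<in> carrier G \<Longrightarrow> P c x \<otimes>\<^bsub>G\<^esub> inv\<^bsub>G\<^esub> x \<in> D"
    and "coloring G K J c \<Longrightarrow> x \<in> carrier G \<Longrightarrow> card (P c ` (\<lambda>b. b \<otimes>\<^bsub>G\<^esub> x) ` B) \<le> C"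
  using assms unfolding coarse_rule_def by simp_all

lemma coloring_less: "coloring G K J c \<Longrightarrow> x \<in> carrier G \<Longrightarrow> c x < J"
  by (simp add: coloring_def)

lemma coloring_neq:
  "coloring G K J c \<Longrightarrow> x \<in> carrier G \<Longrightarrow> k \<in> K \<Longrightarrow> k \<noteq> \<one>\<^bsub>G\<^esub> \<Longrightarrow> c (k \<otimes>\<^bsub>G\<^esub> x) \<noteq> c x"
  by (simp add: coloring_def)

lemma local_mapI:
  assumes "finite T" "T \<subseteq> carrier G"
    and "\<And>c c' x x'. coloring G K J c \<Longrightarrow> coloring G K J c' \<Longrightarrow> x \<in> carrier G \<Longrightarrow> x' \<in> carrier G \<Longrightarrow>
           (\<And>t. t \<in> T \<Longrightarrow> c (t \<otimes>\<^bsub>G\<^esub> x) = c' (t \<otimes>\<^bsub>G\<^esub> x')) \<Longrightarrow> F c x = F c' x'"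
  shows "local_map G K J F"
  unfolding local_map_def
proof (intro exI[of _ T] conjI allI impI)
  fix c c' x x'
  assume "coloring G K J c" "coloring G K J c'" "x \<in> carrier G" "x' \<in> carrier G"
    and eq: "\<forall>t\<in>T. c (t \<otimes>\<^bsub>G\<^esub> x) = c' (t \<otimes>\<^bsub>G\<^esub> x')"
  then show "F c x = F c' x'" by (intro assms(3)) simp_all
qed (fact assms)+

lemma local_mapE:
  assumes "local_map G K J F"
  obtains T where "finite T" "T \<subseteq> carrier G"
    and "\<And>c c' x x'. coloring G K J c \<Longrightarrow> coloring G K J c' \<Longrightarrow> x \<in> carrier G \<Longrightarrow> x' \<in> carrier G \<Longrightarrow>
           (\<And>t. t \<in> T \<Longrightarrow> c (t \<otimes>\<^bsub>G\<^esub> x) = c' (t \<otimes>\<^bsub>G\<^esub> x')) \<Longrightarrow> F c x = F c' x'"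
proof -
  from assms obtain T where T: "finite T" "T \<subseteq> carrier G"
    and *: "\<forall>c c' x x'. coloring G K J c \<longrightarrow> coloring G K J c' \<longrightarrow> x \<in> carrier G \<longrightarrow> x' \<in> carrier G \<longrightarrow>
           (\<forall>t\<in>T. c (t \<otimes>\<^bsub>G\<^esub> x) = c' (t \<otimes>\<^bsub>G\<^esub> x')) \<longrightarrow> F c x = F c' x'"
    unfolding local_map_def by (elim exE conjE)
  show ?thesis
  proof (rule that[OF T])
    fix c c' x x'
    assume "coloring G K J c" "coloring G K J c'" "x \<in> carrier G" "x' \<in> carrier G"
      and "\<And>t. t \<in> T \<Longrightarrow> c (t \<otimes>\<^bsub>G\<^esub> x) = c' (t \<otimes>\<^bsub>G\<^esub> x')"
    then show "F c x = F c' x'" by (intro *[rule_format]) simp_all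
  qed
qed

context group
begin

lemma inv_cancel:
  assumes "g \<in> carrier G" "x \<in> carrier G"
  shows "inv g \<otimes> (g \<otimes> x) = x" "g \<otimes> (inv g \<otimes> x) = x"
  using assms by (simp_all add: m_assoc[symmetric])

lemma local_color: "local_map G K J (\<lambda>c x. c x)"
  by (rule local_mapI[of "{\<one>}"]) auto

text \<open>
  The function \<open>H\<close> need not be an expression in the \<open>F i\<close>: it is enough that equal values of the
  \<open>F i\<close> force equal values of \<open>H\<close>, and properness of the colorings may be used for this.
\<close>

lemma local_determined:
  assumes I: "finite I" "\<And>i. i \<in> I \<Longrightarrow> local_map G K J (F i)"
    and det: "\<And>c c' x x'. coloring G K J c \<Longrightarrow> coloring G K J c' \<Longrightarrow> x \<in> carrier G \<Longrightarrow> x' \<in> carrier G \<Longrightarrow>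
           (\<And>i. i \<in> I \<Longrightarrow> F i c x = F i c' x') \<Longrightarrow> H c x = H c' x'"
  shows "local_map G K J H"
proof -
  have "\<forall>i\<in>I. \<exists>T. finite T \<and> T \<subseteq> carrier G \<and>
        (\<forall>c c' x x'. coloring G K J c \<longrightarrow> coloring G K J c' \<longrightarrow> x \<in> carrier G \<longrightarrow> x' \<in> carrier G \<longrightarrow>
           (\<forall>t\<in>T. c (t \<otimes> x) = c' (t \<otimes> x')) \<longrightarrow> F i c x = F i c' x')"
    using I(2) unfolding local_map_def by blast
  then obtain T where T: "\<And>i. i \<in> I \<Longrightarrow> finite (T i) \<and> T i \<subseteq> carrier G \<and>
        (\<forall>c c' x x'. coloring G K J c \<longrightarrow> coloring G K J c' \<longrightarrow> x \<in> carrier G \<longrightarrow> x' \<in> carrier G \<longrightarrow>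
           (\<forall>t\<in>T i. c (t \<otimes> x) = c' (t \<otimes> x')) \<longrightarrow> F i c x = F i c' x')"
    by (metis (no_types, lifting))
  show ?thesis
  proof (rule local_mapI[of "\<Union>i\<in>I. T i"])
    fix c c' x x'
    assume a: "coloring G K J c" "coloring G K J c'" "x \<in> carrier G" "x' \<in> carrier G"
      and eq: "\<And>t. t \<in> (\<Union>i\<in>I. T i) \<Longrightarrow> c (t \<otimes> x) = c' (t \<otimes> x')"
    have "F i c x = F i c' x'" if "i \<in> I" for i
    proof -
      have "\<forall>t\<in>T i. c (t \<otimes> x) = c' (t \<otimes> x')" using eq that by blast
      then show ?thesis using T[OF that] a by blast
    qed
    then show "H c x = H c' x'" by (rule det[OF a])
  qed (use T I(1) in auto)
qed

lemma local_translate: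
  assumes "local_map G K J F" and g: "g \<in> carrier G"
  shows "local_map G K J (\<lambda>c x. F c (g \<otimes> x))"
proof -
  from assms(1) obtain T where T: "finite T" "T \<subseteq> carrier G"
    and loc: "\<And>c c' x x'. coloring G K J c \<Longrightarrow> coloring G K J c' \<Longrightarrow> x \<in> carrier G \<Longrightarrow> x' \<in> carrier G \<Longrightarrow>
           (\<And>t. t \<in> T \<Longrightarrow> c (t \<otimes> x) = c' (t \<otimes> x')) \<Longrightarrow> F c x = F c' x'"
    by (erule local_mapE)
  show ?thesis
  proof (rule local_mapI[of "(\<lambda>t. t \<otimes> g) ` T"])
    fix c c' x x'
    assume a: "coloring G K J c" "coloring G K J c'" "x \<in> carrier G" "x' \<in> carrier G"
      and eq: "\<And>t. t \<in> (\<lambda>t. t \<otimes> g) ` T \<Longrightarrow> c (t \<otimes> x) = c' (t \<otimes> x')"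
    have "c (t \<otimes> (g \<otimes> x)) = c' (t \<otimes> (g \<otimes> x'))" if "t \<in> T" for t
    proof -
      have "t \<in> carrier G" using that T by auto
      then show ?thesis using eq[of "t \<otimes> g"] that a g by (simp add: m_assoc)
    qed
    then show "F c (g \<otimes> x) = F c' (g \<otimes> x')" using a g by (intro loc) auto
  qed (use T g in auto)
qed

lemma local_comp:
  assumes "local_map G K J F"
  shows "local_map G K J (\<lambda>c x. h (F c x))"
  by (rule local_determined[where I = "{()}" and F = "\<lambda>_. F"]) (use assms in auto)

lemma local_pair:
  assumes "local_map G K J F1" "local_map G K J F2"
  shows "local_map G K J (\<lambda>c x. (F1 c x, F2 c x))"
proof -
  from assms(1) obtain T1 where T1: "finite T1" "T1 \<subseteq> carrier G" "\<And>c c' x x'. coloring G K J c \<Longrightarrow> coloring G K J c' \<Longrightarrow>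
      x \<in> carrier G \<Longrightarrow> x' \<in> carrier G \<Longrightarrow> (\<And>t. t \<in> T1 \<Longrightarrow> c (t \<otimes> x) = c' (t \<otimes> x')) \<Longrightarrow> F1 c x = F1 c' x'"
    by (erule local_mapE)
  from assms(2) obtain T2 where T2: "finite T2" "T2 \<subseteq> carrier G" "\<And>c c' x x'. coloring G K J c \<Longrightarrow> coloring G K J c' \<Longrightarrow>
      x \<in> carrier G \<Longrightarrow> x' \<in> carrier G \<Longrightarrow> (\<And>t. t \<in> T2 \<Longrightarrow> c (t \<otimes> x) = c' (t \<otimes> x')) \<Longrightarrow> F2 c x = F2 c' x'"
    by (erule local_mapE)
  show ?thesis
  proof (rule local_mapI[of "T1 \<union> T2"])
    fix c c' x x'
    assume a: "coloring G K J c" "coloring G K J c'" "x \<in> carrier G" "x' \<in> carrier G"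
      and eq: "\<And>t. t \<in> T1 \<union> T2 \<Longrightarrow> c (t \<otimes> x) = c' (t \<otimes> x')"
    show "(F1 c x, F2 c x) = (F1 c' x', F2 c' x')" using T1(3)[OF a] T2(3)[OF a] eq by simp
  qed (use T1 T2 in auto)
qed

text \<open>
  Values \<open>v c x i\<close> for \<open>i < f\<close> are assigned at the stage \<open>c x * f + i\<close>, that is, color class by
  color class. The recipe \<open>S\<close> sees the values at the translates \<open>g x\<close>, \<open>g \<in> N\<close>, that belong to
  earlier stages, and \<open>None\<close> for the others. There are at most \<open>J * f\<close> stages, so a chain of
  dependencies stays within a product of boundedly many copies of \<open>N\<close>; this is why the result is
  local.
\<close>

lemma local_greedy:
  fixes S :: "('a \<Rightarrow> nat) \<Rightarrow> 'a \<Rightarrow> nat \<Rightarrow> ('a \<Rightarrow> nat \<Rightarrow> 'v option) \<Rightarrow> 'v"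
  assumes N: "finite N" "N \<subseteq> carrier G"
    and I: "finite I" "\<And>j. j \<in> I \<Longrightarrow> local_map G K J (F j)"
    and det: "\<And>c c' x x' i nb nb'. coloring G K J c \<Longrightarrow> coloring G K J c' \<Longrightarrow> x \<in> carrier G \<Longrightarrow>
           x' \<in> carrier G \<Longrightarrow> i < f \<Longrightarrow> (\<And>j. j \<in> I \<Longrightarrow> F j c x = F j c' x') \<Longrightarrow>
           (\<And>g i'. g \<in> N \<Longrightarrow> i' < f \<Longrightarrow> nb g i' = nb' g i') \<Longrightarrow> S c x i nb = S c' x' i nb'"
  obtains v :: "('a \<Rightarrow> nat) \<Rightarrow> 'a \<Rightarrow> nat \<Rightarrow> 'v" where
    "\<And>i. i < f \<Longrightarrow> local_map G K J (\<lambda>c x. v c x i)"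
    "\<And>c x i. v c x i = S c x i (\<lambda>g i'. if i' < f \<and> c (g \<otimes> x) * f + i' < c x * f + i
                                     then Some (v c (g \<otimes> x) i') else None)"
proof -
  define st where "st c = (\<lambda>(x :: 'a, i :: nat). (c x :: nat) * f + i)" for c
  define v where "v c x i = wfrec (Wellfounded.measure (st c)) (\<lambda>r (x, i). S c x i
      (\<lambda>g i'. if i' < f \<and> c (g \<otimes> x) * f + i' < c x * f + i then Some (r (g \<otimes> x, i')) else None)) (x, i)"
    for c x i
  have v_eq: "v c x i = S c x i (\<lambda>g i'. if i' < f \<and> c (g \<otimes> x) * f + i' < c x * f + i
                                     then Some (v c (g \<otimes> x) i') else None)" for c x i
    unfolding v_def
    apply (subst wfrec)
     apply simp
    apply (simp add: cut_apply st_def cong: if_cong)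
    done
  \<comment> \<open>one window serves all values assigned before stage \<open>n\<close>\<close>
  have ex: "\<exists>T. finite T \<and> T \<subseteq> carrier G \<and>
        (\<forall>c c' x x' i. coloring G K J c \<longrightarrow> coloring G K J c' \<longrightarrow> x \<in> carrier G \<longrightarrow> x' \<in> carrier G \<longrightarrow>
           i < f \<longrightarrow> c x * f + i < n \<longrightarrow>
           (\<forall>t\<in>T. c (t \<otimes> x) = c' (t \<otimes> x')) \<longrightarrow> v c x i = v c' x' i)" for n
  proof (induction n)
    case 0
    show ?case by (intro exI[of _ "{}"]) auto
  next
    case (Suc n)
    then obtain T where T: "finite T" "T \<subseteq> carrier G" and IH:
      "\<And>c c' x x' i. coloring G K J c \<Longrightarrow> coloring G K J c' \<Longrightarrow> x \<in> carrier G \<Longrightarrow> x' \<in> carrier G \<Longrightarrow>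
           i < f \<Longrightarrow> c x * f + i < n \<Longrightarrow>
           (\<forall>t\<in>T. c (t \<otimes> x) = c' (t \<otimes> x')) \<Longrightarrow> v c x i = v c' x' i"
      by blast
    have "local_map G K J (\<lambda>c x. restrict (\<lambda>j. F j c x) I)"
      by (rule local_determined[OF I]) (auto simp: restrict_def)
    then obtain T0 where T0: "finite T0" "T0 \<subseteq> carrier G"
      and loc: "\<And>c c' x x'. coloring G K J c \<Longrightarrow> coloring G K J c' \<Longrightarrow> x \<in> carrier G \<Longrightarrow> x' \<in> carrier G \<Longrightarrow>
         (\<And>t. t \<in> T0 \<Longrightarrow> c (t \<otimes> x) = c' (t \<otimes> x')) \<Longrightarrow>
         restrict (\<lambda>j. F j c x) I = restrict (\<lambda>j. F j c' x') I"
      by (erule local_mapE)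
    let ?T = "insert \<one> (T0 \<union> N \<union> (\<lambda>(t, g). t \<otimes> g) ` (T \<times> N))"
    show ?case
    proof (intro exI[of _ ?T] conjI allI impI)
      show "finite ?T" using T T0 N by simp
      show "?T \<subseteq> carrier G" using T T0 N by auto
      fix c c' x x' i
      assume a: "coloring G K J c" "coloring G K J c'" "x \<in> carrier G" "x' \<in> carrier G" "i < f"
        and n: "c x * f + i < Suc n" and eq: "\<forall>t\<in>?T. c (t \<otimes> x) = c' (t \<otimes> x')"
      have cx: "c x = c' x'" using eq a by force
      have cg: "c (g \<otimes> x) = c' (g \<otimes> x')" if "g \<in> N" for g using eq that by blast
      have vg: "v c (g \<otimes> x) i' = v c' (g \<otimes> x') i'"
        if g: "g \<in> N" "i' < f" "c (g \<otimes> x) * f + i' < c x * f + i" for g i'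
      proof (rule IH)
        have gc: "g \<in> carrier G" using g N by auto
        show "g \<otimes> x \<in> carrier G" "g \<otimes> x' \<in> carrier G" using gc a by auto
        show "c (g \<otimes> x) * f + i' < n" using g n by linarith
        show "\<forall>t\<in>T. c (t \<otimes> (g \<otimes> x)) = c' (t \<otimes> (g \<otimes> x'))"
        proof
          fix t assume t: "t \<in> T"
          then have "t \<otimes> g \<in> ?T" using g by auto
          then have "c (t \<otimes> g \<otimes> x) = c' (t \<otimes> g \<otimes> x')" using eq by blast
          moreover have "t \<in> carrier G" using t T by auto
          ultimately show "c (t \<otimes> (g \<otimes> x)) = c' (t \<otimes> (g \<otimes> x'))" using gc a by (simp add: m_assoc)
        qed
      qed (use a g in auto)
      have "restrict (\<lambda>j. F j c x) I = restrict (\<lambda>j. F j c' x') I"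
        using eq by (intro loc a) auto
      then have Fj: "F j c x = F j c' x'" if "j \<in> I" for j using that by (metis restrict_apply')
      show "v c x i = v c' x' i"
        unfolding v_eq[of c x i] v_eq[of c' x' i]
        by (rule det[OF a(1-5) Fj]) (auto simp: cg cx vg)
    qed
  qed
  have "local_map G K J (\<lambda>c x. v c x i)" if i: "i < f" for i
  proof -
    from ex[of "J * f"] obtain T where T: "finite T" "T \<subseteq> carrier G" and *:
      "\<And>c c' x x' i. coloring G K J c \<Longrightarrow> coloring G K J c' \<Longrightarrow> x \<in> carrier G \<Longrightarrow> x' \<in> carrier G \<Longrightarrow>
           i < f \<Longrightarrow> c x * f + i < J * f \<Longrightarrow>
           (\<forall>t\<in>T. c (t \<otimes> x) = c' (t \<otimes> x')) \<Longrightarrow> v c x i = v c' x' i"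
      by blast
    show ?thesis
    proof (rule local_mapI[OF T])
      fix c c' x x'
      assume a: "coloring G K J c" "coloring G K J c'" "x \<in> carrier G" "x' \<in> carrier G"
        and eq: "\<And>t. t \<in> T \<Longrightarrow> c (t \<otimes> x) = c' (t \<otimes> x')"
      have "Suc (c x) * f \<le> J * f" using coloring_less[OF a(1,3)] by (intro mult_right_mono) auto
      then have "c x * f + i < J * f" using i by simp
      then show "v c x i = v c' x' i" using eq a i by (intro *) auto
    qed
  qed
  from this v_eq show ?thesis by (rule that)
qed

text \<open>
  A point is taken when no neighbor of smaller color has been taken. Neighbors never share a
  color, so ties do not occur.
\<close>

lemma local_maximal_separated:
  assumes A: "finite A" "A \<subseteq> carrier G" "\<And>a. a \<in> A \<Longrightarrow> inv a \<in> A" and AK: "A \<subseteq> K"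
  obtains Y :: "('a \<Rightarrow> nat) \<Rightarrow> 'a \<Rightarrow> bool" where
    "local_map G K J Y"
    "\<And>c y a. coloring G K J c \<Longrightarrow> y \<in> carrier G \<Longrightarrow> a \<in> A \<Longrightarrow> Y c y \<Longrightarrow> Y c (a \<otimes> y) \<Longrightarrow> a = \<one>"
    "\<And>c x. coloring G K J c \<Longrightarrow> x \<in> carrier G \<Longrightarrow> \<exists>a\<in>insert \<one> A. Y c (a \<otimes> x)"
proof -
  obtain v where loc: "local_map G K J (\<lambda>c x. v c x (0::nat))"
    and v: "\<And>c x i. v c x i = (\<forall>a\<in>A - {\<one>}. (if 0 < (1::nat) \<and> c (a \<otimes> x) * 1 + 0 < c x * 1 + i
                                     then Some (v c (a \<otimes> x) 0) else None) \<noteq> Some True)"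
    by (rule local_greedy[where 'v = bool and N = A and I = "{}" and K = K and J = J and f = 1
          and S = "\<lambda>c x i nb. \<forall>a\<in>A - {\<one>}. nb a 0 \<noteq> Some True"])
      (use A in auto)
  have v: "v c x 0 \<longleftrightarrow> (\<forall>a\<in>A - {\<one>}. \<not> (c (a \<otimes> x) < c x \<and> v c (a \<otimes> x) 0))" for c x
    using v[of c x 0] by (simp split: if_splits)
  show ?thesis
  proof (rule that[OF loc])
    fix c y a
    assume c: "coloring G K J c" and y: "y \<in> carrier G" and a: "a \<in> A" and Y: "v c y 0" "v c (a \<otimes> y) 0"
    show "a = \<one>"
    proof (rule ccontr)
      assume a1: "a \<noteq> \<one>"
      have ac: "a \<in> carrier G" using a A by auto
      have "c (a \<otimes> y) \<noteq> c y" by (rule coloring_neq[OF c y _ a1]) (use a AK in auto)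
      then consider "c (a \<otimes> y) < c y" | "c y < c (a \<otimes> y)" by linarith
      then show False
      proof cases
        case 1
        then show False using Y a a1 v[of c y] by blast
      next
        case 2
        have "inv a \<in> A - {\<one>}" using A(3)[OF a] a1 ac inv_eq_1_iff by auto
        moreover have "inv a \<otimes> (a \<otimes> y) = y" using ac y by (simp add: m_assoc[symmetric])
        ultimately show False using Y 2 v[of c "a \<otimes> y"] by metis
      qed
    qed
  next
    fix c x
    assume c: "coloring G K J c" and x: "x \<in> carrier G"
    show "\<exists>a\<in>insert \<one> A. v c (a \<otimes> x) 0"
      using v[of c x] x by (cases "v c x 0") auto
  qed
qed

end

section \<open>Standard Borel spaces\<close>

text \<open>
  Balls of radius \<open>1 / (k + 1)\<close> around the points of a countable dense set.
\<close>

lemma standard_borel_separating: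
  fixes X :: "'x measure"
  assumes "standard_borel_space X"
  obtains A :: "nat \<Rightarrow> 'x set" where "\<And>n. A n \<in> sets X"
    and "\<And>x y. x \<in> space X \<Longrightarrow> y \<in> space X \<Longrightarrow> x \<noteq> y \<Longrightarrow> \<exists>n. (x \<in> A n) \<noteq> (y \<in> A n)"
proof -
  from assms obtain T where T: "completely_metrizable_space T" "separable_space T" "topspace T = space X"
    and sets: "sets X = sigma_sets (topspace T) {U. openin T U}"
    unfolding standard_borel_space_def by blast
  from T(1) have "metrizable_space T" by (rule completely_metrizable_imp_metrizable_space)
  then obtain M d where M: "Metric_space M d" and TM: "T = Metric_space.mtopology M d"
    unfolding metrizable_space_def by blast
  interpret Metric_space M d by (rule M)
  from T(2) obtain D where D: "countable D" "D \<subseteq> topspace T" "T closure_of D = topspace T"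
    unfolding separable_space_def by blast
  define \<B> where "\<B> = (\<lambda>(q, k). mball q (1 / real (Suc k))) ` (D \<times> (UNIV :: nat set))"
  have cB: "countable (insert {} \<B>)" unfolding \<B>_def using D(1) by (intro countable_insert countable_image countable_SIGMA) auto
  define A where "A = from_nat_into (insert {} \<B>)"
  have ran: "range A = insert {} \<B>" unfolding A_def by (rule range_from_nat_into) (use cB in auto)
  show ?thesis
  proof (rule that[of A])
    fix n
    have "A n \<in> insert {} \<B>" using ran by blast
    then have "openin T (A n)" unfolding \<B>_def TM by auto
    then show "A n \<in> sets X" unfolding sets by (intro sigma_sets.Basic) simp
  next
    fix x y
    assume xy: "x \<in> space X" "y \<in> space X" "x \<noteq> y"
    then have xM: "x \<in> M" "y \<in> M" using T(3) TM by auto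
    then have pos: "d x y > 0" using xy by (simp add: mdist_pos_eq)
    obtain k where k: "1 / real (Suc k) < d x y / 2"
      using pos by (metis half_gt_zero nat_approx_posE)
    have "x \<in> T closure_of D" using D T xy by simp
    moreover have "openin T (mball x (1 / real (Suc k)))" unfolding TM by simp
    moreover have "x \<in> mball x (1 / real (Suc k))" using xM by simp
    ultimately obtain q where q: "q \<in> D" "q \<in> mball x (1 / real (Suc k))"
      unfolding in_closure_of by blast
    have qM: "q \<in> M" using q by auto
    have x: "x \<in> mball q (1 / real (Suc k))" using q xM by (auto simp: commute)
    have "y \<notin> mball q (1 / real (Suc k))"
    proof
      assume "y \<in> mball q (1 / real (Suc k))"
      then have "d q y < d x y / 2" "d q x < d x y / 2" using x k by auto
      moreover have "d x y \<le> d x q + d q y" using xM qM by (intro triangle) auto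
      ultimately show False by (simp add: commute)
    qed
    moreover have "mball q (1 / real (Suc k)) \<in> range A"
      unfolding ran \<B>_def using q by (intro insertI2 image_eqI[of _ _ "(q, k)"]) auto
    ultimately show "\<exists>n. (x \<in> A n) \<noteq> (y \<in> A n)" using x by (metis rangeE)
  qed
qed

section \<open>Borel colorings\<close>

locale free_borel_action = group G for G :: "('g, 'm) monoid_scheme" (structure) +
  fixes X :: "'x measure" and \<phi> :: "'g \<Rightarrow> 'x \<Rightarrow> 'x"
  assumes cG: "countable (carrier G)"
    and sb: "standard_borel_space X" and ba: "borel_action G X \<phi>"
    and fa: "free_action G (space X) \<phi>"
begin

lemma group_action_phi: "group_action G (space X) \<phi>"
  using ba by (simp add: borel_action_def)

lemma phi_one: "x \<in> space X \<Longrightarrow> \<phi> \<one> x = x"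
  using group_action.id_eq_one[OF group_action_phi] by (metis restrict_apply')

lemma phi_mult:
  "g \<in> carrier G \<Longrightarrow> h \<in> carrier G \<Longrightarrow> x \<in> space X \<Longrightarrow> \<phi> (g \<otimes> h) x = \<phi> g (\<phi> h x)"
  by (rule group_action.composition_rule[OF group_action_phi])

lemma phi_space: "g \<in> carrier G \<Longrightarrow> x \<in> space X \<Longrightarrow> \<phi> g x \<in> space X"
  by (rule group_action.element_image[OF group_action_phi _ _ refl])

lemma phi_inv: "g \<in> carrier G \<Longrightarrow> x \<in> space X \<Longrightarrow> \<phi> (inv g) (\<phi> g x) = x"
  by (simp add: phi_mult[symmetric] phi_one)

lemma phi_free: "g \<in> carrier G \<Longrightarrow> x \<in> space X \<Longrightarrow> g \<noteq> \<one> \<Longrightarrow> \<phi> g x \<noteq> x"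
  using fa by (simp add: free_action_def)

lemma phi_measurable [measurable]: 
  assumes "g \<in> carrier G" shows "\<phi> g \<in> X \<rightarrow>\<^sub>M X"
proof -
  have "(\<lambda>(g, x). \<phi> g x) \<in> count_space (carrier G) \<Otimes>\<^sub>M X \<rightarrow>\<^sub>M X"
    using ba by (simp add: borel_action_def)
  moreover have "Pair g \<in> X \<rightarrow>\<^sub>M count_space (carrier G) \<Otimes>\<^sub>M X"
    using assms by (intro measurable_Pair1') simp
  ultimately have "(\<lambda>(g, x). \<phi> g x) \<circ> Pair g \<in> X \<rightarrow>\<^sub>M X" by (rule measurable_comp[rotated])
  then show ?thesis by (simp add: comp_def)
qed

lemma separating_sets:
  "\<exists>A :: nat \<Rightarrow> 'x set. (\<forall>n. A n \<in> sets X) \<and>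
     (\<forall>x\<in>space X. \<forall>y\<in>space X. x \<noteq> y \<longrightarrow> (\<exists>n. (x \<in> A n) \<noteq> (y \<in> A n)))"
proof (rule standard_borel_separating[OF sb])
  fix A :: "nat \<Rightarrow> 'x set"
  assume "\<And>n. A n \<in> sets X"
    and "\<And>x y. x \<in> space X \<Longrightarrow> y \<in> space X \<Longrightarrow> x \<noteq> y \<Longrightarrow> \<exists>n. (x \<in> A n) \<noteq> (y \<in> A n)"
  then show ?thesis by (intro exI[of _ A]) simp
qed

text \<open>
  A countable separating family turns equality into a countable conjunction of equivalences of
  events.
\<close>

lemma eq_measurable:
  assumes [measurable]: "f \<in> M \<rightarrow>\<^sub>M X" "h \<in> M \<rightarrow>\<^sub>M X"
  shows "{x \<in> space M. f x = h x} \<in> sets M"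
proof -
  obtain A :: "nat \<Rightarrow> 'x set" where *: "(\<forall>n. A n \<in> sets X) \<and>
     (\<forall>x\<in>space X. \<forall>y\<in>space X. x \<noteq> y \<longrightarrow> (\<exists>n. (x \<in> A n) \<noteq> (y \<in> A n)))"
    using separating_sets ..
  have A [measurable]: "A n \<in> sets X" for n using * by simp
  have sep: "\<exists>n. (x \<in> A n) \<noteq> (y \<in> A n)" if "x \<in> space X" "y \<in> space X" "x \<noteq> y" for x y
    using * that by simp
  have "f x = h x \<longleftrightarrow> (\<forall>n. (f x \<in> A n) = (h x \<in> A n))" if "x \<in> space M" for x
    using sep[OF assms[THEN measurable_space, OF that]] by (cases "f x = h x") auto
  then have "{x \<in> space M. f x = h x} = {x \<in> space M. \<forall>n. (f x \<in> A n) = (h x \<in> A n)}"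
    by auto
  also have "\<dots> \<in> sets M" by measurable
  finally show ?thesis .
qed

text \<open>
  The color of \<open>x\<close> records which of the first \<open>N x\<close> separating sets contain \<open>x\<close>, where \<open>N x\<close> is
  the least number for which these sets tell \<open>x\<close> from each \<open>k x\<close>; freeness makes \<open>N x\<close> exist.
\<close>

lemma countable_borel_coloring:
  assumes K: "finite K" "K \<subseteq> carrier G"
  obtains n :: "'x \<Rightarrow> nat" where "\<And>m. {x \<in> space X. n x = m} \<in> sets X"
    and "\<And>x k. x \<in> space X \<Longrightarrow> k \<in> K \<Longrightarrow> k \<noteq> \<one> \<Longrightarrow> n (\<phi> k x) \<noteq> n x"
proof -
  obtain A :: "nat \<Rightarrow> 'x set" where *: "(\<forall>n. A n \<in> sets X) \<and>
     (\<forall>x\<in>space X. \<forall>y\<in>space X. x \<noteq> y \<longrightarrow> (\<exists>n. (x \<in> A n) \<noteq> (y \<in> A n)))"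
    using separating_sets ..
  have A [measurable]: "A n \<in> sets X" for n using * by simp
  have sep: "\<exists>n. (x \<in> A n) \<noteq> (y \<in> A n)" if "x \<in> space X" "y \<in> space X" "x \<noteq> y" for x y
    using * that by simp
  define P where "P N x \<longleftrightarrow> (\<forall>k\<in>K - {\<one>}. \<exists>i<N. (x \<in> A i) \<noteq> (\<phi> k x \<in> A i))" for N x
  have Pm: "Measurable.pred X (P N)" for N
  proof -
    have "Measurable.pred X (\<lambda>x. \<exists>i<N. (x \<in> A i) \<noteq> (\<phi> k x \<in> A i))" if "k \<in> K - {\<one>}" for k
    proof -
      have [measurable]: "\<phi> k \<in> X \<rightarrow>\<^sub>M X" using that K by (intro phi_measurable) auto
      show ?thesis by measurable
    qed
    then show ?thesis unfolding P_def using K(1) by (intro pred_intros_finite(3) finite_Diff)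
  qed
  have ex: "\<exists>N. P N x" if x: "x \<in> space X" for x
  proof -
    have "\<exists>i. (x \<in> A i) \<noteq> (\<phi> k x \<in> A i)" if "k \<in> K - {\<one>}" for k
    proof -
      have k: "k \<in> carrier G" "k \<noteq> \<one>" using that K by auto
      show ?thesis by (rule sep[OF x phi_space[OF k(1) x] phi_free[OF k(1) x k(2), THEN not_sym]])
    qed
    then obtain i where i: "\<And>k. k \<in> K - {\<one>} \<Longrightarrow> (x \<in> A (i k)) \<noteq> (\<phi> k x \<in> A (i k))" by metis
    have "P (Suc (Max (i ` K))) x" unfolding P_def
      using i K by (auto intro!: exI[of _ "i _"] simp: less_Suc_eq_le)
    then show ?thesis ..
  qed
  define N where "N x = (LEAST N. P N x)" for x
  define n where "n x = prod_encode (N x, set_encode {i. i < N x \<and> x \<in> A i})" for x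
  show ?thesis
  proof (rule that[of n])
    fix m
    obtain a b where ab: "prod_decode m = (a, b)" by fastforce
    have set_eq: "S = {i. i < a \<and> x \<in> A i} \<longleftrightarrow> (\<forall>i<a. x \<in> A i \<longleftrightarrow> i \<in> S)" if "S \<subseteq> {..<a}" for S x
      using that by auto
    have "n x = m \<longleftrightarrow> N x = a \<and> (\<exists>S\<in>{S. S \<subseteq> {..<a} \<and> set_encode S = b}. (\<forall>i<a. x \<in> A i \<longleftrightarrow> i \<in> S))" for x
    proof -
      have "n x = m \<longleftrightarrow> prod_decode (n x) = prod_decode m"
        by (metis prod_decode_inverse)
      also have "\<dots> \<longleftrightarrow> N x = a \<and> set_encode {i. i < a \<and> x \<in> A i} = b"
        unfolding n_def ab prod_encode_inverse by (auto simp: prod_eq_iff)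
      also have "\<dots> \<longleftrightarrow> N x = a \<and> (\<exists>S\<in>{S. S \<subseteq> {..<a} \<and> set_encode S = b}. S = {i. i < a \<and> x \<in> A i})"
        by (auto simp: subset_eq)
      also have "(\<exists>S\<in>{S. S \<subseteq> {..<a} \<and> set_encode S = b}. S = {i. i < a \<and> x \<in> A i}) \<longleftrightarrow>
          (\<exists>S\<in>{S. S \<subseteq> {..<a} \<and> set_encode S = b}. (\<forall>i<a. x \<in> A i \<longleftrightarrow> i \<in> S))"
        by (intro bex_cong refl set_eq) simp
      finally show ?thesis .
    qed
    then have eq: "{x \<in> space X. n x = m} = {x \<in> space X. N x = a \<and>
        (\<exists>S\<in>{S. S \<subseteq> {..<a} \<and> set_encode S = b}. (\<forall>i<a. x \<in> A i \<longleftrightarrow> i \<in> S))}"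
      by (simp only:)
    have Nm [measurable]: "N \<in> X \<rightarrow>\<^sub>M count_space UNIV"
      unfolding N_def using Pm by measurable
    have fin: "finite {S. S \<subseteq> {..<a} \<and> set_encode S = b}" by (rule finite_subset[of _ "Pow {..<a}"]) auto
    have "Measurable.pred X (\<lambda>x. N x = a \<and>
        (\<exists>S\<in>{S. S \<subseteq> {..<a} \<and> set_encode S = b}. (\<forall>i<a. x \<in> A i \<longleftrightarrow> i \<in> S)))"
      using fin by measurable
    then show "{x \<in> space X. n x = m} \<in> sets X" unfolding eq by (simp add: pred_def)
  next
    fix x k
    assume x: "x \<in> space X" and k: "k \<in> K" "k \<noteq> \<one>"
    show "n (\<phi> k x) \<noteq> n x"
    proof
      assume "n (\<phi> k x) = n x"
      then have N: "N (\<phi> k x) = N x"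
        and "set_encode {i. i < N (\<phi> k x) \<and> \<phi> k x \<in> A i} = set_encode {i. i < N x \<and> x \<in> A i}"
        by (auto simp: n_def)
      then have S: "{i. i < N (\<phi> k x) \<and> \<phi> k x \<in> A i} = {i. i < N x \<and> x \<in> A i}"
        by (subst (asm) set_encode_eq) auto
      have "P (N x) x" unfolding N_def using ex[OF x] by (rule LeastI_ex)
      then obtain i where "i < N x" "(x \<in> A i) \<noteq> (\<phi> k x \<in> A i)" unfolding P_def using k by blast
      then show False using S N by auto
    qed
  qed
qed

end

text \<open>
  First fit in the order of \<open>n\<close>: a point with at most \<open>m\<close> neighbors finds one of \<open>m + 1\<close> colors
  free.
\<close>

lemma greedy_coloring:
  fixes n :: "'x \<Rightarrow> nat" and Nb :: "'x \<Rightarrow> 'x set"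
  assumes "\<And>x. finite (Nb x)" and "\<And>x. card (Nb x) \<le> m"
  obtains c :: "'x \<Rightarrow> nat" where "\<And>x. c x \<le> m"
    "\<And>x. c x = (LEAST k. k \<notin> c ` {y \<in> Nb x. n y < n x})"
    "\<And>x y. y \<in> Nb x \<Longrightarrow> n y < n x \<Longrightarrow> c y \<noteq> c x"
proof -
  define c :: "'x \<Rightarrow> nat" where "c = wfrec (Wellfounded.measure n) (\<lambda>r x. LEAST k. k \<notin> r ` {y \<in> Nb x. n y < n x})"
  have c: "c x = (LEAST k. k \<notin> c ` {y \<in> Nb x. n y < n x})" for x
  proof -
    have "c x = (LEAST k. k \<notin> cut c (Wellfounded.measure n) x ` {y \<in> Nb x. n y < n x})"
      unfolding c_def by (subst wfrec) simp_all
    moreover have "cut c (Wellfounded.measure n) x ` {y \<in> Nb x. n y < n x} = c ` {y \<in> Nb x. n y < n x}"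
      by (intro image_cong refl) (simp add: cut_apply)
    ultimately show ?thesis by simp
  qed
  have ex: "\<exists>k\<le>m. k \<notin> c ` {y \<in> Nb x. n y < n x}" for x
  proof (rule ccontr)
    assume "\<not> ?thesis"
    then have "{..m} \<subseteq> c ` {y \<in> Nb x. n y < n x}" by auto
    then have "card {..m} \<le> card {y \<in> Nb x. n y < n x}"
      using assms(1)[of x] by (intro surj_card_le) auto
    also have "\<dots> \<le> card (Nb x)" using assms(1) by (intro card_mono) auto
    finally show False using assms(2)[of x] by simp
  qed
  show ?thesis
  proof (rule that[OF _ c])
    show "c x \<le> m" for x using ex[of x] unfolding c[of x] by (meson Least_le le_trans)
    show "c y \<noteq> c x" if "y \<in> Nb x" "n y < n x" for x y
    proof -
      have "c x \<notin> c ` {y \<in> Nb x. n y < n x}" 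
        using ex[of x] unfolding c[of x] by (metis (mono_tags, lifting) LeastI)
      then show ?thesis using that by (metis (mono_tags, lifting) imageI mem_Collect_eq)
    qed
  qed
qed

context free_borel_action begin

text \<open>
  A countable coloring serves as the order for a first-fit coloring. Whether first fit gives \<open>x\<close>
  the color \<open>m\<close> depends only on neighbors of smaller countable color, so the color classes are
  Borel by induction on the countable color.
\<close>

lemma finite_borel_coloring:
  assumes K: "finite K" "K \<subseteq> carrier G"
  obtains J and c :: "'x \<Rightarrow> nat" where "\<And>m. {x \<in> space X. c x = m} \<in> sets X"
    and "\<And>x. x \<in> space X \<Longrightarrow> coloring G K J (\<lambda>g. c (\<phi> g x))"
proof -
  define K' where "K' = (K \<union> m_inv G ` K) - {\<one>}"
  have K': "finite K'" "K' \<subseteq> carrier G" using K by (auto simp: K'_def)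
  obtain n :: "'x \<Rightarrow> nat" where n: "\<And>m. {x \<in> space X. n x = m} \<in> sets X"
    and nneq: "\<And>x k. x \<in> space X \<Longrightarrow> k \<in> K' \<Longrightarrow> k \<noteq> \<one> \<Longrightarrow> n (\<phi> k x) \<noteq> n x"
    by (rule countable_borel_coloring[OF K']) (rule that)
  obtain c :: "'x \<Rightarrow> nat" where c: "\<And>x. c x \<le> card K'"
    "\<And>x. c x = (LEAST k. k \<notin> c ` {y \<in> (\<lambda>k. \<phi> k x) ` K'. n y < n x})"
    "\<And>x y. y \<in> (\<lambda>k. \<phi> k x) ` K' \<Longrightarrow> n y < n x \<Longrightarrow> c y \<noteq> c x"
    by (rule greedy_coloring[of "\<lambda>x. (\<lambda>k. \<phi> k x) ` K'" "card K'" n]) (rule finite_imageI[OF K'(1)], rule card_image_le[OF K'(1)], rule that)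
  show ?thesis
  proof (rule that[of c "Suc (card K')"])
    have meas: "{x \<in> space X. n x = i \<and> c x = m} \<in> sets X" for i m
    proof (induction i arbitrary: m rule: less_induct)
      case (less i)
      define Q where "Q m x \<longleftrightarrow> (\<exists>k\<in>K'. \<exists>j\<in>{..<i}. \<phi> k x \<in> {x \<in> space X. n x = j \<and> c x = m})" for m x
      have Qm: "Measurable.pred X (Q m)" for m
      proof -
        have "Measurable.pred X (\<lambda>x. \<phi> k x \<in> {x \<in> space X. n x = j \<and> c x = m})" if "k \<in> K'" "j < i" for k j
        proof -
          have "\<phi> k \<in> X \<rightarrow>\<^sub>M X" using that(1) K' by (intro phi_measurable) auto
          then show ?thesis by (rule pred_sets2[OF less[OF that(2)]])
        qed
        then have "Measurable.pred X (\<lambda>x. \<exists>j\<in>{..<i}. \<phi> k x \<in> {x \<in> space X. n x = j \<and> c x = m})" if "k \<in> K'" for k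
          using that by (intro pred_intros_finite(4)) simp_all
        then show ?thesis unfolding Q_def using K'
          by (intro pred_intros_finite(4)[OF K'(1)])
      qed
      have "(n x = i \<and> c x = m) \<longleftrightarrow> n x = i \<and> \<not> Q m x \<and> (\<forall>m'<m. Q m' x)" if x: "x \<in> space X" for x
      proof (cases "n x = i")
        case True
        have Q: "Q m' x \<longleftrightarrow> m' \<in> c ` {y \<in> (\<lambda>k. \<phi> k x) ` K'. n y < n x}" for m'
          unfolding Q_def True using x K'(2) by (fastforce intro: phi_space)
        have "c x = (LEAST k. \<not> Q k x)" unfolding Q by (rule c(2))
        moreover have "\<exists>k. \<not> Q k x"
          using infinite_nat_iff_unbounded ex_new_if_finite[OF infinite_UNIV_nat, of "c ` {y \<in> (\<lambda>k. \<phi> k x) ` K'. n y < n x}"] K'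
          unfolding Q by auto
        ultimately have "\<not> Q (c x) x" "\<forall>m'<c x. Q m' x"
          by (metis (mono_tags, lifting) LeastI_ex, metis (mono_tags, lifting) not_less_Least)
        then show ?thesis using True by (metis nat_neq_iff)
      qed simp
      then have "{x \<in> space X. n x = i \<and> c x = m} = {x \<in> space X. n x = i \<and> \<not> Q m x \<and> (\<forall>m'<m. Q m' x)}" by auto
      also have "\<dots> \<in> sets X"
      proof -
        note [measurable] = Qm
        have [measurable]: "Measurable.pred X (\<lambda>x. n x = i)" using n[of i] by (simp add: pred_def)
        show ?thesis by measurable
      qed
      finally show ?case .
    qed
    have "{x \<in> space X. c x = m} = (\<Union>i. {x \<in> space X. n x = i \<and> c x = m})" for m by auto
    also have "\<dots> m \<in> sets X" for m using meas by (intro sets.countable_UN) auto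
    finally show "{x \<in> space X. c x = m} \<in> sets X" for m .
    fix x assume x: "x \<in> space X"
    show "coloring G K (Suc (card K')) (\<lambda>g. c (\<phi> g x))"
      unfolding coloring_def
    proof (intro ballI conjI impI)
      fix g assume g: "g \<in> carrier G"
      show "c (\<phi> g x) < Suc (card K')" using c(1) by (simp add: less_Suc_eq_le)
      fix k assume k: "k \<in> K" "k \<noteq> \<one>"
      then have kc: "k \<in> carrier G" using K by auto
      define y where "y = \<phi> g x"
      have y: "y \<in> space X" using g x by (simp add: y_def phi_space)
      have kK: "k \<in> K'" "inv k \<in> K'" using k kc by (auto simp: K'_def inv_eq_1_iff)
      have "n (\<phi> k y) \<noteq> n y" using nneq[OF y kK(1) k(2)] .
      then consider "n (\<phi> k y) < n y" | "n y < n (\<phi> k y)" by linarith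
      then have "c (\<phi> k y) \<noteq> c y"
      proof cases
        case 1 then show ?thesis using kK by (intro c(3)) auto
      next
        case 2
        have "y = \<phi> (inv k) (\<phi> k y)" using y kc by (simp add: phi_inv)
        then have "c y \<noteq> c (\<phi> k y)" using kK 2 by (intro c(3)) auto
        then show ?thesis by simp
      qed
      then show "c (\<phi> (k \<otimes> g) x) \<noteq> c (\<phi> g x)" using g kc x by (simp add: phi_mult y_def)
    qed
  qed
qed

end

section \<open>Hyperfiniteness from local rules\<close>

context free_borel_action begin

text \<open>
  Each \<open>x\<close> gives the coloring \<open>g \<mapsto> c (g x)\<close> of the group, and the rule is evaluated at the
  identity. The displacement is a function of finitely many colors, hence Borel. By locality the
  rule evaluated at \<open>b x\<close> gives the same point as the rule evaluated at \<open>b\<close> in the coloring of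
  \<open>x\<close>, so the bound on the number of images carries over.
\<close>

lemma coarse_maps:
  assumes "finite_rule_dimension G"
  obtains C where "\<And>B. finite B \<Longrightarrow> B \<subseteq> carrier G \<Longrightarrow>
     \<exists>D p. finite D \<and> D \<subseteq> carrier G \<and> p \<in> X \<rightarrow>\<^sub>M X \<and>
        (\<forall>x\<in>space X. \<exists>d\<in>D. p x = \<phi> d x) \<and> (\<forall>x\<in>space X. card (p ` (\<lambda>b. \<phi> b x) ` B) \<le> C)"
proof -
  obtain C where C: "\<And>B. finite B \<Longrightarrow> B \<subseteq> carrier G \<Longrightarrow>
        \<exists>K. finite K \<and> K \<subseteq> carrier G \<and> (\<forall>J. \<exists>P D. coarse_rule G B C K J P D)"
    by (rule finite_rule_dimensionE[OF assms]) (rule that)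
  show ?thesis
  proof (rule that[of C])
    fix B assume B: "finite B" "B \<subseteq> carrier G"
    from C[OF B] obtain K where K: "finite K" "K \<subseteq> carrier G"
      and KJ: "\<forall>J. \<exists>P D. coarse_rule G B C K J P D" by (elim exE conjE)
    obtain J and c :: "'x \<Rightarrow> nat" where cm: "\<And>m. {x \<in> space X. c x = m} \<in> sets X"
      and col: "\<And>x. x \<in> space X \<Longrightarrow> coloring G K J (\<lambda>g. c (\<phi> g x))"
      by (rule finite_borel_coloring[OF K]) (rule that)
    from KJ[rule_format, of J] obtain P D where PD: "coarse_rule G B C K J P D" by (elim exE)
    note loc = coarse_ruleD(1)[OF PD] and D = coarse_ruleD(2,3)[OF PD]
    note Pc = coarse_ruleD(4)[OF PD] and PD' = coarse_ruleD(5)[OF PD] and Pcard = coarse_ruleD(6)[OF PD]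
    define cc where "cc x = (\<lambda>g. c (\<phi> g x))" for x
    define s where "s x = P (cc x) \<one>" for x
    define p where "p x = \<phi> (s x) x" for x
    have cc: "coloring G K J (cc x)" if "x \<in> space X" for x using col[OF that] by (simp add: cc_def)
    have sD: "s x \<in> D" if "x \<in> space X" for x
      using Pc[OF cc[OF that], of \<one>] PD'[OF cc[OF that], of \<one>] by (simp add: s_def)
    from loc obtain T where T: "finite T" "T \<subseteq> carrier G"
      and TP: "\<And>c c' x x'. coloring G K J c \<Longrightarrow> coloring G K J c' \<Longrightarrow> x \<in> carrier G \<Longrightarrow> x' \<in> carrier G \<Longrightarrow>
           (\<And>t. t \<in> T \<Longrightarrow> c (t \<otimes> x) = c' (t \<otimes> x')) \<Longrightarrow> P c x \<otimes> inv x = P c' x' \<otimes> inv x'"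
      by (erule local_mapE)
    have s_eq: "s x = s y" if "x \<in> space X" "y \<in> space X" "\<And>t. t \<in> T \<Longrightarrow> c (\<phi> t x) = c (\<phi> t y)" for x y
    proof -
      have "P (cc x) \<one> \<otimes> inv \<one> = P (cc y) \<one> \<otimes> inv \<one>"
        using T that by (intro TP cc) (auto simp: cc_def subset_iff)
      then show ?thesis using Pc[OF cc[OF that(1)], of \<one>] Pc[OF cc[OF that(2)], of \<one>] by (simp add: s_def)
    qed
    have c_meas: "{x \<in> space X. \<forall>t\<in>T. c (\<phi> t x) = h t} \<in> sets X" for h
    proof -
      have "{x \<in> space X. c (\<phi> t x) = h t} \<in> sets X" if "t \<in> T" for t
      proof -
        have "\<phi> t -` {x \<in> space X. c x = h t} \<inter> space X \<in> sets X"
          using that T by (intro measurable_sets[OF phi_measurable cm]) auto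
        also have "\<phi> t -` {x \<in> space X. c x = h t} \<inter> space X = {x \<in> space X. c (\<phi> t x) = h t}"
          using that T by (auto simp: phi_space)
        finally show ?thesis .
      qed
      then show ?thesis using T(1) by (intro sets.sets_Collect_finite_All)
    qed
    have s_meas: "{x \<in> space X. s x = d} \<in> sets X" for d
    proof -
      define Hs where "Hs = {h \<in> T \<rightarrow>\<^sub>E {..<J}. \<exists>x\<in>space X. (\<forall>t\<in>T. c (\<phi> t x) = h t) \<and> s x = d}"
      have "finite (T \<rightarrow>\<^sub>E {..<J})" using T(1) by (intro finite_PiE) auto
      then have fin: "finite Hs" unfolding Hs_def by (rule rev_finite_subset) auto
      have "{x \<in> space X. s x = d} = (\<Union>h\<in>Hs. {x \<in> space X. \<forall>t\<in>T. c (\<phi> t x) = h t})" (is "?L = ?R")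
      proof (intro equalityI subsetI)
        fix x assume x: "x \<in> ?L"
        define h where "h = restrict (\<lambda>t. c (\<phi> t x)) T"
        have "h \<in> T \<rightarrow>\<^sub>E {..<J}" using coloring_less[OF cc[of x]] x T by (auto simp: h_def cc_def)
        then have "h \<in> Hs" unfolding Hs_def using x by (auto simp: h_def)
        then show "x \<in> ?R" using x by (intro UN_I[of h]) (auto simp: h_def)
      next
        fix x assume "x \<in> ?R"
        then obtain h where h: "h \<in> Hs" "x \<in> space X" "\<forall>t\<in>T. c (\<phi> t x) = h t" by auto
        then obtain y where y: "y \<in> space X" "\<forall>t\<in>T. c (\<phi> t y) = h t" "s y = d" unfolding Hs_def by auto
        have "s x = s y" using h y by (intro s_eq) auto
        then show "x \<in> ?L" using h y by auto
      qed
      also have "\<dots> \<in> sets X" using fin c_meas by (intro sets.finite_UN) auto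
      finally show ?thesis .
    qed
    have p_meas: "p \<in> X \<rightarrow>\<^sub>M X"
    proof (rule measurableI)
      fix x assume "x \<in> space X"
      then show "p x \<in> space X" unfolding p_def using sD D by (intro phi_space) auto
    next
      fix A assume A: "A \<in> sets X"
      have "p -` A \<inter> space X = (\<Union>d\<in>D. {x \<in> space X. s x = d} \<inter> (\<phi> d -` A \<inter> space X))"
        using sD by (auto simp: p_def)
      also have "\<dots> \<in> sets X"
        using D s_meas A by (intro sets.finite_UN sets.Int measurable_sets[OF phi_measurable]) auto
      finally show "p -` A \<inter> space X \<in> sets X" .
    qed
    have card: "card (p ` (\<lambda>b. \<phi> b x) ` B) \<le> C" if x: "x \<in> space X" for x
    proof -
      have pb: "p (\<phi> b x) = \<phi> (P (cc x) b) x" if b: "b \<in> B" for b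
      proof -
        have bc: "b \<in> carrier G" using b B by auto
        have bx: "\<phi> b x \<in> space X" using bc x by (rule phi_space)
        have Pcb: "P (cc x) b \<in> carrier G" by (rule Pc[OF cc[OF x] bc])
        have "P (cc (\<phi> b x)) \<one> \<otimes> inv \<one> = P (cc x) b \<otimes> inv b"
        proof (rule TP[OF cc[OF bx] cc[OF x] _ bc])
          fix t assume "t \<in> T"
          then have "t \<in> carrier G" using T by auto
          then show "cc (\<phi> b x) (t \<otimes> \<one>) = cc x (t \<otimes> b)" using x bc by (simp add: cc_def phi_mult)
        qed simp
        then have "s (\<phi> b x) = P (cc x) b \<otimes> inv b"
          using Pc[OF cc[OF bx], of \<one>] by (simp add: s_def)
        then have "p (\<phi> b x) = \<phi> (P (cc x) b \<otimes> inv b \<otimes> b) x"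
          using x bc Pcb by (simp add: p_def phi_mult phi_inv)
        then show ?thesis using bc Pcb by (simp add: m_assoc)
      qed
      have "p ` (\<lambda>b. \<phi> b x) ` B = (\<lambda>g. \<phi> g x) ` P (cc x) ` (\<lambda>b. b \<otimes> \<one>) ` B"
        using pb B by (force simp: image_image subset_iff)
      then have "card (p ` (\<lambda>b. \<phi> b x) ` B) \<le> card (P (cc x) ` (\<lambda>b. b \<otimes> \<one>) ` B)"
        using B by (simp add: card_image_le)
      also have "\<dots> \<le> C" using Pcard[OF cc[OF x], of \<one>] by simp
      finally show ?thesis .
    qed
    show "\<exists>D p. finite D \<and> D \<subseteq> carrier G \<and> p \<in> X \<rightarrow>\<^sub>M X \<and>
        (\<forall>x\<in>space X. \<exists>d\<in>D. p x = \<phi> d x) \<and> (\<forall>x\<in>space X. card (p ` (\<lambda>b. \<phi> b x) ` B) \<le> C)"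
      using D p_meas card sD unfolding p_def by (intro exI[of _ D] exI[of _ p]) (auto simp: p_def[abs_def])
  qed
qed

text \<open>
  The maps \<open>gm n\<close> are compositions of coarse maps at scales \<open>B n\<close>, where \<open>B n\<close> is so large that
  the image under \<open>gm n\<close> of the first \<open>n\<close> translates of \<open>x\<close> lies in \<open>B n x\<close>. Hence \<open>gm (n + 1)\<close>
  takes at most \<open>C\<close> values on these translates (\<open>few\<close>), and an orbit contains at most \<open>C\<close> points
  no two of which are ever identified. Let \<open>N x\<close> be a number such that each translate of \<open>x\<close> is
  eventually identified with one of the first \<open>N x\<close> of them. The set \<open>S k x\<close> of the images of
  these under \<open>gm k\<close> lies in the orbit, and for two points of one orbit the sets agree once \<open>k\<close> is
  large. So the relations \<open>S k x = S k y\<close> exhaust the orbit equivalence relation; their classes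
  are finite because \<open>gm k\<close> moves points by a finite set \<open>Dn k\<close>.
\<close>

theorem hyperfinite_of_finite_rule_dimension:
  assumes "finite_rule_dimension G"
  shows "hyperfinite X (orbit_equiv_rel G (space X) \<phi>)"
proof -
  obtain C where "\<And>B. finite B \<Longrightarrow> B \<subseteq> carrier G \<Longrightarrow>
     \<exists>D p. finite D \<and> D \<subseteq> carrier G \<and> p \<in> X \<rightarrow>\<^sub>M X \<and>
        (\<forall>x\<in>space X. \<exists>d\<in>D. p x = \<phi> d x) \<and> (\<forall>x\<in>space X. card (p ` (\<lambda>b. \<phi> b x) ` B) \<le> C)"
    by (rule coarse_maps[OF assms]) (rule that)
  then obtain DD pp where pp: "\<And>B. finite B \<Longrightarrow> B \<subseteq> carrier G \<Longrightarrow>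
     finite (DD B) \<and> DD B \<subseteq> carrier G \<and> pp B \<in> X \<rightarrow>\<^sub>M X \<and>
        (\<forall>x\<in>space X. \<exists>d\<in>DD B. pp B x = \<phi> d x) \<and> (\<forall>x\<in>space X. card (pp B ` (\<lambda>b. \<phi> b x) ` B) \<le> C)"
    by metis
  \<comment> \<open>an enumeration of the group, with repetitions if the group is finite\<close>
  define e where "e = from_nat_into (carrier G)"
  have e: "e i \<in> carrier G" for i unfolding e_def by (rule from_nat_into) auto
  have e_surj: "\<exists>i. g = e i" if "g \<in> carrier G" for g
    using from_nat_into_surj[OF cG that] unfolding e_def by auto
  define BB where "BB n D = (\<lambda>(d, i). d \<otimes> e i) ` (D \<times> {..n})" for n :: nat and D
  \<comment> \<open>\<open>Dn n\<close> contains the displacements of \<open>gm n\<close>\<close>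
  define Dn where "Dn = rec_nat {\<one>} (\<lambda>n D. (\<lambda>(d, d'). d \<otimes> d') ` (DD (BB n D) \<times> D))"
  have Dn0: "Dn 0 = {\<one>}" and DnS: "Dn (Suc n) = (\<lambda>(d, d'). d \<otimes> d') ` (DD (BB n (Dn n)) \<times> Dn n)" for n
    by (simp_all add: Dn_def)
  have BBf: "finite (BB n D) \<and> BB n D \<subseteq> carrier G" if "finite D" "D \<subseteq> carrier G" for n D
    unfolding BB_def using that e by auto
  have Dn: "finite (Dn n) \<and> Dn n \<subseteq> carrier G" for n
  proof (induction n)
    case (Suc n)
    then have "finite (DD (BB n (Dn n))) \<and> DD (BB n (Dn n)) \<subseteq> carrier G" using pp BBf by blast
    then show ?case unfolding DnS using Suc by auto
  qed (simp add: Dn0)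
  define B where "B n = BB n (Dn n)" for n
  have Bf: "finite (B n)" "B n \<subseteq> carrier G" for n unfolding B_def using BBf Dn by blast+
  define gm where "gm = rec_nat (\<lambda>x. x) (\<lambda>n g x. pp (B n) (g x))"
  have gm0: "gm 0 x = x" and gmS: "gm (Suc n) x = pp (B n) (gm n x)" for n x by (simp_all add: gm_def)
  have gm_meas: "gm n \<in> X \<rightarrow>\<^sub>M X" for n
  proof (induction n)
    case 0 show ?case by (simp add: gm0[abs_def])
  next
    case (Suc n)
    have "pp (B n) \<in> X \<rightarrow>\<^sub>M X" using pp Bf by blast
    then show ?case unfolding gmS[abs_def] by (rule measurable_compose[OF Suc])
  qed
  have gm_D: "\<exists>d\<in>Dn n. gm n x = \<phi> d x" if "x \<in> space X" for n x
  proof (induction n)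
    case 0 show ?case using that by (simp add: Dn0 gm0 phi_one)
  next
    case (Suc n)
    then obtain d where d: "d \<in> Dn n" "gm n x = \<phi> d x" by auto
    have dx: "\<phi> d x \<in> space X" using d Dn that by (auto intro!: phi_space)
    obtain d' where d': "d' \<in> DD (B n)" "pp (B n) (\<phi> d x) = \<phi> d' (\<phi> d x)"
      using pp Bf dx by meson
    have "d' \<in> carrier G" "d \<in> carrier G" using d d' Dn pp Bf by blast+
    then have "gm (Suc n) x = \<phi> (d' \<otimes> d) x" using d d' that by (simp add: gmS phi_mult)
    moreover have "d' \<otimes> d \<in> Dn (Suc n)" unfolding DnS using d d' by (force simp: B_def)
    ultimately show ?case by blast
  qed
  have gm_mono: "gm k' x = gm k' y" if "gm k x = gm k y" "k \<le> k'" for k k' x y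
    using that(2) by (induction rule: dec_induct) (simp_all add: that gmS)
  have few: "card ((\<lambda>i. gm (Suc n) (\<phi> (e i) x)) ` {..n}) \<le> C" if x: "x \<in> space X" for n x
  proof -
    have "(\<lambda>i. gm (Suc n) (\<phi> (e i) x)) ` {..n} \<subseteq> pp (B n) ` (\<lambda>b. \<phi> b x) ` B n"
    proof (rule image_subsetI)
      fix i assume i: "i \<in> {..n}"
      obtain d where d: "d \<in> Dn n" "gm n (\<phi> (e i) x) = \<phi> d (\<phi> (e i) x)"
        using gm_D[OF phi_space[OF e x]] by blast
      then have "gm n (\<phi> (e i) x) = \<phi> (d \<otimes> e i) x" using Dn[of n] x e[of i] by (auto simp: phi_mult)
      moreover have "d \<otimes> e i \<in> B n" unfolding B_def BB_def using d i by force
      ultimately show "gm (Suc n) (\<phi> (e i) x) \<in> pp (B n) ` (\<lambda>b. \<phi> b x) ` B n" unfolding gmS by auto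
    qed
    then have "card ((\<lambda>i. gm (Suc n) (\<phi> (e i) x)) ` {..n}) \<le> card (pp (B n) ` (\<lambda>b. \<phi> b x) ` B n)"
      using Bf by (intro card_mono) auto
    also have "\<dots> \<le> C" using pp[OF Bf] x by blast
    finally show ?thesis .
  qed
  \<comment> \<open>the first translates of \<open>x\<close> meet every class of the relation of being eventually identified\<close>
  define P where "P n x \<longleftrightarrow> (\<forall>i. \<exists>j\<le>n. \<exists>k. gm k (\<phi> (e i) x) = gm k (\<phi> (e j) x))" for n x
  have Pex: "\<exists>n. P n x" if x: "x \<in> space X" for x
  proof -
    \<comment> \<open>a largest set of translates that are never identified bounds the translates needed\<close>
    define R where "R i j \<longleftrightarrow> (\<exists>k. gm k (\<phi> (e i) x) = gm k (\<phi> (e j) x))" for i j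
    define Q where "Q M \<longleftrightarrow> finite M \<and> (\<forall>i\<in>M. \<forall>j\<in>M. i \<noteq> j \<longrightarrow> \<not> R i j)" for M
    have bound: "card M \<le> C" if qM: "Q M" for M
    proof -
      obtain n where n: "M \<subseteq> {..n}" using qM finite_nat_iff_bounded_le[of M] unfolding Q_def by blast
      have "inj_on (\<lambda>i. gm (Suc n) (\<phi> (e i) x)) M"
        using qM unfolding Q_def R_def by (auto intro!: inj_onI)
      then have "card M = card ((\<lambda>i. gm (Suc n) (\<phi> (e i) x)) ` M)" by (simp add: card_image)
      also have "\<dots> \<le> card ((\<lambda>i. gm (Suc n) (\<phi> (e i) x)) ` {..n})" using n by (intro card_mono) auto
      finally show ?thesis using few[OF x, of n] by simp
    qed
    have "Q {}" by (simp add: Q_def)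
    moreover have "\<forall>M. Q M \<longrightarrow> card M < Suc C" using bound by (simp add: less_Suc_eq_le)
    ultimately have "\<exists>M. Q M \<and> (\<forall>M'. Q M' \<longrightarrow> card M' \<le> card M)" by (rule ex_has_greatest_nat)
    then obtain M where M: "Q M" "\<And>M'. Q M' \<Longrightarrow> card M' \<le> card M" by blast
    obtain n where n: "M \<subseteq> {..n}" using M(1) finite_nat_iff_bounded_le[of M] unfolding Q_def by blast
    have "\<exists>j\<in>M. R i j" for i
    proof (rule ccontr)
      assume *: "\<not> ?thesis"
      have sym: "R a b \<longleftrightarrow> R b a" for a b unfolding R_def by metis
      have "i \<notin> M" using * by (auto simp: R_def)
      moreover have "Q (insert i M)" using M(1) * sym unfolding Q_def by auto
      ultimately show False using M(2)[of "insert i M"] M(1) by (simp add: Q_def)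
    qed
    then have "P n x" unfolding P_def using n by (fastforce simp: R_def)
    then show ?thesis ..
  qed
  define N where "N x = (LEAST n. P n x)" for x
  have PN: "P (N x) x" if "x \<in> space X" for x unfolding N_def using Pex[OF that] by (rule LeastI_ex)
  have [measurable]: "(\<lambda>x. gm k (\<phi> (e i) x)) \<in> X \<rightarrow>\<^sub>M X" for k i
    by (rule measurable_compose[OF phi_measurable[OF e] gm_meas])
  have P_meas [measurable]: "Measurable.pred X (P n)" for n
  proof -
    have "Measurable.pred X (\<lambda>x. gm k (\<phi> (e i) x) = gm k (\<phi> (e j) x))" for i j k
      unfolding pred_def by (intro eq_measurable) measurable
    note [measurable] = this
    show ?thesis unfolding P_def by measurable
  qed
  have N_meas [measurable]: "N \<in> X \<rightarrow>\<^sub>M count_space UNIV" unfolding N_def by measurable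
  define S where "S k x = (\<lambda>i. gm k (\<phi> (e i) x)) ` {..N x}" for k x
  define E where "E k = {(x, y) \<in> space X \<times> space X. S k x = S k y}" for k
  have E_equiv: "equiv (space X) (E k)" for k
    by (intro equivI refl_onI symI transI) (auto simp: E_def)
  have S_step: "S (Suc k) x = pp (B k) ` S k x" for k x
    by (auto simp: S_def gmS image_image)
  have E_mono: "incseq E"
    by (intro incseq_SucI) (auto simp: E_def S_step)
  have S_orbit: "\<exists>g\<in>carrier G. \<phi> g x = y" if ox: "x \<in> space X" and oy: "y \<in> space X" and S: "S k x = S k y" for k x y
  proof -
    have "gm k (\<phi> (e 0) x) \<in> S k y" unfolding S[symmetric] by (auto simp: S_def)
    then obtain j where j: "gm k (\<phi> (e 0) x) = gm k (\<phi> (e j) y)" by (auto simp: S_def)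
    obtain d where d: "d \<in> carrier G" "gm k (\<phi> (e 0) x) = \<phi> d (\<phi> (e 0) x)"
      using gm_D[OF phi_space[OF e ox]] Dn[of k] by blast
    obtain d' where d': "d' \<in> carrier G" "gm k (\<phi> (e j) y) = \<phi> d' (\<phi> (e j) y)"
      using gm_D[OF phi_space[OF e oy]] Dn[of k] by blast
    have "\<phi> (d \<otimes> e 0) x = \<phi> (d' \<otimes> e j) y" using j d d' e ox oy by (simp add: phi_mult)
    then have "\<phi> (inv (d' \<otimes> e j)) (\<phi> (d \<otimes> e 0) x) = y" using d' e ox oy by (simp only: phi_inv m_closed)
    then have "\<phi> (inv (d' \<otimes> e j) \<otimes> (d \<otimes> e 0)) x = y" using d d' e ox oy by (simp add: phi_mult del: inv_mult_group)
    then show ?thesis using d d' e by (intro bexI[of _ "inv (d' \<otimes> e j) \<otimes> (d \<otimes> e 0)"]) auto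
  qed
  have E_fin: "finite (E k `` {x})" for k x
  proof (cases "x \<in> space X")
    case x: True
    have "E k `` {x} \<subseteq> (\<lambda>(d, d', j). \<phi> (inv (d' \<otimes> e 0) \<otimes> (d \<otimes> e j)) x) ` (Dn k \<times> Dn k \<times> {..N x})"
    proof
      fix y assume "y \<in> E k `` {x}"
      then have 2: "y \<in> space X" "S k x = S k y" by (auto simp: E_def)
      have "gm k (\<phi> (e 0) y) \<in> S k x" using 2 by (auto simp: S_def)
      then obtain j where j: "j \<le> N x" "gm k (\<phi> (e j) x) = gm k (\<phi> (e 0) y)" by (auto simp: S_def)
      obtain d where d: "d \<in> Dn k" "gm k (\<phi> (e j) x) = \<phi> d (\<phi> (e j) x)"
        using gm_D[OF phi_space[OF e x]] by blast
      obtain d' where d': "d' \<in> Dn k" "gm k (\<phi> (e 0) y) = \<phi> d' (\<phi> (e 0) y)"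
        using gm_D[OF phi_space[OF e 2(1)]] by blast
      have dc: "d \<in> carrier G" "d' \<in> carrier G" using d d' Dn by blast+
      have "\<phi> (d \<otimes> e j) x = \<phi> (d' \<otimes> e 0) y" using j d d' dc e x 2 by (simp add: phi_mult)
      then have "\<phi> (inv (d' \<otimes> e 0)) (\<phi> (d \<otimes> e j) x) = y" using dc e x 2 by (simp only: phi_inv m_closed)
      then have "\<phi> (inv (d' \<otimes> e 0) \<otimes> (d \<otimes> e j)) x = y" using dc e x by (simp add: phi_mult del: inv_mult_group)
      then show "y \<in> (\<lambda>(d, d', j). \<phi> (inv (d' \<otimes> e 0) \<otimes> (d \<otimes> e j)) x) ` (Dn k \<times> Dn k \<times> {..N x})" using d d' j by force
    qed
    moreover have "finite (Dn k)" using Dn by blast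
    ultimately show ?thesis by (elim finite_subset) simp
  qed (auto simp: E_def)
  have E_meas: "E k \<in> sets (X \<Otimes>\<^sub>M X)" for k
  proof -
    define Q where "Q n m z \<longleftrightarrow> (\<forall>i\<in>{..n}. \<exists>j\<in>{..m}. gm k (\<phi> (e i) (fst z)) = gm k (\<phi> (e j) (snd z))) \<and>
        (\<forall>j\<in>{..m}. \<exists>i\<in>{..n}. gm k (\<phi> (e i) (fst z)) = gm k (\<phi> (e j) (snd z)))" for n m z
    have m1: "(\<lambda>z. gm k (\<phi> (e i) (fst z))) \<in> X \<Otimes>\<^sub>M X \<rightarrow>\<^sub>M X"
      "(\<lambda>z. gm k (\<phi> (e i) (snd z))) \<in> X \<Otimes>\<^sub>M X \<rightarrow>\<^sub>M X" for i by measurable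
    have "Measurable.pred (X \<Otimes>\<^sub>M X) (\<lambda>z. gm k (\<phi> (e i) (fst z)) = gm k (\<phi> (e j) (snd z)))" for i j
      unfolding pred_def by (rule eq_measurable[OF m1])
    note [measurable] = this
    have Qm [measurable]: "Measurable.pred (X \<Otimes>\<^sub>M X) (Q n m)" for n m
      unfolding Q_def by measurable
    have S_eq: "S k x = S k y \<longleftrightarrow> Q (N x) (N y) (x, y)" for x y
    proof
      assume *: "S k x = S k y"
      have "\<exists>j\<in>{..N y}. gm k (\<phi> (e i) x) = gm k (\<phi> (e j) y)" if "i \<in> {..N x}" for i
      proof -
        have "gm k (\<phi> (e i) x) \<in> S k x" unfolding S_def using that by (rule imageI)
        then have "gm k (\<phi> (e i) x) \<in> S k y" unfolding * .
        then show ?thesis by (auto simp: S_def)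
      qed
      moreover have "\<exists>i\<in>{..N x}. gm k (\<phi> (e i) x) = gm k (\<phi> (e j) y)" if "j \<in> {..N y}" for j
      proof -
        have "gm k (\<phi> (e j) y) \<in> S k y" unfolding S_def using that by (rule imageI)
        then have "gm k (\<phi> (e j) y) \<in> S k x" unfolding * .
        then show ?thesis by (auto simp: S_def)
      qed
      ultimately show "Q (N x) (N y) (x, y)" by (simp add: Q_def)
    next
      assume Q: "Q (N x) (N y) (x, y)"
      have "gm k (\<phi> (e i) x) \<in> S k y" if "i \<in> {..N x}" for i
      proof -
        obtain j where "j \<in> {..N y}" "gm k (\<phi> (e i) x) = gm k (\<phi> (e j) y)"
          using Q \<open>i \<in> {..N x}\<close> unfolding Q_def fst_conv snd_conv by blast
        then show ?thesis unfolding S_def by (rule_tac image_eqI)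
      qed
      moreover have "gm k (\<phi> (e j) y) \<in> S k x" if "j \<in> {..N y}" for j
      proof -
        obtain i where "i \<in> {..N x}" "gm k (\<phi> (e i) x) = gm k (\<phi> (e j) y)"
          using Q \<open>j \<in> {..N y}\<close> unfolding Q_def fst_conv snd_conv by blast
        then show ?thesis unfolding S_def by (intro image_eqI[of _ _ i]) simp_all
      qed
      ultimately show "S k x = S k y"
        unfolding S_def[of k x] S_def[of k y] by (intro equalityI image_subsetI) (simp_all add: S_def)
    qed
    have "E k = {z \<in> space (X \<Otimes>\<^sub>M X). \<exists>n m. N (fst z) = n \<and> N (snd z) = m \<and> Q n m z}"
      unfolding E_def S_eq by (auto simp: space_pair_measure)
    also have "\<dots> \<in> sets (X \<Otimes>\<^sub>M X)" by measurable
    finally show ?thesis .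
  qed
  have un: "orbit_equiv_rel G (space X) \<phi> = (\<Union>k. E k)"
  proof (intro equalityI subrelI)
    fix x y assume "(x, y) \<in> (\<Union>k. E k)"
    then obtain k where "(x, y) \<in> E k" by blast
    then have xy: "x \<in> space X" "y \<in> space X" and "S k x = S k y" by (auto simp: E_def)
    then show "(x, y) \<in> orbit_equiv_rel G (space X) \<phi>"
      using S_orbit[OF xy] by (auto simp: orbit_equiv_rel_def)
  next
    fix x y assume "(x, y) \<in> orbit_equiv_rel G (space X) \<phi>"
    then obtain g where x: "x \<in> space X" and y: "y \<in> space X" and g: "g \<in> carrier G" and gx: "\<phi> g x = y"
      by (auto simp: orbit_equiv_rel_def)
    have xy: "\<exists>k. gm k (\<phi> (e i) y) \<in> S k x" for i
    proof -
      obtain i' where i': "e i' = e i \<otimes> g" using e_surj[of "e i \<otimes> g"] e g by auto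
      obtain j k where "j \<le> N x" "gm k (\<phi> (e i') x) = gm k (\<phi> (e j) x)" using PN[OF x] unfolding P_def by blast
      then show ?thesis using i' x g e by (auto simp: S_def gx[symmetric] phi_mult intro!: exI[of _ k])
    qed
    have yx: "\<exists>k. gm k (\<phi> (e i) x) \<in> S k y" for i
    proof -
      obtain i' where i': "e i' = e i \<otimes> inv g" using e_surj[of "e i \<otimes> inv g"] e g by auto
      have x': "x = \<phi> (inv g) y" using gx g x phi_inv by auto
      obtain j k where "j \<le> N y" "gm k (\<phi> (e i') y) = gm k (\<phi> (e j) y)" using PN[OF y] unfolding P_def by blast
      then show ?thesis using i' y g e by (auto simp: S_def x' phi_mult intro!: exI[of _ k])
    qed
    from xy obtain a where a: "\<And>i. gm (a i) (\<phi> (e i) y) \<in> S (a i) x" by metis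
    from yx obtain b where b: "\<And>i. gm (b i) (\<phi> (e i) x) \<in> S (b i) y" by metis
    define k where "k = Max (a ` {..N y} \<union> b ` {..N x})"
    have k: "a i \<le> k" if "i \<le> N y" for i unfolding k_def using that by (intro Max_ge) auto
    have k': "b i \<le> k" if "i \<le> N x" for i unfolding k_def using that by (intro Max_ge) auto
    have up: "gm k u \<in> S k v" if "gm l u \<in> S l v" "l \<le> k" for l u v
    proof -
      from that(1) obtain i where i: "i \<in> {..N v}" and eq: "gm l u = gm l (\<phi> (e i) v)"
        unfolding S_def by (elim imageE)
      have "gm k u = gm k (\<phi> (e i) v)" by (rule gm_mono[OF eq that(2)])
      then show ?thesis unfolding S_def using i by (rule image_eqI)
    qed
    have "S k y \<subseteq> S k x"
    proof
      fix z assume "z \<in> S k y"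
      then obtain i where "i \<le> N y" "z = gm k (\<phi> (e i) y)" by (auto simp: S_def)
      then show "z \<in> S k x" using up[OF a k] by simp
    qed
    moreover have "S k x \<subseteq> S k y"
    proof
      fix z assume "z \<in> S k x"
      then obtain i where "i \<le> N x" "z = gm k (\<phi> (e i) x)" by (auto simp: S_def)
      then show "z \<in> S k y" using up[OF b k'] by simp
    qed
    ultimately have "(x, y) \<in> E k" using x y by (auto simp: E_def)
    then show "(x, y) \<in> (\<Union>k. E k)" by blast
  qed
  have "finite_borel_equiv X (E k)" for k
    unfolding finite_borel_equiv_def using E_equiv E_meas E_fin by (auto simp: quotient_def)
  then show ?thesis unfolding hyperfinite_def using E_mono un by blast
qed

end

section \<open>Tame normal subgroups\<close>

text \<open>
  The functionals \<open>lam i\<close>, \<open>i < f\<close>, are closed under negation, so that the set \<open>lam i v \<le> r\<close> for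
  all \<open>i\<close> is a symmetric box; a conjugate of a box lies in a multiple of it. Conjugating
  functionals by elements of \<open>G\<close> gives new functionals on \<open>H\<close>, and \<open>d\<close> bounds the dimension of the
  space that they span. In a torsion-free abelian group of rank \<open>d\<close> boxes are infinite unless the
  group is finitely generated. They are finite in the members of \<open>Fam\<close>, subgroups that contain any
  given finite part of \<open>H\<close>. These need not be invariant under conjugation, but \<open>H0 \<inter> g\<^sup>-\<^sup>1 H0 g\<close>
  has an index in \<open>H0\<close> that is bounded for fixed \<open>g\<close>, and \<open>\<kappa>\<close> labels the cosets. Neither \<open>\<sigma>\<close> nor
  \<open>m\<close> may depend on \<open>r\<close> or \<open>H0\<close>: these are chosen after the constants that \<open>\<sigma>\<close> and \<open>m\<close> enter.
\<close>

locale tame_subgroup = group G for G :: "('g, 'm) monoid_scheme" (structure) +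
  fixes H :: "'g set" and f d :: nat and lam :: "nat \<Rightarrow> 'g \<Rightarrow> real" and Fam :: "'g set set"
  assumes normal: "H \<lhd> G"
    and lam_mult: "i < f \<Longrightarrow> u \<in> H \<Longrightarrow> v \<in> H \<Longrightarrow> lam i (u \<otimes> v) = lam i u + lam i v"
    and lam_neg: "i < f \<Longrightarrow> \<exists>j<f. \<forall>v\<in>H. lam j v = - lam i v"
    and lam_conj: "g \<in> carrier G \<Longrightarrow> \<exists>\<sigma>\<ge>0. \<forall>v\<in>H. \<forall>r. (\<forall>i<f. lam i v \<le> r) \<longrightarrow>
                     (\<forall>i<f. lam i (g \<otimes> v \<otimes> inv g) \<le> \<sigma> * r)"
    and lam_dep: "(\<And>j. j \<le> d \<Longrightarrow> t j \<in> carrier G \<and> e j < f) \<Longrightarrow>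
       \<exists>\<alpha> :: nat \<Rightarrow> real. (\<exists>j\<le>d. \<alpha> j \<noteq> 0) \<and>
          (\<forall>v\<in>H. (\<Sum>j\<le>d. \<alpha> j * lam (e j) (t j \<otimes> v \<otimes> inv (t j))) = 0)"
    and lam_nonzero: "i < f \<Longrightarrow> \<exists>v\<in>H. lam i v \<noteq> 0"
    and fam_subgroup: "H0 \<in> Fam \<Longrightarrow> subgroup H0 G" and fam_subset: "H0 \<in> Fam \<Longrightarrow> H0 \<subseteq> H"
    and fam_cofinal: "finite V \<Longrightarrow> V \<subseteq> H \<Longrightarrow> \<exists>H0\<in>Fam. V \<subseteq> H0"
    and fam_box: "H0 \<in> Fam \<Longrightarrow> finite {v \<in> H0. \<forall>i<f. lam i v \<le> r}"
    and fam_conj: "g \<in> carrier G \<Longrightarrow> \<exists>m. \<forall>H0\<in>Fam. \<exists>\<kappa> :: 'g \<Rightarrow> nat. (\<forall>v\<in>H0. \<kappa> v < m) \<and>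
       (\<forall>v\<in>H0. \<forall>w\<in>H0. \<kappa> v = \<kappa> w \<longrightarrow> g \<otimes> (v \<otimes> inv w) \<otimes> inv g \<in> H0)"
begin

definition box :: "'g set \<Rightarrow> real \<Rightarrow> 'g set" where
  "box H0 r = {v \<in> H0. \<forall>i<f. lam i v \<le> r}"

text \<open>
  If \<open>x\<close> lies in the box of the center \<open>y\<close> and \<open>g x\<close> in the box of the center \<open>y'\<close>, then \<open>y'
  y\<^sup>-\<^sup>1\<close> is in the reach of \<open>g\<close>.
\<close>

definition reach :: "'g set \<Rightarrow> real \<Rightarrow> 'g \<Rightarrow> 'g set" where
  "reach H0 r g = (\<lambda>(u', u). u' \<otimes> g \<otimes> u) ` (box H0 r \<times> box H0 r)"

lemma subgroup_H: "subgroup H G"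
  using normal by (simp add: normal_def)

lemma H_carrier: "v \<in> H \<Longrightarrow> v \<in> carrier G"
  by (rule subgroup.mem_carrier[OF subgroup_H])

lemma H_closed [simp]: "\<one> \<in> H" "u \<in> H \<Longrightarrow> v \<in> H \<Longrightarrow> u \<otimes> v \<in> H" "v \<in> H \<Longrightarrow> inv v \<in> H"
  using subgroup_H by (auto simp: subgroup_def)

lemma H_conj: "g \<in> carrier G \<Longrightarrow> v \<in> H \<Longrightarrow> g \<otimes> v \<otimes> inv g \<in> H"
  by (rule normal.inv_op_closed2[OF normal])

lemma H_conj': "g \<in> carrier G \<Longrightarrow> v \<in> H \<Longrightarrow> inv g \<otimes> v \<otimes> g \<in> H"
  by (rule normal.inv_op_closed1[OF normal])

lemma lam_one: "i < f \<Longrightarrow> lam i \<one> = 0"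
  using lam_mult[of i \<one> \<one>] by simp

lemma lam_inv: "i < f \<Longrightarrow> v \<in> H \<Longrightarrow> lam i (inv v) = - lam i v"
  using lam_mult[of i v "inv v"] by (simp add: lam_one H_carrier)

lemma fam_closed:
  assumes "H0 \<in> Fam"
  shows "\<one> \<in> H0" "u \<in> H0 \<Longrightarrow> v \<in> H0 \<Longrightarrow> u \<otimes> v \<in> H0" "v \<in> H0 \<Longrightarrow> inv v \<in> H0"
  using fam_subgroup[OF assms] by (auto simp: subgroup_def)

lemma box_H0: "v \<in> box H0 r \<Longrightarrow> v \<in> H0"
  by (simp add: box_def)

lemma box_H: "H0 \<in> Fam \<Longrightarrow> v \<in> box H0 r \<Longrightarrow> v \<in> H"
  using fam_subset by (auto simp: box_def)

lemma box_carrier: "H0 \<in> Fam \<Longrightarrow> v \<in> box H0 r \<Longrightarrow> v \<in> carrier G"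
  by (rule H_carrier[OF box_H])

lemma finite_box: "H0 \<in> Fam \<Longrightarrow> finite (box H0 r)"
  unfolding box_def by (rule fam_box)

lemma box_abs: "H0 \<in> Fam \<Longrightarrow> v \<in> box H0 r \<Longrightarrow> i < f \<Longrightarrow> \<bar>lam i v\<bar> \<le> r"
proof -
  assume H0: "H0 \<in> Fam" and v: "v \<in> box H0 r" and i: "i < f"
  obtain j where "j < f" "lam j v = - lam i v" using lam_neg[OF i] box_H[OF H0 v] by blast
  then have "- lam i v \<le> r" "lam i v \<le> r" using v i unfolding box_def by force+
  then show ?thesis by simp
qed

lemma box_inv: "H0 \<in> Fam \<Longrightarrow> v \<in> box H0 r \<Longrightarrow> inv v \<in> box H0 r"
  using box_abs[of H0 v r] lam_inv[of _ v] box_H[of H0 v r] fam_closed(3)[of H0 v]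
  by (auto simp: box_def abs_le_iff)

lemma box_one: "H0 \<in> Fam \<Longrightarrow> 0 \<le> r \<Longrightarrow> \<one> \<in> box H0 r"
  by (simp add: box_def fam_closed lam_one)

lemma box_mono: "v \<in> box H0 r \<Longrightarrow> r \<le> s \<Longrightarrow> v \<in> box H0 s"
  unfolding box_def by (blast intro: order_trans)

lemma reachI: "u' \<in> box H0 r \<Longrightarrow> u \<in> box H0 r \<Longrightarrow> u' \<otimes> g \<otimes> u \<in> reach H0 r g"
  unfolding reach_def by force

lemma finite_reach: "H0 \<in> Fam \<Longrightarrow> finite (reach H0 r g)"
  unfolding reach_def using finite_box by simp

lemma reach_carrier: "H0 \<in> Fam \<Longrightarrow> g \<in> carrier G \<Longrightarrow> reach H0 r g \<subseteq> carrier G"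
  unfolding reach_def using box_carrier by auto

lemma reach_inv:
  assumes "H0 \<in> Fam" "g \<in> carrier G" "k \<in> reach H0 r g"
  shows "inv k \<in> reach H0 r (inv g)"
proof -
  from assms obtain u u' where u: "u \<in> box H0 r" "u' \<in> box H0 r" "k = u' \<otimes> g \<otimes> u"
    unfolding reach_def by auto
  then have "inv k = inv u \<otimes> inv g \<otimes> inv u'"
    using assms box_carrier[OF assms(1)] by (simp add: inv_mult_group m_assoc)
  then show ?thesis using u box_inv[OF assms(1)] by (auto intro!: reachI)
qed

definition separated :: "'g set \<Rightarrow> real \<Rightarrow> ('g \<Rightarrow> bool) \<Rightarrow> bool" where
  "separated H0 r Y \<longleftrightarrow> (\<forall>y\<in>carrier G. \<forall>v\<in>box H0 r. Y y \<longrightarrow> Y (v \<otimes> y) \<longrightarrow> v = \<one>)"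

text \<open>
  Write an element of the reach as \<open>u' g u\<close> and sort it by the label \<open>\<kappa> u\<close> and by the integer
  parts of \<open>lam i (u') + lam i (g u g\<^sup>-\<^sup>1)\<close> measured in units of \<open>a\<close>. If two elements are sorted
  equally, their quotient lies in the box of size \<open>a\<close>, so a separated set contains at most one of
  them. The number of sorts involves \<open>m\<close>, \<open>f\<close> and the stretch \<open>\<sigma>\<close> of \<open>g\<close>, and neither \<open>a\<close> nor
  \<open>H0\<close>.
\<close>

lemma packing_bounded:
  assumes g: "g \<in> carrier G"
  shows "\<exists>P. \<forall>H0\<in>Fam. \<forall>a>0. \<forall>Y. \<forall>y\<in>carrier G. separated H0 a Y \<longrightarrow>
     card {k \<in> reach H0 (3 * a) g. Y (k \<otimes> y)} \<le> P"
proof -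
  obtain \<sigma> where \<sigma>: "\<sigma> \<ge> 0" and \<sigma>H: "\<And>v r i. v \<in> H \<Longrightarrow> (\<forall>i<f. lam i v \<le> r) \<Longrightarrow> i < f \<Longrightarrow>
                     lam i (g \<otimes> v \<otimes> inv g) \<le> \<sigma> * r"
    using lam_conj[OF g] by blast
  obtain m where m: "\<And>H0. H0 \<in> Fam \<Longrightarrow> \<exists>\<kappa> :: 'g \<Rightarrow> nat. (\<forall>v\<in>H0. \<kappa> v < m) \<and>
       (\<forall>v\<in>H0. \<forall>w\<in>H0. \<kappa> v = \<kappa> w \<longrightarrow> g \<otimes> (v \<otimes> inv w) \<otimes> inv g \<in> H0)"
    using fam_conj[OF g] by blast
  define M where "M = \<lceil>3 + 3 * \<sigma>\<rceil> + 1"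
  define Keys where "Keys = {..<m} \<times> ({..<f} \<rightarrow>\<^sub>E {-M..M})"
  have finK: "finite Keys" unfolding Keys_def by (intro finite_cartesian_product finite_PiE) auto
  show ?thesis
  proof (intro exI[of _ "card Keys"] ballI allI impI)
    fix H0 :: "'g set" and a :: real and Y y
    assume H0: "H0 \<in> Fam" and a: "a > 0" and y: "y \<in> carrier G" and sep: "separated H0 a Y"
    obtain \<kappa> :: "'g \<Rightarrow> nat" where \<kappa>: "\<And>v. v \<in> H0 \<Longrightarrow> \<kappa> v < m"
      and \<kappa>': "\<And>v w. v \<in> H0 \<Longrightarrow> w \<in> H0 \<Longrightarrow> \<kappa> v = \<kappa> w \<Longrightarrow> g \<otimes> (v \<otimes> inv w) \<otimes> inv g \<in> H0"
      using m[OF H0] by blast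
    let ?Z = "{k \<in> reach H0 (3 * a) g. Y (k \<otimes> y)}"
    have "\<forall>k\<in>?Z. \<exists>p. fst p \<in> box H0 (3 * a) \<and> snd p \<in> box H0 (3 * a) \<and> k = snd p \<otimes> g \<otimes> fst p"
      unfolding reach_def by auto
    from bchoice[OF this] obtain p where p: "\<forall>k\<in>?Z. fst (p k) \<in> box H0 (3 * a) \<and>
        snd (p k) \<in> box H0 (3 * a) \<and> k = snd (p k) \<otimes> g \<otimes> fst (p k)" ..
    define u u' where "u = (\<lambda>k. fst (p k))" and "u' = (\<lambda>k. snd (p k))"
    have u: "u k \<in> box H0 (3 * a)" and u': "u' k \<in> box H0 (3 * a)"
      and uu: "k = u' k \<otimes> g \<otimes> u k" if "k \<in> ?Z" for k
      using p that unfolding u_def u'_def by simp_all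
    define cj where "cj v = g \<otimes> v \<otimes> inv g" for v
    define s where "s i k = (lam i (u' k) + lam i (cj (u k))) / a" for i k
    define key where "key k = (\<kappa> (u k), restrict (\<lambda>i. \<lfloor>s i k\<rfloor>) {..<f})" for k
    have cjH: "cj v \<in> H" if "v \<in> H" for v unfolding cj_def using H_conj[OF g that] .
    have cj_le: "lam i (cj v) \<le> \<sigma> * (3 * a)" if "v \<in> box H0 (3 * a)" "i < f" for v i
      unfolding cj_def using that box_H[OF H0] by (intro \<sigma>H) (auto simp: box_def)
    have cj_inv: "cj (inv v) = inv (cj v)" if "v \<in> H" for v
      using H_carrier[OF that] g by (simp add: cj_def inv_mult_group m_assoc)
    have cj_mult: "cj (v \<otimes> w) = cj v \<otimes> cj w" if "v \<in> H" "w \<in> H" for v w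
    proof -
      have "v \<in> carrier G" "w \<in> carrier G" using that by (simp_all only: H_carrier)
      then show ?thesis using g by (simp add: cj_def m_assoc inv_cancel)
    qed
    have cj_abs: "\<bar>lam i (cj v)\<bar> \<le> \<sigma> * (3 * a)" if v: "v \<in> box H0 (3 * a)" and i: "i < f" for v i
    proof -
      have "lam i (cj (inv v)) \<le> \<sigma> * (3 * a)" by (rule cj_le[OF box_inv[OF H0 v] i])
      then have "- lam i (cj v) \<le> \<sigma> * (3 * a)"
        using cj_inv lam_inv[OF i cjH] box_H[OF H0 v] by simp
      then show ?thesis using cj_le[OF v i] by linarith
    qed
    have s_bound: "\<bar>s i k\<bar> \<le> 3 + 3 * \<sigma>" if "k \<in> ?Z" "i < f" for i k
    proof -
      have "\<bar>lam i (u' k) + lam i (cj (u k))\<bar> \<le> 3 * a + \<sigma> * (3 * a)"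
        using box_abs[OF H0 u'[OF that(1)] that(2)] cj_abs[OF u[OF that(1)] that(2)] by linarith
      also have "\<dots> = (3 + 3 * \<sigma>) * a" by (simp add: algebra_simps)
      finally show ?thesis using a by (simp add: s_def pos_divide_le_eq)
    qed
    have key_in: "key ` ?Z \<subseteq> Keys"
    proof (rule image_subsetI)
      fix k assume k: "k \<in> ?Z"
      have "\<lfloor>s i k\<rfloor> \<in> {-M..M}" if "i < f" for i
        using s_bound[OF k that] unfolding M_def by (simp, linarith)
      then show "key k \<in> Keys"
        using \<kappa>[OF box_H0[OF u[OF k]]] by (auto simp: key_def Keys_def)
    qed
    have "inj_on key ?Z"
    proof (rule inj_onI)
      fix k1 k2 assume k12: "k1 \<in> ?Z" "k2 \<in> ?Z" and eq: "key k1 = key k2"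
      let ?u1 = "u k1" and ?u2 = "u k2" and ?v1 = "u' k1" and ?v2 = "u' k2"
      have H12: "?u1 \<in> H" "?u2 \<in> H" "?v1 \<in> H" "?v2 \<in> H"
        using u u' k12 box_H[OF H0] by blast+
      have C12: "?u1 \<in> carrier G" "?u2 \<in> carrier G" "?v1 \<in> carrier G" "?v2 \<in> carrier G"
        using H12 by (simp_all only: H_carrier)
      have yc: "k1 \<in> carrier G" "k2 \<in> carrier G" using k12 reach_carrier[OF H0 g] by auto
      have kH: "cj (?u2 \<otimes> inv ?u1) \<in> H0"
        unfolding cj_def using eq
        by (intro \<kappa>'[OF box_H0[OF u[OF k12(2)]] box_H0[OF u[OF k12(1)]]]) (simp add: key_def)
      have "k2 \<otimes> inv k1 = (?v2 \<otimes> g \<otimes> ?u2) \<otimes> inv (?v1 \<otimes> g \<otimes> ?u1)"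
        by (simp only: uu[OF k12(1), symmetric] uu[OF k12(2), symmetric])
      also have "\<dots> = ?v2 \<otimes> cj (?u2 \<otimes> inv ?u1) \<otimes> inv ?v1"
        using C12 g by (simp add: cj_def inv_mult_group m_assoc inv_cancel)
      finally have w: "k2 \<otimes> inv k1 = ?v2 \<otimes> cj (?u2 \<otimes> inv ?u1) \<otimes> inv ?v1" .
      have "k2 \<otimes> inv k1 \<in> H0"
        unfolding w by (intro fam_closed[OF H0] kH box_H0[OF u'[OF k12(1)]] box_H0[OF u'[OF k12(2)]])
      moreover have "lam i (k2 \<otimes> inv k1) \<le> a" if i: "i < f" for i
      proof -
        have "lam i (k2 \<otimes> inv k1) = lam i ?v2 + (lam i (cj ?u2) - lam i (cj ?u1)) - lam i ?v1"
          unfolding w using H12 i by (simp add: lam_mult lam_inv cj_mult cj_inv cjH)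
        also have "\<dots> = a * (s i k2 - s i k1)"
          using a by (simp add: s_def field_simps)
        finally have *: "lam i (k2 \<otimes> inv k1) = a * (s i k2 - s i k1)" .
        have "restrict (\<lambda>i. \<lfloor>s i k1\<rfloor>) {..<f} i = restrict (\<lambda>i. \<lfloor>s i k2\<rfloor>) {..<f} i"
          using eq by (simp add: key_def)
        then have "\<lfloor>s i k1\<rfloor> = \<lfloor>s i k2\<rfloor>" using i by simp
        then have "s i k2 - s i k1 \<le> 1" by linarith
        then show ?thesis unfolding * using a by (simp add: mult_left_le)
      qed
      ultimately have "k2 \<otimes> inv k1 \<in> box H0 a" by (simp add: box_def)
      moreover have "k2 \<otimes> inv k1 \<otimes> (k1 \<otimes> y) = k2 \<otimes> y" using yc y by (simp add: m_assoc inv_cancel)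
      ultimately have "k2 \<otimes> inv k1 = \<one>"
        using sep[unfolded separated_def, rule_format, of "k1 \<otimes> y" "k2 \<otimes> inv k1"] k12 yc y by simp
      then show "k1 = k2" using yc by (metis inv_equality inv_inv inv_closed)
    qed
    then show "card ?Z \<le> card Keys" using key_in finK by (rule card_inj_on_le)
  qed
qed

definition packing_number :: "'g \<Rightarrow> nat" where
  "packing_number g = (SOME P. \<forall>H0\<in>Fam. \<forall>a>0. \<forall>Y. \<forall>y\<in>carrier G. separated H0 a Y \<longrightarrow>
     card {k \<in> reach H0 (3 * a) g. Y (k \<otimes> y)} \<le> P)"

lemma card_packing:
  assumes Gs: "finite Gs" "Gs \<subseteq> carrier G" and "H0 \<in> Fam" "a > 0" "y \<in> carrier G" "separated H0 a Y"
  shows "card {k \<in> (\<Union>g\<in>Gs. reach H0 (3 * a) g). Y (k \<otimes> y)} \<le> (\<Sum>g\<in>Gs. packing_number g)"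
proof -
  have "{k \<in> (\<Union>g\<in>Gs. reach H0 (3 * a) g). Y (k \<otimes> y)} = (\<Union>g\<in>Gs. {k \<in> reach H0 (3 * a) g. Y (k \<otimes> y)})" by auto
  then have "card {k \<in> (\<Union>g\<in>Gs. reach H0 (3 * a) g). Y (k \<otimes> y)} \<le> (\<Sum>g\<in>Gs. card {k \<in> reach H0 (3 * a) g. Y (k \<otimes> y)})"
    using card_UN_le[OF Gs(1)] by simp
  also have "\<dots> \<le> (\<Sum>g\<in>Gs. packing_number g)"
  proof (rule sum_mono)
    fix g assume "g \<in> Gs"
    then have "g \<in> carrier G" using Gs(2) by blast
    from someI_ex[OF packing_bounded[OF this], folded packing_number_def]
    show "card {k \<in> reach H0 (3 * a) g. Y (k \<otimes> y)} \<le> packing_number g" using assms(3-6) by blast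
  qed
  finally show ?thesis .
qed

end

section \<open>Boxes in general position\<close>

context tame_subgroup begin

text \<open>
  The box of the center \<open>y\<close> consists of the \<open>w\<close> with \<open>lam i (w y\<^sup>-\<^sup>1) \<le> off y i\<close> for all \<open>i\<close>, so
  \<open>(t, y, i)\<close> says that \<open>t x\<close> is within \<open>\<delta>\<close> of the \<open>i\<close>-th face of this box. Offsets are at most \<open>2
  * a\<close>, and points within \<open>a\<close> of a box lie within \<open>3 * a\<close> of its center.
\<close>

definition near_faces ::
    "'g set \<Rightarrow> real \<Rightarrow> real \<Rightarrow> 'g set \<Rightarrow> ('g \<Rightarrow> bool) \<Rightarrow> ('g \<Rightarrow> nat \<Rightarrow> real) \<Rightarrow> 'g \<Rightarrow> ('g \<times> 'g \<times> nat) set" where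
  "near_faces H0 a \<delta> T Y off x =
     {(t, y, i). t \<in> T \<and> y \<in> carrier G \<and> Y y \<and> i < f \<and> t \<otimes> x \<otimes> inv y \<in> box H0 (3 * a) \<and>
                 \<bar>lam i (t \<otimes> x \<otimes> inv y) - off y i\<bar> \<le> \<delta>}"

lemma finite_near_faces:
  assumes "H0 \<in> Fam" "finite T" "T \<subseteq> carrier G" "x \<in> carrier G"
  shows "finite (near_faces H0 a \<delta> T Y off x)"
proof (rule finite_subset)
  show "near_faces H0 a \<delta> T Y off x \<subseteq>
      (\<lambda>(t, u, i). (t, inv u \<otimes> (t \<otimes> x), i)) ` (T \<times> box H0 (3 * a) \<times> {..<f})"
  proof
    fix z assume "z \<in> near_faces H0 a \<delta> T Y off x"
    then obtain t y i where z: "z = (t, y, i)" "t \<in> T" "y \<in> carrier G" "i < f" "t \<otimes> x \<otimes> inv y \<in> box H0 (3 * a)"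
      unfolding near_faces_def by auto
    have "t \<in> carrier G" "y \<in> carrier G" using z assms by auto
    then have "inv (t \<otimes> x \<otimes> inv y) \<otimes> (t \<otimes> x) = y"
      using assms(4) by (simp add: inv_mult_group m_assoc inv_cancel)
    then show "z \<in> (\<lambda>(t, u, i). (t, inv u \<otimes> (t \<otimes> x), i)) ` (T \<times> box H0 (3 * a) \<times> {..<f})"
      using z by (intro image_eqI[of _ _ "(t, t \<otimes> x \<otimes> inv y, i)"]) auto
  qed
  show "finite ((\<lambda>(t, u, i). (t, inv u \<otimes> (t \<otimes> x), i)) ` (T \<times> box H0 (3 * a) \<times> {..<f}))"
    using assms finite_box by simp
qed

definition generic_offsets where
  "generic_offsets H0 a \<delta> T K J Y off \<longleftrightarrow>
     (\<forall>i<f. local_map G K J (\<lambda>c x. off c x i)) \<and>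
     (\<forall>c. coloring G K J c \<longrightarrow>
        (\<forall>y\<in>carrier G. \<forall>i<f. a \<le> off c y i \<and> off c y i \<le> 2 * a) \<and>
        (\<forall>x\<in>carrier G. card (near_faces H0 a \<delta> T (Y c) (off c) x) \<le> d))"

text \<open>
  Offsets are \<open>a + \<Delta> * n\<close> with \<open>n \<le> N\<close>, chosen greedily. Suppose that \<open>x\<close> is near \<open>d + 1\<close> faces.
  The corresponding functionals satisfy a linear relation, and this relation determines, up to an
  error below \<open>\<Delta>\<close>, the offset of any face that occurs in it with a nonzero coefficient in terms of
  the others. So the offset that is assigned last has to avoid one value for every combinatorial
  type of such a configuration. By the packing bound the number of types is at most \<open>N\<close>,
  independently of \<open>a\<close>, so some \<open>n \<le> N\<close> is left, and \<open>\<Delta> * N \<le> a\<close> keeps the offsets below \<open>2 * a\<close>.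
\<close>

lemma general_position:
  assumes T: "finite T" "T \<subseteq> carrier G"
    and T_inj: "\<And>t t'. t \<in> T \<Longrightarrow> t' \<in> T \<Longrightarrow> t' \<otimes> inv t \<in> H \<Longrightarrow> t = t'"
    and \<delta>: "\<delta> \<ge> 0"
  obtains a0 :: real where "\<And>a H0 K J Yf. a0 \<le> a \<Longrightarrow> 0 < a \<Longrightarrow> H0 \<in> Fam \<Longrightarrow>
     \<forall>t\<in>T. \<forall>t'\<in>T. reach H0 (3 * a) (t \<otimes> inv t') \<subseteq> K \<Longrightarrow> local_map G K J Yf \<Longrightarrow>
     \<forall>c. coloring G K J c \<longrightarrow> separated H0 a (Yf c) \<Longrightarrow> \<exists>off. generic_offsets H0 a \<delta> T K J Yf off"
proof -
  define Te where "Te = ({..d} \<rightarrow>\<^sub>E T) \<times> ({..d} \<rightarrow>\<^sub>E {..<f})"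
  have finTe: "finite Te" unfolding Te_def using T by (intro finite_cartesian_product finite_PiE) auto
  define \<alpha> where "\<alpha> t e = (SOME \<alpha> :: nat \<Rightarrow> real. (\<exists>j\<le>d. \<alpha> j \<noteq> 0) \<and>
          (\<forall>v\<in>H. (\<Sum>j\<le>d. \<alpha> j * lam (e j) (t j \<otimes> v \<otimes> inv (t j))) = 0))" for t e
  have \<alpha>: "(\<exists>j\<le>d. \<alpha> t e j \<noteq> 0) \<and>
          (\<forall>v\<in>H. (\<Sum>j\<le>d. \<alpha> t e j * lam (e j) (t j \<otimes> v \<otimes> inv (t j))) = 0)" if "(t, e) \<in> Te" for t e
  proof -
    have "\<exists>\<alpha> :: nat \<Rightarrow> real. (\<exists>j\<le>d. \<alpha> j \<noteq> 0) \<and>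
          (\<forall>v\<in>H. (\<Sum>j\<le>d. \<alpha> j * lam (e j) (t j \<otimes> v \<otimes> inv (t j))) = 0)"
      by (rule lam_dep) (use that T in \<open>auto simp: Te_def PiE_iff\<close>)
    then show ?thesis unfolding \<alpha>_def by (rule someI_ex)
  qed
  \<comment> \<open>\<open>W\<close> bounds the error in a relation with coefficients \<open>\<alpha> t e\<close> after division by a coefficient;
  a zero coefficient contributes \<open>0\<close>, as division by zero gives zero\<close>
  define W where "W = (\<lambda>(t, e). \<Sum>m\<le>d. 2 * \<delta> * (\<Sum>j\<le>d. \<bar>\<alpha> t e j\<bar>) / \<bar>\<alpha> t e m\<bar>)"
  define \<Delta> where "\<Delta> = 1 + sum W Te"
  have term_nonneg: "0 \<le> 2 * \<delta> * (\<Sum>j\<le>d. \<bar>\<alpha> t e j\<bar>) / \<bar>\<alpha> t e m\<bar>" for t e m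
    using \<delta> by (intro divide_nonneg_nonneg mult_nonneg_nonneg sum_nonneg) simp_all
  have W_nonneg: "0 \<le> W te" for te
    unfolding W_def by (cases te) (simp only: prod.case, intro sum_nonneg term_nonneg)
  have \<Delta>: "2 * \<delta> * (\<Sum>j\<le>d. \<bar>\<alpha> t e j\<bar>) / \<bar>\<alpha> t e m\<bar> \<le> \<Delta> - 1" if "(t, e) \<in> Te" "m \<le> d" for t e m
  proof -
    have "2 * \<delta> * (\<Sum>j\<le>d. \<bar>\<alpha> t e j\<bar>) / \<bar>\<alpha> t e m\<bar> \<le> (\<Sum>m\<le>d. 2 * \<delta> * (\<Sum>j\<le>d. \<bar>\<alpha> t e j\<bar>) / \<bar>\<alpha> t e m\<bar>)"
      by (rule member_le_sum[where f = "\<lambda>m. 2 * \<delta> * (\<Sum>j\<le>d. \<bar>\<alpha> t e j\<bar>) / \<bar>\<alpha> t e m\<bar>"])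
        (use that term_nonneg in auto)
    also have "\<dots> = W (t, e)" by (simp add: W_def)
    also have "\<dots> \<le> sum W Te" by (rule member_le_sum) (use that finTe W_nonneg in auto)
    finally show ?thesis by (simp add: \<Delta>_def)
  qed
  have \<Delta>1: "\<Delta> \<ge> 1" unfolding \<Delta>_def using sum_nonneg[of Te W] W_nonneg by simp
  define Gs where "Gs = (\<lambda>(t, t'). t \<otimes> inv t') ` (T \<times> T)"
  have Gs: "finite Gs" "Gs \<subseteq> carrier G" unfolding Gs_def using T by auto
  define P where "P = 1 + (\<Sum>g\<in>Gs. packing_number g)"
  define N where "N = (d + 1) * card Te * P ^ (d + 1)"
  show ?thesis
  proof (rule that[of "\<Delta> * N"])
    fix a H0 K J and Yf :: "('g \<Rightarrow> nat) \<Rightarrow> 'g \<Rightarrow> bool"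
    assume a0: "\<Delta> * N \<le> a" and a: "0 < a" and H0: "H0 \<in> Fam"
      and reach_K: "\<forall>t\<in>T. \<forall>t'\<in>T. reach H0 (3 * a) (t \<otimes> inv t') \<subseteq> K"
      and Y_loc: "local_map G K J Yf"
      and Y_sep: "\<forall>c. coloring G K J c \<longrightarrow> separated H0 a (Yf c)"
    define K' where "K' = (\<Union>g\<in>Gs. reach H0 (3 * a) g)"
    have K': "finite K'" "K' \<subseteq> carrier G" "K' \<subseteq> K"
    proof -
      show "finite K'" unfolding K'_def using Gs(1) finite_reach[OF H0] by simp
      show "K' \<subseteq> carrier G" unfolding K'_def using reach_carrier[OF H0] Gs(2) by (intro UN_least) blast
      show "K' \<subseteq> K" unfolding K'_def Gs_def using reach_K by (intro UN_least) auto
    qed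
    define K1 where "K1 = insert \<one> K'"
    have K1: "finite K1" "K1 \<subseteq> carrier G" using K' by (auto simp: K1_def)
    \<comment> \<open>a configuration seen from its last face \<open>m\<close>, which belongs to \<open>y\<close>: \<open>w\<close> is the position \<open>x
    y\<^sup>-\<^sup>1\<close> of the common near point, \<open>h j\<close> the position \<open>y j y\<^sup>-\<^sup>1\<close> of the center of the \<open>j\<close>-th
    face, with the dummy value \<open>\<one>\<close> for faces that do not occur in the relation\<close>
    define fits where "fits t e h w n m nb j \<longleftrightarrow> t j \<otimes> w \<otimes> inv (h j) \<in> box H0 (3 * a) \<and>
        (\<exists>q. (if j = m then q = n else nb (h j) (e j) = Some q) \<and>
             \<bar>lam (e j) (t j \<otimes> w \<otimes> inv (h j)) - (a + \<Delta> * real q)\<bar> \<le> \<delta>)"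
      for t :: "nat \<Rightarrow> 'g" and e :: "nat \<Rightarrow> nat" and h :: "nat \<Rightarrow> 'g" and w :: 'g and n m :: nat
        and nb :: "'g \<Rightarrow> nat \<Rightarrow> nat option" and j :: nat
    define excl where "excl c y i nb n \<longleftrightarrow> (\<exists>m t e h w. m \<le> d \<and> (t, e) \<in> Te \<and> h \<in> {..d} \<rightarrow>\<^sub>E K1 \<and> w \<in> carrier G \<and>
        e m = i \<and> h m = \<one> \<and> \<alpha> t e m \<noteq> 0 \<and>
        (\<forall>j\<le>d. if \<alpha> t e j = 0 then h j = \<one> else Yf c (h j \<otimes> y) \<and> fits t e h w n m nb j))"
      for c y i nb n
    define S where "S c y i nb = (LEAST n. \<not> excl c y i nb n)" for c y i nb
    obtain v :: "('g \<Rightarrow> nat) \<Rightarrow> 'g \<Rightarrow> nat \<Rightarrow> nat" where v_loc: "\<And>i. i < f \<Longrightarrow> local_map G K J (\<lambda>c x. v c x i)"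
      and v: "\<And>c x i. v c x i = S c x i (\<lambda>g i'. if i' < f \<and> c (g \<otimes> x) * f + i' < c x * f + i
                                     then Some (v c (g \<otimes> x) i') else None)"
    proof (rule local_greedy[where N = K1 and I = K1 and F = "\<lambda>g c x. Yf c (g \<otimes> x)" and K = K and J = J and f = f and S = S])
      show "local_map G K J (\<lambda>c x. Yf c (g \<otimes> x))" if "g \<in> K1" for g
        using that K1 Y_loc by (intro local_translate) auto
      show "S c x i nb = S c' x' i nb'"
        if "\<And>j. j \<in> K1 \<Longrightarrow> Yf c (j \<otimes> x) = Yf c' (j \<otimes> x')"
          "\<And>g i'. g \<in> K1 \<Longrightarrow> i' < f \<Longrightarrow> nb g i' = nb' g i'" for c c' x x' i and nb nb' :: "'g \<Rightarrow> nat \<Rightarrow> nat option"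
      proof -
        have fe: "fits t e h w n m nb j = fits t e h w n m nb' j"
          if "(t, e) \<in> Te" "h \<in> {..d} \<rightarrow>\<^sub>E K1" "j \<le> d" for t e h w n m j
          using that \<open>\<And>g i'. g \<in> K1 \<Longrightarrow> i' < f \<Longrightarrow> nb g i' = nb' g i'\<close>[of "h j" "e j"]
          by (auto simp: fits_def Te_def PiE_iff)
        have Ye: "Yf c (h j \<otimes> x) = Yf c' (h j \<otimes> x')" if "h \<in> {..d} \<rightarrow>\<^sub>E K1" "j \<le> d" for h j
          using that \<open>\<And>j. j \<in> K1 \<Longrightarrow> Yf c (j \<otimes> x) = Yf c' (j \<otimes> x')\<close> by (auto simp: PiE_iff)
        have "excl c x i nb n = excl c' x' i nb' n" for n
          unfolding excl_def
          by (intro ex_cong1 conj_cong refl all_cong1 imp_cong if_cong) (use fe Ye in auto)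
        then show ?thesis by (simp add: S_def)
      qed
    qed (use K1 in auto)
    define nbv where "nbv c x i = (\<lambda>g i'. if i' < f \<and> c (g \<otimes> x) * f + i' < c x * f + i
                                     then Some (v c (g \<otimes> x) i') else None)" for c x i
    have v_least: "v c y i = (LEAST n. \<not> excl c y i (nbv c y i) n)" for c y i
      using v[of c y i] unfolding S_def nbv_def .
    have bound: "\<exists>n\<le>N. \<not> excl c y i nb n" if c: "coloring G K J c" and y: "y \<in> carrier G" for c y i nb
    proof (rule ccontr)
      assume "\<not> ?thesis"
      then have ex: "\<forall>n\<in>{..N}. excl c y i nb n" by auto
      define R where "R = insert \<one> {k \<in> K'. Yf c (k \<otimes> y)}"
      have Rf: "finite R" using K' by (simp add: R_def)
      have "card R \<le> Suc (card {k \<in> K'. Yf c (k \<otimes> y)})" using K' by (simp add: R_def card_insert_if)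
      also have "\<dots> \<le> P"
        unfolding P_def K'_def using card_packing[OF Gs H0 a y, of "Yf c"] Y_sep c by simp
      finally have RP: "card R \<le> P" .
      have "\<forall>n\<in>{..N}. \<exists>p. case p of (m, (t, e), h, w) \<Rightarrow> m \<le> d \<and> (t, e) \<in> Te \<and> h \<in> {..d} \<rightarrow>\<^sub>E K1 \<and> w \<in> carrier G \<and>
        e m = i \<and> h m = \<one> \<and> \<alpha> t e m \<noteq> 0 \<and>
        (\<forall>j\<le>d. if \<alpha> t e j = 0 then h j = \<one> else Yf c (h j \<otimes> y) \<and> fits t e h w n m nb j)"
        using ex unfolding excl_def by fastforce
      from bchoice[OF this] obtain p where p: "\<forall>n\<in>{..N}. case p n of (m, (t, e), h, w) \<Rightarrow> m \<le> d \<and> (t, e) \<in> Te \<and> h \<in> {..d} \<rightarrow>\<^sub>E K1 \<and> w \<in> carrier G \<and>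
        e m = i \<and> h m = \<one> \<and> \<alpha> t e m \<noteq> 0 \<and>
        (\<forall>j\<le>d. if \<alpha> t e j = 0 then h j = \<one> else Yf c (h j \<otimes> y) \<and> fits t e h w n m nb j)" ..
      \<comment> \<open>a type \<open>(m, t, e, h)\<close> excludes at most one value, whatever \<open>w\<close> is\<close>
      define key where "key n = (case p n of (m, te, h, w) \<Rightarrow> (m, te, h))" for n
      let ?Keys = "{..d} \<times> Te \<times> ({..d} \<rightarrow>\<^sub>E R)"
      have finKeys: "finite ?Keys" using finTe Rf by (intro finite_cartesian_product finite_PiE) auto
      have "key ` {..N} \<subseteq> ?Keys"
      proof (rule image_subsetI)
        fix n assume n: "n \<in> {..N}"
        obtain m t e h w where pn: "p n = (m, (t, e), h, w)" by (metis prod.exhaust)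
        have q: "m \<le> d" "(t, e) \<in> Te" "h \<in> {..d} \<rightarrow>\<^sub>E K1"
          "\<forall>j\<le>d. if \<alpha> t e j = 0 then h j = \<one> else Yf c (h j \<otimes> y) \<and> fits t e h w n m nb j"
          using p[rule_format, OF n] unfolding pn by auto
        have "h j \<in> R" if "j \<le> d" for j
          using q(3) q(4)[rule_format, OF that] that by (auto simp: R_def K1_def PiE_iff split: if_splits)
        then show "key n \<in> ?Keys" using q unfolding key_def pn by (auto simp: PiE_iff)
      qed
      moreover have "inj_on key {..N}"
      proof (rule inj_onI)
        fix n1 n2 assume n: "n1 \<in> {..N}" "n2 \<in> {..N}" and eq: "key n1 = key n2"
        obtain m t e h w where pn1: "p n1 = (m, (t, e), h, w)" by (metis prod.exhaust)
        obtain w' where pn2: "p n2 = (m, (t, e), h, w')"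
          using eq unfolding key_def pn1 by (cases "p n2") auto
        have q: "m \<le> d" "(t, e) \<in> Te" "h \<in> {..d} \<rightarrow>\<^sub>E K1" "w \<in> carrier G" "h m = \<one>" "\<alpha> t e m \<noteq> 0"
          and q': "w' \<in> carrier G"
          and fits1: "\<And>j. j \<le> d \<Longrightarrow> \<alpha> t e j \<noteq> 0 \<Longrightarrow> fits t e h w n1 m nb j"
          and fits2: "\<And>j. j \<le> d \<Longrightarrow> \<alpha> t e j \<noteq> 0 \<Longrightarrow> fits t e h w' n2 m nb j"
          using p[rule_format, OF n(1)] p[rule_format, OF n(2)] unfolding pn1 pn2 by auto
        have hc: "h j \<in> carrier G" if "j \<le> d" for j
          using q that K1 by (auto simp: PiE_iff)
        have tc: "t j \<in> carrier G" if "j \<le> d" for j using q(2) that T by (auto simp: Te_def PiE_iff)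
        have ef: "e j < f" if "j \<le> d" for j using q(2) that by (auto simp: Te_def PiE_iff)
        define u where "u j = t j \<otimes> w \<otimes> inv (h j)" for j
        define u' where "u' j = t j \<otimes> w' \<otimes> inv (h j)" for j
        \<comment> \<open>the displacement between the two near points lies in \<open>H\<close>, so the relation applies to it\<close>
        define x where "x = w' \<otimes> inv w"
        have uH: "u j \<in> H" "u' j \<in> H" if "j \<le> d" "\<alpha> t e j \<noteq> 0" for j
          using fits1[OF that] fits2[OF that] box_H[OF H0] by (auto simp: fits_def u_def u'_def)
        have "t m \<otimes> x \<otimes> inv (t m) = u' m \<otimes> inv (u m)"
          using tc[OF q(1)] q q' by (simp add: u_def u'_def x_def inv_mult_group m_assoc)
        then have "t m \<otimes> x \<otimes> inv (t m) \<in> H" using uH[OF q(1) q(6)] by simp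
        then have "inv (t m) \<otimes> (t m \<otimes> x \<otimes> inv (t m)) \<otimes> t m \<in> H" by (rule H_conj'[OF tc[OF q(1)]])
        then have xH: "x \<in> H" using tc[OF q(1)] q q' by (simp add: x_def m_assoc inv_cancel)
        have uu: "u' j = (t j \<otimes> x \<otimes> inv (t j)) \<otimes> u j" if "j \<le> d" for j
          using tc[OF that] hc[OF that] q q' by (simp add: u_def u'_def x_def m_assoc inv_cancel)
        have lam_uu: "lam (e j) (u' j) - lam (e j) (u j) = lam (e j) (t j \<otimes> x \<otimes> inv (t j))"
          if "j \<le> d" "\<alpha> t e j \<noteq> 0" for j
          unfolding uu[OF that(1)] using lam_mult[OF ef[OF that(1)] H_conj[OF tc[OF that(1)] xH] uH(1)[OF that]] by simp
        define D where "D j = lam (e j) (t j \<otimes> x \<otimes> inv (t j))" for j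
        have sumD: "(\<Sum>j\<le>d. \<alpha> t e j * D j) = 0" using \<alpha>[OF q(2)] xH unfolding D_def by blast
        have Dj: "\<bar>D j\<bar> \<le> 2 * \<delta>" if j: "j \<le> d" "\<alpha> t e j \<noteq> 0" "j \<noteq> m" for j
        proof -
          obtain s where s: "nb (h j) (e j) = Some s" "\<bar>lam (e j) (u j) - (a + \<Delta> * real s)\<bar> \<le> \<delta>"
            using fits1[OF j(1,2)] j(3) by (auto simp: fits_def u_def)
          obtain s' where s': "nb (h j) (e j) = Some s'" "\<bar>lam (e j) (u' j) - (a + \<Delta> * real s')\<bar> \<le> \<delta>"
            using fits2[OF j(1,2)] j(3) by (auto simp: fits_def u'_def)
          have "s' = s" using s s' by simp
          then show ?thesis using s(2) s'(2) lam_uu[OF j(1,2)] unfolding D_def abs_le_iff by simp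
        qed
        have Dm: "\<bar>D m - \<Delta> * (real n2 - real n1)\<bar> \<le> 2 * \<delta>"
        proof -
          have "\<bar>lam (e m) (u m) - (a + \<Delta> * real n1)\<bar> \<le> \<delta>"
            using fits1[OF q(1,6)] by (auto simp: fits_def u_def)
          moreover have "\<bar>lam (e m) (u' m) - (a + \<Delta> * real n2)\<bar> \<le> \<delta>"
            using fits2[OF q(1,6)] by (auto simp: fits_def u'_def)
          ultimately show ?thesis using lam_uu[OF q(1,6)] unfolding D_def abs_le_iff right_diff_distrib by linarith
        qed
        have "\<alpha> t e m * (\<Delta> * (real n2 - real n1)) =
            - (\<alpha> t e m * (D m - \<Delta> * (real n2 - real n1)) + (\<Sum>j\<in>{..d} - {m}. \<alpha> t e j * D j))"
          using sumD q(1) by (simp add: sum.remove[of "{..d}" m] algebra_simps)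
        then have "\<bar>\<alpha> t e m\<bar> * (\<Delta> * \<bar>real n2 - real n1\<bar>) =
            \<bar>\<alpha> t e m * (D m - \<Delta> * (real n2 - real n1)) + (\<Sum>j\<in>{..d} - {m}. \<alpha> t e j * D j)\<bar>"
        proof -
          assume eq: "\<alpha> t e m * (\<Delta> * (real n2 - real n1)) =
            - (\<alpha> t e m * (D m - \<Delta> * (real n2 - real n1)) + (\<Sum>j\<in>{..d} - {m}. \<alpha> t e j * D j))"
          have "\<bar>\<alpha> t e m\<bar> * (\<Delta> * \<bar>real n2 - real n1\<bar>) = \<bar>\<alpha> t e m * (\<Delta> * (real n2 - real n1))\<bar>"
            using \<Delta>1 by (simp only: abs_mult)
          then show ?thesis unfolding eq abs_minus_cancel .
        qed
        also have "\<dots> \<le> \<bar>\<alpha> t e m\<bar> * (2 * \<delta>) + (\<Sum>j\<in>{..d} - {m}. \<bar>\<alpha> t e j\<bar> * (2 * \<delta>))"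
        proof -
          have "\<bar>\<alpha> t e j * D j\<bar> \<le> \<bar>\<alpha> t e j\<bar> * (2 * \<delta>)" if "j \<in> {..d} - {m}" for j
            using Dj[of j] that by (cases "\<alpha> t e j = 0") (auto simp: abs_mult intro: mult_left_mono)
          then have "\<bar>\<Sum>j\<in>{..d} - {m}. \<alpha> t e j * D j\<bar> \<le> (\<Sum>j\<in>{..d} - {m}. \<bar>\<alpha> t e j\<bar> * (2 * \<delta>))"
            by (intro order_trans[OF sum_abs] sum_mono)
          moreover have "\<bar>\<alpha> t e m * (D m - \<Delta> * (real n2 - real n1))\<bar> \<le> \<bar>\<alpha> t e m\<bar> * (2 * \<delta>)"
            unfolding abs_mult using Dm by (intro mult_left_mono) auto
          ultimately show ?thesis by linarith
        qed
        also have "\<dots> = 2 * \<delta> * (\<Sum>j\<le>d. \<bar>\<alpha> t e j\<bar>)"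
          using q(1) by (simp add: sum.remove[of "{..d}" m] sum_distrib_left[symmetric] sum_distrib_right[symmetric] algebra_simps)
        also have "\<dots> \<le> \<bar>\<alpha> t e m\<bar> * (\<Delta> - 1)"
          using \<Delta>[OF q(2,1)] q(6) by (simp add: field_simps)
        finally have "\<Delta> * \<bar>real n2 - real n1\<bar> \<le> \<Delta> - 1" using q(6) by simp
        then have "\<Delta> * \<bar>real n2 - real n1\<bar> < \<Delta> * 1" by linarith
        then have "\<bar>real n2 - real n1\<bar> < 1" using \<Delta>1 by (subst (asm) mult_less_cancel_left_pos) auto
        then show "n1 = n2" by linarith
      qed
      ultimately have "card {..N} \<le> card ?Keys" using finKeys by (intro card_inj_on_le)
      also have "\<dots> = (d + 1) * card Te * card R ^ (d + 1)" by (simp add: card_cartesian_product card_PiE algebra_simps)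
      also have "\<dots> \<le> N" unfolding N_def using RP by (intro mult_left_mono power_mono) auto
      finally show False by simp
    qed
    define off where "off c y i = a + \<Delta> * real (v c y i)" for c y i
    show "\<exists>off. generic_offsets H0 a \<delta> T K J Yf off"
      unfolding generic_offsets_def
    proof (intro exI[of _ off] conjI allI impI ballI)
      fix i assume i: "i < f"
      show "local_map G K J (\<lambda>c x. off c x i)"
        by (rule local_determined[where I = "{()}" and F = "\<lambda>_ c x. v c x i"]) (simp_all add: off_def v_loc[OF i])
    next
      fix c y i assume c: "coloring G K J c" and y: "y \<in> carrier G"
      show "a \<le> off c y i" using \<Delta>1 by (simp add: off_def)
      have "v c y i \<le> N"
        using bound[OF c y, of i "nbv c y i"] unfolding v_least by (meson Least_le le_trans)
      then have "\<Delta> * real (v c y i) \<le> \<Delta> * N" using \<Delta>1 by (intro mult_left_mono) auto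
      then show "off c y i \<le> 2 * a" using a0 by (simp add: off_def)
    next
      fix c x assume c: "coloring G K J c" and x: "x \<in> carrier G"
      let ?F = "near_faces H0 a \<delta> T (Yf c) (off c) x"
      show "card ?F \<le> d"
      proof (rule ccontr)
        assume "\<not> ?thesis"
        then have "Suc d \<le> card ?F" by simp
        then obtain F where F: "F \<subseteq> ?F" "card F = Suc d" "finite F" by (rule obtain_subset_with_card_n)
        obtain b where b: "bij_betw b {0..<Suc d} F" using ex_bij_betw_nat_finite[OF F(3)] F(2) by auto
        have bF: "b j \<in> ?F" if "j \<le> d" for j using bij_betwE[OF b] that F(1) by auto
        have binj: "j = j'" if "b j = b j'" "j \<le> d" "j' \<le> d" for j j'
          using bij_betw_imp_inj_on[OF b] that by (auto dest: inj_onD)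
        define t where "t = restrict (\<lambda>j. fst (b j)) {..d}"
        define y where "y j = fst (snd (b j))" for j
        define e where "e = restrict (\<lambda>j. snd (snd (b j))) {..d}"
        have bj: "t j \<in> T" "y j \<in> carrier G" "Yf c (y j)" "e j < f" "t j \<otimes> x \<otimes> inv (y j) \<in> box H0 (3 * a)"
            "\<bar>lam (e j) (t j \<otimes> x \<otimes> inv (y j)) - off c (y j) (e j)\<bar> \<le> \<delta>" "b j = (t j, y j, e j)" if "j \<le> d" for j
          using bF[OF that] that unfolding near_faces_def by (auto simp: t_def y_def e_def)
        have te: "(t, e) \<in> Te" unfolding Te_def using bj(1,4) by (intro SigmaI PiE_I) (simp_all add: t_def e_def)
        have tc: "t j \<in> carrier G" if "j \<le> d" for j using bj(1)[OF that] T by auto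
        \<comment> \<open>among the faces that occur in the relation, \<open>m\<close> is the one that received its offset last\<close>
        define Sup where "Sup = {j. j \<le> d \<and> \<alpha> t e j \<noteq> 0}"
        have Sup: "finite Sup" "Sup \<noteq> {}" using \<alpha>[OF te] by (auto simp: Sup_def)
        define st where "st j = c (y j) * f + e j" for j
        have "Max (st ` Sup) \<in> st ` Sup" using Sup by (intro Max_in) auto
        then obtain m where m: "m \<in> Sup" "st m = Max (st ` Sup)" by auto
        have md: "m \<le> d" and \<alpha>m: "\<alpha> t e m \<noteq> 0" using m by (auto simp: Sup_def)
        have quot: "y j \<otimes> inv (y m) \<in> reach H0 (3 * a) (t j \<otimes> inv (t m))" if j: "j \<le> d" for j
        proof -
          have "y j \<otimes> inv (y m) = inv (t j \<otimes> x \<otimes> inv (y j)) \<otimes> (t j \<otimes> inv (t m)) \<otimes> (t m \<otimes> x \<otimes> inv (y m))"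
            using tc[OF j] tc[OF md] bj(2)[OF j] bj(2)[OF md] x by (simp add: inv_mult_group m_assoc inv_cancel)
          then show ?thesis using bj(5)[OF j] bj(5)[OF md] box_inv[OF H0] by (auto intro!: reachI)
        qed
        then have quotK: "y j \<otimes> inv (y m) \<in> K'" if "j \<le> d" for j
          using that bj(1) md unfolding K'_def Gs_def by blast
        \<comment> \<open>equal stages would mean equal face numbers and centers of equal color; distinct centers in
        the window have distinct colors, and for a single center \<open>T_inj\<close> makes the two faces equal\<close>
        have less: "st j < st m" if j: "j \<in> Sup" "j \<noteq> m" for j
        proof -
          have jd: "j \<le> d" using j by (simp add: Sup_def)
          have "st j \<le> st m" unfolding m(2) using Sup j by (intro Max_ge) auto
          moreover have "st j \<noteq> st m"
          proof
            assume "st j = st m"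
            then have "(c (y j) * f + e j) mod f = (c (y m) * f + e m) mod f"
              "(c (y j) * f + e j) div f = (c (y m) * f + e m) div f" by (simp_all add: st_def)
            then have ej: "e j = e m" and cj: "c (y j) = c (y m)" using bj(4)[OF jd] bj(4)[OF md] by auto
            have "y j \<noteq> y m"
            proof
              assume yy: "y j = y m"
              have "t m \<otimes> inv (t j) = (t m \<otimes> x \<otimes> inv (y m)) \<otimes> inv (t j \<otimes> x \<otimes> inv (y j))"
                unfolding yy using tc[OF jd] tc[OF md] bj(2)[OF md] x by (simp add: inv_mult_group m_assoc inv_cancel)
              then have "t m \<otimes> inv (t j) \<in> H" using bj(5)[OF jd] bj(5)[OF md] box_H[OF H0] by simp
              then have "t j = t m" by (rule T_inj[OF bj(1)[OF jd] bj(1)[OF md]])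
              then have "b j = b m" using bj(7)[OF jd] bj(7)[OF md] yy ej by simp
              then show False using binj jd md j(2) by blast
            qed
            moreover have "y j \<otimes> inv (y m) \<otimes> y m = y j" using bj(2)[OF jd] bj(2)[OF md] by (simp add: m_assoc)
            ultimately have "y j \<otimes> inv (y m) \<noteq> \<one>" using bj(2)[OF md] by auto
            then have "c (y j \<otimes> inv (y m) \<otimes> y m) \<noteq> c (y m)"
              using quotK[OF jd] K'(3) bj(2)[OF md] by (intro coloring_neq[OF c]) auto
            then show False using cj \<open>y j \<otimes> inv (y m) \<otimes> y m = y j\<close> by simp
          qed
          ultimately show ?thesis by simp
        qed
        define h where "h = restrict (\<lambda>j. if \<alpha> t e j = 0 then \<one> else y j \<otimes> inv (y m)) {..d}"
        define w where "w = x \<otimes> inv (y m)"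
        have hy: "h j \<otimes> y m = y j" if "j \<le> d" "\<alpha> t e j \<noteq> 0" for j
          using that bj(2)[OF that(1)] bj(2)[OF md] by (simp add: h_def m_assoc)
        have hm: "h m = \<one>" using md bj(2)[OF md] by (simp add: h_def)
        have tw: "t j \<otimes> w \<otimes> inv (h j) = t j \<otimes> x \<otimes> inv (y j)" if "j \<le> d" "\<alpha> t e j \<noteq> 0" for j
          using that bj(2)[OF that(1)] bj(2)[OF md] tc[OF that(1)] x by (simp add: h_def w_def inv_mult_group m_assoc inv_cancel)
        have fit: "fits t e h w (v c (y m) (e m)) m (nbv c (y m) (e m)) j" if j: "j \<le> d" "\<alpha> t e j \<noteq> 0" for j
          unfolding fits_def tw[OF j]
        proof (intro conjI exI[of _ "v c (y j) (e j)"])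
          show "t j \<otimes> x \<otimes> inv (y j) \<in> box H0 (3 * a)" using bj(5)[OF j(1)] .
          show "\<bar>lam (e j) (t j \<otimes> x \<otimes> inv (y j)) - (a + \<Delta> * real (v c (y j) (e j)))\<bar> \<le> \<delta>"
            using bj(6)[OF j(1)] by (simp add: off_def)
          show "if j = m then v c (y j) (e j) = v c (y m) (e m) else nbv c (y m) (e m) (h j) (e j) = Some (v c (y j) (e j))"
            using less[of j] j bj(4)[OF j(1)] hy[OF j] by (auto simp: nbv_def st_def Sup_def)
        qed
        have "excl c (y m) (e m) (nbv c (y m) (e m)) (v c (y m) (e m))"
          unfolding excl_def
        proof (rule exI[of _ m], rule exI[of _ t], rule exI[of _ e], rule exI[of _ h], rule exI[of _ w], intro conjI allI impI)
          show "h \<in> {..d} \<rightarrow>\<^sub>E K1" using quotK by (auto simp: h_def K1_def)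
          show "w \<in> carrier G" using x bj(2)[OF md] by (simp add: w_def)
          fix j assume j: "j \<le> d"
          show "if \<alpha> t e j = 0 then h j = \<one>
              else Yf c (h j \<otimes> y m) \<and> fits t e h w (v c (y m) (e m)) m (nbv c (y m) (e m)) j"
            using j bj(3)[OF j] hy[OF j] fit[OF j] by (simp add: h_def)
        qed (use md te \<alpha>m hm in auto)
        moreover have "\<not> excl c (y m) (e m) (nbv c (y m) (e m)) (v c (y m) (e m))"
          unfolding v_least[of c "y m" "e m"] using bound[OF c bj(2)[OF md]] by (metis (mono_tags, lifting) LeastI)
        ultimately show False by blast
      qed
    qed
  qed
qed

end

section \<open>Cells and deep points\<close>

context tame_subgroup begin

lemma H_pow: "v \<in> H \<Longrightarrow> v [^] (n :: nat) \<in> H"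
  by (induction n) simp_all

lemma additive_pow:
  assumes "\<And>u v. u \<in> H \<Longrightarrow> v \<in> H \<Longrightarrow> \<phi> (u \<otimes> v) = \<phi> u + (\<phi> v :: real)" and v: "v \<in> H"
  shows "\<phi> (v [^] (n :: nat)) = real n * \<phi> v"
proof (induction n)
  case 0
  have "\<phi> (\<one> \<otimes> \<one>) = \<phi> \<one> + \<phi> \<one>" by (rule assms(1)) simp_all
  then show ?case by simp
next
  case (Suc n)
  have "\<phi> (v [^] Suc n) = \<phi> (v [^] n) + \<phi> v"
    unfolding nat_pow_Suc by (rule assms(1)[OF H_pow[OF v] v])
  then show ?case using Suc by (simp add: algebra_simps)
qed

text \<open>
  On the sequence \<open>w v\<^sup>n\<close> a homomorphism to the reals vanishes at most once, unless it vanishes at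
  \<open>v\<close> and at \<open>w\<close>.
\<close>

lemma additive_nonvanishing:
  assumes "finite \<Phi>" and "\<And>\<phi> u v. \<phi> \<in> \<Phi> \<Longrightarrow> u \<in> H \<Longrightarrow> v \<in> H \<Longrightarrow> \<phi> (u \<otimes> v) = \<phi> u + (\<phi> v :: real)"
    and "\<And>\<phi>. \<phi> \<in> \<Phi> \<Longrightarrow> \<exists>v\<in>H. \<phi> v \<noteq> 0"
  shows "\<exists>v\<in>H. \<forall>\<phi>\<in>\<Phi>. \<phi> v \<noteq> 0"
  using assms
proof (induction \<Phi> rule: finite_induct)
  case empty show ?case by (intro bexI[of _ \<one>]) auto
next
  case (insert \<psi> \<Phi>)
  have "\<exists>v\<in>H. \<forall>\<phi>\<in>\<Phi>. \<phi> v \<noteq> 0"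
    by (rule insert.IH) (use insert.prems in auto)
  then obtain v where v: "v \<in> H" "\<And>\<phi>. \<phi> \<in> \<Phi> \<Longrightarrow> \<phi> v \<noteq> 0" by blast
  obtain w where w: "w \<in> H" "\<psi> w \<noteq> 0" using insert.prems(2) by blast
  have val: "\<phi> (w \<otimes> v [^] n) = \<phi> w + real n * \<phi> v" if "\<phi> \<in> insert \<psi> \<Phi>" for \<phi> and n :: nat
    using insert.prems(1)[OF that w(1) H_pow[OF v(1)]] additive_pow[of \<phi> v n] insert.prems(1)[OF that] v(1) by simp
  have "finite {n. \<phi> (w \<otimes> v [^] (n :: nat)) = 0}" if \<phi>: "\<phi> \<in> insert \<psi> \<Phi>" for \<phi>
  proof (cases "\<phi> v = 0")
    case True
    then have "\<phi> = \<psi>" using \<phi> v(2) by auto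
    then show ?thesis using val[OF \<phi>] True w(2) by simp
  next
    case False
    have "n = nat \<lfloor>- \<phi> w / \<phi> v\<rfloor>" if "\<phi> w + real n * \<phi> v = 0" for n :: nat
    proof -
      have "real n * \<phi> v = - \<phi> w" using that by linarith
      then have "- \<phi> w / \<phi> v = real n" using False by (metis nonzero_mult_div_cancel_right)
      then show ?thesis by simp
    qed
    then have "{n. \<phi> (w \<otimes> v [^] (n :: nat)) = 0} \<subseteq> {nat \<lfloor>- \<phi> w / \<phi> v\<rfloor>}"
      unfolding val[OF \<phi>] by blast
    then show ?thesis by (rule finite_subset) simp
  qed
  then have "finite (\<Union>\<phi>\<in>insert \<psi> \<Phi>. {n. \<phi> (w \<otimes> v [^] (n :: nat)) = 0})"
    using insert.hyps(1) by blast
  from ex_new_if_finite[OF infinite_UNIV_nat this] obtain n :: nat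
    where "\<forall>\<phi>\<in>insert \<psi> \<Phi>. \<phi> (w \<otimes> v [^] n) \<noteq> 0" by blast
  then show ?case using w(1) H_pow[OF v(1)] by (intro bexI[of _ "w \<otimes> v [^] n"]) auto
qed

lemma lam_conj_mult:
  assumes "t \<in> carrier G" "i < f" "u \<in> H" "v \<in> H"
  shows "lam i (t \<otimes> (u \<otimes> v) \<otimes> inv t) = lam i (t \<otimes> u \<otimes> inv t) + lam i (t \<otimes> v \<otimes> inv t)"
proof -
  have "t \<otimes> (u \<otimes> v) \<otimes> inv t = (t \<otimes> u \<otimes> inv t) \<otimes> (t \<otimes> v \<otimes> inv t)"
    using assms(1) H_carrier[OF assms(3)] H_carrier[OF assms(4)] by (simp add: m_assoc inv_cancel)
  then show ?thesis using lam_mult[OF assms(2) H_conj[OF assms(1,3)] H_conj[OF assms(1,4)]] by simp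
qed

text \<open>
  A high power of an element at which none of the conjugated functionals vanishes.
\<close>

lemma large_displacement:
  assumes T: "finite T" "T \<subseteq> carrier G"
  obtains v where "v \<in> H" "\<And>t i. t \<in> T \<Longrightarrow> i < f \<Longrightarrow> r < \<bar>lam i (t \<otimes> v \<otimes> inv t)\<bar>"
proof -
  define \<Phi> where "\<Phi> = (\<lambda>(t, i) v. lam i (t \<otimes> v \<otimes> inv t)) ` (T \<times> {..<f})"
  have fin: "finite \<Phi>" using T by (simp add: \<Phi>_def)
  have add: "\<phi> (u \<otimes> v) = \<phi> u + \<phi> v" if "\<phi> \<in> \<Phi>" "u \<in> H" "v \<in> H" for \<phi> u v
    using that T lam_conj_mult by (auto simp: \<Phi>_def subset_iff)
  have nz: "\<exists>v\<in>H. \<phi> v \<noteq> 0" if "\<phi> \<in> \<Phi>" for \<phi>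
  proof -
    from that obtain t i where ti: "t \<in> T" "i < f" "\<phi> = (\<lambda>v. lam i (t \<otimes> v \<otimes> inv t))" by (auto simp: \<Phi>_def)
    obtain v where v: "v \<in> H" "lam i v \<noteq> 0" using lam_nonzero[OF ti(2)] by blast
    have t: "t \<in> carrier G" using ti T by auto
    have "t \<otimes> (inv t \<otimes> v \<otimes> t) \<otimes> inv t = v" using t H_carrier[OF v(1)] by (simp add: m_assoc inv_cancel)
    then show ?thesis using v H_conj'[OF t v(1)] unfolding ti(3) by (intro bexI[of _ "inv t \<otimes> v \<otimes> t"]) simp_all
  qed
  obtain v where v: "v \<in> H" "\<And>\<phi>. \<phi> \<in> \<Phi> \<Longrightarrow> \<phi> v \<noteq> 0"
    using additive_nonvanishing[OF fin add nz] by blast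
  define N where "N = (\<Sum>\<phi>\<in>\<Phi>. nat \<lceil>(\<bar>r\<bar> + 1) / \<bar>\<phi> v\<bar>\<rceil>)"
  have large: "r < \<bar>\<phi> (v [^] N)\<bar>" if \<phi>: "\<phi> \<in> \<Phi>" for \<phi>
  proof -
    have "nat \<lceil>(\<bar>r\<bar> + 1) / \<bar>\<phi> v\<bar>\<rceil> \<le> N" unfolding N_def by (rule member_le_sum[OF \<phi> _ fin]) simp
    then have "(\<bar>r\<bar> + 1) / \<bar>\<phi> v\<bar> \<le> real N" by linarith
    then have "\<bar>r\<bar> + 1 \<le> real N * \<bar>\<phi> v\<bar>" using v(2)[OF \<phi>] by (simp add: pos_divide_le_eq)
    moreover have "\<bar>\<phi> (v [^] N)\<bar> = real N * \<bar>\<phi> v\<bar>"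
      using additive_pow[of \<phi> v N] add[OF \<phi>] v(1) by (simp add: abs_mult)
    ultimately show ?thesis by linarith
  qed
  show ?thesis
  proof (rule that[OF H_pow[OF v(1), of N]])
    fix t i assume "t \<in> T" "i < f"
    then have "(\<lambda>v. lam i (t \<otimes> v \<otimes> inv t)) \<in> \<Phi>" by (auto simp: \<Phi>_def)
    from large[OF this] show "r < \<bar>lam i (t \<otimes> v [^] N \<otimes> inv t)\<bar>" .
  qed
qed

lemma conj_bound:
  assumes "finite T" "finite V"
  obtains \<delta> where "0 \<le> \<delta>" "\<And>t v i. t \<in> T \<Longrightarrow> v \<in> V \<Longrightarrow> i < f \<Longrightarrow> \<bar>lam i (t \<otimes> v \<otimes> inv t)\<bar> \<le> \<delta>"
proof -
  define S where "S = insert 0 ((\<lambda>(t, v, i). \<bar>lam i (t \<otimes> v \<otimes> inv t)\<bar>) ` (T \<times> V \<times> {..<f}))"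
  have "finite S" using assms by (simp add: S_def)
  then have le: "s \<le> Max S" if "s \<in> S" for s using that by simp
  show ?thesis
  proof (rule that[of "Max S"])
    show "0 \<le> Max S" by (rule le) (simp add: S_def)
    fix t v i assume "t \<in> T" "v \<in> V" "i < f"
    then show "\<bar>lam i (t \<otimes> v \<otimes> inv t)\<bar> \<le> Max S" by (intro le) (force simp: S_def)
  qed
qed

text \<open>
  What the extension step needs. The map \<open>cen\<close> sends a point to the center of its cell, \<open>q\<close> colors
  centers with \<open>M\<close> colors such that cells that correspond under \<open>Ks\<close> get different colors, and \<open>\<rho>\<close>
  moves a point \<open>x\<close> to a deep point: the cells of \<open>t \<rho> x\<close> and \<open>t v \<rho> x\<close> agree. The last clause
  counts the patterns over \<open>T\<close> seen from all points \<open>b\<^sup>-\<^sup>1 \<rho> b x\<close> that may arise when the rule is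
  evaluated on \<open>B x\<close>.
\<close>

definition cell_rule where
  "cell_rule Ks M T V B K V1 J cen q \<rho> D \<longleftrightarrow>
     local_map G K J (\<lambda>c x. cen c x \<otimes> inv x) \<and> local_map G K J q \<and> local_map G K J \<rho> \<and>
     finite D \<and> D \<subseteq> carrier G \<and>
     (\<forall>c. coloring G K J c \<longrightarrow> (\<forall>x\<in>carrier G.
        cen c x \<in> carrier G \<and> cen c x \<otimes> inv x \<in> D \<and> \<rho> c x \<in> V1 \<and> q c (cen c x) < (M :: nat) \<and>
        (\<forall>k\<in>Ks. q c (cen c (k \<otimes> x)) \<noteq> q c (cen c x)) \<and>
        (\<forall>t\<in>T. \<forall>v\<in>V. cen c (t \<otimes> v \<otimes> (\<rho> c x \<otimes> x)) = cen c (t \<otimes> (\<rho> c x \<otimes> x))) \<and>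
        card ((\<lambda>w. restrict (\<lambda>t. cen c (t \<otimes> w)) T) `
              (\<lambda>(b, v). inv b \<otimes> v \<otimes> b \<otimes> x) ` (B \<times> V1)) \<le> 2 ^ d))"

end

lemma card_image_factor:
  assumes "finite (g ` S)" "\<And>x y. x \<in> S \<Longrightarrow> y \<in> S \<Longrightarrow> g x = g y \<Longrightarrow> h x = h y"
  shows "card (h ` S) \<le> card (g ` S)"
proof -
  have "h ` S \<subseteq> (\<lambda>z. h (SOME x. x \<in> S \<and> g x = z)) ` g ` S"
  proof (rule image_subsetI)
    fix x assume x: "x \<in> S"
    let ?y = "SOME y. y \<in> S \<and> g y = g x"
    have "?y \<in> S \<and> g ?y = g x" by (rule someI[of "\<lambda>y. y \<in> S \<and> g y = g x" x]) (use x in simp)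
    then have "h x = h ?y" using assms(2)[OF x, of ?y] by simp
    then show "h x \<in> (\<lambda>z. h (SOME x. x \<in> S \<and> g x = z)) ` g ` S" using x by blast
  qed
  then have "card (h ` S) \<le> card ((\<lambda>z. h (SOME x. x \<in> S \<and> g x = z)) ` g ` S)"
    using assms(1) by (intro card_mono) auto
  also have "\<dots> \<le> card (g ` S)" by (rule card_image_le[OF assms(1)])
  finally show ?thesis .
qed

context tame_subgroup begin

text \<open>
  First fit: a center has boundedly many neighbors by packing. The number of colors depends on
  \<open>Ks\<close> only, and therefore can be fixed before the scale \<open>a\<close> and the subgroup \<open>H0\<close> are known.
\<close>

lemma center_coloring:
  assumes Ks: "finite Ks" "Ks \<subseteq> carrier G" "\<And>g. g \<in> Ks \<Longrightarrow> inv g \<in> Ks"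
    and H0: "H0 \<in> Fam" and a: "0 < a" and K_reach: "\<And>g. g \<in> Ks \<Longrightarrow> reach H0 (3 * a) g \<subseteq> K"
    and Y_loc: "local_map G K J Yf" and Y_sep: "\<And>c. coloring G K J c \<Longrightarrow> separated H0 a (Yf c)"
  obtains q :: "('g \<Rightarrow> nat) \<Rightarrow> 'g \<Rightarrow> nat" where "local_map G K J q"
    and "\<And>c x. coloring G K J c \<Longrightarrow> x \<in> carrier G \<Longrightarrow> q c x < Suc (\<Sum>g\<in>Ks. packing_number g)"
    and "\<And>c x k. coloring G K J c \<Longrightarrow> x \<in> carrier G \<Longrightarrow> k \<in> (\<Union>g\<in>Ks. reach H0 (3 * a) g) \<Longrightarrow> k \<noteq> \<one> \<Longrightarrow>
           Yf c x \<Longrightarrow> Yf c (k \<otimes> x) \<Longrightarrow> q c (k \<otimes> x) \<noteq> q c x"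
proof -
  define Nq where "Nq = (\<Union>g\<in>Ks. reach H0 (3 * a) g)"
  have Nq: "finite Nq" "Nq \<subseteq> carrier G" "Nq \<subseteq> K"
  proof -
    show "finite Nq" unfolding Nq_def using Ks(1) finite_reach[OF H0] by simp
    show "Nq \<subseteq> carrier G" unfolding Nq_def using reach_carrier[OF H0] Ks(2) by (intro UN_least) blast
    show "Nq \<subseteq> K" unfolding Nq_def using K_reach by (intro UN_least) auto
  qed
  have Nq_inv: "inv g \<in> Nq" if "g \<in> Nq" for g
  proof -
    from that obtain k where k: "k \<in> Ks" "g \<in> reach H0 (3 * a) k" by (auto simp: Nq_def)
    have "inv g \<in> reach H0 (3 * a) (inv k)" using k Ks(2) by (intro reach_inv[OF H0]) auto
    then show ?thesis using Ks(3)[OF k(1)] by (auto simp: Nq_def)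
  qed
  define S where "S = (\<lambda>c x (i :: nat) (nb :: 'g \<Rightarrow> nat \<Rightarrow> nat option).
      LEAST k. k \<notin> {k. \<exists>g\<in>Nq. Yf c (g \<otimes> x) \<and> nb g 0 = Some k})"
  obtain q' :: "('g \<Rightarrow> nat) \<Rightarrow> 'g \<Rightarrow> nat \<Rightarrow> nat" where q'_loc: "\<And>i. i < 1 \<Longrightarrow> local_map G K J (\<lambda>c x. q' c x i)"
    and q': "\<And>c x i. q' c x i = S c x i (\<lambda>g i'. if i' < 1 \<and> c (g \<otimes> x) * 1 + i' < c x * 1 + i
                                 then Some (q' c (g \<otimes> x) i') else None)"
  proof (rule local_greedy[where N = Nq and I = Nq and F = "\<lambda>g c x. Yf c (g \<otimes> x)" and K = K and J = J and f = 1 and S = S])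
    show "local_map G K J (\<lambda>c x. Yf c (g \<otimes> x))" if "g \<in> Nq" for g
      using that Nq Y_loc by (intro local_translate) auto
    show "S c x i nb = S c' x' i nb'"
      if "\<And>j. j \<in> Nq \<Longrightarrow> Yf c (j \<otimes> x) = Yf c' (j \<otimes> x')"
        "\<And>g i'. g \<in> Nq \<Longrightarrow> i' < 1 \<Longrightarrow> nb g i' = nb' g i'" for c c' x x' i and nb nb' :: "'g \<Rightarrow> nat \<Rightarrow> nat option"
      unfolding S_def using that by simp
  qed (use Nq in auto)
  define q where "q c x = q' c x 0" for c x
  have q_loc: "local_map G K J q" using q'_loc[of 0] by (simp add: q_def[abs_def])
  have q: "q c x = (LEAST k. k \<notin> {k. \<exists>g\<in>Nq. Yf c (g \<otimes> x) \<and> c (g \<otimes> x) < c x \<and> q c (g \<otimes> x) = k})" for c x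
    unfolding q_def q'[of c x 0] S_def by (rule arg_cong[where f = Least]) (auto split: if_splits)
  have q_ex: "\<exists>k<Suc (\<Sum>g\<in>Ks. packing_number g). k \<notin> {k. \<exists>g\<in>Nq. Yf c (g \<otimes> x) \<and> c (g \<otimes> x) < c x \<and> q c (g \<otimes> x) = k}"
    if c: "coloring G K J c" and x: "x \<in> carrier G" for c x
  proof (rule ccontr)
    assume "\<not> ?thesis"
    then have "{..<Suc (\<Sum>g\<in>Ks. packing_number g)} \<subseteq> (\<lambda>g. q c (g \<otimes> x)) ` {g \<in> Nq. Yf c (g \<otimes> x)}" by blast
    then have "card {..<Suc (\<Sum>g\<in>Ks. packing_number g)} \<le> card {g \<in> Nq. Yf c (g \<otimes> x)}"
      using Nq(1) by (intro surj_card_le) auto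
    also have "\<dots> \<le> (\<Sum>g\<in>Ks. packing_number g)"
      unfolding Nq_def by (rule card_packing[OF Ks(1,2) H0 a x Y_sep[OF c]])
    finally show False by simp
  qed
  have q_less: "q c x < Suc (\<Sum>g\<in>Ks. packing_number g)" if "coloring G K J c" "x \<in> carrier G" for c x
    using q_ex[OF that] unfolding q[of c x] by (meson Least_le le_less_trans)
  have q_neq1: "q c (g \<otimes> x) \<noteq> q c x"
    if "coloring G K J c" "x \<in> carrier G" "g \<in> Nq" "Yf c (g \<otimes> x)" "c (g \<otimes> x) < c x" for c x g
  proof -
    have "q c x \<notin> {k. \<exists>g\<in>Nq. Yf c (g \<otimes> x) \<and> c (g \<otimes> x) < c x \<and> q c (g \<otimes> x) = k}"
      using q_ex[OF that(1,2)] unfolding q[of c x] by (metis (mono_tags, lifting) LeastI)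
    then show ?thesis using that by auto
  qed
  have q_neq: "q c (g \<otimes> x) \<noteq> q c x"
    if c: "coloring G K J c" and x: "x \<in> carrier G" and g: "g \<in> Nq" "g \<noteq> \<one>" and Y: "Yf c x" "Yf c (g \<otimes> x)" for c x g
  proof -
    have gc: "g \<in> carrier G" using g Nq by auto
    have "c (g \<otimes> x) \<noteq> c x" using g Nq by (intro coloring_neq[OF c x]) auto
    then consider "c (g \<otimes> x) < c x" | "c x < c (g \<otimes> x)" by linarith
    then show ?thesis
    proof cases
      case 1 then show ?thesis by (rule q_neq1[OF c x g(1) Y(2)])
    next
      case 2
      have eq: "inv g \<otimes> (g \<otimes> x) = x" using gc x by (simp add: inv_cancel)
      have "q c (inv g \<otimes> (g \<otimes> x)) \<noteq> q c (g \<otimes> x)"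
        using gc x Y 2 by (intro q_neq1[OF c _ Nq_inv[OF g(1)]]) (simp_all add: eq)
      then show ?thesis by (simp add: eq)
    qed
  qed
  from q_loc q_less q_neq show ?thesis unfolding Nq_def by (rule that)
qed

definition boxes_over where
  "boxes_over H0 Yf off c w =
     {y \<in> carrier G. Yf c y \<and> w \<otimes> inv y \<in> H0 \<and> (\<forall>i<f. lam i (w \<otimes> inv y) \<le> off c y i)}"

lemma boxes_over_bounded:
  assumes "\<And>y i. y \<in> carrier G \<Longrightarrow> i < f \<Longrightarrow> off c y i \<le> r" "y \<in> boxes_over H0 Yf off c w"
  shows "w \<otimes> inv y \<in> box H0 r"
  using assms unfolding boxes_over_def box_def by (auto intro: order_trans)

text \<open>
  Among the boxes over a point, take the one whose center has the least color. The centers of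
  these boxes differ by elements of \<open>K\<close>, so they have different colors, and the choice depends
  only on the set of these boxes.
\<close>

lemma local_center:
  assumes H0: "H0 \<in> Fam" and a: "0 < a" and K_reach: "reach H0 (2 * a) \<one> \<subseteq> K"
    and Y_loc: "local_map G K J Yf"
    and Y_cov: "\<And>c x. coloring G K J c \<Longrightarrow> x \<in> carrier G \<Longrightarrow> \<exists>v\<in>insert \<one> (box H0 a). Yf c (v \<otimes> x)"
    and off_loc: "\<And>i. i < f \<Longrightarrow> local_map G K J (\<lambda>c x. off c x i)"
    and off: "\<And>c y i. coloring G K J c \<Longrightarrow> y \<in> carrier G \<Longrightarrow> i < f \<Longrightarrow> a \<le> off c y i \<and> off c y i \<le> 2 * a"
  obtains cen :: "('g \<Rightarrow> nat) \<Rightarrow> 'g \<Rightarrow> 'g" where "local_map G K J (\<lambda>c x. cen c x \<otimes> inv x)"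
    and "\<And>c w. coloring G K J c \<Longrightarrow> w \<in> carrier G \<Longrightarrow> cen c w \<in> boxes_over H0 Yf off c w"
    and "\<And>c w w'. boxes_over H0 Yf off c w = boxes_over H0 Yf off c w' \<Longrightarrow> cen c w = cen c w'"
proof -
  define cen where "cen c w = (ARG_MIN c y. y \<in> boxes_over H0 Yf off c w)" for c w
  have Cov_box: "w \<otimes> inv y \<in> box H0 (2 * a)" if "coloring G K J c" "y \<in> boxes_over H0 Yf off c w" for c w y
    by (rule boxes_over_bounded[OF _ that(2)]) (use off[OF that(1)] in blast)
  have Cov_ne: "\<exists>y. y \<in> boxes_over H0 Yf off c w" if c: "coloring G K J c" and w: "w \<in> carrier G" for c w
  proof -
    obtain v where v: "v \<in> box H0 a" "Yf c (v \<otimes> w)"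
      using Y_cov[OF c w] box_one[OF H0, of a] a by auto
    have vc: "v \<in> carrier G" by (rule box_carrier[OF H0 v(1)])
    have "w \<otimes> inv (v \<otimes> w) = inv v" using vc w by (simp add: inv_mult_group inv_cancel)
    moreover have "inv v \<in> box H0 a" by (rule box_inv[OF H0 v(1)])
    moreover have "v \<otimes> w \<in> carrier G" using vc w by simp
    ultimately have "v \<otimes> w \<in> boxes_over H0 Yf off c w"
      using v off[OF c] unfolding boxes_over_def box_def by (auto intro: order_trans)
    then show ?thesis ..
  qed
  have Cov_c: "c y \<noteq> c y'" if c: "coloring G K J c" and w: "w \<in> carrier G" and y: "y \<in> boxes_over H0 Yf off c w" "y' \<in> boxes_over H0 Yf off c w" "y \<noteq> y'" for c w y y'
  proof -
    have yc: "y \<in> carrier G" "y' \<in> carrier G" using y by (auto simp: boxes_over_def)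
    have "inv (w \<otimes> inv y) \<otimes> \<one> \<otimes> (w \<otimes> inv y') \<in> K"
      using reachI[OF box_inv[OF H0 Cov_box[OF c y(1)]] Cov_box[OF c y(2)], of \<one>] K_reach by blast
    then have "inv (w \<otimes> inv y) \<otimes> (w \<otimes> inv y') \<in> K" using yc w by simp
    moreover have "inv (w \<otimes> inv y) \<otimes> (w \<otimes> inv y') = y \<otimes> inv y'"
      using yc w by (simp add: inv_mult_group m_assoc inv_cancel)
    ultimately have k: "y \<otimes> inv y' \<in> K" by simp
    have eq: "y \<otimes> inv y' \<otimes> y' = y" using yc by (simp add: m_assoc)
    then have "y \<otimes> inv y' \<noteq> \<one>" using y(3) yc by auto
    then have "c (y \<otimes> inv y' \<otimes> y') \<noteq> c y'" by (rule coloring_neq[OF c yc(2) k])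
    then show ?thesis by (simp add: eq)
  qed
  have cen_in: "cen c w \<in> boxes_over H0 Yf off c w" and cen_le: "\<And>y. y \<in> boxes_over H0 Yf off c w \<Longrightarrow> c (cen c w) \<le> c y"
    if "coloring G K J c" "w \<in> carrier G" for c w
    using arg_min_nat_lemma[of "\<lambda>y. y \<in> boxes_over H0 Yf off c w" _ c] Cov_ne[OF that] unfolding cen_def by blast+
  have cen_eq: "cen c w = y" if "coloring G K J c" "w \<in> carrier G" "y \<in> boxes_over H0 Yf off c w" "\<And>y'. y' \<in> boxes_over H0 Yf off c w \<Longrightarrow> c y \<le> c y'" for c w y
    using Cov_c[OF that(1,2) cen_in[OF that(1,2)] that(3)] cen_le[OF that(1,2,3)] that(4)[OF cen_in[OF that(1,2)]]
    by (metis le_antisym)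
  have cen_carrier: "cen c w \<in> carrier G" if "coloring G K J c" "w \<in> carrier G" for c w
    using cen_in[OF that] by (simp add: boxes_over_def)
  have cen_cong: "cen c w = cen c w'" if "boxes_over H0 Yf off c w = boxes_over H0 Yf off c w'" for c w w' unfolding cen_def that ..
  have Cov_iff: "inv u \<otimes> w \<in> boxes_over H0 Yf off c w \<longleftrightarrow> Yf c (inv u \<otimes> w) \<and> (\<forall>i<f. lam i u \<le> off c (inv u \<otimes> w) i)"
    if "u \<in> H0" "w \<in> carrier G" for u w c
  proof -
    have u: "u \<in> carrier G" using that fam_subset[OF H0] H_carrier by auto
    then have "w \<otimes> inv (inv u \<otimes> w) = u" using that by (simp add: inv_mult_group inv_cancel)
    then show ?thesis using that u by (simp add: boxes_over_def)
  qed
  have cen_loc: "local_map G K J (\<lambda>c x. cen c x \<otimes> inv x)"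
  proof (rule local_determined[where I = "box H0 (2 * a)"
        and F = "\<lambda>u c x. (Yf c (inv u \<otimes> x), restrict (\<lambda>i. off c (inv u \<otimes> x) i) {..<f}, c (inv u \<otimes> x))"])
    show "finite (box H0 (2 * a))" by (rule finite_box[OF H0])
    fix u assume "u \<in> box H0 (2 * a)"
    then have u: "inv u \<in> carrier G" using box_carrier[OF H0] by simp
    have l1: "local_map G K J (\<lambda>c x. off c (inv u \<otimes> x) i)" if "i \<in> {..<f}" for i
      using local_translate[OF off_loc u] that by simp
    have l2: "local_map G K J (\<lambda>c x. restrict (\<lambda>i. off c (inv u \<otimes> x) i) {..<f})"
      by (rule local_determined[where I = "{..<f}" and F = "\<lambda>i c x. off c (inv u \<otimes> x) i"])
        (use l1 in \<open>auto simp: restrict_def\<close>)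
    show "local_map G K J (\<lambda>c x. (Yf c (inv u \<otimes> x), restrict (\<lambda>i. off c (inv u \<otimes> x) i) {..<f}, c (inv u \<otimes> x)))"
      by (intro local_pair l2 local_translate[OF Y_loc u] local_translate[OF local_color u])
  next
    fix c c' x x'
    assume c: "coloring G K J c" "coloring G K J c'" and x: "x \<in> carrier G" "x' \<in> carrier G"
      and eq: "\<And>u. u \<in> box H0 (2 * a) \<Longrightarrow>
        (Yf c (inv u \<otimes> x), restrict (\<lambda>i. off c (inv u \<otimes> x) i) {..<f}, c (inv u \<otimes> x)) =
        (Yf c' (inv u \<otimes> x'), restrict (\<lambda>i. off c' (inv u \<otimes> x') i) {..<f}, c' (inv u \<otimes> x'))"
    have off_eq: "off c (inv u \<otimes> x) i = off c' (inv u \<otimes> x') i" if "u \<in> box H0 (2 * a)" "i < f" for u i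
    proof -
      have "restrict (\<lambda>i. off c (inv u \<otimes> x) i) {..<f} i = restrict (\<lambda>i. off c' (inv u \<otimes> x') i) {..<f} i"
        using eq[OF that(1)] by simp
      then show ?thesis using that(2) by simp
    qed
    have Cov_eq: "inv u \<otimes> x \<in> boxes_over H0 Yf off c x \<longleftrightarrow> inv u \<otimes> x' \<in> boxes_over H0 Yf off c' x'" if u: "u \<in> box H0 (2 * a)" for u
      using eq[OF u] off_eq[OF u] Cov_iff[OF box_H0[OF u] x(1)] Cov_iff[OF box_H0[OF u] x(2)] by auto
    define u where "u = x \<otimes> inv (cen c x)"
    have u: "u \<in> box H0 (2 * a)" unfolding u_def by (rule Cov_box[OF c(1) cen_in[OF c(1) x(1)]])
    have uc: "u \<in> carrier G" by (rule box_carrier[OF H0 u])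
    have cu: "inv u \<otimes> x = cen c x"
      using x cen_carrier[OF c(1) x(1)] by (simp add: u_def inv_mult_group m_assoc)
    have "cen c' x' = inv u \<otimes> x'"
    proof (rule cen_eq[OF c(2) x(2)])
      show "inv u \<otimes> x' \<in> boxes_over H0 Yf off c' x'" using Cov_eq[OF u] cu cen_in[OF c(1) x(1)] by simp
      fix y' assume y': "y' \<in> boxes_over H0 Yf off c' x'"
      define u' where "u' = x' \<otimes> inv y'"
      have u': "u' \<in> box H0 (2 * a)" unfolding u'_def by (rule Cov_box[OF c(2) y'])
      have "y' \<in> carrier G" using y' by (simp add: boxes_over_def)
      then have yu: "y' = inv u' \<otimes> x'" using x by (simp add: u'_def inv_mult_group m_assoc)
      then have "inv u' \<otimes> x \<in> boxes_over H0 Yf off c x" using Cov_eq[OF u'] y' by simp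
      then have "c (inv u \<otimes> x) \<le> c (inv u' \<otimes> x)" unfolding cu by (rule cen_le[OF c(1) x(1)])
      then show "c' (inv u \<otimes> x') \<le> c' y'" using eq[OF u] eq[OF u'] yu by simp
    qed
    then show "cen c x \<otimes> inv x = cen c' x' \<otimes> inv x'"
      using cu[symmetric] x uc by (simp add: m_assoc)
  qed
  from cen_loc cen_in cen_cong show ?thesis by (rule that)
qed

text \<open>
  The cells are the boxes of \<open>local_center\<close> with offsets in general position. When \<open>x\<close> is moved by
  a bounded element of \<open>H\<close>, the cell of \<open>t x\<close> can only change if a face near \<open>t x\<close> is crossed
  (\<open>cross\<close>), and at most \<open>d\<close> faces are near the points \<open>t x\<close>, \<open>t \<in> T\<close>, taken together. So there
  are at most \<open>2 ^ d\<close> patterns. Let \<open>v0\<close> be an element of \<open>H\<close> that all conjugated functionals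
  displace by more than twice the size of the elements of \<open>V\<close>. Each near face spoils at most one
  of the \<open>d + 1\<close> points \<open>v0\<^sup>n x\<close>, \<open>n \<le> d\<close>, so one of them is deep.
\<close>

lemma cells:
  assumes Ks: "finite Ks" "Ks \<subseteq> carrier G" "Ks \<inter> H = {}"
  obtains M where "\<And>T V B. finite T \<Longrightarrow> T \<subseteq> carrier G \<Longrightarrow>
      (\<And>t t'. t \<in> T \<Longrightarrow> t' \<in> T \<Longrightarrow> t' \<otimes> inv t \<in> H \<Longrightarrow> t = t') \<Longrightarrow>
      finite V \<Longrightarrow> V \<subseteq> H \<Longrightarrow> finite B \<Longrightarrow> B \<subseteq> carrier G \<Longrightarrow>
      \<exists>K V1. finite K \<and> K \<subseteq> carrier G \<and> finite V1 \<and> V1 \<subseteq> H \<and>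
        (\<forall>J. \<exists>cen q \<rho> D. cell_rule Ks M T V B K V1 J cen q \<rho> D)"
proof -
  define Ks' where "Ks' = Ks \<union> m_inv G ` Ks"
  have Ks': "finite Ks'" "Ks' \<subseteq> carrier G" using Ks by (auto simp: Ks'_def)
  have Ks'_inv: "inv g \<in> Ks'" if "g \<in> Ks'" for g using that Ks by (auto simp: Ks'_def)
  define M where "M = Suc (\<Sum>g\<in>Ks'. packing_number g)"
  show ?thesis
  proof (rule that[of M])
    fix T V B
    assume T: "finite T" "T \<subseteq> carrier G" and T_inj: "\<And>t t'. t \<in> T \<Longrightarrow> t' \<in> T \<Longrightarrow> t' \<otimes> inv t \<in> H \<Longrightarrow> t = t'"
      and V: "finite V" "V \<subseteq> H" and B: "finite B" "B \<subseteq> carrier G"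
    \<comment> \<open>\<open>\<delta>0\<close> is the size of the motions that a deep point has to withstand, \<open>\<delta>\<close> the size of all
    motions considered\<close>
    obtain \<delta>0 where \<delta>0: "0 \<le> \<delta>0" "\<And>t v i. t \<in> T \<Longrightarrow> v \<in> V \<Longrightarrow> i < f \<Longrightarrow> \<bar>lam i (t \<otimes> v \<otimes> inv t)\<bar> \<le> \<delta>0"
      by (rule conj_bound[OF T(1) V(1)]) (rule that)
    obtain v0 where v0: "v0 \<in> H" and v0_large: "\<And>t i. t \<in> T \<Longrightarrow> i < f \<Longrightarrow> 2 * \<delta>0 < \<bar>lam i (t \<otimes> v0 \<otimes> inv t)\<bar>"
      by (rule large_displacement[OF T]) (rule that)
    define V1 where "V1 = (\<lambda>n. v0 [^] n) ` {..d}"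
    have V1: "finite V1" "V1 \<subseteq> H" using H_pow[OF v0] by (auto simp: V1_def)
    define V2 where "V2 = (\<lambda>(b, v). inv b \<otimes> v \<otimes> b) ` (B \<times> V1)"
    have V2: "finite V2" "V2 \<subseteq> H" using B V1 H_conj' by (auto simp: V2_def subset_iff)
    define V3 where "V3 = V1 \<union> V2 \<union> (\<lambda>(v, n). v \<otimes> v0 [^] n) ` (V \<times> {..d})"
    have V3: "finite V3" "V3 \<subseteq> H" using V V1 V2 H_pow[OF v0] by (auto simp: V3_def)
    obtain \<delta> where \<delta>: "0 \<le> \<delta>" "\<And>t v i. t \<in> T \<Longrightarrow> v \<in> V3 \<Longrightarrow> i < f \<Longrightarrow> \<bar>lam i (t \<otimes> v \<otimes> inv t)\<bar> \<le> \<delta>"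
      by (rule conj_bound[OF T(1) V3(1)]) (rule that)
    have \<delta>_pow: "v0 [^] n \<in> V3" "v \<in> V \<Longrightarrow> v \<otimes> v0 [^] n \<in> V3" if "n \<le> d" for v n
      using that by (auto simp: V3_def V1_def)
    \<comment> \<open>\<open>H0\<close> is chosen so large that no motion considered leaves its cosets\<close>
    define V4 where "V4 = (\<lambda>(t, v). t \<otimes> v \<otimes> inv t) ` (T \<times> V3)"
    have V4: "finite V4" "V4 \<subseteq> H" using T V3 H_conj by (auto simp: V4_def subset_iff)
    obtain H0 where H0: "H0 \<in> Fam" and V4_H0: "V4 \<subseteq> H0" using fam_cofinal[OF V4] by blast
    have V3_H0: "t \<otimes> v \<otimes> inv t \<in> H0" if "t \<in> T" "v \<in> V3" for t v using that V4_H0 by (auto simp: V4_def)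
    obtain a0 :: real where gp: "\<And>a H0 K J Yf. a0 \<le> a \<Longrightarrow> 0 < a \<Longrightarrow> H0 \<in> Fam \<Longrightarrow>
     \<forall>t\<in>T. \<forall>t'\<in>T. reach H0 (3 * a) (t \<otimes> inv t') \<subseteq> K \<Longrightarrow> local_map G K J Yf \<Longrightarrow>
     \<forall>c. coloring G K J c \<longrightarrow> separated H0 a (Yf c) \<Longrightarrow> \<exists>off. generic_offsets H0 a \<delta> T K J Yf off"
      by (rule general_position[OF T _ \<delta>(1)]) (use T_inj in blast, rule that)
    define a where "a = Max {a0, \<delta>, 1}"
    have a: "a0 \<le> a" "\<delta> \<le> a" "0 < a" by (auto simp: a_def less_max_iff_disj)
    define Gs where "Gs = insert \<one> (Ks' \<union> (\<lambda>(t, t'). t \<otimes> inv t') ` (T \<times> T))"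
    have Gs: "finite Gs" "Gs \<subseteq> carrier G" using Ks' T by (auto simp: Gs_def)
    define K where "K = (\<Union>g\<in>Gs. reach H0 (3 * a) g)"
    have K: "finite K" unfolding K_def using Gs(1) finite_reach[OF H0] by simp
    have Kc: "K \<subseteq> carrier G" unfolding K_def using reach_carrier[OF H0] Gs(2) by (intro UN_least) blast
    have K_reach: "reach H0 (3 * a) g \<subseteq> K" if "g \<in> Gs" for g using that by (auto simp: K_def)
    have one_box: "\<one> \<in> box H0 (3 * a)" using box_one[OF H0] a by simp
    have box_up: "v \<in> box H0 (3 * a)" if "v \<in> box H0 s" "s \<le> 3 * a" for v s using that by (rule box_mono)
    have box_mult_K: "u \<otimes> v \<in> K" if "u \<in> box H0 (3 * a)" "v \<in> box H0 (3 * a)" for u v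
    proof -
      have "u \<otimes> \<one> \<otimes> v \<in> K" using reachI[OF that, of \<one>] K_reach[of \<one>] by (auto simp: Gs_def)
      then show ?thesis using box_carrier[OF H0 that(1)] by simp
    qed
    have box_K: "box H0 a \<subseteq> K"
    proof
      fix v assume "v \<in> box H0 a"
      then have "v \<in> box H0 (3 * a)" using a by (intro box_up) auto
      then show "v \<in> K" using box_mult_K[OF _ one_box, of v] box_carrier[OF H0] by simp
    qed
    have "\<exists>cen q \<rho> D. cell_rule Ks M T V B K V1 J cen q \<rho> D" for J
    proof -
      obtain Yf :: "('g \<Rightarrow> nat) \<Rightarrow> 'g \<Rightarrow> bool" where Y_loc: "local_map G K J Yf"
        and Y_sep: "\<And>c y v. coloring G K J c \<Longrightarrow> y \<in> carrier G \<Longrightarrow> v \<in> box H0 a \<Longrightarrow> Yf c y \<Longrightarrow> Yf c (v \<otimes> y) \<Longrightarrow> v = \<one>"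
        and Y_cov: "\<And>c x. coloring G K J c \<Longrightarrow> x \<in> carrier G \<Longrightarrow> \<exists>v\<in>insert \<one> (box H0 a). Yf c (v \<otimes> x)"
        by (rule local_maximal_separated[of "box H0 a" K J])
          (use finite_box[OF H0] box_carrier[OF H0] box_inv[OF H0] box_K in \<open>auto 4 3\<close>)
      have rK: "\<forall>t\<in>T. \<forall>t'\<in>T. reach H0 (3 * a) (t \<otimes> inv t') \<subseteq> K"
        by (intro ballI K_reach) (auto simp: Gs_def)
      have sepY: "separated H0 a (Yf c)" if "coloring G K J c" for c
        using Y_sep[OF that] unfolding separated_def by blast
      obtain off where off': "generic_offsets H0 a \<delta> T K J Yf off"
        using gp[OF a(1,3) H0 rK Y_loc] sepY by blast
      have off_loc: "local_map G K J (\<lambda>c x. off c x i)" if "i < f" for i using off' that unfolding generic_offsets_def by blast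
      have off: "a \<le> off c y i \<and> off c y i \<le> 2 * a" if "coloring G K J c" "y \<in> carrier G" "i < f" for c y i
        using off' that unfolding generic_offsets_def by blast
      have near: "card (near_faces H0 a \<delta> T (Yf c) (off c) x) \<le> d"
        if "coloring G K J c" "x \<in> carrier G" for c x
        using off' that unfolding generic_offsets_def by blast
      obtain q :: "('g \<Rightarrow> nat) \<Rightarrow> 'g \<Rightarrow> nat" where q_loc: "local_map G K J q"
        and q_less: "\<And>c x. coloring G K J c \<Longrightarrow> x \<in> carrier G \<Longrightarrow> q c x < M"
        and q_neq: "\<And>c x k. coloring G K J c \<Longrightarrow> x \<in> carrier G \<Longrightarrow> k \<in> (\<Union>g\<in>Ks'. reach H0 (3 * a) g) \<Longrightarrow> k \<noteq> \<one> \<Longrightarrow>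
           Yf c x \<Longrightarrow> Yf c (k \<otimes> x) \<Longrightarrow> q c (k \<otimes> x) \<noteq> q c x"
        unfolding M_def
        by (rule center_coloring[OF Ks' Ks'_inv H0 a(3) K_reach Y_loc sepY]) (simp_all add: Gs_def that)
      have one_K: "reach H0 (2 * a) \<one> \<subseteq> K"
        using K_reach[of \<one>] box_up a unfolding reach_def by (fastforce simp: Gs_def)
      obtain cen :: "('g \<Rightarrow> nat) \<Rightarrow> 'g \<Rightarrow> 'g" where cen_loc: "local_map G K J (\<lambda>c x. cen c x \<otimes> inv x)"
        and cen_in': "\<And>c w. coloring G K J c \<Longrightarrow> w \<in> carrier G \<Longrightarrow> cen c w \<in> boxes_over H0 Yf off c w"
        and cen_cong': "\<And>c w w'. boxes_over H0 Yf off c w = boxes_over H0 Yf off c w' \<Longrightarrow> cen c w = cen c w'"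
        by (rule local_center[OF H0 a(3) one_K Y_loc Y_cov off_loc off]) (assumption | rule that)+
      define Cov where "Cov = boxes_over H0 Yf off"
      note cen_in = cen_in'[folded Cov_def] and cen_cong = cen_cong'[folded Cov_def]
      have Cov_def: "Cov c w = {y \<in> carrier G. Yf c y \<and> w \<otimes> inv y \<in> H0 \<and> (\<forall>i<f. lam i (w \<otimes> inv y) \<le> off c y i)}" for c w
        by (simp add: Cov_def boxes_over_def)
      have cen_carrier: "cen c w \<in> carrier G" if "coloring G K J c" "w \<in> carrier G" for c w
        using cen_in[OF that] by (simp add: Cov_def)
      have Cov_box: "w \<otimes> inv y \<in> box H0 (2 * a)" if "coloring G K J c" "y \<in> Cov c w" for c w y
        using that off[OF that(1)] unfolding Cov_def box_def by (auto intro: order_trans)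
      \<comment> \<open>the choice among the deep points is made by looking at the cells, so that it is local\<close>
      define deep where "deep c x n \<longleftrightarrow> (\<forall>t\<in>T. \<forall>v\<in>V. cen c (t \<otimes> v \<otimes> (v0 [^] n \<otimes> x)) = cen c (t \<otimes> (v0 [^] n \<otimes> x)))" for c x and n :: nat
      define \<rho> where "\<rho> c x = v0 [^] (if \<exists>n\<le>d. deep c x n then (SOME n. n \<le> d \<and> deep c x n) else 0)" for c x
      have v0c: "v0 [^] n \<in> carrier G" for n :: nat using H_carrier[OF v0] by simp
      have Vc: "v \<in> carrier G" if "v \<in> V" for v using that V H_carrier by auto
      have Tc: "t \<in> carrier G" if "t \<in> T" for t using that T by auto
      have \<rho>_loc: "local_map G K J \<rho>"
      proof (rule local_determined[where I = "(\<lambda>(t, v, n). t \<otimes> v \<otimes> v0 [^] n) ` (T \<times> insert \<one> V \<times> {..d})"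
            and F = "\<lambda>g c x. cen c (g \<otimes> x) \<otimes> inv (g \<otimes> x)"])
        show "finite ((\<lambda>(t, v, n). t \<otimes> v \<otimes> v0 [^] n) ` (T \<times> insert \<one> V \<times> {..d}))" using T V by simp
        fix g assume "g \<in> (\<lambda>(t, v, n). t \<otimes> v \<otimes> v0 [^] n) ` (T \<times> insert \<one> V \<times> {..d})"
        then have "g \<in> carrier G" using Tc Vc v0c by auto
        then show "local_map G K J (\<lambda>c x. cen c (g \<otimes> x) \<otimes> inv (g \<otimes> x))" by (rule local_translate[OF cen_loc])
      next
        fix c c' x x'
        assume c: "coloring G K J c" "coloring G K J c'" and x: "x \<in> carrier G" "x' \<in> carrier G"
          and eq: "\<And>g. g \<in> (\<lambda>(t, v, n). t \<otimes> v \<otimes> v0 [^] n) ` (T \<times> insert \<one> V \<times> {..d}) \<Longrightarrow>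
              cen c (g \<otimes> x) \<otimes> inv (g \<otimes> x) = cen c' (g \<otimes> x') \<otimes> inv (g \<otimes> x')"
        have shift: "cen c (g \<otimes> x) = cen c' (g \<otimes> x') \<otimes> inv x' \<otimes> x" if "g \<in> (\<lambda>(t, v, n). t \<otimes> v \<otimes> v0 [^] n) ` (T \<times> insert \<one> V \<times> {..d})" for g
        proof -
          have g: "g \<in> carrier G" using that Tc Vc v0c by auto
          have "cen c (g \<otimes> x) = cen c (g \<otimes> x) \<otimes> inv (g \<otimes> x) \<otimes> (g \<otimes> x)"
            using cen_carrier[OF c(1)] g x by (simp add: m_assoc)
          also have "\<dots> = cen c' (g \<otimes> x') \<otimes> inv x' \<otimes> x"
            unfolding eq[OF that] using cen_carrier[OF c(2)] g x by (simp add: m_assoc inv_mult_group inv_cancel)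
          finally show ?thesis .
        qed
        have "deep c x n = deep c' x' n" if n: "n \<le> d" for n
        proof -
          have "(cen c (t \<otimes> v \<otimes> (v0 [^] n \<otimes> x)) = cen c (t \<otimes> (v0 [^] n \<otimes> x))) =
              (cen c' (t \<otimes> v \<otimes> (v0 [^] n \<otimes> x')) = cen c' (t \<otimes> (v0 [^] n \<otimes> x')))" if tv: "t \<in> T" "v \<in> V" for t v
          proof -
            note car = Tc[OF tv(1)] Vc[OF tv(2)] v0c[of n]
            have g1: "t \<otimes> v \<otimes> v0 [^] n \<in> (\<lambda>(t, v, n). t \<otimes> v \<otimes> v0 [^] n) ` (T \<times> insert \<one> V \<times> {..d})"
              using tv n by force
            have "t \<otimes> \<one> \<otimes> v0 [^] n \<in> (\<lambda>(t, v, n). t \<otimes> v \<otimes> v0 [^] n) ` (T \<times> insert \<one> V \<times> {..d})"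
              using tv n by force
            then have g2: "t \<otimes> v0 [^] n \<in> (\<lambda>(t, v, n). t \<otimes> v \<otimes> v0 [^] n) ` (T \<times> insert \<one> V \<times> {..d})"
              using car by simp
            have r: "t \<otimes> v \<otimes> (v0 [^] n \<otimes> x) = t \<otimes> v \<otimes> v0 [^] n \<otimes> x" "t \<otimes> (v0 [^] n \<otimes> x) = t \<otimes> v0 [^] n \<otimes> x"
              "t \<otimes> v \<otimes> (v0 [^] n \<otimes> x') = t \<otimes> v \<otimes> v0 [^] n \<otimes> x'" "t \<otimes> (v0 [^] n \<otimes> x') = t \<otimes> v0 [^] n \<otimes> x'"
              using car x by (simp_all add: m_assoc)
            have "cen c' (t \<otimes> v \<otimes> v0 [^] n \<otimes> x') \<in> carrier G" "cen c' (t \<otimes> v0 [^] n \<otimes> x') \<in> carrier G"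
              using car x by (auto intro!: cen_carrier[OF c(2)])
            then show ?thesis unfolding r shift[OF g1] shift[OF g2] using x by simp
          qed
          then show ?thesis unfolding deep_def by blast
        qed
        then have "(\<lambda>n. n \<le> d \<and> deep c x n) = (\<lambda>n. n \<le> d \<and> deep c' x' n)" by auto
        then show "\<rho> c x = \<rho> c' x'" unfolding \<rho>_def by metis
      qed
      \<comment> \<open>two motions of \<open>t x\<close> that end on the same side of all near faces end in the same boxes\<close>
      have cross: "Cov c (t \<otimes> (h1 \<otimes> x)) \<subseteq> Cov c (t \<otimes> (h2 \<otimes> x))"
        if c: "coloring G K J c" and x: "x \<in> carrier G" and t: "t \<in> T" and h: "h1 \<in> V3" "h2 \<in> V3"
          and same: "\<And>y i. (t, y, i) \<in> near_faces H0 a \<delta> T (Yf c) (off c) x \<Longrightarrow>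
             lam i (t \<otimes> (h1 \<otimes> x) \<otimes> inv y) \<le> off c y i \<Longrightarrow> lam i (t \<otimes> (h2 \<otimes> x) \<otimes> inv y) \<le> off c y i" for c x t h1 h2
      proof
        fix y assume y: "y \<in> Cov c (t \<otimes> (h1 \<otimes> x))"
        then have yc: "y \<in> carrier G" and Yy: "Yf c y" and u1H: "t \<otimes> (h1 \<otimes> x) \<otimes> inv y \<in> H0"
          and u1le: "\<And>i. i < f \<Longrightarrow> lam i (t \<otimes> (h1 \<otimes> x) \<otimes> inv y) \<le> off c y i" by (auto simp: Cov_def)
        have tc: "t \<in> carrier G" using t Tc by simp
        have hH: "h1 \<in> H" "h2 \<in> H" using h V3 by auto
        have hc: "h1 \<in> carrier G" "h2 \<in> carrier G" using hH by (simp_all only: H_carrier)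
        define u where "u = t \<otimes> x \<otimes> inv y"
        have e1: "t \<otimes> (h1 \<otimes> x) \<otimes> inv y = (t \<otimes> h1 \<otimes> inv t) \<otimes> u"
          using tc hc x yc by (simp add: u_def m_assoc inv_cancel)
        have e2: "t \<otimes> (h2 \<otimes> x) \<otimes> inv y = (t \<otimes> h2 \<otimes> inv t) \<otimes> u"
          using tc hc x yc by (simp add: u_def m_assoc inv_cancel)
        have uc: "u \<in> carrier G" using tc x yc by (simp add: u_def)
        have g1: "t \<otimes> h1 \<otimes> inv t \<in> H0" and g2: "t \<otimes> h2 \<otimes> inv t \<in> H0" using V3_H0 t h by auto
        have "inv (t \<otimes> h1 \<otimes> inv t) \<otimes> ((t \<otimes> h1 \<otimes> inv t) \<otimes> u) \<in> H0"
          using fam_closed(2)[OF H0 fam_closed(3)[OF H0 g1] u1H[unfolded e1]] .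
        then have uH0: "u \<in> H0" using tc hc uc by (simp add: inv_cancel)
        have uH: "u \<in> H" using uH0 fam_subset[OF H0] by auto
        have l1: "lam i (t \<otimes> (h1 \<otimes> x) \<otimes> inv y) = lam i (t \<otimes> h1 \<otimes> inv t) + lam i u" if "i < f" for i
          unfolding e1 by (rule lam_mult[OF that H_conj[OF tc hH(1)] uH])
        have l2: "lam i (t \<otimes> (h2 \<otimes> x) \<otimes> inv y) = lam i (t \<otimes> h2 \<otimes> inv t) + lam i u" if "i < f" for i
          unfolding e2 by (rule lam_mult[OF that H_conj[OF tc hH(2)] uH])
        have ubox: "u \<in> box H0 (3 * a)"
        proof -
          have "lam i u \<le> 3 * a" if "i < f" for i
            using l1[OF that] u1le[OF that] off[OF c yc that] \<delta>(2)[OF t h(1) that] a \<delta>0(1) unfolding abs_le_iff by linarith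
          then show ?thesis using uH0 by (simp add: box_def)
        qed
        have "lam i (t \<otimes> (h2 \<otimes> x) \<otimes> inv y) \<le> off c y i" if i: "i < f" for i
        proof (cases "\<bar>lam i u - off c y i\<bar> \<le> \<delta>")
          case True
          then have "(t, y, i) \<in> near_faces H0 a \<delta> T (Yf c) (off c) x"
            using t yc Yy i ubox by (simp add: near_faces_def u_def)
          then show ?thesis using same u1le[OF i] by blast
        next
          case False
          then show ?thesis using l1[OF i] l2[OF i] u1le[OF i] \<delta>(2)[OF t h(1) i] \<delta>(2)[OF t h(2) i] \<delta>0(1)
            unfolding abs_le_iff by linarith
        qed
        then show "y \<in> Cov c (t \<otimes> (h2 \<otimes> x))"
          using yc Yy fam_closed(2)[OF H0 g2 uH0] by (simp add: Cov_def e2)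
      qed
      have fin_near: "finite (near_faces H0 a \<delta> T (Yf c) (off c) x)" if "x \<in> carrier G" for c x
        using T that by (intro finite_near_faces[OF H0]) auto
      have deep_ex: "\<exists>n\<le>d. deep c x n" if c: "coloring G K J c" and x: "x \<in> carrier G" for c x
      proof -
        let ?F = "near_faces H0 a \<delta> T (Yf c) (off c) x"
        \<comment> \<open>the face \<open>z\<close> is too close to \<open>v0\<^sup>n x\<close> for \<open>v0\<^sup>n x\<close> to be deep\<close>
        define bad where "bad n z \<longleftrightarrow> (case z of (t, y, i) \<Rightarrow>
            \<bar>lam i (t \<otimes> (v0 [^] n \<otimes> x) \<otimes> inv y) - off c y i\<bar> \<le> \<delta>0)" for n :: nat and z
        have val: "lam i (t \<otimes> (v0 [^] n \<otimes> x) \<otimes> inv y) = real n * lam i (t \<otimes> v0 \<otimes> inv t) + lam i (t \<otimes> x \<otimes> inv y)"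
          if "(t, y, i) \<in> ?F" for t y i and n :: nat
        proof -
          have tc: "t \<in> carrier G" and yc: "y \<in> carrier G" and i: "i < f" and uH: "t \<otimes> x \<otimes> inv y \<in> H"
            using that Tc box_H[OF H0] by (auto simp: near_faces_def)
          have "t \<otimes> (v0 [^] n \<otimes> x) \<otimes> inv y = (t \<otimes> v0 [^] n \<otimes> inv t) \<otimes> (t \<otimes> x \<otimes> inv y)"
            using tc yc x v0c[of n] by (simp add: m_assoc inv_cancel)
          then have "lam i (t \<otimes> (v0 [^] n \<otimes> x) \<otimes> inv y) = lam i (t \<otimes> v0 [^] n \<otimes> inv t) + lam i (t \<otimes> x \<otimes> inv y)"
            using lam_mult[OF i H_conj[OF tc H_pow[OF v0, of n]] uH] by simp
          moreover have "lam i (t \<otimes> v0 [^] n \<otimes> inv t) = real n * lam i (t \<otimes> v0 \<otimes> inv t)"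
            by (rule additive_pow[of "\<lambda>v. lam i (t \<otimes> v \<otimes> inv t)"]) (use lam_conj_mult[OF tc i] v0 in auto)
          ultimately show ?thesis by simp
        qed
        have once: "n = n'" if z: "z \<in> ?F" "bad n z" "bad n' z" for n n' z
        proof -
          obtain t y i where z': "z = (t, y, i)" by (metis prod.exhaust)
          define \<mu> where "\<mu> = lam i (t \<otimes> v0 \<otimes> inv t)"
          have "\<bar>(real n * \<mu> + lam i (t \<otimes> x \<otimes> inv y)) - off c y i\<bar> \<le> \<delta>0"
            "\<bar>(real n' * \<mu> + lam i (t \<otimes> x \<otimes> inv y)) - off c y i\<bar> \<le> \<delta>0"
            using z val[of t y i n] val[of t y i n'] unfolding bad_def z' \<mu>_def by auto
          then have "\<bar>real n * \<mu> - real n' * \<mu>\<bar> \<le> 2 * \<delta>0" unfolding abs_le_iff by linarith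
          then have "\<bar>real n - real n'\<bar> * \<bar>\<mu>\<bar> \<le> 2 * \<delta>0" by (simp add: left_diff_distrib abs_mult[symmetric])
          moreover have "2 * \<delta>0 < \<bar>\<mu>\<bar>" unfolding \<mu>_def using z(1) by (intro v0_large) (auto simp: z' near_faces_def)
          ultimately have *: "\<bar>real n - real n'\<bar> * \<bar>\<mu>\<bar> < 1 * \<bar>\<mu>\<bar>" by linarith
          have "\<bar>real n - real n'\<bar> < 1" by (rule mult_right_less_imp_less[OF *]) simp
          then show ?thesis by linarith
        qed
        have "\<exists>n\<le>d. \<forall>z\<in>?F. \<not> bad n z"
        proof (rule ccontr)
          assume "\<not> ?thesis"
          then have "\<forall>n\<in>{..d}. \<exists>z. z \<in> ?F \<and> bad n z" by blast
          from bchoice[OF this] obtain z where z: "\<forall>n\<in>{..d}. z n \<in> ?F \<and> bad n (z n)" ..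
          have "inj_on z {..d}"
          proof (rule inj_onI)
            fix n n' assume n: "n \<in> {..d}" "n' \<in> {..d}" and eq: "z n = z n'"
            have "bad n' (z n)" using z n(2) by (simp add: eq)
            then show "n = n'" using z n(1) by (intro once[of "z n"]) auto
          qed
          moreover have "z ` {..d} \<subseteq> ?F" using z by auto
          ultimately have "card {..d} \<le> card ?F" using fin_near[OF x] by (intro card_inj_on_le)
          then show False using near[OF c x] by simp
        qed
        then obtain n where n: "n \<le> d" and good: "\<And>z. z \<in> ?F \<Longrightarrow> \<not> bad n z" by blast
        have "cen c (t \<otimes> v \<otimes> (v0 [^] n \<otimes> x)) = cen c (t \<otimes> (v0 [^] n \<otimes> x))" if t: "t \<in> T" and v: "v \<in> V" for t v
        proof -
          have tc: "t \<in> carrier G" and vc: "v \<in> carrier G" and vH: "v \<in> H" using t v Tc Vc V by auto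
          have e: "t \<otimes> v \<otimes> (v0 [^] n \<otimes> x) = t \<otimes> ((v \<otimes> v0 [^] n) \<otimes> x)" using tc vc v0c x by (simp add: m_assoc)
          have iff: "lam i (t \<otimes> ((v \<otimes> v0 [^] n) \<otimes> x) \<otimes> inv y) \<le> off c y i \<longleftrightarrow> lam i (t \<otimes> (v0 [^] n \<otimes> x) \<otimes> inv y) \<le> off c y i"
            if z: "(t, y, i) \<in> ?F" for y i
          proof -
            have yc: "y \<in> carrier G" and i: "i < f" and uH: "t \<otimes> x \<otimes> inv y \<in> H"
              using z box_H[OF H0] by (auto simp: near_faces_def)
            have "t \<otimes> (v0 [^] n \<otimes> x) \<otimes> inv y = (t \<otimes> v0 [^] n \<otimes> inv t) \<otimes> (t \<otimes> x \<otimes> inv y)"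
              using tc yc x v0c[of n] by (simp add: m_assoc inv_cancel)
            then have wH: "t \<otimes> (v0 [^] n \<otimes> x) \<otimes> inv y \<in> H" using H_conj[OF tc H_pow[OF v0, of n]] uH by simp
            have "t \<otimes> ((v \<otimes> v0 [^] n) \<otimes> x) \<otimes> inv y = (t \<otimes> v \<otimes> inv t) \<otimes> (t \<otimes> (v0 [^] n \<otimes> x) \<otimes> inv y)"
              using tc vc yc x v0c[of n] by (simp add: m_assoc inv_cancel)
            then have "lam i (t \<otimes> ((v \<otimes> v0 [^] n) \<otimes> x) \<otimes> inv y) =
                lam i (t \<otimes> v \<otimes> inv t) + lam i (t \<otimes> (v0 [^] n \<otimes> x) \<otimes> inv y)"
              using lam_mult[OF i H_conj[OF tc vH] wH] by simp
            moreover have "\<bar>lam i (t \<otimes> v \<otimes> inv t)\<bar> \<le> \<delta>0" by (rule \<delta>0(2)[OF t v i])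
            moreover have "\<not> \<bar>lam i (t \<otimes> (v0 [^] n \<otimes> x) \<otimes> inv y) - off c y i\<bar> \<le> \<delta>0"
              using good[OF z] by (simp add: bad_def)
            ultimately show ?thesis unfolding abs_le_iff by linarith
          qed
          have "Cov c (t \<otimes> ((v \<otimes> v0 [^] n) \<otimes> x)) = Cov c (t \<otimes> (v0 [^] n \<otimes> x))"
            using iff \<delta>_pow[OF n] v by (intro equalityI cross[OF c x t]) auto
          then show ?thesis unfolding e by (rule cen_cong)
        qed
        then show ?thesis using n unfolding deep_def by blast
      qed
      have \<rho>_V1: "\<rho> c x \<in> V1" for c x
      proof (cases "\<exists>n\<le>d. deep c x n")
        case True
        from someI_ex[OF this[unfolded Bex_def]] show ?thesis using True by (auto simp: \<rho>_def V1_def)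
      next
        case False then show ?thesis unfolding \<rho>_def V1_def if_not_P[OF False] by (intro imageI) simp
      qed
      have \<rho>_deep: "cen c (t \<otimes> v \<otimes> (\<rho> c x \<otimes> x)) = cen c (t \<otimes> (\<rho> c x \<otimes> x))"
        if "coloring G K J c" "x \<in> carrier G" "t \<in> T" "v \<in> V" for c x t v
      proof -
        have ex: "\<exists>n. n \<le> d \<and> deep c x n" using deep_ex[OF that(1,2)] by blast
        have "\<rho> c x = v0 [^] (SOME n. n \<le> d \<and> deep c x n)" unfolding \<rho>_def by (rule if_P[OF ex, THEN arg_cong])
        moreover have "deep c x (SOME n. n \<le> d \<and> deep c x n)" using someI_ex[OF ex] by simp
        ultimately show ?thesis using that unfolding deep_def by simp
      qed
      have patterns: "card ((\<lambda>w. restrict (\<lambda>t. cen c (t \<otimes> w)) T) ` (\<lambda>(b, v). inv b \<otimes> v \<otimes> b \<otimes> x) ` (B \<times> V1)) \<le> 2 ^ d"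
        if c: "coloring G K J c" and x: "x \<in> carrier G" for c x
      proof -
        let ?F = "near_faces H0 a \<delta> T (Yf c) (off c) x"
        \<comment> \<open>the sides of the near faces on which a point lies determine its pattern\<close>
        define bits where "bits h = {(t, y, i) \<in> ?F. lam i (t \<otimes> (h \<otimes> x) \<otimes> inv y) \<le> off c y i}" for h
        have "(\<lambda>(b, v). inv b \<otimes> v \<otimes> b \<otimes> x) ` (B \<times> V1) = (\<lambda>h. h \<otimes> x) ` V2"
          unfolding V2_def by (force simp: image_iff)
        then have "card ((\<lambda>w. restrict (\<lambda>t. cen c (t \<otimes> w)) T) ` (\<lambda>(b, v). inv b \<otimes> v \<otimes> b \<otimes> x) ` (B \<times> V1)) =
            card ((\<lambda>h. restrict (\<lambda>t. cen c (t \<otimes> (h \<otimes> x))) T) ` V2)" by (simp only: image_image)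
        also have "\<dots> \<le> card (bits ` V2)"
        proof (rule card_image_factor)
          show "finite (bits ` V2)" using V2 by simp
          fix h1 h2 assume h: "h1 \<in> V2" "h2 \<in> V2" and eq: "bits h1 = bits h2"
          have h3: "h1 \<in> V3" "h2 \<in> V3" using h by (auto simp: V3_def)
          have "cen c (t \<otimes> (h1 \<otimes> x)) = cen c (t \<otimes> (h2 \<otimes> x))" if t: "t \<in> T" for t
          proof -
            have iff: "lam i (t \<otimes> (h1 \<otimes> x) \<otimes> inv y) \<le> off c y i \<longleftrightarrow> lam i (t \<otimes> (h2 \<otimes> x) \<otimes> inv y) \<le> off c y i"
              if "(t, y, i) \<in> ?F" for y i
            proof -
              have "(t, y, i) \<in> bits h1 \<longleftrightarrow> (t, y, i) \<in> bits h2" unfolding eq ..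
              then show ?thesis using that by (simp add: bits_def)
            qed
            have "Cov c (t \<otimes> (h1 \<otimes> x)) = Cov c (t \<otimes> (h2 \<otimes> x))"
              using iff h3 by (intro equalityI cross[OF c x t]) auto
            then show ?thesis by (rule cen_cong)
          qed
          then show "restrict (\<lambda>t. cen c (t \<otimes> (h1 \<otimes> x))) T = restrict (\<lambda>t. cen c (t \<otimes> (h2 \<otimes> x))) T" by auto
        qed
        also have "\<dots> \<le> card (Pow ?F)"
          using fin_near[OF x] by (intro card_mono) (auto simp: bits_def)
        also have "\<dots> = 2 ^ card ?F" by (rule card_Pow[OF fin_near[OF x]])
        also have "\<dots> \<le> 2 ^ d" using near[OF c x] by (intro power_increasing) auto
        finally show ?thesis .
      qed
      have color_neq: "q c (cen c (k \<otimes> x)) \<noteq> q c (cen c x)" if c: "coloring G K J c" and x: "x \<in> carrier G" and k: "k \<in> Ks" for c x k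
      proof -
        have kc: "k \<in> carrier G" using k Ks by auto
        have kx: "k \<otimes> x \<in> carrier G" using kc x by simp
        define y where "y = cen c x"
        define y' where "y' = cen c (k \<otimes> x)"
        have y: "y \<in> Cov c x" "y \<in> carrier G" "Yf c y" using cen_in[OF c x] by (auto simp: y_def Cov_def)
        have y': "y' \<in> Cov c (k \<otimes> x)" "y' \<in> carrier G" "Yf c y'" using cen_in[OF c kx] by (auto simp: y'_def Cov_def)
        have b: "x \<otimes> inv y \<in> box H0 (3 * a)" using box_up[OF Cov_box[OF c y(1)]] a by simp
        have b': "k \<otimes> x \<otimes> inv y' \<in> box H0 (3 * a)" using box_up[OF Cov_box[OF c y'(1)]] a by simp
        have "y' \<otimes> inv y = inv (k \<otimes> x \<otimes> inv y') \<otimes> k \<otimes> (x \<otimes> inv y)"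
          using kc x y(2) y'(2) by (simp add: inv_mult_group m_assoc inv_cancel)
        then have "y' \<otimes> inv y \<in> reach H0 (3 * a) k" using reachI[OF box_inv[OF H0 b'] b] by simp
        then have g: "y' \<otimes> inv y \<in> (\<Union>g\<in>Ks'. reach H0 (3 * a) g)" using k by (auto simp: Ks'_def)
        have eq: "y' \<otimes> inv y \<otimes> y = y'" using y y' by (simp add: m_assoc)
        have "y' \<otimes> inv y \<noteq> \<one>"
        proof
          assume "y' \<otimes> inv y = \<one>"
          then have "y' = y" using eq y by simp
          then have "k = (k \<otimes> x \<otimes> inv y') \<otimes> inv (x \<otimes> inv y)"
            using kc x y(2) by (simp add: inv_mult_group m_assoc inv_cancel)
          moreover have "(k \<otimes> x \<otimes> inv y') \<otimes> inv (x \<otimes> inv y) \<in> H"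
            using box_H[OF H0 b] box_H[OF H0 b'] by simp
          ultimately show False using k Ks(3) by auto
        qed
        from q_neq[OF c y(2) g this y(3)] y'(3) have "q c y' \<noteq> q c y" unfolding eq by simp
        then show ?thesis by (simp add: y_def y'_def)
      qed
      have disp: "cen c x \<otimes> inv x \<in> box H0 (2 * a)" if c: "coloring G K J c" and x: "x \<in> carrier G" for c x
      proof -
        have "inv (x \<otimes> inv (cen c x)) \<in> box H0 (2 * a)" by (rule box_inv[OF H0 Cov_box[OF c cen_in[OF c x]]])
        then show ?thesis using x cen_carrier[OF c x] by (simp add: inv_mult_group)
      qed
      have "cell_rule Ks M T V B K V1 J cen q \<rho> (box H0 (2 * a))"
        unfolding cell_rule_def
        using cen_loc q_loc \<rho>_loc finite_box[OF H0] box_carrier[OF H0] cen_carrier disp \<rho>_V1 q_less color_neq \<rho>_deep patterns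
        by (intro conjI allI impI ballI subsetI) simp_all
      then show ?thesis by blast
    qed
    then show "\<exists>K V1. finite K \<and> K \<subseteq> carrier G \<and> finite V1 \<and> V1 \<subseteq> H \<and>
        (\<forall>J. \<exists>cen q \<rho> D. cell_rule Ks M T V B K V1 J cen q \<rho> D)"
      using K Kc V1 by blast
  qed
qed

end

section \<open>Extensions with tame kernel\<close>

text \<open>
  First fit along an enumeration of the group.
\<close>

lemma coloring_exists:
  assumes "group Q" and cQ: "countable (carrier Q)" and K: "finite K" "K \<subseteq> carrier Q"
  obtains J c where "coloring Q K J c"
proof -
  interpret Q: group Q by (rule assms(1))
  define K' where "K' = K \<union> m_inv Q ` K"
  have K': "finite K'" using K by (simp add: K'_def)
  define n where "n = to_nat_on (carrier Q)"
  obtain c :: "'a \<Rightarrow> nat" where c: "\<And>x. c x \<le> card K'"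
    "\<And>x. c x = (LEAST k. k \<notin> c ` {y \<in> (\<lambda>k. k \<otimes>\<^bsub>Q\<^esub> x) ` K'. n y < n x})"
    "\<And>x y. y \<in> (\<lambda>k. k \<otimes>\<^bsub>Q\<^esub> x) ` K' \<Longrightarrow> n y < n x \<Longrightarrow> c y \<noteq> c x"
    by (rule greedy_coloring[of "\<lambda>x. (\<lambda>k. k \<otimes>\<^bsub>Q\<^esub> x) ` K'" "card K'" n])
      (rule finite_imageI[OF K'], rule card_image_le[OF K'], rule that)
  have "coloring Q K (Suc (card K')) c"
    unfolding coloring_def
  proof (intro ballI conjI impI)
    fix g assume g: "g \<in> carrier Q"
    show "c g < Suc (card K')" using c(1) by (simp add: less_Suc_eq_le)
    fix k assume k: "k \<in> K" "k \<noteq> \<one>\<^bsub>Q\<^esub>"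
    have kc: "k \<in> carrier Q" using k K by auto
    have "k \<otimes>\<^bsub>Q\<^esub> g \<noteq> g" using k g kc by simp
    then have "n (k \<otimes>\<^bsub>Q\<^esub> g) \<noteq> n g" unfolding n_def using g kc cQ by simp
    then consider "n (k \<otimes>\<^bsub>Q\<^esub> g) < n g" | "n g < n (k \<otimes>\<^bsub>Q\<^esub> g)" by linarith
    then show "c (k \<otimes>\<^bsub>Q\<^esub> g) \<noteq> c g"
    proof cases
      case 1 then show ?thesis using k by (intro c(3)) (auto simp: K'_def)
    next
      case 2
      have "g = inv\<^bsub>Q\<^esub> k \<otimes>\<^bsub>Q\<^esub> (k \<otimes>\<^bsub>Q\<^esub> g)" using g kc by (simp add: Q.inv_cancel)
      then have "c g \<noteq> c (k \<otimes>\<^bsub>Q\<^esub> g)" using k 2 by (intro c(3)) (auto simp: K'_def)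
      then show ?thesis by simp
    qed
  qed
  then show ?thesis by (rule that)
qed

context tame_subgroup begin

text \<open>
  Let \<open>\<sigma>\<close> be a section of \<open>\<pi>\<close>. From \<open>x\<close> move to the deep point \<open>z = \<rho> x\<close>. The colors of the cells
  of \<open>\<sigma> q z\<close>, for \<open>q\<close> in a window \<open>U\<close>, form a proper coloring of the window: \<open>\<sigma> (k q) z\<close> and \<open>\<sigma> k
  \<sigma> q z\<close> differ by a bounded motion in \<open>H\<close> and so lie in the same cell, and \<open>\<sigma> k\<close> changes the
  color of cells. Outside \<open>U\<close> it is completed by a fixed coloring \<open>c0\<close> of \<open>Q\<close> in new colors. The
  rule of \<open>Q\<close>, evaluated at the identity, gives some \<open>q\<close>, and \<open>P x\<close> is the center of the cell of
  \<open>\<sigma> q z\<close>.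

  To count the values at \<open>b x\<close>, \<open>b \<in> B\<close>, look at the deep point of \<open>b x\<close> from \<open>w = b\<^sup>-\<^sup>1 \<rho> b x\<close>, a
  point close to \<open>x\<close> in its \<open>H\<close>-coset. The labelling of \<open>Q\<close> seen from there is the one seen from
  the deep point, translated by \<open>\<pi> b\<close>, so \<open>P (b x)\<close> is the value at \<open>\<pi> b\<close> of the rule of \<open>Q\<close> in
  the labelling of \<open>w\<close>. There are at most \<open>2 ^ d\<close> labellings, and each contributes at most \<open>CQ\<close>
  values.
\<close>

theorem finite_rule_dimension_extension:
  fixes Q :: "('q, 'n) monoid_scheme" and \<pi> :: "'g \<Rightarrow> 'q"
  assumes grQ: "group Q" and hom: "\<pi> \<in> hom G Q" and surj: "\<pi> ` carrier G = carrier Q"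
    and ker: "H = kernel G Q \<pi>" and cQ: "countable (carrier Q)" and fQ: "finite_rule_dimension Q"
  shows "finite_rule_dimension G"
proof -
  interpret Q: group Q by (rule grQ)
  have \<pi>_mult: "\<pi> (g \<otimes> h) = \<pi> g \<otimes>\<^bsub>Q\<^esub> \<pi> h" if "g \<in> carrier G" "h \<in> carrier G" for g h
    using hom that by (simp add: hom_def)
  have \<pi>_c: "\<pi> g \<in> carrier Q" if "g \<in> carrier G" for g using surj that by auto
  have \<pi>_inv: "\<pi> (inv g) = inv\<^bsub>Q\<^esub> \<pi> g" if "g \<in> carrier G" for g
    using group_hom.hom_inv[of G Q \<pi>] that hom is_group grQ
    by (simp add: group_hom_def group_hom_axioms_def)
  have \<pi>_H: "g \<in> H \<longleftrightarrow> \<pi> g = \<one>\<^bsub>Q\<^esub>" if "g \<in> carrier G" for g using that by (simp add: ker kernel_def)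
  define \<sigma> where "\<sigma> = inv_into (carrier G) \<pi>"
  have \<sigma>: "\<sigma> q \<in> carrier G" "\<pi> (\<sigma> q) = q" if "q \<in> carrier Q" for q
    using that surj unfolding \<sigma>_def by (auto intro: inv_into_into f_inv_into_f)
  obtain CQ where CQ: "\<And>B. finite B \<Longrightarrow> B \<subseteq> carrier Q \<Longrightarrow>
        \<exists>K. finite K \<and> K \<subseteq> carrier Q \<and> (\<forall>J. \<exists>P D. coarse_rule Q B CQ K J P D)"
    by (rule finite_rule_dimensionE[OF fQ]) (rule that)
  show ?thesis
    unfolding finite_rule_dimension_def
  proof (intro exI[of _ "2 ^ d * CQ"] allI impI)
    fix B0 assume B0: "finite B0" "B0 \<subseteq> carrier G"
    define B where "B = insert \<one> B0"
    have B: "finite B" "B \<subseteq> carrier G" "\<one> \<in> B" using B0 by (auto simp: B_def)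
    have Bc: "b \<in> carrier G" if "b \<in> B" for b using that B by auto
    define BQ where "BQ = \<pi> ` B"
    have BQ: "finite BQ" "BQ \<subseteq> carrier Q" using B \<pi>_c by (auto simp: BQ_def)
    have one_BQ: "\<one>\<^bsub>Q\<^esub> \<in> BQ" unfolding BQ_def using B(3) \<pi>_H[of \<one>] by force
    obtain KQ where KQ: "finite KQ" "KQ \<subseteq> carrier Q" and KQJ: "\<forall>J. \<exists>P D. coarse_rule Q BQ CQ KQ J P D"
      using CQ[OF BQ] by blast
    \<comment> \<open>lifts of the elements along which colorings of \<open>Q\<close> have to be proper; none of them preserves
    a coset of \<open>H\<close>\<close>
    define Ks where "Ks = \<sigma> ` (KQ - {\<one>\<^bsub>Q\<^esub>})"
    have Ks: "finite Ks" "Ks \<subseteq> carrier G" "Ks \<inter> H = {}"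
      using KQ \<sigma> \<pi>_H by (auto simp: Ks_def subset_iff)
    obtain M where cells: "\<And>T V B. finite T \<Longrightarrow> T \<subseteq> carrier G \<Longrightarrow>
      (\<And>t t'. t \<in> T \<Longrightarrow> t' \<in> T \<Longrightarrow> t' \<otimes> inv t \<in> H \<Longrightarrow> t = t') \<Longrightarrow>
      finite V \<Longrightarrow> V \<subseteq> H \<Longrightarrow> finite B \<Longrightarrow> B \<subseteq> carrier G \<Longrightarrow>
      \<exists>K V1. finite K \<and> K \<subseteq> carrier G \<and> finite V1 \<and> V1 \<subseteq> H \<and>
        (\<forall>J. \<exists>cen q \<rho> D. cell_rule Ks M T V B K V1 J cen q \<rho> D)"
      using cells[OF Ks] by metis
    obtain J0 c0 where c0: "coloring Q KQ J0 c0" by (rule coloring_exists[OF grQ cQ KQ])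
    \<comment> \<open>\<open>M\<close> colors for cells inside the window, \<open>J0\<close> further ones outside\<close>
    define J' where "J' = M + J0"
    obtain PQ DQ where PQ: "coarse_rule Q BQ CQ KQ J' PQ DQ" using KQJ by blast
    note PQ_loc = coarse_ruleD(1)[OF PQ] and DQ = coarse_ruleD(2,3)[OF PQ]
      and PQ_c = coarse_ruleD(4)[OF PQ] and PQ_D = coarse_ruleD(5)[OF PQ] and PQ_card = coarse_ruleD(6)[OF PQ]
    from PQ_loc obtain TQ where TQ: "finite TQ" "TQ \<subseteq> carrier Q"
      and PQ_T: "\<And>c c' x x'. coloring Q KQ J' c \<Longrightarrow> coloring Q KQ J' c' \<Longrightarrow> x \<in> carrier Q \<Longrightarrow> x' \<in> carrier Q \<Longrightarrow>
           (\<And>t. t \<in> TQ \<Longrightarrow> c (t \<otimes>\<^bsub>Q\<^esub> x) = c' (t \<otimes>\<^bsub>Q\<^esub> x')) \<Longrightarrow> PQ c x \<otimes>\<^bsub>Q\<^esub> inv\<^bsub>Q\<^esub> x = PQ c' x' \<otimes>\<^bsub>Q\<^esub> inv\<^bsub>Q\<^esub> x'"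
      by (erule local_mapE)
    \<comment> \<open>\<open>U\<close> is what the rule of \<open>Q\<close> sees from the points of \<open>BQ\<close>; \<open>S\<close> is what remains of it after
    translation by \<open>BQ\<^sup>-\<^sup>1\<close>, together with the possible values of the rule; \<open>W\<close> contains the
    translates of \<open>S\<close> by \<open>BQ\<close>\<close>
    define U where "U = (\<lambda>(t, b). t \<otimes>\<^bsub>Q\<^esub> b) ` (TQ \<times> BQ)"
    define S where "S = (\<lambda>(u, b). u \<otimes>\<^bsub>Q\<^esub> inv\<^bsub>Q\<^esub> b) ` (U \<times> BQ) \<union> DQ \<union> TQ"
    define W where "W = (\<lambda>(s, b). s \<otimes>\<^bsub>Q\<^esub> b) ` (S \<times> BQ)"
    have U: "finite U" "U \<subseteq> carrier Q" using TQ BQ by (auto simp: U_def)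
    have S: "finite S" "S \<subseteq> carrier Q" using U BQ DQ TQ by (auto simp: S_def)
    have W: "finite W" "W \<subseteq> carrier Q" using S BQ by (auto simp: W_def)
    have S_W: "s \<in> S \<Longrightarrow> s \<in> W" for s
      using one_BQ S unfolding W_def by (intro image_eqI[of _ _ "(s, \<one>\<^bsub>Q\<^esub>)"]) auto
    have U_W: "u \<in> U \<Longrightarrow> u \<in> W" for u
    proof -
      assume u: "u \<in> U"
      have "u \<otimes>\<^bsub>Q\<^esub> inv\<^bsub>Q\<^esub> \<one>\<^bsub>Q\<^esub> \<in> S" unfolding S_def using u one_BQ by force
      then have "u \<in> S" using u U by auto
      then show "u \<in> W" by (rule S_W)
    qed
    have US: "u \<otimes>\<^bsub>Q\<^esub> inv\<^bsub>Q\<^esub> b \<in> S" if "u \<in> U" "b \<in> BQ" for u b unfolding S_def using that by force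
    have TU: "t \<otimes>\<^bsub>Q\<^esub> b \<in> U" if "t \<in> TQ" "b \<in> BQ" for t b unfolding U_def using that by force
    define T where "T = \<sigma> ` W"
    have T: "finite T" "T \<subseteq> carrier G" using W \<sigma> by (auto simp: T_def)
    have T_inj: "t = t'" if tT: "t \<in> T" "t' \<in> T" and tH: "t' \<otimes> inv t \<in> H" for t t'
    proof -
      obtain q q' where q: "q \<in> carrier Q" "t = \<sigma> q" and q': "q' \<in> carrier Q" "t' = \<sigma> q'"
        using tT W by (auto simp: T_def)
      have "\<pi> (t' \<otimes> inv t) = q' \<otimes>\<^bsub>Q\<^esub> inv\<^bsub>Q\<^esub> q" using q q' \<sigma> by (simp add: \<pi>_mult \<pi>_inv)
      then have "q' \<otimes>\<^bsub>Q\<^esub> inv\<^bsub>Q\<^esub> q = \<one>\<^bsub>Q\<^esub>" using tH H_carrier \<pi>_H by metis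
      then have "q' = q" using q q' by (metis Q.inv_closed Q.inv_equality Q.inv_inv)
      then show ?thesis using q q' by simp
    qed
    \<comment> \<open>the elements of \<open>H\<close> by which \<open>\<sigma>\<close> fails to be multiplicative on these windows\<close>
    define V where "V = (\<lambda>(q, b). inv (\<sigma> q) \<otimes> \<sigma> (q \<otimes>\<^bsub>Q\<^esub> \<pi> b) \<otimes> inv b) ` (S \<times> B) \<union>
        (\<lambda>(k, q). inv (\<sigma> (k \<otimes>\<^bsub>Q\<^esub> q)) \<otimes> \<sigma> k \<otimes> \<sigma> q) ` (KQ \<times> S)"
    have V: "finite V" "V \<subseteq> H"
    proof -
      show "finite V" using S B KQ by (simp add: V_def)
      have "inv (\<sigma> q) \<otimes> \<sigma> (q \<otimes>\<^bsub>Q\<^esub> \<pi> b) \<otimes> inv b \<in> H" if "q \<in> S" "b \<in> B" for q b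
      proof -
        have c: "q \<in> carrier Q" "b \<in> carrier G" "\<pi> b \<in> carrier Q" using that S Bc \<pi>_c by auto
        then show ?thesis using \<sigma>[of q] \<sigma>[of "q \<otimes>\<^bsub>Q\<^esub> \<pi> b"]
          by (subst \<pi>_H) (simp_all add: \<pi>_mult \<pi>_inv Q.m_assoc Q.inv_cancel)
      qed
      moreover have "inv (\<sigma> (k \<otimes>\<^bsub>Q\<^esub> q)) \<otimes> \<sigma> k \<otimes> \<sigma> q \<in> H" if "k \<in> KQ" "q \<in> S" for k q
      proof -
        have c: "q \<in> carrier Q" "k \<in> carrier Q" using that S KQ by auto
        then show ?thesis using \<sigma>[of q] \<sigma>[of k] \<sigma>[of "k \<otimes>\<^bsub>Q\<^esub> q"]
          by (subst \<pi>_H) (simp_all add: \<pi>_mult \<pi>_inv Q.m_assoc)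
      qed
      ultimately show "V \<subseteq> H" by (auto simp: V_def)
    qed
    obtain K V1 where K: "finite K" "K \<subseteq> carrier G" and V1: "finite V1" "V1 \<subseteq> H"
      and KJ: "\<forall>J. \<exists>cen q \<rho> D. cell_rule Ks M T V B K V1 J cen q \<rho> D"
      using cells[OF T T_inj V B(1,2)] by blast
    have "\<exists>P D. coarse_rule G B0 (2 ^ d * CQ) K J P D" for J
    proof -
      obtain cen qc \<rho> D where cr: "cell_rule Ks M T V B K V1 J cen qc \<rho> D" using KJ by blast
      have cen_loc: "local_map G K J (\<lambda>c x. cen c x \<otimes> inv x)" and qc_loc: "local_map G K J qc"
        and \<rho>_loc: "local_map G K J \<rho>" and D: "finite D" "D \<subseteq> carrier G"
        using cr by (simp_all add: cell_rule_def)
      have cen: "cen c x \<in> carrier G" "cen c x \<otimes> inv x \<in> D" and \<rho>: "\<rho> c x \<in> V1"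
        and qc: "qc c (cen c x) < M" "\<And>k. k \<in> Ks \<Longrightarrow> qc c (cen c (k \<otimes> x)) \<noteq> qc c (cen c x)"
        and deep: "\<And>t v. t \<in> T \<Longrightarrow> v \<in> V \<Longrightarrow> cen c (t \<otimes> v \<otimes> (\<rho> c x \<otimes> x)) = cen c (t \<otimes> (\<rho> c x \<otimes> x))"
        and pats: "card ((\<lambda>w. restrict (\<lambda>t. cen c (t \<otimes> w)) T) `
              (\<lambda>(b, v). inv b \<otimes> v \<otimes> b \<otimes> x) ` (B \<times> V1)) \<le> 2 ^ d"
        if "coloring G K J c" "x \<in> carrier G" for c x
        using cr that unfolding cell_rule_def by blast+
      have \<rho>c: "\<rho> c x \<in> carrier G" if "coloring G K J c" "x \<in> carrier G" for c x
        using \<rho>[OF that] V1 H_carrier by auto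
      define lab where "lab c p q = (if q \<in> U then qc c (p (\<sigma> q)) else M + c0 q)" for c p q
      define pat where "pat c w = restrict (\<lambda>t. cen c (t \<otimes> w)) T" for c w
      define z where "z c x = \<rho> c x \<otimes> x" for c x
      define P where "P c x = cen c (\<sigma> (PQ (lab c (pat c (z c x))) \<one>\<^bsub>Q\<^esub>) \<otimes> z c x)" for c x
      have pat: "pat c w (\<sigma> q) = cen c (\<sigma> q \<otimes> w)" if "q \<in> W" for c w q
        using that by (simp add: pat_def T_def)
      have zc: "z c x \<in> carrier G" if "coloring G K J c" "x \<in> carrier G" for c x
        using that \<rho>c by (simp add: z_def)
      \<comment> \<open>seen from \<open>b\<^sup>-\<^sup>1 z\<close> instead of \<open>z\<close>, the pattern of cells over \<open>Q\<close> is translated by \<open>\<pi> b\<close>\<close>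
      have shift: "cen c (\<sigma> (q \<otimes>\<^bsub>Q\<^esub> \<pi> b) \<otimes> (inv b \<otimes> z c x)) = cen c (\<sigma> q \<otimes> z c x)"
        if c: "coloring G K J c" and x: "x \<in> carrier G" and b: "b \<in> B" and q: "q \<in> S" for c x b q
      proof -
        have qc': "q \<in> carrier Q" "\<pi> b \<in> carrier Q" "b \<in> carrier G" using q S b Bc \<pi>_c by auto
        have sc: "\<sigma> q \<in> carrier G" "\<sigma> (q \<otimes>\<^bsub>Q\<^esub> \<pi> b) \<in> carrier G" using qc' \<sigma> by auto
        have "\<sigma> (q \<otimes>\<^bsub>Q\<^esub> \<pi> b) \<otimes> (inv b \<otimes> z c x) =
            \<sigma> q \<otimes> (inv (\<sigma> q) \<otimes> \<sigma> (q \<otimes>\<^bsub>Q\<^esub> \<pi> b) \<otimes> inv b) \<otimes> z c x"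
          using sc qc' zc[OF c x] by (simp add: m_assoc inv_cancel)
        moreover have "inv (\<sigma> q) \<otimes> \<sigma> (q \<otimes>\<^bsub>Q\<^esub> \<pi> b) \<otimes> inv b \<in> V" using q b by (force simp: V_def)
        moreover have "\<sigma> q \<in> T" using S_W[OF q] by (simp add: T_def)
        ultimately show ?thesis using deep[OF c x] by (simp add: z_def)
      qed
      have lab_col: "coloring Q KQ J' (lab c (pat c (inv b \<otimes> z c x)))"
        if c: "coloring G K J c" and x: "x \<in> carrier G" and b: "b \<in> B" for c x b
      proof -
        let ?l = "lab c (pat c (inv b \<otimes> z c x))"
        have bc: "b \<in> carrier G" "\<pi> b \<in> carrier Q" "\<pi> b \<in> BQ" using b Bc \<pi>_c by (auto simp: BQ_def)
        have inU: "?l q = qc c (cen c (\<sigma> (q \<otimes>\<^bsub>Q\<^esub> inv\<^bsub>Q\<^esub> \<pi> b) \<otimes> z c x))" if q: "q \<in> U" for q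
        proof -
          have "q \<in> carrier Q" using q U by auto
          then have "q \<otimes>\<^bsub>Q\<^esub> inv\<^bsub>Q\<^esub> \<pi> b \<otimes>\<^bsub>Q\<^esub> \<pi> b = q" using bc by (simp add: Q.m_assoc)
          then show ?thesis using shift[OF c x b US[OF q bc(3)]] q pat[OF U_W[OF q]] by (simp add: lab_def)
        qed
        have outU: "?l q = M + c0 q" if "q \<notin> U" for q using that by (simp add: lab_def)
        have sz: "\<sigma> q \<otimes> z c x \<in> carrier G" if "q \<in> carrier Q" for q using \<sigma>[OF that] zc[OF c x] by simp
        have lessU: "?l q < M" if "q \<in> U" for q
          unfolding inU[OF that] using U BQ bc that by (intro qc(1)[OF c] sz) auto
        show ?thesis
          unfolding coloring_def
        proof (intro ballI conjI impI)
          fix q assume q: "q \<in> carrier Q"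
          show "?l q < J'" using lessU[of q] outU[of q] coloring_less[OF c0 q] by (cases "q \<in> U") (auto simp: J'_def)
          fix k assume k: "k \<in> KQ" "k \<noteq> \<one>\<^bsub>Q\<^esub>"
          have kc: "k \<in> carrier Q" using k KQ by auto
          consider "q \<in> U" "k \<otimes>\<^bsub>Q\<^esub> q \<in> U" | "q \<notin> U" "k \<otimes>\<^bsub>Q\<^esub> q \<notin> U" | "(q \<in> U) \<noteq> (k \<otimes>\<^bsub>Q\<^esub> q \<in> U)" by blast
          then show "?l (k \<otimes>\<^bsub>Q\<^esub> q) \<noteq> ?l q"
          proof cases
            case 1
            define q' where "q' = q \<otimes>\<^bsub>Q\<^esub> inv\<^bsub>Q\<^esub> \<pi> b"
            have q'c: "q' \<in> carrier Q" using q bc by (simp add: q'_def)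
            have kq': "k \<otimes>\<^bsub>Q\<^esub> q \<otimes>\<^bsub>Q\<^esub> inv\<^bsub>Q\<^esub> \<pi> b = k \<otimes>\<^bsub>Q\<^esub> q'" using q bc kc by (simp add: q'_def Q.m_assoc)
            have q'S: "q' \<in> S" "k \<otimes>\<^bsub>Q\<^esub> q' \<in> S" using US[OF 1(1) bc(3)] US[OF 1(2) bc(3)] kq' by (simp_all add: q'_def)
            have sc: "\<sigma> q' \<in> carrier G" "\<sigma> k \<in> carrier G" "\<sigma> (k \<otimes>\<^bsub>Q\<^esub> q') \<in> carrier G" using \<sigma> q'c kc by auto
            have "\<sigma> (k \<otimes>\<^bsub>Q\<^esub> q') \<otimes> (inv (\<sigma> (k \<otimes>\<^bsub>Q\<^esub> q')) \<otimes> \<sigma> k \<otimes> \<sigma> q') \<otimes> z c x = \<sigma> k \<otimes> (\<sigma> q' \<otimes> z c x)"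
              using sc zc[OF c x] by (simp add: m_assoc inv_cancel)
            moreover have "inv (\<sigma> (k \<otimes>\<^bsub>Q\<^esub> q')) \<otimes> \<sigma> k \<otimes> \<sigma> q' \<in> V" using k q'S by (force simp: V_def)
            moreover have "\<sigma> (k \<otimes>\<^bsub>Q\<^esub> q') \<in> T" using S_W[OF q'S(2)] by (simp add: T_def)
            ultimately have "cen c (\<sigma> (k \<otimes>\<^bsub>Q\<^esub> q') \<otimes> z c x) = cen c (\<sigma> k \<otimes> (\<sigma> q' \<otimes> z c x))"
              using deep[OF c x] by (metis z_def)
            moreover have "\<sigma> k \<in> Ks" using k by (simp add: Ks_def)
            ultimately show ?thesis
              unfolding inU[OF 1(1)] inU[OF 1(2)] kq' q'_def[symmetric] using qc(2)[OF c sz[OF q'c]] by simp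
          next
            case 2
            then show ?thesis using coloring_neq[OF c0 q k] by (simp add: outU)
          next
            case 3
            then show ?thesis using lessU outU by (metis add.commute not_add_less2)
          qed
        qed
      qed
      have one_z: "inv \<one> \<otimes> z c x = z c x" if "coloring G K J c" "x \<in> carrier G" for c x
        using zc[OF that] by simp
      have lab_col1: "coloring Q KQ J' (lab c (pat c (z c x)))" if "coloring G K J c" "x \<in> carrier G" for c x
        using lab_col[OF that B(3)] by (simp only: one_z[OF that])
      have q0: "PQ (lab c (pat c (z c x))) \<one>\<^bsub>Q\<^esub> \<in> DQ" if "coloring G K J c" "x \<in> carrier G" for c x
        using PQ_D[OF lab_col1[OF that] Q.one_closed] PQ_c[OF lab_col1[OF that] Q.one_closed] by simp
      have P_eq: "P c (b \<otimes> x) = pat c (inv b \<otimes> z c (b \<otimes> x)) (\<sigma> (PQ (lab c (pat c (inv b \<otimes> z c (b \<otimes> x)))) (\<pi> b)))"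
        if c: "coloring G K J c" and x: "x \<in> carrier G" and b: "b \<in> B" for c x b
      proof -
        have bc: "b \<in> carrier G" "\<pi> b \<in> carrier Q" "\<pi> b \<in> BQ" using b Bc \<pi>_c by (auto simp: BQ_def)
        have bx: "b \<otimes> x \<in> carrier G" using bc x by simp
        let ?z = "z c (b \<otimes> x)" and ?w = "inv b \<otimes> z c (b \<otimes> x)"
        let ?q0 = "PQ (lab c (pat c ?z)) \<one>\<^bsub>Q\<^esub>"
        have "?q0 \<otimes>\<^bsub>Q\<^esub> inv\<^bsub>Q\<^esub> \<one>\<^bsub>Q\<^esub> = PQ (lab c (pat c ?w)) (\<pi> b) \<otimes>\<^bsub>Q\<^esub> inv\<^bsub>Q\<^esub> \<pi> b"
        proof (rule PQ_T[OF lab_col1[OF c bx] lab_col[OF c bx b] Q.one_closed bc(2)])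
          fix t assume t: "t \<in> TQ"
          then have tc: "t \<in> carrier Q" and tS: "t \<in> S" using TQ by (auto simp: S_def)
          have "t \<in> U" using TU[OF t one_BQ] tc by simp
          then show "lab c (pat c ?z) (t \<otimes>\<^bsub>Q\<^esub> \<one>\<^bsub>Q\<^esub>) = lab c (pat c ?w) (t \<otimes>\<^bsub>Q\<^esub> \<pi> b)"
            using tc TU[OF t bc(3)] shift[OF c bx b tS] pat[OF U_W] by (simp add: lab_def)
        qed
        moreover have q0D: "?q0 \<in> DQ" by (rule q0[OF c bx])
        moreover have PQw: "PQ (lab c (pat c ?w)) (\<pi> b) \<in> carrier Q" by (rule PQ_c[OF lab_col[OF c bx b] bc(2)])
        moreover have q0c: "?q0 \<in> carrier Q" using q0D DQ by auto
        ultimately have "?q0 = PQ (lab c (pat c ?w)) (\<pi> b) \<otimes>\<^bsub>Q\<^esub> inv\<^bsub>Q\<^esub> \<pi> b" by simp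
        then have eq: "?q0 \<otimes>\<^bsub>Q\<^esub> \<pi> b = PQ (lab c (pat c ?w)) (\<pi> b)" using bc PQw by (simp add: Q.m_assoc)
        have q0S: "?q0 \<in> S" using q0D by (simp add: S_def)
        have "?q0 \<otimes>\<^bsub>Q\<^esub> \<pi> b \<in> W" using q0S bc by (force simp: W_def)
        then have "pat c ?w (\<sigma> (?q0 \<otimes>\<^bsub>Q\<^esub> \<pi> b)) = P c (b \<otimes> x)"
          using shift[OF c bx b q0S] pat by (simp add: P_def)
        then show ?thesis unfolding eq by simp
      qed
      have P_card: "card (P c ` (\<lambda>b. b \<otimes> x) ` B0) \<le> 2 ^ d * CQ" if c: "coloring G K J c" and x: "x \<in> carrier G" for c x
      proof -
        define Ps where "Ps = (\<lambda>b. pat c (inv b \<otimes> z c (b \<otimes> x))) ` B"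
        have bx: "b \<otimes> x \<in> carrier G" if "b \<in> B" for b using that Bc x by simp
        have "Ps \<subseteq> (\<lambda>w. restrict (\<lambda>t. cen c (t \<otimes> w)) T) ` (\<lambda>(b, v). inv b \<otimes> v \<otimes> b \<otimes> x) ` (B \<times> V1)"
        proof
          fix p assume "p \<in> Ps"
          then obtain b where b: "b \<in> B" "p = pat c (inv b \<otimes> z c (b \<otimes> x))" by (auto simp: Ps_def)
          have "inv b \<otimes> z c (b \<otimes> x) = inv b \<otimes> \<rho> c (b \<otimes> x) \<otimes> b \<otimes> x"
            using Bc[OF b(1)] x \<rho>c[OF c bx[OF b(1)]] by (simp add: z_def m_assoc)
          then have "p = (\<lambda>w. restrict (\<lambda>t. cen c (t \<otimes> w)) T) ((\<lambda>(b, v). inv b \<otimes> v \<otimes> b \<otimes> x) (b, \<rho> c (b \<otimes> x)))"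
            using b(2) by (simp add: pat_def)
          moreover have "(b, \<rho> c (b \<otimes> x)) \<in> B \<times> V1" using b \<rho>[OF c bx[OF b(1)]] by simp
          ultimately show "p \<in> (\<lambda>w. restrict (\<lambda>t. cen c (t \<otimes> w)) T) ` (\<lambda>(b, v). inv b \<otimes> v \<otimes> b \<otimes> x) ` (B \<times> V1)"
            by blast
        qed
        then have "card Ps \<le> card ((\<lambda>w. restrict (\<lambda>t. cen c (t \<otimes> w)) T) ` (\<lambda>(b, v). inv b \<otimes> v \<otimes> b \<otimes> x) ` (B \<times> V1))"
          using B(1) V1(1) by (intro card_mono) auto
        then have Ps: "card Ps \<le> 2 ^ d" using pats[OF c x] by simp
        have finPs: "finite Ps" using B by (simp add: Ps_def)
        have each: "card ((\<lambda>r. p (\<sigma> r)) ` PQ (lab c p) ` BQ) \<le> CQ" if "p \<in> Ps" for p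
        proof -
          obtain b where b: "b \<in> B" "p = pat c (inv b \<otimes> z c (b \<otimes> x))" using \<open>p \<in> Ps\<close> by (auto simp: Ps_def)
          have "coloring Q KQ J' (lab c p)" unfolding b(2) by (rule lab_col[OF c bx[OF b(1)] b(1)])
          then have "card (PQ (lab c p) ` (\<lambda>b. b \<otimes>\<^bsub>Q\<^esub> \<one>\<^bsub>Q\<^esub>) ` BQ) \<le> CQ" by (rule PQ_card[OF _ Q.one_closed])
          moreover have "(\<lambda>b. b \<otimes>\<^bsub>Q\<^esub> \<one>\<^bsub>Q\<^esub>) ` BQ = BQ" using BQ by (force simp: image_iff)
          ultimately have "card (PQ (lab c p) ` BQ) \<le> CQ" by simp
          then show ?thesis using card_image_le[of "PQ (lab c p) ` BQ" "\<lambda>r. p (\<sigma> r)"] BQ(1) by simp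
        qed
        have "P c ` (\<lambda>b. b \<otimes> x) ` B0 \<subseteq> (\<Union>p\<in>Ps. (\<lambda>r. p (\<sigma> r)) ` PQ (lab c p) ` BQ)"
        proof
          fix y assume "y \<in> P c ` (\<lambda>b. b \<otimes> x) ` B0"
          then obtain b where b: "b \<in> B" "y = P c (b \<otimes> x)" by (auto simp: B_def)
          show "y \<in> (\<Union>p\<in>Ps. (\<lambda>r. p (\<sigma> r)) ` PQ (lab c p) ` BQ)"
            unfolding b(2) P_eq[OF c x b(1)] using b(1) by (force simp: Ps_def BQ_def)
        qed
        then have "card (P c ` (\<lambda>b. b \<otimes> x) ` B0) \<le> card (\<Union>p\<in>Ps. (\<lambda>r. p (\<sigma> r)) ` PQ (lab c p) ` BQ)"
          using finPs BQ by (intro card_mono) auto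
        also have "\<dots> \<le> (\<Sum>p\<in>Ps. card ((\<lambda>r. p (\<sigma> r)) ` PQ (lab c p) ` BQ))" by (rule card_UN_le[OF finPs])
        also have "\<dots> \<le> (\<Sum>p\<in>Ps. CQ)" by (rule sum_mono) (rule each)
        also have "\<dots> \<le> 2 ^ d * CQ" using Ps by simp
        finally show ?thesis .
      qed
      define DP where "DP = (\<lambda>(e, q, v). e \<otimes> (\<sigma> q \<otimes> v)) ` (D \<times> DQ \<times> V1)"
      have \<sigma>D: "\<sigma> q \<in> carrier G" if "q \<in> DQ" for q using that DQ \<sigma> by auto
      have DP: "finite DP" "DP \<subseteq> carrier G" using D DQ V1 \<sigma>D H_carrier by (auto simp: DP_def subset_iff)
      have P_disp: "P c x \<in> carrier G" "P c x \<otimes> inv x = (let y = \<sigma> (PQ (lab c (pat c (z c x))) \<one>\<^bsub>Q\<^esub>) \<otimes> \<rho> c x in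
          cen c (y \<otimes> x) \<otimes> inv (y \<otimes> x) \<otimes> y)"
        if c: "coloring G K J c" and x: "x \<in> carrier G" for c x
      proof -
        let ?s = "\<sigma> (PQ (lab c (pat c (z c x))) \<one>\<^bsub>Q\<^esub>)"
        have s: "?s \<in> carrier G" by (rule \<sigma>D[OF q0[OF c x]])
        have szx: "?s \<otimes> z c x = ?s \<otimes> \<rho> c x \<otimes> x" using s x \<rho>c[OF c x] by (simp add: z_def m_assoc)
        have yc: "?s \<otimes> \<rho> c x \<in> carrier G" using s \<rho>c[OF c x] by simp
        have cc: "cen c (?s \<otimes> \<rho> c x \<otimes> x) \<in> carrier G" using yc x by (intro cen(1)[OF c]) simp
        show "P c x \<in> carrier G" unfolding P_def szx by (rule cc)
        show "P c x \<otimes> inv x = (let y = ?s \<otimes> \<rho> c x in cen c (y \<otimes> x) \<otimes> inv (y \<otimes> x) \<otimes> y)"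
          unfolding P_def szx Let_def using yc x cc
          by (simp add: inv_mult_group[of "?s \<otimes> \<rho> c x" x] m_assoc del: inv_mult_group)
      qed
      have P_D: "P c x \<otimes> inv x \<in> DP" if c: "coloring G K J c" and x: "x \<in> carrier G" for c x
      proof -
        let ?q = "PQ (lab c (pat c (z c x))) \<one>\<^bsub>Q\<^esub>"
        have "\<sigma> ?q \<otimes> \<rho> c x \<otimes> x \<in> carrier G" using \<sigma>D[OF q0[OF c x]] \<rho>c[OF c x] x by simp
        then show ?thesis unfolding P_disp(2)[OF c x] Let_def
          using cen(2)[OF c] q0[OF c x] \<rho>[OF c x] by (force simp: DP_def)
      qed
      have P_loc: "local_map G K J (\<lambda>c x. P c x \<otimes> inv x)"
      proof -
        have qcen_loc: "local_map G K J (\<lambda>c x. qc c (cen c x))"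
        proof (rule local_determined[where I = "insert None (Some ` D)"
              and F = "\<lambda>i c x. case i of None \<Rightarrow> (cen c x \<otimes> inv x, 0) | Some e \<Rightarrow> (\<one>, qc c (e \<otimes> x))"])
          show "finite (insert None (Some ` D))" using D by simp
          fix i assume i: "i \<in> insert None (Some ` D)"
          show "local_map G K J (\<lambda>c x. case i of None \<Rightarrow> (cen c x \<otimes> inv x, 0) | Some e \<Rightarrow> (\<one>, qc c (e \<otimes> x)))"
          proof (cases i)
            case None then show ?thesis using local_comp[OF cen_loc, of "\<lambda>y. (y, 0)"] by simp
          next
            case (Some e)
            then have "e \<in> carrier G" using i D by auto
            then show ?thesis using local_comp[OF local_translate[OF qc_loc], of e "\<lambda>y. (\<one>, y)"] Some by simp
          qed
        next
          fix c c' x x'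
          assume c: "coloring G K J c" "coloring G K J c'" and x: "x \<in> carrier G" "x' \<in> carrier G"
            and eq: "\<And>i. i \<in> insert None (Some ` D) \<Longrightarrow>
              (case i of None \<Rightarrow> (cen c x \<otimes> inv x, 0) | Some e \<Rightarrow> (\<one>, qc c (e \<otimes> x))) =
              (case i of None \<Rightarrow> (cen c' x' \<otimes> inv x', 0) | Some e \<Rightarrow> (\<one>, qc c' (e \<otimes> x')))"
          define e where "e = cen c x \<otimes> inv x"
          have e': "e = cen c' x' \<otimes> inv x'" using eq[of None] by (simp add: e_def)
          have eD: "e \<in> D" unfolding e_def by (rule cen(2)[OF c(1) x(1)])
          have "cen c x = e \<otimes> x" unfolding e_def using cen(1)[OF c(1) x(1)] x by (simp add: m_assoc)
          moreover have "cen c' x' = e \<otimes> x'" unfolding e' using cen(1)[OF c(2) x(2)] x by (simp add: m_assoc)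
          moreover have "qc c (e \<otimes> x) = qc c' (e \<otimes> x')" using eq[of "Some e"] eD by simp
          ultimately show "qc c (cen c x) = qc c' (cen c' x')" by simp
        qed
        define E where "E = (\<lambda>(q, v). \<sigma> q \<otimes> v) ` ((U \<union> DQ) \<times> V1)"
        have \<sigma>UD: "\<sigma> q \<in> carrier G" if "q \<in> U \<union> DQ" for q using that U DQ \<sigma> by auto
        have E: "finite E" "E \<subseteq> carrier G" using U DQ V1 \<sigma>UD H_carrier by (auto simp: E_def subset_iff)
        show ?thesis
        proof (rule local_determined[where I = "insert None (Some ` E)"
              and F = "\<lambda>i c x. case i of None \<Rightarrow> (\<rho> c x, 0)
                 | Some g \<Rightarrow> (cen c (g \<otimes> x) \<otimes> inv (g \<otimes> x), qc c (cen c (g \<otimes> x)))"])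
          show "finite (insert None (Some ` E))" using E by simp
          fix i assume i: "i \<in> insert None (Some ` E)"
          show "local_map G K J (\<lambda>c x. case i of None \<Rightarrow> (\<rho> c x, 0)
                 | Some g \<Rightarrow> (cen c (g \<otimes> x) \<otimes> inv (g \<otimes> x), qc c (cen c (g \<otimes> x))))"
          proof (cases i)
            case None then show ?thesis using local_comp[OF \<rho>_loc, of "\<lambda>y. (y, 0)"] by simp
          next
            case (Some g)
            then have "g \<in> carrier G" using i E by auto
            then show ?thesis using local_translate[OF local_pair[OF cen_loc qcen_loc]] Some by simp
          qed
        next
          fix c c' x x'
          assume c: "coloring G K J c" "coloring G K J c'" and x: "x \<in> carrier G" "x' \<in> carrier G"
            and eq: "\<And>i. i \<in> insert None (Some ` E) \<Longrightarrow>
              (case i of None \<Rightarrow> (\<rho> c x, 0)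
                 | Some g \<Rightarrow> (cen c (g \<otimes> x) \<otimes> inv (g \<otimes> x), qc c (cen c (g \<otimes> x)))) =
              (case i of None \<Rightarrow> (\<rho> c' x', 0)
                 | Some g \<Rightarrow> (cen c' (g \<otimes> x') \<otimes> inv (g \<otimes> x'), qc c' (cen c' (g \<otimes> x'))))"
          define v where "v = \<rho> c x"
          have v': "\<rho> c' x' = v" using eq[of None] by (simp add: v_def)
          have vV: "v \<in> V1" unfolding v_def by (rule \<rho>[OF c(1) x(1)])
          have vc: "v \<in> carrier G" using vV V1 H_carrier by auto
          have eqE: "cen c (\<sigma> q \<otimes> v \<otimes> x) \<otimes> inv (\<sigma> q \<otimes> v \<otimes> x) = cen c' (\<sigma> q \<otimes> v \<otimes> x') \<otimes> inv (\<sigma> q \<otimes> v \<otimes> x')"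
            "qc c (cen c (\<sigma> q \<otimes> v \<otimes> x)) = qc c' (cen c' (\<sigma> q \<otimes> v \<otimes> x'))" if "q \<in> U \<union> DQ" for q
          proof -
            have "\<sigma> q \<otimes> v \<in> E" using that vV by (force simp: E_def)
            then show "cen c (\<sigma> q \<otimes> v \<otimes> x) \<otimes> inv (\<sigma> q \<otimes> v \<otimes> x) = cen c' (\<sigma> q \<otimes> v \<otimes> x') \<otimes> inv (\<sigma> q \<otimes> v \<otimes> x')"
              "qc c (cen c (\<sigma> q \<otimes> v \<otimes> x)) = qc c' (cen c' (\<sigma> q \<otimes> v \<otimes> x'))"
              using eq[of "Some (\<sigma> q \<otimes> v)"] by simp_all
          qed
          have "lab c (pat c (z c x)) = lab c' (pat c' (z c' x'))"
          proof
            fix q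
            show "lab c (pat c (z c x)) q = lab c' (pat c' (z c' x')) q"
            proof (cases "q \<in> U")
              case True
              have "\<sigma> q \<in> carrier G" using \<sigma>UD True by simp
              then have "\<sigma> q \<otimes> z c x = \<sigma> q \<otimes> v \<otimes> x" "\<sigma> q \<otimes> z c' x' = \<sigma> q \<otimes> v \<otimes> x'"
                using vc x by (simp_all add: z_def v' v_def[symmetric] m_assoc)
              then show ?thesis using True eqE(2)[of q] pat[OF U_W[OF True]] by (simp add: lab_def)
            qed (simp add: lab_def)
          qed
          then show "P c x \<otimes> inv x = P c' x' \<otimes> inv x'"
            unfolding P_disp(2)[OF c(1) x(1)] P_disp(2)[OF c(2) x(2)] Let_def v' v_def[symmetric]
            using eqE(1) q0[OF c(1) x(1)] by simp
        qed
      qed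
      have "coarse_rule G B0 (2 ^ d * CQ) K J P DP"
        unfolding coarse_rule_def using P_loc DP P_disp(1) P_D P_card by simp
      then show ?thesis by blast
    qed
    then show "\<exists>K. finite K \<and> K \<subseteq> carrier G \<and> (\<forall>J. \<exists>P D. coarse_rule G B0 (2 ^ d * CQ) K J P D)"
      using K by blast
  qed
qed

end

section \<open>Polynomial growth\<close>

lemma (in group) finite_rule_dimension_trivial:
  assumes "carrier G = {\<one>}"
  shows "finite_rule_dimension G"
  unfolding finite_rule_dimension_def
proof (intro exI[of _ 1] allI impI exI[of _ "{}"] conjI)
  fix B :: "'a set" and J
  assume "finite B"
  show "\<exists>P D. coarse_rule G B 1 {} J P D"
    unfolding coarse_rule_def
  proof (intro exI[of _ "\<lambda>c x. \<one>"] exI[of _ "{\<one>}"] conjI allI impI)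
    show "local_map G {} J (\<lambda>c x. \<one> \<otimes> inv x)"
      by (rule local_mapI[of "{}"]) (use assms in auto)
    show "card ((\<lambda>x. \<one>) ` (\<lambda>b. b \<otimes> x) ` B) \<le> 1" for x
      by (rule order_trans[OF card_mono[of "{\<one>}"]]) auto
  qed (use assms in auto)
qed auto

context group
begin

lemma set_power_carrier: "S \<subseteq> carrier G \<Longrightarrow> set_power G S r \<subseteq> carrier G"
  by (induction r) (auto simp: set_mult_def)

lemma finite_set_power: "finite S \<Longrightarrow> finite (set_power G S r)"
proof (induction r)
  case (Suc r)
  have "set_power G S (Suc r) = (\<lambda>(a, b). a \<otimes> b) ` (set_power G S r \<times> S)"
    by (auto simp: set_mult_def)
  then show ?case using Suc by simp
qed simp

lemma set_power_mult:
  assumes S: "S \<subseteq> carrier G" and x: "x \<in> set_power G S a" and y: "y \<in> set_power G S b"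
  shows "x \<otimes> y \<in> set_power G S (a + b)"
  using y
proof (induction b arbitrary: y)
  case 0
  then show ?case using x set_power_carrier[OF S, of a] by auto
next
  case (Suc b)
  then obtain y' s where y': "y' \<in> set_power G S b" "s \<in> S" "y = y' \<otimes> s" by (auto simp: set_mult_def)
  have "x \<otimes> y = x \<otimes> y' \<otimes> s"
    using y' x set_power_carrier[OF S, of a] set_power_carrier[OF S, of b] S by (auto simp: m_assoc subset_iff)
  then show ?case using Suc.IH[OF y'(1)] y'(2) by (auto simp: set_mult_def)
qed

lemma set_power_one: "S \<subseteq> carrier G \<Longrightarrow> s \<in> S \<Longrightarrow> s \<in> set_power G S 1"
  by (auto simp: set_mult_def intro!: bexI[of _ s])

lemma set_power_inv:
  assumes S: "S \<subseteq> carrier G" "\<And>s. s \<in> S \<Longrightarrow> inv s \<in> S" and x: "x \<in> set_power G S r"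
  shows "inv x \<in> set_power G S r"
  using x
proof (induction r arbitrary: x)
  case (Suc r)
  then obtain y s where y: "y \<in> set_power G S r" "s \<in> S" "x = y \<otimes> s" by (auto simp: set_mult_def)
  have "inv x = inv s \<otimes> inv y" using y set_power_carrier[OF S(1), of r] S by (auto simp: inv_mult_group subset_iff)
  moreover have "inv s \<otimes> inv y \<in> set_power G S (1 + r)"
    by (rule set_power_mult[OF S(1) set_power_one[OF S(1) S(2)[OF y(2)]] Suc.IH[OF y(1)]])
  ultimately show ?case by simp
qed simp

lemma set_power_mono:
  assumes S: "S \<subseteq> carrier G" "\<one> \<in> S" and "a \<le> b"
  shows "set_power G S a \<subseteq> set_power G S b"
  using assms(3)
proof (induction rule: dec_induct)
  case (step n)
  have "x \<in> set_power G S (Suc n)" if "x \<in> set_power G S n" for x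
  proof -
    have "x \<otimes> \<one> = x" using that set_power_carrier[OF S(1), of n] by auto
    then show ?thesis using that S(2) by (force simp: set_mult_def)
  qed
  then show ?case using step by blast
qed simp

text \<open>
  Otherwise the cardinality would grow by a factor of at least \<open>4 ^ d + 1\<close> whenever the radius is
  multiplied by \<open>4\<close>, which is faster than \<open>r ^ d\<close>.
\<close>

lemma doubling_scale:
  assumes poly: "\<And>r. r \<ge> 1 \<Longrightarrow> real (card (set_power G S r)) \<le> c * real r ^ d"
    and S: "finite S" "S \<subseteq> carrier G" "\<one> \<in> S"
  shows "\<exists>i. card (set_power G S (4 ^ Suc i)) \<le> (4 ^ d + 1) * card (set_power G S (4 ^ i))"
proof (rule ccontr)
  assume "\<not> ?thesis"
  then have step: "(4 ^ d + 1) * card (set_power G S (4 ^ i)) < card (set_power G S (4 ^ Suc i))" for i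
    by (simp add: not_le)
  have lower: "(4 ^ d + 1) ^ i \<le> card (set_power G S (4 ^ i))" for i
  proof (induction i)
    case 0
    have "\<one> \<in> set_power G S (4 ^ 0)" using set_power_mono[OF S(2,3), of 0 "4 ^ 0"] by auto
    then have "0 < card (set_power G S (4 ^ 0))" using finite_set_power[OF S(1)] card_gt_0_iff by blast
    then show ?case by simp
  next
    case (Suc i)
    have "(4 ^ d + 1) ^ Suc i \<le> (4 ^ d + 1) * card (set_power G S (4 ^ i))"
      using mult_left_mono[OF Suc, of "4 ^ d + 1"] by simp
    then show ?case using step[of i] by linarith
  qed
  have "((4 ^ d + 1) / 4 ^ d) ^ i \<le> c" for i
  proof -
    have "real ((4 ^ d + 1) ^ i) \<le> real (card (set_power G S (4 ^ i)))" using lower[of i] by linarith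
    also have "\<dots> \<le> c * real (4 ^ i) ^ d" by (rule poly) simp
    also have "real (4 ^ i) ^ d = (4 ^ d) ^ i" by (simp add: power_mult[symmetric] mult.commute)
    finally have "(4 ^ d + 1) ^ i \<le> c * (4 ^ d) ^ i" by (simp add: add.commute)
    then show ?thesis by (simp add: power_divide pos_divide_le_eq)
  qed
  moreover obtain i where "c < ((4 ^ d + 1) / 4 ^ d :: real) ^ i"
    using real_arch_pow[of "(4 ^ d + 1) / 4 ^ d" c] by (auto simp: field_simps)
  ultimately show False using not_le by blast
qed

text \<open>
  Let \<open>W\<close> be a ball in the subgroup generated by \<open>B\<close>, of a radius \<open>r\<close> for which the ball of radius
  \<open>4 * r\<close> is at most \<open>4 ^ d + 1\<close> times as large. Choose a maximal set of markers separated by \<open>A =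
  W W\<close> and send each point to a marker in \<open>A x\<close>. The markers that occur on \<open>B x\<close> lie in \<open>W W W x\<close>,
  and their translates under \<open>W\<close> are disjoint subsets of the ball of radius \<open>4 * r\<close> at \<open>x\<close>;
  comparing cardinalities bounds their number. Only the degree \<open>d\<close> enters, and it is the same for
  all finitely generated subgroups.
\<close>

theorem finite_rule_dimension_growth:
  assumes "uniform_local_polynomial_growth G"
  shows "finite_rule_dimension G"
proof -
  obtain d where d: "\<And>K. subgroup K G \<Longrightarrow> finitely_generated (G\<lparr>carrier := K\<rparr>) \<Longrightarrow>
        \<exists>e\<le>d. polynomial_growth_degree (G\<lparr>carrier := K\<rparr>) e"
    using assms unfolding uniform_local_polynomial_growth_def by blast
  show ?thesis
    unfolding finite_rule_dimension_def
  proof (intro exI[of _ "4 ^ d + 1"] allI impI)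
    fix B assume B: "finite B" "B \<subseteq> carrier G"
    define S where "S = insert \<one> (B \<union> m_inv G ` B)"
    have S: "finite S" "S \<subseteq> carrier G" "\<one> \<in> S" using B by (auto simp: S_def)
    have S_inv: "inv s \<in> S" if "s \<in> S" for s using that B by (auto simp: S_def)
    define H where "H = generate G S"
    have H: "subgroup H G" unfolding H_def by (rule generate_is_subgroup[OF S(2)])
    have SH: "S \<subseteq> H" unfolding H_def by (auto intro: generate.incl)
    have gen: "generate (G\<lparr>carrier := H\<rparr>) S = H"
      unfolding H_def using generate_consistent[OF SH[unfolded H_def] H[unfolded H_def]] by simp
    have "finitely_generated (G\<lparr>carrier := H\<rparr>)"
      unfolding finitely_generated_def using S SH gen by (intro exI[of _ S]) simp
    then obtain e where e: "e \<le> d" "growth_bound (G\<lparr>carrier := H\<rparr>) e"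
      using d[OF H] unfolding polynomial_growth_degree_def by blast
    have sp: "set_power (G\<lparr>carrier := H\<rparr>) S r = set_power G S r" for r
      by (induction r) (simp_all add: set_mult_def)
    have "\<exists>c::real. c > 0 \<and> (\<forall>r\<ge>1. real (card (set_power G S r)) \<le> c * real r ^ e)"
      using e(2)[unfolded growth_bound_def, rule_format, of S] S SH S_inv gen
      by (simp add: sp m_inv_consistent[OF H] subset_iff)
    then obtain c :: real where c: "c > 0" "\<And>r. r \<ge> 1 \<Longrightarrow> real (card (set_power G S r)) \<le> c * real r ^ e" by blast
    have "real (card (set_power G S r)) \<le> c * real r ^ d" if "r \<ge> 1" for r
    proof -
      have "c * real r ^ e \<le> c * real r ^ d"
        using that e(1) c(1) by (intro mult_left_mono power_increasing) auto
      then show ?thesis using c(2)[OF that] by linarith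
    qed
    from doubling_scale[OF this S] obtain i where
      i: "card (set_power G S (4 ^ Suc i)) \<le> (4 ^ d + 1) * card (set_power G S (4 ^ i))" by blast
    define r where "r = (4 :: nat) ^ i"
    have r: "r \<ge> 1" by (simp add: r_def)
    define A where "A = set_power G S (r + r)"
    have A: "finite A" "A \<subseteq> carrier G" "\<And>a. a \<in> A \<Longrightarrow> inv a \<in> A"
      unfolding A_def using finite_set_power[OF S(1)] set_power_carrier[OF S(2)] set_power_inv[OF S(2) S_inv] by auto
    have oneA: "\<one> \<in> A" using set_power_mono[OF S(2,3), of 0 "r + r"] by (auto simp: A_def)
    have "\<exists>P D. coarse_rule G B (4 ^ d + 1) A J P D" for J
    proof -
      obtain Y :: "('a \<Rightarrow> nat) \<Rightarrow> 'a \<Rightarrow> bool" where Y_loc: "local_map G A J Y"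
        and Y_sep: "\<And>c y a. coloring G A J c \<Longrightarrow> y \<in> carrier G \<Longrightarrow> a \<in> A \<Longrightarrow> Y c y \<Longrightarrow> Y c (a \<otimes> y) \<Longrightarrow> a = \<one>"
        and Y_cov: "\<And>c x. coloring G A J c \<Longrightarrow> x \<in> carrier G \<Longrightarrow> \<exists>a\<in>insert \<one> A. Y c (a \<otimes> x)"
        by (rule local_maximal_separated[OF A subset_refl, of J]) (assumption | rule that)+
      define s where "s c x = (SOME a. a \<in> A \<and> Y c (a \<otimes> x))" for c x
      have s: "s c x \<in> A" "Y c (s c x \<otimes> x)" if "coloring G A J c" "x \<in> carrier G" for c x
      proof -
        have "\<exists>a. a \<in> A \<and> Y c (a \<otimes> x)" using Y_cov[OF that] oneA by auto
        from someI_ex[OF this] show "s c x \<in> A" "Y c (s c x \<otimes> x)" by (simp_all add: s_def)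
      qed
      have sc: "s c x \<in> carrier G" if "coloring G A J c" "x \<in> carrier G" for c x using s(1)[OF that] A by auto
      have disp: "s c x \<otimes> x \<otimes> inv x = s c x" if "coloring G A J c" "x \<in> carrier G" for c x
        using sc[OF that] that by (simp add: m_assoc)
      have loc: "local_map G A J (\<lambda>c x. s c x \<otimes> x \<otimes> inv x)"
      proof (rule local_determined[where I = A and F = "\<lambda>a c x. Y c (a \<otimes> x)"])
        show "local_map G A J (\<lambda>c x. Y c (a \<otimes> x))" if "a \<in> A" for a using that A Y_loc by (intro local_translate) auto
        fix c c' x x'
        assume c: "coloring G A J c" "coloring G A J c'" and x: "x \<in> carrier G" "x' \<in> carrier G"
          and eq: "\<And>a. a \<in> A \<Longrightarrow> Y c (a \<otimes> x) = Y c' (a \<otimes> x')"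
        have "s c x = s c' x'" unfolding s_def using eq by (metis (no_types, lifting))
        then show "s c x \<otimes> x \<otimes> inv x = s c' x' \<otimes> x' \<otimes> inv x'"
          unfolding disp[OF c(1) x(1)] disp[OF c(2) x(2)] .
      qed (rule A(1))
      have card: "card ((\<lambda>x. s c x \<otimes> x) ` (\<lambda>b. b \<otimes> x) ` B) \<le> 4 ^ d + 1"
        if c: "coloring G A J c" and x: "x \<in> carrier G" for c x
      proof -
        define Z where "Z = (\<lambda>x. s c x \<otimes> x) ` (\<lambda>b. b \<otimes> x) ` B"
        let ?W = "set_power G S r"
        have W: "finite ?W" "?W \<subseteq> carrier G" "\<one> \<in> ?W"
          using finite_set_power[OF S(1)] set_power_carrier[OF S(2)] set_power_mono[OF S(2,3), of 0 r] by auto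
        have finZ: "finite Z" using B by (simp add: Z_def)
        have Z: "z \<in> carrier G" "Y c z" "z \<otimes> inv x \<in> set_power G S (r + r + r)" if zZ: "z \<in> Z" for z
        proof -
          obtain b where b: "b \<in> B" "z = s c (b \<otimes> x) \<otimes> (b \<otimes> x)" using zZ by (auto simp: Z_def)
          have bc: "b \<in> carrier G" "b \<otimes> x \<in> carrier G" using b B x by auto
          show "z \<in> carrier G" "Y c z" using b s(2)[OF c bc(2)] sc[OF c bc(2)] bc by auto
          have "b \<in> set_power G S r"
            using set_power_one[OF S(2), of b] b set_power_mono[OF S(2,3) r] by (auto simp: S_def)
          then have "s c (b \<otimes> x) \<otimes> b \<in> set_power G S (r + r + r)"
            using s(1)[OF c bc(2)] unfolding A_def by (intro set_power_mult[OF S(2)])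
          moreover have "z \<otimes> inv x = s c (b \<otimes> x) \<otimes> b"
            using b bc x sc[OF c bc(2)] by (simp add: m_assoc)
          ultimately show "z \<otimes> inv x \<in> set_power G S (r + r + r)" by simp
        qed
        have disj: "(\<lambda>w. w \<otimes> z) ` ?W \<inter> (\<lambda>w. w \<otimes> z') ` ?W = {}" if z: "z \<in> Z" "z' \<in> Z" "z \<noteq> z'" for z z'
        proof (rule ccontr)
          assume "\<not> ?thesis"
          then obtain w w' where w: "w \<in> ?W" "w' \<in> ?W" "w \<otimes> z = w' \<otimes> z'" by auto
          have wc: "w \<in> carrier G" "w' \<in> carrier G" using w W by auto
          have zc: "z \<in> carrier G" "z' \<in> carrier G" using Z z by auto
          have a: "inv w' \<otimes> w \<in> A"
            unfolding A_def by (rule set_power_mult[OF S(2) set_power_inv[OF S(2) S_inv w(2)] w(1)])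
          have "inv w' \<otimes> w \<otimes> z = inv w' \<otimes> (w' \<otimes> z')" using wc zc w(3) by (simp add: m_assoc)
          then have eq: "inv w' \<otimes> w \<otimes> z = z'" using wc zc by (simp add: inv_cancel)
          then have "inv w' \<otimes> w = \<one>" using Y_sep[OF c zc(1) a Z(2)[OF z(1)]] Z(2)[OF z(2)] by simp
          then show False using eq zc z(3) by simp
        qed
        have "card Z * card ?W = (\<Sum>z\<in>Z. card ((\<lambda>w. w \<otimes> z) ` ?W))"
        proof -
          have "card ((\<lambda>w. w \<otimes> z) ` ?W) = card ?W" if "z \<in> Z" for z
            using W Z(1)[OF that] by (intro card_image inj_onI) (auto simp: subset_iff)
          then show ?thesis by simp
        qed
        also have "\<dots> = card (\<Union>z\<in>Z. (\<lambda>w. w \<otimes> z) ` ?W)"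
          using finZ W disj by (intro card_UN_disjoint[symmetric]) auto
        also have "\<dots> \<le> card ((\<lambda>g. g \<otimes> x) ` set_power G S (4 ^ Suc i))"
        proof (rule card_mono)
          show "finite ((\<lambda>g. g \<otimes> x) ` set_power G S (4 ^ Suc i))" using finite_set_power[OF S(1)] by simp
          show "(\<Union>z\<in>Z. (\<lambda>w. w \<otimes> z) ` ?W) \<subseteq> (\<lambda>g. g \<otimes> x) ` set_power G S (4 ^ Suc i)"
          proof
            fix y assume "y \<in> (\<Union>z\<in>Z. (\<lambda>w. w \<otimes> z) ` ?W)"
            then obtain z w where zw: "z \<in> Z" "w \<in> ?W" "y = w \<otimes> z" by auto
            have "w \<otimes> (z \<otimes> inv x) \<in> set_power G S (r + (r + r + r))"
              by (rule set_power_mult[OF S(2) zw(2) Z(3)[OF zw(1)]])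
            moreover have "r + (r + r + r) = 4 ^ Suc i" by (simp add: r_def)
            moreover have "y = w \<otimes> (z \<otimes> inv x) \<otimes> x" using zw Z(1)[OF zw(1)] W x by (auto simp: m_assoc)
            ultimately show "y \<in> (\<lambda>g. g \<otimes> x) ` set_power G S (4 ^ Suc i)" by force
          qed
        qed
        also have "\<dots> \<le> card (set_power G S (4 ^ Suc i))" using finite_set_power[OF S(1)] by (rule card_image_le)
        also have "\<dots> \<le> (4 ^ d + 1) * card ?W" using i by (simp add: r_def)
        finally have "card Z * card ?W \<le> (4 ^ d + 1) * card ?W" .
        moreover have "0 < card ?W" using W card_gt_0_iff by blast
        ultimately have "card Z \<le> 4 ^ d + 1" by (rule mult_right_le_imp_le)
        then show ?thesis unfolding Z_def .
      qed
      have "coarse_rule G B (4 ^ d + 1) A J (\<lambda>c x. s c x \<otimes> x) A"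
        unfolding coarse_rule_def using loc A(1,2) s(1) sc disp card by auto
      then show ?thesis by blast
    qed
    then show "\<exists>K. finite K \<and> K \<subseteq> carrier G \<and> (\<forall>J. \<exists>P D. coarse_rule G B (4 ^ d + 1) K J P D)"
      using A by blast
  qed
qed

end

section \<open>Rational rank and coordinates\<close>

definition integrally_independent :: "('a, 'm) monoid_scheme \<Rightarrow> 'a set \<Rightarrow> bool" where
  "integrally_independent A S \<longleftrightarrow>
     (\<forall>n :: 'a \<Rightarrow> int. finprod A (\<lambda>a. a [^]\<^bsub>A\<^esub> n a) S = \<one>\<^bsub>A\<^esub> \<longrightarrow> (\<forall>a\<in>S. n a = 0))"

lemma rat_multiple_int:
  fixes R :: "rat set"
  assumes "finite R"
  shows "\<exists>D::int. D > 0 \<and> (\<forall>r\<in>R. of_int D * r \<in> \<int>)"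
  using assms
proof induction
  case empty show ?case by (intro exI[of _ 1]) simp
next
  case (insert r R)
  then obtain D :: int where D: "D > 0" "\<And>s. s \<in> R \<Longrightarrow> of_int D * s \<in> \<int>" by blast
  obtain p q where pq: "r = of_int p / of_int q" "q > 0"
    by (metis quotient_of_denom_pos quotient_of_div surj_pair)
  have "of_int (D * q) * s \<in> \<int>" if "s \<in> insert r R" for s
  proof (cases "s = r")
    case True
    have "of_int q * s = of_int p" unfolding True pq(1) using pq(2) by simp
    then have "of_int (D * q) * s = of_int (D * p)" by (simp add: mult.assoc)
    then show ?thesis by (metis Ints_of_int)
  next
    case False
    then have "of_int q * (of_int D * s) \<in> \<int>" using D(2) that by auto
    then show ?thesis by (simp add: mult.assoc mult.left_commute)
  qed
  then show ?case using D(1) pq(2) by (intro exI[of _ "D * q"]) simp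
qed

context
  fixes A :: "('a, 'm) monoid_scheme"
  assumes A: "comm_group A"
begin

interpretation A: comm_group A by (rule A)

interpretation F: comm_group "rat_tensor_free A" by (rule abelian_free_Abelian_group)

text \<open>
  The pairs \<open>(p, a)\<close> generate a free abelian group, so sending \<open>(p, a)\<close> to \<open>a\<close> raised to \<open>\<lfloor>m * p\<rfloor>\<close>
  defines a homomorphism. It respects a given bilinearity relation if \<open>m\<close> clears the denominators
  in it, and this replaces a map from the rational tensor product to \<open>A\<close>, which does not exist in
  general.
\<close>

lemma denominator_clearing_homs:
  obtains hv where "\<And>m. hv m \<in> hom (rat_tensor_free A) A"
    and "\<And>m p a. a \<in> carrier A \<Longrightarrow> hv m (frag_of (p, a)) = a [^]\<^bsub>A\<^esub> \<lfloor>of_int m * p\<rfloor>"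
proof -
  have "\<exists>h. h \<in> hom (rat_tensor_free A) A \<and>
      (\<forall>x\<in>UNIV \<times> carrier A. h (frag_of x) = (case x of (p, a) \<Rightarrow> a [^]\<^bsub>A\<^esub> \<lfloor>of_int m * p\<rfloor>))" for m :: int
  proof -
    have "(\<lambda>(p :: rat, a). a [^]\<^bsub>A\<^esub> \<lfloor>of_int m * p\<rfloor>) ` (UNIV \<times> carrier A) \<subseteq> carrier A" by auto
    then show ?thesis by (rule A.free_Abelian_group_universal) blast
  qed
  then obtain hv where "\<And>m. hv m \<in> hom (rat_tensor_free A) A \<and>
      (\<forall>x\<in>UNIV \<times> carrier A. hv m (frag_of x) = (case x of (p, a) \<Rightarrow> a [^]\<^bsub>A\<^esub> \<lfloor>of_int m * p\<rfloor>))" by metis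
  then show ?thesis by (intro that[of hv]) auto
qed

text \<open>
  An element of the relation subgroup involves finitely many defining relations; take a common
  multiple of their denominators.
\<close>

lemma rat_tensor_rels_cleared:
  assumes hom: "\<And>m. hv m \<in> hom (rat_tensor_free A) A"
    and hv: "\<And>m p a. a \<in> carrier A \<Longrightarrow> hv m (frag_of (p, a)) = a [^]\<^bsub>A\<^esub> \<lfloor>of_int m * p\<rfloor>"
    and x: "x \<in> rat_tensor_rels A"
  shows "\<exists>D>0. \<forall>k>0. hv (k * D) x = \<one>\<^bsub>A\<^esub>"
proof -
  have add: "hv m (u + v) = hv m u \<otimes>\<^bsub>A\<^esub> hv m v"
    if "u \<in> carrier (rat_tensor_free A)" "v \<in> carrier (rat_tensor_free A)" for m u v
    using hom[of m] that unfolding hom_def by simp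
  have gh: "group_hom (rat_tensor_free A) A (hv m)" for m
    using hom[of m] by (simp add: group_hom_def group_hom_axioms_def)
  have cl: "hv m u \<in> carrier A" if "u \<in> carrier (rat_tensor_free A)" for m u
    by (rule group_hom.hom_closed[OF gh that])
  have minus: "hv m (- u) = inv\<^bsub>A\<^esub> hv m u" if "u \<in> carrier (rat_tensor_free A)" for m u
    using group_hom.hom_inv[OF gh that] that by simp
  have diff: "hv m (u - v) = hv m u \<otimes>\<^bsub>A\<^esub> inv\<^bsub>A\<^esub> hv m v"
    if "u \<in> carrier (rat_tensor_free A)" "v \<in> carrier (rat_tensor_free A)" for m u v
    using add[of u "- v" m] minus[OF that(2)] that by simp
  have frag: "frag_of (p, a) \<in> carrier (rat_tensor_free A)" if "a \<in> carrier A" for p :: rat and a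
    using that by simp
  have frag2: "frag_of (p, a) - frag_of (q, b) \<in> carrier (rat_tensor_free A)" if "a \<in> carrier A" "b \<in> carrier A" for p q :: rat and a b
    using F.m_closed[OF frag[OF that(1), of p] F.inv_closed[OF frag[OF that(2), of q]]] that by simp
  note gens = rat_tensor_rels_gens[OF A]
  have gen: "\<exists>D>0. \<forall>k>0. hv (k * D) g = \<one>\<^bsub>A\<^esub>" if "g \<in>
     {frag_of (p + q, a) - frag_of (p, a) - frag_of (q, a) | p q a. a \<in> carrier A} \<union>
     {frag_of (q, a \<otimes>\<^bsub>A\<^esub> b) - frag_of (q, a) - frag_of (q, b) | q a b. a \<in> carrier A \<and> b \<in> carrier A}" for g
  proof -
    from that consider
        p q a where "g = frag_of (p + q, a) - frag_of (p, a) - frag_of (q, a)" "a \<in> carrier A"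
      | q a b where "g = frag_of (q, a \<otimes>\<^bsub>A\<^esub> b) - frag_of (q, a) - frag_of (q, b)"
          "a \<in> carrier A" "b \<in> carrier A" by blast
    then show ?thesis
    proof cases
      case (1 p q a)
      obtain D :: int where D: "D > 0" "of_int D * p \<in> \<int>" "of_int D * q \<in> \<int>"
        using rat_multiple_int[of "{p, q}"] by auto
      have "hv (k * D) g = \<one>\<^bsub>A\<^esub>" for k
      proof -
        have "of_int k * (of_int D * p) \<in> \<int>" "of_int k * (of_int D * q) \<in> \<int>" using D by auto
        then obtain i j :: int where ij: "of_int (k * D) * p = of_int i" "of_int (k * D) * q = of_int j"
          by (auto elim!: Ints_cases simp: mult.assoc)
        have s: "of_int (k * D) * (p + q) = of_int (i + j)" by (simp only: distrib_left ij of_int_add)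
        have "hv (k * D) g = a [^]\<^bsub>A\<^esub> (i + j) \<otimes>\<^bsub>A\<^esub> inv\<^bsub>A\<^esub> (a [^]\<^bsub>A\<^esub> i) \<otimes>\<^bsub>A\<^esub> inv\<^bsub>A\<^esub> (a [^]\<^bsub>A\<^esub> j)"
          unfolding 1(1) diff[OF frag2[OF 1(2) 1(2)] frag[OF 1(2)]] diff[OF frag[OF 1(2)] frag[OF 1(2)]] hv[OF 1(2)] s ij
          by (simp only: floor_of_int)
        then show ?thesis using 1(2) by (simp add: A.int_pow_mult A.m_assoc A.m_comm[of "a [^]\<^bsub>A\<^esub> i" "a [^]\<^bsub>A\<^esub> j"] A.inv_cancel)
      qed
      then show ?thesis using D(1) by blast
    next
      case (2 q a b)
      have "hv (k * 1) g = \<one>\<^bsub>A\<^esub>" for k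
      proof -
        define i where "i = \<lfloor>of_int (k * 1) * q\<rfloor>"
        have "hv (k * 1) g = (a \<otimes>\<^bsub>A\<^esub> b) [^]\<^bsub>A\<^esub> i \<otimes>\<^bsub>A\<^esub> inv\<^bsub>A\<^esub> (a [^]\<^bsub>A\<^esub> i) \<otimes>\<^bsub>A\<^esub> inv\<^bsub>A\<^esub> (b [^]\<^bsub>A\<^esub> i)"
          unfolding 2(1) diff[OF frag2[OF A.m_closed[OF 2(2,3)] 2(2)] frag[OF 2(3)]]
            diff[OF frag[OF A.m_closed[OF 2(2,3)]] frag[OF 2(2)]] hv[OF A.m_closed[OF 2(2,3)]] hv[OF 2(2)] hv[OF 2(3)] i_def ..
        then show ?thesis using 2(2,3)
          by (simp add: A.int_pow_distrib A.m_assoc A.m_comm[of "a [^]\<^bsub>A\<^esub> i" "b [^]\<^bsub>A\<^esub> i"] A.inv_cancel)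
      qed
      then show ?thesis by (intro exI[of _ 1]) simp
    qed
  qed
  have "x \<in> generate (rat_tensor_free A)
     ({frag_of (p + q, a) - frag_of (p, a) - frag_of (q, a) | p q a. a \<in> carrier A} \<union>
      {frag_of (q, a \<otimes>\<^bsub>A\<^esub> b) - frag_of (q, a) - frag_of (q, b) | q a b. a \<in> carrier A \<and> b \<in> carrier A})"
    using x unfolding rat_tensor_rels_def .
  then show ?thesis
  proof (induction rule: generate.induct)
    case one
    show ?case using group_hom.hom_one[OF gh] by (intro exI[of _ 1]) simp
  next
    case (incl h)
    then show ?case by (rule gen)
  next
    case (inv h)
    have h: "h \<in> carrier (rat_tensor_free A)" by (rule subsetD[OF gens inv])
    from gen[OF inv] obtain D where D: "D > 0" "\<forall>k>0. hv (k * D) h = \<one>\<^bsub>A\<^esub>" by (elim exE conjE)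
    have "hv (k * D) (inv\<^bsub>rat_tensor_free A\<^esub> h) = \<one>\<^bsub>A\<^esub>" if "k > 0" for k
      using group_hom.hom_inv[OF gh h, of "k * D"] D(2) that by simp
    then show ?case using D(1) by blast
  next
    case (eng u v)
    have uv: "u \<in> carrier (rat_tensor_free A)" "v \<in> carrier (rat_tensor_free A)"
      by (rule F.generate_in_carrier[OF gens eng(1)], rule F.generate_in_carrier[OF gens eng(2)])
    from eng.IH(1) obtain D where D1: "D > 0" "\<forall>k>0. hv (k * D) u = \<one>\<^bsub>A\<^esub>" by (elim exE conjE)
    from eng.IH(2) obtain D' where D2: "D' > 0" "\<forall>k>0. hv (k * D') v = \<one>\<^bsub>A\<^esub>" by (elim exE conjE)
    have "hv (k * (D * D')) (u + v) = \<one>\<^bsub>A\<^esub>" if "k > 0" for k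
    proof -
      have e: "k * (D * D') = (k * D') * D" "k * (D * D') = (k * D) * D'" by (simp_all add: ac_simps)
      have p: "k * D' > 0" "k * D > 0" using that D1(1) D2(1) by simp_all
      have "hv (k * (D * D')) u = \<one>\<^bsub>A\<^esub>" unfolding e(1) using D1(2) p(1) by blast
      moreover have "hv (k * (D * D')) v = \<one>\<^bsub>A\<^esub>" unfolding e(2) using D2(2) p(2) by blast
      ultimately show ?thesis using add[OF uv, of "k * (D * D')"] by simp
    qed
    then show ?case using D1(1) D2(1) by (intro exI[of _ "D * D'"]) simp
  qed
qed

text \<open>
  A rational linear relation between the classes of \<open>(1, a)\<close>, \<open>a \<in> S\<close>, becomes a multiplicative
  relation between the elements of \<open>S\<close> under a homomorphism that clears denominators. So
  integrally independent elements give linearly independent vectors, whose number is bounded by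
  the dimension.
\<close>

lemma integrally_independent_bounded:
  assumes "finite_rat_rank A"
  obtains N where "\<And>S. finite S \<Longrightarrow> S \<subseteq> carrier A \<Longrightarrow> integrally_independent A S \<Longrightarrow> card S \<le> N"
proof -
  interpret V: vectorspace rat_ring "rat_tensor A" by (rule vectorspace_rat_tensor[OF A])
  obtain hv where hom: "\<And>m. hv m \<in> hom (rat_tensor_free A) A"
    and hv: "\<And>m p a. a \<in> carrier A \<Longrightarrow> hv m (frag_of (p, a)) = a [^]\<^bsub>A\<^esub> \<lfloor>of_int m * p\<rfloor>"
    by (rule denominator_clearing_homs) (rule that)
  note simps = rat_tensor_rels_simps[OF A]
  let ?R = "rat_tensor_rels A" and ?F = "rat_tensor_free A"
  define \<iota> where "\<iota> a = ?R #>\<^bsub>?F\<^esub> frag_of (1 :: rat, a)" for a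
  have coset_self: "x \<in> ?R #>\<^bsub>?F\<^esub> x" for x
    using simps(1) by (auto simp: rat_tensor_coset[OF A] intro!: exI[of _ 0])
  have coset_zero: "?R #>\<^bsub>?F\<^esub> (0 :: rat \<times> 'a \<Rightarrow>\<^sub>0 int) = ?R" by (auto simp: rat_tensor_coset[OF A])
  have zero: "\<zero>\<^bsub>rat_tensor A\<^esub> = ?R" by (simp add: rat_tensor_def FactGroup_def)
  have \<iota>_c: "\<iota> a \<in> carrier (rat_tensor A)" if "a \<in> carrier A" for a
    unfolding rat_tensor_carrier[OF A] \<iota>_def using that by (intro exI[of _ "frag_of (1, a)"]) simp
  have keys: "Poly_Mapping.keys (\<Sum>a\<in>S. frag_of (q a, a)) \<subseteq> UNIV \<times> carrier A" if "S \<subseteq> carrier A" for S and q :: "'a \<Rightarrow> rat"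
  proof -
    have "Poly_Mapping.keys (\<Sum>a\<in>S. frag_of (q a, a)) \<subseteq> (\<Union>a\<in>S. Poly_Mapping.keys (frag_of (q a, a)))"
      by (rule keys_sum)
    then show ?thesis using that by auto
  qed
  have comb: "finsum (rat_tensor A) (\<lambda>a. q a \<odot>\<^bsub>rat_tensor A\<^esub> \<iota> a) S = ?R #>\<^bsub>?F\<^esub> (\<Sum>a\<in>S. frag_of (q a, a))"
    if "finite S" "S \<subseteq> carrier A" for S and q :: "'a \<Rightarrow> rat"
    using that
  proof (induction S rule: finite_induct)
    case empty
    then show ?case by (simp add: zero coset_zero)
  next
    case (insert s S)
    have s: "q s \<odot>\<^bsub>rat_tensor A\<^esub> \<iota> s = ?R #>\<^bsub>?F\<^esub> frag_of (q s, s)"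
      unfolding \<iota>_def by (simp add: smult_rat_tensor_coset[OF A])
    have cl: "q a \<odot>\<^bsub>rat_tensor A\<^esub> \<iota> a \<in> carrier (rat_tensor A)" if "a \<in> carrier A" for a
      using \<iota>_c[OF that] by simp
    have "finsum (rat_tensor A) (\<lambda>a. q a \<odot>\<^bsub>rat_tensor A\<^esub> \<iota> a) (insert s S) =
        q s \<odot>\<^bsub>rat_tensor A\<^esub> \<iota> s \<oplus>\<^bsub>rat_tensor A\<^esub> finsum (rat_tensor A) (\<lambda>a. q a \<odot>\<^bsub>rat_tensor A\<^esub> \<iota> a) S"
      using insert cl by (intro V.finsum_insert) auto
    also have "\<dots> = ?R #>\<^bsub>?F\<^esub> (frag_of (q s, s) + (\<Sum>a\<in>S. frag_of (q a, a)))"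
      unfolding s using insert keys[of S q] by (simp add: rat_tensor_add[OF A])
    finally show ?case using insert(1,2) by simp
  qed
  have sum_carrier: "(\<Sum>a\<in>S. frag_of (q a, a)) \<in> carrier ?F" if "S \<subseteq> carrier A" for S and q :: "'a \<Rightarrow> rat"
    using keys[OF that, of q] by (simp only: carrier_free_Abelian_group_iff)
  have hv_sum: "hv m (\<Sum>a\<in>S. frag_of (q a, a)) = finprod A (\<lambda>a. a [^]\<^bsub>A\<^esub> \<lfloor>of_int m * q a\<rfloor>) S"
    if "finite S" "S \<subseteq> carrier A" for S and q :: "'a \<Rightarrow> rat" and m
    using that
  proof (induction S rule: finite_induct)
    case empty
    have "hv m \<one>\<^bsub>?F\<^esub> = \<one>\<^bsub>A\<^esub>" using hom[of m] by (intro group_hom.hom_one) (simp add: group_hom_def group_hom_axioms_def)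
    then show ?case by simp
  next
    case (insert s S)
    have "hv m (frag_of (q s, s) \<otimes>\<^bsub>?F\<^esub> (\<Sum>a\<in>S. frag_of (q a, a))) = hv m (frag_of (q s, s)) \<otimes>\<^bsub>A\<^esub> hv m (\<Sum>a\<in>S. frag_of (q a, a))"
      using insert sum_carrier[of S q] by (intro hom_mult[OF hom]) auto
    moreover have "finprod A (\<lambda>a. a [^]\<^bsub>A\<^esub> \<lfloor>of_int m * q a\<rfloor>) (insert s S) =
        s [^]\<^bsub>A\<^esub> \<lfloor>of_int m * q s\<rfloor> \<otimes>\<^bsub>A\<^esub> finprod A (\<lambda>a. a [^]\<^bsub>A\<^esub> \<lfloor>of_int m * q a\<rfloor>) S"
      using insert by (intro A.finprod_insert) auto
    ultimately show ?case using insert hv[of s m "q s"] by simp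
  qed
  have rel: "q a = 0" if S: "finite S" "S \<subseteq> carrier A" "integrally_independent A S"
      and sum: "(\<Sum>a\<in>S. frag_of (q a, a)) \<in> ?R" and a: "a \<in> S" for S and q :: "'a \<Rightarrow> rat" and a
  proof -
    obtain D where D: "D > 0" "\<And>k. k > 0 \<Longrightarrow> hv (k * D) (\<Sum>a\<in>S. frag_of (q a, a)) = \<one>\<^bsub>A\<^esub>"
      using rat_tensor_rels_cleared[OF hom hv sum] by blast
    obtain k :: int where k: "k > 0" "\<And>r. r \<in> q ` S \<Longrightarrow> of_int k * r \<in> \<int>"
      using rat_multiple_int[of "q ` S"] S(1) by blast
    have "finprod A (\<lambda>a. a [^]\<^bsub>A\<^esub> \<lfloor>of_int (k * D) * q a\<rfloor>) S = \<one>\<^bsub>A\<^esub>"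
      using D(2)[OF k(1)] hv_sum[OF S(1,2), of "k * D" q] by simp
    then have "\<lfloor>of_int (k * D) * q a\<rfloor> = 0"
      using S(3)[unfolded integrally_independent_def, THEN spec, of "\<lambda>a. \<lfloor>of_int (k * D) * q a\<rfloor>"] a by blast
    moreover have "of_int D * (of_int k * q a) \<in> \<int>" using k(2) a by auto
    then have "of_int (k * D) * q a \<in> \<int>" by (simp add: mult.assoc mult.left_commute)
    ultimately have "of_int (k * D) * q a = 0" by (metis Ints_cases floor_of_int of_int_0)
    then show ?thesis using k(1) D(1) by simp
  qed
  have "card S \<le> V.dim" if S: "finite S" "S \<subseteq> carrier A" "integrally_independent A S" for S
  proof -
    have inj: "inj_on \<iota> S"
    proof (rule inj_onI, rule ccontr)
      fix a b assume ab: "a \<in> S" "b \<in> S" "\<iota> a = \<iota> b" "a \<noteq> b"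
      define q :: "'a \<Rightarrow> rat" where "q = (\<lambda>s. if s = a then 1 else if s = b then - 1 else 0)"
      have qsum: "finsum (rat_tensor A) (\<lambda>s. q s \<odot>\<^bsub>rat_tensor A\<^esub> \<iota> s) {a, b} = \<zero>\<^bsub>rat_tensor A\<^esub>"
      proof -
        have c: "\<iota> a \<in> carrier (rat_tensor A)" "\<iota> b \<in> carrier (rat_tensor A)" using ab S \<iota>_c by auto
        have "finsum (rat_tensor A) (\<lambda>s. q s \<odot>\<^bsub>rat_tensor A\<^esub> \<iota> s) {a, b} =
            (1 :: rat) \<odot>\<^bsub>rat_tensor A\<^esub> \<iota> a \<oplus>\<^bsub>rat_tensor A\<^esub> (- 1 :: rat) \<odot>\<^bsub>rat_tensor A\<^esub> \<iota> b"
          using ab c by (simp add: q_def)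
        also have "\<dots> = ((1 :: rat) \<oplus>\<^bsub>rat_ring\<^esub> (- 1)) \<odot>\<^bsub>rat_tensor A\<^esub> \<iota> b"
          unfolding ab(3) using c by (subst V.smult_l_distr) simp_all
        also have "\<dots> = \<zero>\<^bsub>rat_ring\<^esub> \<odot>\<^bsub>rat_tensor A\<^esub> \<iota> b" by simp
        also have "\<dots> = \<zero>\<^bsub>rat_tensor A\<^esub>" using c by (rule_tac V.lmult_0)
        finally show ?thesis .
      qed
      have ab': "{a, b} \<subseteq> carrier A" "finite {a, b}" using ab S by auto
      have "(\<Sum>s\<in>{a, b}. frag_of (q s, s)) \<in> ?R #>\<^bsub>?F\<^esub> (\<Sum>s\<in>{a, b}. frag_of (q s, s))" by (rule coset_self)
      then have R: "(\<Sum>s\<in>{a, b}. frag_of (q s, s)) \<in> ?R" using comb[OF ab'(2,1), of q] qsum zero by simp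
      have "integrally_independent A {a, b}"
        unfolding integrally_independent_def
      proof (intro allI impI)
        fix n :: "'a \<Rightarrow> int" assume n: "finprod A (\<lambda>a. a [^]\<^bsub>A\<^esub> n a) {a, b} = \<one>\<^bsub>A\<^esub>"
        define n' where "n' = (\<lambda>s. if s \<in> {a, b} then n s else 0)"
        have "finprod A (\<lambda>s. s [^]\<^bsub>A\<^esub> n' s) S = finprod A (\<lambda>a. a [^]\<^bsub>A\<^esub> n a) {a, b}"
          using ab S by (intro A.finprod_mono_neutral_cong_left[symmetric]) (auto simp: n'_def)
        then have "\<forall>s\<in>S. n' s = 0" using n S(3) unfolding integrally_independent_def by simp
        then show "\<forall>s\<in>{a, b}. n s = 0" using ab by (auto simp: n'_def split: if_splits)
      qed
      from rel[OF ab'(2,1) this R, of a] show False by (simp add: q_def)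
    qed
    have "V.lin_indpt (\<iota> ` S)"
    proof
      assume "V.lin_dep (\<iota> ` S)"
      then obtain q v where q: "q \<in> \<iota> ` S \<rightarrow> carrier rat_ring" "V.lincomb q (\<iota> ` S) = \<zero>\<^bsub>rat_tensor A\<^esub>"
        "v \<in> \<iota> ` S" "q v \<noteq> \<zero>\<^bsub>rat_ring\<^esub>"
        using V.finite_lin_dep[of "\<iota> ` S"] S \<iota>_c by blast
      obtain a where a: "a \<in> S" "v = \<iota> a" using q(3) by auto
      have "V.lincomb q (\<iota> ` S) = finsum (rat_tensor A) (\<lambda>v. q v \<odot>\<^bsub>rat_tensor A\<^esub> v) (\<iota> ` S)"
        by (simp add: V.lincomb_def)
      also have "\<dots> = finsum (rat_tensor A) (\<lambda>a. q (\<iota> a) \<odot>\<^bsub>rat_tensor A\<^esub> \<iota> a) S"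
        using inj S \<iota>_c by (intro V.finsum_reindex) auto
      also have "\<dots> = ?R #>\<^bsub>?F\<^esub> (\<Sum>a\<in>S. frag_of (q (\<iota> a), a))" by (rule comb[OF S(1,2)])
      finally have "(\<Sum>a\<in>S. frag_of (q (\<iota> a), a)) \<in> ?R"
        using coset_self[of "\<Sum>a\<in>S. frag_of (q (\<iota> a), a)"] q(2) zero by simp
      from rel[OF S this a(1)] show False using q(4) a(2) by simp
    qed
    then have "card (\<iota> ` S) \<le> V.dim"
      using assms S \<iota>_c unfolding finite_rat_rank_def by (intro V.li_le_dim(2)) auto
    then show ?thesis using card_image[OF inj] by simp
  qed
  then show ?thesis by (rule that)
qed

end

context
  fixes A :: "('a, 'm) monoid_scheme"
  assumes A: "comm_group A"
begin

interpretation A: comm_group A by (rule A)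

definition monomial where "monomial S k = finprod A (\<lambda>a. a [^]\<^bsub>A\<^esub> (k a :: int)) S"

lemma monomial_closed: "S \<subseteq> carrier A \<Longrightarrow> monomial S k \<in> carrier A"
  unfolding monomial_def by (intro A.finprod_closed) auto

lemma monomial_add: "S \<subseteq> carrier A \<Longrightarrow> monomial S (\<lambda>a. k a + l a) = monomial S k \<otimes>\<^bsub>A\<^esub> monomial S l"
proof -
  assume S: "S \<subseteq> carrier A"
  have "monomial S (\<lambda>a. k a + l a) = finprod A (\<lambda>a. a [^]\<^bsub>A\<^esub> k a \<otimes>\<^bsub>A\<^esub> a [^]\<^bsub>A\<^esub> l a) S"
    unfolding monomial_def using S by (intro A.finprod_cong') (auto simp: A.int_pow_mult subset_iff)
  also have "\<dots> = monomial S k \<otimes>\<^bsub>A\<^esub> monomial S l"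
    unfolding monomial_def using S by (intro A.finprod_multf) auto
  finally show ?thesis .
qed

lemma monomial_zero: "monomial S (\<lambda>a. 0) = \<one>\<^bsub>A\<^esub>"
  unfolding monomial_def by simp

lemma monomial_minus:
  assumes "S \<subseteq> carrier A"
  shows "monomial S (\<lambda>a. - k a) = inv\<^bsub>A\<^esub> monomial S k"
proof -
  have "monomial S (\<lambda>a. - k a + k a) = monomial S (\<lambda>a. - k a) \<otimes>\<^bsub>A\<^esub> monomial S k"
    by (rule monomial_add[OF assms])
  then have "monomial S (\<lambda>a. - k a) \<otimes>\<^bsub>A\<^esub> monomial S k = \<one>\<^bsub>A\<^esub>" by (simp add: monomial_zero)
  then show ?thesis by (rule A.inv_equality[symmetric]) (simp_all add: monomial_closed[OF assms])
qed

lemma monomial_pow: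
  assumes S: "S \<subseteq> carrier A"
  shows "monomial S k [^]\<^bsub>A\<^esub> (n :: int) = monomial S (\<lambda>a. n * k a)"
proof -
  have nat: "monomial S k [^]\<^bsub>A\<^esub> int n = monomial S (\<lambda>a. int n * k a)" for n
  proof (induction n)
    case 0 show ?case by (simp add: monomial_zero)
  next
    case (Suc n)
    have "monomial S k [^]\<^bsub>A\<^esub> int (Suc n) = monomial S k [^]\<^bsub>A\<^esub> int n \<otimes>\<^bsub>A\<^esub> monomial S k"
      using A.int_pow_mult[OF monomial_closed[OF S], of k "int n" 1] monomial_closed[OF S, of k]
      by (simp add: A.int_pow_1 add.commute)
    also have "\<dots> = monomial S (\<lambda>a. int n * k a + k a)" unfolding Suc by (rule monomial_add[OF S, symmetric])
    finally show ?case by (simp add: algebra_simps)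
  qed
  show ?thesis
  proof (cases "n \<ge> 0")
    case True then show ?thesis using nat[of "nat n"] by simp
  next
    case False
    then have "monomial S k [^]\<^bsub>A\<^esub> n = inv\<^bsub>A\<^esub> (monomial S k [^]\<^bsub>A\<^esub> int (nat (- n)))"
      using A.int_pow_neg[OF monomial_closed[OF S], of k "- n"] by simp
    also have "\<dots> = monomial S (\<lambda>a. - (int (nat (- n)) * k a))" unfolding nat by (rule monomial_minus[OF S, symmetric])
    finally show ?thesis using False by simp
  qed
qed

text \<open>
  Let \<open>S\<close> be a largest integrally independent set. Every \<open>v\<close> has a positive power \<open>v\<^sup>n\<close> that is a
  monomial in \<open>S\<close>, and its coordinates are the exponents divided by \<open>n\<close>. They determine \<open>v\<close>
  because \<open>A\<close> is torsion-free. The last clause says that they form a basis of the additive real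
  functions on \<open>A\<close>: such a function is determined by its values on \<open>S\<close>.
\<close>

lemma rational_coordinates:
  assumes tf: "torsion_free A" and fr: "finite_rat_rank A"
  obtains S and lam :: "'a \<Rightarrow> 'a \<Rightarrow> real" where "finite S" "S \<subseteq> carrier A"
    and "\<And>a u v. a \<in> S \<Longrightarrow> u \<in> carrier A \<Longrightarrow> v \<in> carrier A \<Longrightarrow> lam a (u \<otimes>\<^bsub>A\<^esub> v) = lam a u + lam a v"
    and "\<And>a v. a \<in> S \<Longrightarrow> v \<in> carrier A \<Longrightarrow> lam a v \<in> \<rat>"
    and "\<And>v. v \<in> carrier A \<Longrightarrow> (\<And>a. a \<in> S \<Longrightarrow> lam a v = 0) \<Longrightarrow> v = \<one>\<^bsub>A\<^esub>"
    and "\<And>a. a \<in> S \<Longrightarrow> lam a a = 1"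
    and "\<And>\<mu> v. (\<And>u v. u \<in> carrier A \<Longrightarrow> v \<in> carrier A \<Longrightarrow> \<mu> (u \<otimes>\<^bsub>A\<^esub> v) = \<mu> u + (\<mu> v :: real)) \<Longrightarrow>
           v \<in> carrier A \<Longrightarrow> \<mu> v = (\<Sum>a\<in>S. lam a v * \<mu> a)"
proof -
  obtain N where N: "\<And>S. finite S \<Longrightarrow> S \<subseteq> carrier A \<Longrightarrow> integrally_independent A S \<Longrightarrow> card S \<le> N"
    by (rule integrally_independent_bounded[OF A fr]) (rule that)
  define P where "P S \<longleftrightarrow> finite S \<and> S \<subseteq> carrier A \<and> integrally_independent A S" for S
  have "P {}" by (simp add: P_def integrally_independent_def)
  moreover have "\<forall>S. P S \<longrightarrow> card S < Suc N" using N by (simp add: P_def less_Suc_eq_le)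
  ultimately have "\<exists>S. P S \<and> (\<forall>S'. P S' \<longrightarrow> card S' \<le> card S)" by (rule ex_has_greatest_nat)
  then obtain S where "P S" and max: "\<And>S'. P S' \<Longrightarrow> card S' \<le> card S" by blast
  then have S: "finite S" "S \<subseteq> carrier A" and ind: "integrally_independent A S" by (auto simp: P_def)
  have ind': "k a = 0" if "monomial S k = \<one>\<^bsub>A\<^esub>" "a \<in> S" for k a
    using ind that unfolding integrally_independent_def monomial_def by blast
  have ind_eq: "k a = l a" if "monomial S k = monomial S l" "a \<in> S" for k l a
  proof -
    have "monomial S (\<lambda>a. k a + - l a) = monomial S k \<otimes>\<^bsub>A\<^esub> inv\<^bsub>A\<^esub> monomial S l"
      using monomial_add[OF S(2), of k "\<lambda>a. - l a"] monomial_minus[OF S(2), of l] by simp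
    then have "monomial S (\<lambda>a. k a + - l a) = \<one>\<^bsub>A\<^esub>" using that monomial_closed[OF S(2)] by simp
    from ind'[OF this that(2)] show ?thesis by simp
  qed
  have rep: "\<exists>n k. n > 0 \<and> b [^]\<^bsub>A\<^esub> (n :: int) = monomial S k" if b: "b \<in> carrier A" for b
  proof (cases "b \<in> S")
    case True
    have "monomial S (\<lambda>a. if a = b then 1 else 0) = finprod A (\<lambda>a. if b = a then a else \<one>\<^bsub>A\<^esub>) S"
      unfolding monomial_def using S by (intro A.finprod_cong') (auto simp: A.int_pow_1 subset_iff)
    also have "\<dots> = b" using A.finprod_singleton[OF True S(1), of "\<lambda>a. a"] S by auto
    finally show ?thesis using b by (intro exI[of _ 1] exI[of _ "\<lambda>a. if a = b then 1 else 0"]) (simp add: A.int_pow_1)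
  next
    case False
    have "\<not> P (insert b S)" using max[of "insert b S"] False S(1) by auto
    then have "\<not> integrally_independent A (insert b S)" using S b by (simp add: P_def)
    then obtain n a where n: "monomial (insert b S) n = \<one>\<^bsub>A\<^esub>" "a \<in> insert b S" "n a \<noteq> 0"
      unfolding integrally_independent_def monomial_def by blast
    have ins: "monomial (insert b S) n = b [^]\<^bsub>A\<^esub> n b \<otimes>\<^bsub>A\<^esub> monomial S n"
      unfolding monomial_def using S b False by (intro A.finprod_insert) auto
    have nb: "n b \<noteq> 0"
    proof
      assume "n b = 0"
      then have "monomial S n = \<one>\<^bsub>A\<^esub>" using ins n(1) monomial_closed[OF S(2), of n] by simp
      then show False using ind' n(2,3) \<open>n b = 0\<close> by auto
    qed
    have bn: "b [^]\<^bsub>A\<^esub> n b = inv\<^bsub>A\<^esub> monomial S n"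
      using ins n(1) b monomial_closed[OF S(2)] by (simp add: A.inv_equality)
    then have bn': "b [^]\<^bsub>A\<^esub> n b = monomial S (\<lambda>a. - n a)" by (simp add: monomial_minus[OF S(2)])
    have bnn: "b [^]\<^bsub>A\<^esub> (- n b) = monomial S n"
      using bn b monomial_closed[OF S(2)] by (simp add: A.int_pow_neg)
    show ?thesis
    proof (cases "n b > 0")
      case True then show ?thesis using bn' by blast
    next
      case False then show ?thesis using bnn nb by (intro exI[of _ "- n b"] exI[of _ n]) simp
    qed
  qed
  have "\<forall>b\<in>carrier A. \<exists>p. fst p > 0 \<and> b [^]\<^bsub>A\<^esub> (fst p :: int) = monomial S (snd p)" using rep by fastforce
  from bchoice[OF this] obtain p where p: "\<forall>b\<in>carrier A. fst (p b) > 0 \<and> b [^]\<^bsub>A\<^esub> (fst (p b) :: int) = monomial S (snd (p b))" ..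
  define lam :: "'a \<Rightarrow> 'a \<Rightarrow> real" where "lam a b = of_int (snd (p b) a) / of_int (fst (p b))" for a b
  have lam: "lam a b = of_int (k a) / of_int n" if b: "b \<in> carrier A" and n: "n \<noteq> 0" "b [^]\<^bsub>A\<^esub> n = monomial S k" and a: "a \<in> S"
    for a b n k
  proof -
    let ?m = "fst (p b)" and ?l = "snd (p b)"
    have m: "?m > 0" "b [^]\<^bsub>A\<^esub> ?m = monomial S ?l" using p b by auto
    have "b [^]\<^bsub>A\<^esub> (?m * n) = monomial S (\<lambda>a. n * ?l a)"
      using A.int_pow_pow[OF b, of ?m n] m(2) monomial_pow[OF S(2), of ?l n] by simp
    moreover have "b [^]\<^bsub>A\<^esub> (?m * n) = monomial S (\<lambda>a. ?m * k a)"
      using A.int_pow_pow[OF b, of n ?m] n(2) monomial_pow[OF S(2), of k ?m] by (simp add: mult.commute)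
    ultimately have "n * ?l a = ?m * k a" using ind_eq[OF _ a] by metis
    then have "real_of_int n * real_of_int (?l a) = real_of_int ?m * real_of_int (k a)" by (metis of_int_mult)
    then show ?thesis using m(1) n(1) by (simp add: lam_def field_simps)
  qed
  show ?thesis
  proof (rule that[OF S, of lam])
    fix a u v assume a: "a \<in> S" and u: "u \<in> carrier A" and v: "v \<in> carrier A"
    obtain n k where n: "n > 0" "u [^]\<^bsub>A\<^esub> (n :: int) = monomial S k" using rep[OF u] by blast
    obtain m l where m: "m > 0" "v [^]\<^bsub>A\<^esub> (m :: int) = monomial S l" using rep[OF v] by blast
    have "(u \<otimes>\<^bsub>A\<^esub> v) [^]\<^bsub>A\<^esub> (n * m) = u [^]\<^bsub>A\<^esub> (n * m) \<otimes>\<^bsub>A\<^esub> v [^]\<^bsub>A\<^esub> (m * n)"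
      using A.int_pow_distrib[OF u v, of "n * m"] by (simp add: mult.commute)
    also have "\<dots> = monomial S (\<lambda>a. m * k a + n * l a)"
      using A.int_pow_pow[OF u, of n m] A.int_pow_pow[OF v, of m n] n(2) m(2)
        monomial_pow[OF S(2), of k m] monomial_pow[OF S(2), of l n] monomial_add[OF S(2), of "\<lambda>a. m * k a" "\<lambda>a. n * l a"] by simp
    finally have "lam a (u \<otimes>\<^bsub>A\<^esub> v) = of_int (m * k a + n * l a) / of_int (n * m)"
      using n m u v a by (intro lam) auto
    moreover have "lam a u = of_int (k a) / of_int n" "lam a v = of_int (l a) / of_int m"
      using n m by (auto intro!: lam u v a)
    ultimately show "lam a (u \<otimes>\<^bsub>A\<^esub> v) = lam a u + lam a v" using n(1) m(1) by (simp add: add_divide_distrib)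
  next
    fix a v assume "a \<in> S" "v \<in> carrier A"
    show "lam a v \<in> \<rat>" unfolding lam_def by simp
  next
    fix v assume v: "v \<in> carrier A" and z: "\<And>a. a \<in> S \<Longrightarrow> lam a v = 0"
    have pv: "fst (p v) > 0" "v [^]\<^bsub>A\<^esub> fst (p v) = monomial S (snd (p v))" using p v by auto
    have "snd (p v) a = 0" if "a \<in> S" for a using z[OF that] pv(1) by (simp add: lam_def)
    then have "monomial S (snd (p v)) = monomial S (\<lambda>a. 0)"
      unfolding monomial_def using S(2) by (intro A.finprod_cong') auto
    then have "v [^]\<^bsub>A\<^esub> int (nat (fst (p v))) = \<one>\<^bsub>A\<^esub>" using pv by (simp add: monomial_zero)
    then have "v [^]\<^bsub>A\<^esub> nat (fst (p v)) = \<one>\<^bsub>A\<^esub>" by (simp only: int_pow_int)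
    then show "v = \<one>\<^bsub>A\<^esub>" using tf v pv(1) unfolding torsion_free_def by (metis zero_less_nat_eq)
  next
    fix a assume a: "a \<in> S"
    have ac: "a \<in> carrier A" using a S by auto
    have "monomial S (\<lambda>s. if s = a then 1 else 0) = finprod A (\<lambda>s. if a = s then s else \<one>\<^bsub>A\<^esub>) S"
      unfolding monomial_def using S by (intro A.finprod_cong') (auto simp: A.int_pow_1 subset_iff)
    also have "\<dots> = a" using A.finprod_singleton[OF a S(1), of "\<lambda>a. a"] S by auto
    finally have "a [^]\<^bsub>A\<^esub> (1 :: int) = monomial S (\<lambda>s. if s = a then 1 else 0)" using ac by (simp add: A.int_pow_1)
    from lam[OF ac _ this a] show "lam a a = 1" by simp
  next
    fix \<mu> :: "'a \<Rightarrow> real" and v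
    assume add: "\<And>u v. u \<in> carrier A \<Longrightarrow> v \<in> carrier A \<Longrightarrow> \<mu> (u \<otimes>\<^bsub>A\<^esub> v) = \<mu> u + \<mu> v" and v: "v \<in> carrier A"
    have one: "\<mu> \<one>\<^bsub>A\<^esub> = 0" using add[of "\<one>\<^bsub>A\<^esub>" "\<one>\<^bsub>A\<^esub>"] by simp
    have inv: "\<mu> (inv\<^bsub>A\<^esub> u) = - \<mu> u" if "u \<in> carrier A" for u
      using add[of u "inv\<^bsub>A\<^esub> u"] that one by simp
    have npow: "\<mu> (u [^]\<^bsub>A\<^esub> (n :: nat)) = real n * \<mu> u" if "u \<in> carrier A" for u n
      by (induction n) (simp_all add: one add that algebra_simps)
    have pow: "\<mu> (u [^]\<^bsub>A\<^esub> (n :: int)) = of_int n * \<mu> u" if u: "u \<in> carrier A" for u n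
    proof (cases "n \<ge> 0")
      case True
      then show ?thesis using npow[OF u, of "nat n"] by (simp add: int_pow_int[symmetric])
    next
      case False
      then have "u [^]\<^bsub>A\<^esub> n = inv\<^bsub>A\<^esub> (u [^]\<^bsub>A\<^esub> nat (- n))"
        using A.int_pow_neg[OF u, of "- n"] by (simp add: int_pow_int[symmetric])
      then show ?thesis using False npow[OF u, of "nat (- n)"] u by (simp add: inv)
    qed
    have mono: "\<mu> (monomial S' k) = (\<Sum>a\<in>S'. of_int (k a) * \<mu> a)" if "finite S'" "S' \<subseteq> S" for S' k
      using that
    proof (induction S' rule: finite_induct)
      case empty show ?case by (simp add: monomial_def one)
    next
      case (insert s S')
      have sc: "s \<in> carrier A" "S' \<subseteq> carrier A" using insert.prems S by auto
      have "monomial (insert s S') k = s [^]\<^bsub>A\<^esub> k s \<otimes>\<^bsub>A\<^esub> monomial S' k"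
        unfolding monomial_def using insert.hyps sc by (intro A.finprod_insert) auto
      then show ?case using insert sc monomial_closed[OF sc(2)] by (simp add: add pow)
    qed
    have pv: "fst (p v) > 0" "v [^]\<^bsub>A\<^esub> fst (p v) = monomial S (snd (p v))" using p v by auto
    have "of_int (fst (p v)) * \<mu> v = (\<Sum>a\<in>S. of_int (snd (p v) a) * \<mu> a)"
      using pow[OF v, of "fst (p v)"] mono[OF S(1) subset_refl, of "snd (p v)"] pv(2) by simp
    also have "\<dots> = of_int (fst (p v)) * (\<Sum>a\<in>S. lam a v * \<mu> a)"
      unfolding sum_distrib_left using pv(1) by (intro sum.cong refl) (simp add: lam_def)
    finally show "\<mu> v = (\<Sum>a\<in>S. lam a v * \<mu> a)" using pv(1) by simp
  qed
qed

end

section \<open>Instances of tameness\<close>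

text \<open>
  With no functionals at all, \<open>f = d = 0\<close>, boxes are entire subgroups of the family.
\<close>

lemma (in group) tame_locally_finite:
  assumes "H \<lhd> G"
    and "\<And>H0. H0 \<in> Fam \<Longrightarrow> subgroup H0 G" "\<And>H0. H0 \<in> Fam \<Longrightarrow> H0 \<subseteq> H" "\<And>H0. H0 \<in> Fam \<Longrightarrow> finite H0"
    and "\<And>V. finite V \<Longrightarrow> V \<subseteq> H \<Longrightarrow> \<exists>H0\<in>Fam. V \<subseteq> H0"
    and "\<And>g. g \<in> carrier G \<Longrightarrow> \<exists>m. \<forall>H0\<in>Fam. \<exists>\<kappa> :: 'a \<Rightarrow> nat. (\<forall>v\<in>H0. \<kappa> v < m) \<and>
       (\<forall>v\<in>H0. \<forall>w\<in>H0. \<kappa> v = \<kappa> w \<longrightarrow> g \<otimes> (v \<otimes> inv w) \<otimes> inv g \<in> H0)"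
  shows "tame_subgroup G H 0 0 (\<lambda>_ _. 0) Fam"
proof (intro tame_subgroup.intro tame_subgroup_axioms.intro is_group)
  fix g assume "g \<in> carrier G"
  show "\<exists>\<sigma>\<ge>0. \<forall>v\<in>H. \<forall>r. (\<forall>i<0. 0 \<le> r) \<longrightarrow> (\<forall>i<0::nat. 0 \<le> \<sigma> * (r :: real))"
    by (intro exI[of _ 0]) simp
next
  fix t :: "nat \<Rightarrow> 'a" and e :: "nat \<Rightarrow> nat"
  assume "\<And>j. j \<le> 0 \<Longrightarrow> t j \<in> carrier G \<and> e j < 0"
  from this[of 0] show "\<exists>\<alpha> :: nat \<Rightarrow> real. (\<exists>j\<le>0. \<alpha> j \<noteq> 0) \<and> (\<forall>v\<in>H. (\<Sum>j\<le>0. \<alpha> j * 0) = 0)" by simp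
next
  fix H0 :: "'a set" and r :: real assume "H0 \<in> Fam"
  then show "finite {v \<in> H0. \<forall>i<0::nat. 0 \<le> r}" using assms(4) by simp
qed (use assms in auto)

text \<open>
  Gaussian elimination, by induction on the number of columns.
\<close>

lemma dependent_rows:
  fixes c :: "nat \<Rightarrow> nat \<Rightarrow> real"
  shows "\<exists>\<alpha>. (\<exists>j\<le>d. \<alpha> j \<noteq> 0) \<and> (\<forall>l<d. (\<Sum>j\<le>d. \<alpha> j * c j l) = 0)"
proof (induction d arbitrary: c)
  case 0
  show ?case by (intro exI[of _ "\<lambda>_. 1"]) simp
next
  case (Suc d)
  show ?case
  proof (cases "\<forall>j\<le>d. c j d = 0")
    case True
    obtain \<alpha> where \<alpha>: "\<exists>j\<le>d. \<alpha> j \<noteq> 0" "\<forall>l<d. (\<Sum>j\<le>d. \<alpha> j * c j l) = 0" using Suc by blast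
    let ?\<beta> = "\<lambda>j. if j \<le> d then \<alpha> j else 0"
    have "(\<Sum>j\<le>Suc d. ?\<beta> j * c j l) = (\<Sum>j\<le>d. \<alpha> j * c j l)" for l by simp
    moreover have "(\<Sum>j\<le>d. \<alpha> j * c j d) = 0" using True by simp
    ultimately have "(\<Sum>j\<le>Suc d. ?\<beta> j * c j l) = 0" if "l < Suc d" for l
      using \<alpha>(2)[rule_format, of l] that by (cases "l = d") (simp_all only: less_Suc_eq simp_thms)
    moreover obtain j where "j \<le> d" "\<alpha> j \<noteq> 0" using \<alpha>(1) by blast
    then have "j \<le> Suc d \<and> ?\<beta> j \<noteq> 0" by simp
    ultimately show ?thesis by (intro exI[of _ ?\<beta>] conjI exI[of _ j] allI impI) simp_all
  next
    case False
    then obtain p where p: "p \<le> d" "c p d \<noteq> 0" by blast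
    \<comment> \<open>exchange the pivot row with the last one and eliminate the last column\<close>
    define s where "s j = (if j = p then Suc d else j)" for j
    define c' where "c' j l = c (s j) l - c (s j) d / c p d * c p l" for j l
    obtain \<alpha> where \<alpha>: "\<exists>j\<le>d. \<alpha> j \<noteq> 0" "\<forall>l<d. (\<Sum>j\<le>d. \<alpha> j * c' j l) = 0" using Suc by blast
    define \<gamma> where "\<gamma> = - (\<Sum>j\<le>d. \<alpha> j * c (s j) d / c p d)"
    define \<beta> where "\<beta> j = (if j = p then \<gamma> else if j = Suc d then \<alpha> p else \<alpha> j)" for j
    have split: "(\<Sum>j\<le>Suc d. \<beta> j * c j l) = \<gamma> * c p l + (\<Sum>j\<le>d. \<alpha> j * c (s j) l)" for l
    proof -
      have 1: "(\<Sum>j\<le>Suc d. \<beta> j * c j l) = (\<Sum>j\<le>d. \<beta> j * c j l) + \<alpha> p * c (Suc d) l"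
        using p by (simp add: \<beta>_def)
      have 2: "(\<Sum>j\<le>d. \<beta> j * c j l) = \<gamma> * c p l + (\<Sum>j\<in>{..d} - {p}. \<alpha> j * c j l)"
        using p by (simp add: sum.remove[of "{..d}" p] \<beta>_def)
      have 3: "(\<Sum>j\<le>d. \<alpha> j * c (s j) l) = \<alpha> p * c (Suc d) l + (\<Sum>j\<in>{..d} - {p}. \<alpha> j * c j l)"
        using p by (simp add: sum.remove[of "{..d}" p] s_def)
      show ?thesis unfolding 1 2 3 by simp
    qed
    have zero: "(\<Sum>j\<le>d. \<alpha> j * c' j l) = \<gamma> * c p l + (\<Sum>j\<le>d. \<alpha> j * c (s j) l)" for l
      by (simp add: c'_def \<gamma>_def right_diff_distrib sum_subtractf sum_distrib_right mult.assoc)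
    have "(\<Sum>j\<le>Suc d. \<beta> j * c j l) = 0" if "l < Suc d" for l
    proof (cases "l = d")
      case True
      have "c' j d = 0" for j using p by (simp add: c'_def)
      then show ?thesis using split[of d] zero[of d] True by simp
    next
      case False
      then show ?thesis using split[of l] zero[of l] \<alpha>(2) that by simp
    qed
    moreover have "\<exists>j\<le>Suc d. \<beta> j \<noteq> 0"
    proof -
      obtain j where j: "j \<le> d" "\<alpha> j \<noteq> 0" using \<alpha>(1) by blast
      show ?thesis using j p by (intro exI[of _ "s j"]) (auto simp: s_def \<beta>_def)
    qed
    ultimately show ?thesis by blast
  qed
qed

lemma real_rational_multiple_int:
  fixes R :: "real set"
  assumes "finite R" "R \<subseteq> \<rat>"
  shows "\<exists>D::nat. D > 0 \<and> (\<forall>r\<in>R. of_nat D * r \<in> \<int>)"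
proof -
  have "\<forall>r\<in>R. \<exists>q. r = of_rat q" using assms(2) by (auto elim!: Rats_cases)
  from bchoice[OF this] obtain q where q: "\<forall>r\<in>R. r = of_rat (q r)" ..
  obtain D :: int where D: "D > 0" "\<And>r. r \<in> R \<Longrightarrow> of_int D * q r \<in> \<int>"
    using rat_multiple_int[of "q ` R"] assms(1) by blast
  have "of_nat (nat D) * r \<in> \<int>" if r: "r \<in> R" for r
  proof -
    obtain i where "of_int D * q r = of_int i" using D(2)[OF r] by (auto elim: Ints_cases)
    then have "of_rat (of_int D * q r) = (of_rat (of_int i) :: real)" by simp
    then have "of_int D * r = of_int i" using q r by (simp add: of_rat_mult)
    then show ?thesis using D(1) by (metis Ints_of_int int_nat_eq less_imp_le of_int_of_nat_eq)
  qed
  then show ?thesis using D(1) by (intro exI[of _ "nat D"]) auto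
qed

text \<open>
  The functionals are the rational coordinates and their negatives. Additive functions on \<open>H\<close> are
  determined by \<open>d\<close> values, so any \<open>d + 1\<close> of them are dependent. The family consists of the
  subgroups \<open>Hm M\<close> of the elements whose coordinates have denominator \<open>M\<close>. Conjugation by \<open>g\<close> acts
  on coordinates through a rational matrix; if \<open>N\<close> clears its denominators, then an element of \<open>Hm
  M\<close> whose coordinates, multiplied by \<open>M\<close>, are divisible by \<open>N\<close> is conjugated into \<open>Hm M\<close>. So the
  residues modulo \<open>N\<close> label the cosets, and their number does not depend on \<open>M\<close>.
\<close>

lemma (in group) tame_torsion_free_finite_rank:
  assumes H: "H \<lhd> G" and comm: "comm_group (G\<lparr>carrier := H\<rparr>)"
    and tf: "torsion_free (G\<lparr>carrier := H\<rparr>)" and fr: "finite_rat_rank (G\<lparr>carrier := H\<rparr>)"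
  shows "\<exists>f d lam Fam. tame_subgroup G H f d lam Fam"
proof -
  have subH: "subgroup H G" using H by (simp add: normal_def)
  have Hc: "v \<in> carrier G" if "v \<in> H" for v using subgroup.mem_carrier[OF subH that] .
  have Hcl: "\<one> \<in> H" "\<And>u v. u \<in> H \<Longrightarrow> v \<in> H \<Longrightarrow> u \<otimes> v \<in> H" "\<And>v. v \<in> H \<Longrightarrow> inv v \<in> H"
    using subH by (auto simp: subgroup_def)
  have conj: "g \<otimes> v \<otimes> inv g \<in> H" if "g \<in> carrier G" "v \<in> H" for g v
    by (rule normal.inv_op_closed2[OF H that])
  obtain S and cl :: "'a \<Rightarrow> 'a \<Rightarrow> real" where S: "finite S" "S \<subseteq> H"
    and cl_mult': "\<And>a u v. a \<in> S \<Longrightarrow> u \<in> H \<Longrightarrow> v \<in> H \<Longrightarrow> cl a (u \<otimes> v) = cl a u + cl a v"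
    and cl_rat: "\<And>a v. a \<in> S \<Longrightarrow> v \<in> H \<Longrightarrow> cl a v \<in> \<rat>"
    and cl_inj: "\<And>v. v \<in> H \<Longrightarrow> (\<And>a. a \<in> S \<Longrightarrow> cl a v = 0) \<Longrightarrow> v = \<one>"
    and cl_one: "\<And>a. a \<in> S \<Longrightarrow> cl a a = 1"
    and cl_span: "\<And>\<mu> v. (\<And>u v. u \<in> H \<Longrightarrow> v \<in> H \<Longrightarrow> \<mu> (u \<otimes> v) = \<mu> u + (\<mu> v :: real)) \<Longrightarrow>
           v \<in> H \<Longrightarrow> \<mu> v = (\<Sum>a\<in>S. cl a v * \<mu> a)"
  proof (rule rational_coordinates[OF comm tf fr], goal_cases)
    case (1 S cl)
    show ?case by (rule 1(1)[of S cl]) (use 1(2-) in auto)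
  qed
  define d where "d = card S"
  obtain b where b: "bij_betw b {0..<d} S" using ex_bij_betw_nat_finite[OF S(1)] by (auto simp: d_def)
  have bS: "b i \<in> S" if "i < d" for i using bij_betwE[OF b] that by auto
  have bH: "b i \<in> H" if "i < d" for i using bS[OF that] S by auto
  have sumS: "(\<Sum>a\<in>S. h a) = (\<Sum>l<d. h (b l))" for h :: "'a \<Rightarrow> real"
    using sum.reindex_bij_betw[OF b, of h] by (simp add: atLeast0LessThan)
  define lam where "lam i v = (if i < d then cl (b i) v else - cl (b (i - d)) v)" for i v
  have cl_mult: "cl (b i) (u \<otimes> v) = cl (b i) u + cl (b i) v" if "i < d" "u \<in> H" "v \<in> H" for i u v
    by (rule cl_mult'[OF bS[OF that(1)] that(2,3)])
  have lam_mult: "lam i (u \<otimes> v) = lam i u + lam i v" if "i < 2 * d" "u \<in> H" "v \<in> H" for i u v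
    using that cl_mult[of i] cl_mult[of "i - d"] by (auto simp: lam_def)
  have cl_zero: "cl (b i) \<one> = 0" if "i < d" for i using cl_mult[OF that, of \<one> \<one>] Hcl by simp
  have cl_inv: "cl (b i) (inv v) = - cl (b i) v" if "i < d" "v \<in> H" for i v
    using cl_mult[OF that(1), of v "inv v"] Hcl that Hc cl_zero[OF that(1)] by simp
  have span: "\<mu> v = (\<Sum>l<d. cl (b l) v * \<mu> (b l))"
    if "\<And>u v. u \<in> H \<Longrightarrow> v \<in> H \<Longrightarrow> \<mu> (u \<otimes> v) = \<mu> u + (\<mu> v :: real)" "v \<in> H" for \<mu> v
    using cl_span[OF that] by (simp add: sumS)
  have conj_mult: "g \<otimes> (u \<otimes> v) \<otimes> inv g = (g \<otimes> u \<otimes> inv g) \<otimes> (g \<otimes> v \<otimes> inv g)"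
    if "g \<in> carrier G" "u \<in> H" "v \<in> H" for g u v
  proof -
    have "u \<in> carrier G" "v \<in> carrier G" using that Hc by auto
    then show ?thesis using that(1) by (simp add: m_assoc inv_cancel)
  qed
  have conj_span: "lam i (g \<otimes> v \<otimes> inv g) = (\<Sum>l<d. cl (b l) v * lam i (g \<otimes> b l \<otimes> inv g))"
    if "g \<in> carrier G" "v \<in> H" "i < 2 * d" for g v i
    by (rule span) (use that conj conj_mult lam_mult in auto)
  have cl_conj_span: "cl (b i) (g \<otimes> v \<otimes> inv g) = (\<Sum>l<d. cl (b l) v * cl (b i) (g \<otimes> b l \<otimes> inv g))"
    if "g \<in> carrier G" "v \<in> H" "i < d" for g v i
    using conj_span[of g v i] that by (simp add: lam_def)
  define Hm where "Hm M = {v \<in> H. \<forall>i<d. of_nat M * cl (b i) v \<in> \<int>}" for M :: nat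
  define Fam where "Fam = Hm ` {M. M > 0}"
  have "tame_subgroup G H (2 * d) d lam Fam"
  proof (intro tame_subgroup.intro tame_subgroup_axioms.intro is_group)
    show "H \<lhd> G" by (rule H)
    show "lam i (u \<otimes> v) = lam i u + lam i v" if "i < 2 * d" "u \<in> H" "v \<in> H" for i u v by (rule lam_mult[OF that])
    show "\<exists>j<2 * d. \<forall>v\<in>H. lam j v = - lam i v" if "i < 2 * d" for i
    proof (cases "i < d")
      case True then show ?thesis by (intro exI[of _ "i + d"]) (simp add: lam_def)
    next
      case False
      then have "i - d < 2 * d" "i - d < d" using that by linarith+
      then show ?thesis using False by (intro exI[of _ "i - d"]) (simp add: lam_def)
    qed
    show "\<exists>v\<in>H. lam i v \<noteq> 0" if "i < 2 * d" for i
    proof (cases "i < d")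
      case True then show ?thesis using bH cl_one[OF bS[OF True]] by (intro bexI[of _ "b i"]) (simp_all add: lam_def)
    next
      case False
      then have "i - d < d" using that by simp
      then show ?thesis using False bH cl_one[OF bS[of "i - d"]] by (intro bexI[of _ "b (i - d)"]) (simp_all add: lam_def)
    qed
    show "\<exists>\<sigma>\<ge>0. \<forall>v\<in>H. \<forall>r. (\<forall>i<2 * d. lam i v \<le> r) \<longrightarrow> (\<forall>i<2 * d. lam i (g \<otimes> v \<otimes> inv g) \<le> \<sigma> * r)"
      if g: "g \<in> carrier G" for g
    proof -
      define \<sigma> where "\<sigma> = (\<Sum>i<2 * d. \<Sum>l<d. \<bar>lam i (g \<otimes> b l \<otimes> inv g)\<bar>)"
      have "lam i (g \<otimes> v \<otimes> inv g) \<le> \<sigma> * r" if v: "v \<in> H" and r: "\<forall>i<2 * d. lam i v \<le> r" and i: "i < 2 * d" for v r i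
      proof -
        have cb: "\<bar>cl (b l) v\<bar> \<le> r" if "l < d" for l
          using r[rule_format, of l] r[rule_format, of "l + d"] that by (auto simp: lam_def)
        have d0: "0 < d" using i by simp
        have r0: "0 \<le> r" using cb[OF d0] by linarith
        have "lam i (g \<otimes> v \<otimes> inv g) \<le> (\<Sum>l<d. r * \<bar>lam i (g \<otimes> b l \<otimes> inv g)\<bar>)"
          unfolding conj_span[OF g v i]
        proof (rule sum_mono)
          fix l assume "l \<in> {..<d}"
          then have "\<bar>cl (b l) v * lam i (g \<otimes> b l \<otimes> inv g)\<bar> \<le> r * \<bar>lam i (g \<otimes> b l \<otimes> inv g)\<bar>"
            unfolding abs_mult using cb by (intro mult_right_mono) auto
          then show "cl (b l) v * lam i (g \<otimes> b l \<otimes> inv g) \<le> r * \<bar>lam i (g \<otimes> b l \<otimes> inv g)\<bar>" by linarith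
        qed
        also have "\<dots> = r * (\<Sum>l<d. \<bar>lam i (g \<otimes> b l \<otimes> inv g)\<bar>)" by (simp add: sum_distrib_left)
        also have "\<dots> \<le> r * \<sigma>"
          unfolding \<sigma>_def using i r0
          by (intro mult_left_mono member_le_sum[where f = "\<lambda>i. \<Sum>l<d. \<bar>lam i (g \<otimes> b l \<otimes> inv g)\<bar>"]) (auto intro: sum_nonneg)
        finally show ?thesis by (simp add: mult.commute)
      qed
      moreover have "0 \<le> \<sigma>" unfolding \<sigma>_def by (intro sum_nonneg) simp
      ultimately show ?thesis by blast
    qed
    show "\<exists>\<alpha>. (\<exists>j\<le>d. \<alpha> j \<noteq> 0) \<and> (\<forall>v\<in>H. (\<Sum>j\<le>d. \<alpha> j * lam (e j) (t j \<otimes> v \<otimes> inv t j)) = 0)"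
      if te: "\<And>j. j \<le> d \<Longrightarrow> t j \<in> carrier G \<and> e j < 2 * d" for t e
    proof -
      obtain \<alpha> where \<alpha>: "\<exists>j\<le>d. \<alpha> j \<noteq> 0" "\<forall>l<d. (\<Sum>j\<le>d. \<alpha> j * lam (e j) (t j \<otimes> b l \<otimes> inv t j)) = 0"
        using dependent_rows[of d "\<lambda>j l. lam (e j) (t j \<otimes> b l \<otimes> inv t j)"] by blast
      have "(\<Sum>j\<le>d. \<alpha> j * lam (e j) (t j \<otimes> v \<otimes> inv t j)) = 0" if v: "v \<in> H" for v
      proof -
        have "(\<Sum>j\<le>d. \<alpha> j * lam (e j) (t j \<otimes> v \<otimes> inv t j)) =
            (\<Sum>j\<le>d. \<Sum>l<d. cl (b l) v * (\<alpha> j * lam (e j) (t j \<otimes> b l \<otimes> inv t j)))"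
          using te v by (intro sum.cong refl) (simp add: conj_span sum_distrib_left mult.left_commute)
        also have "\<dots> = (\<Sum>l<d. cl (b l) v * (\<Sum>j\<le>d. \<alpha> j * lam (e j) (t j \<otimes> b l \<otimes> inv t j)))"
          by (subst sum.swap) (simp add: sum_distrib_left)
        also have "\<dots> = 0" using \<alpha>(2) by simp
        finally show ?thesis .
      qed
      then show ?thesis using \<alpha>(1) by blast
    qed
    show "subgroup H0 G" if F: "H0 \<in> Fam" for H0
    proof -
      obtain M where M: "H0 = Hm M" using F by (auto simp: Fam_def)
      show ?thesis unfolding M
      proof (rule subgroupI)
        show "Hm M \<subseteq> carrier G" using Hc by (auto simp: Hm_def)
        show "Hm M \<noteq> {}" using Hcl(1) cl_zero by (auto simp: Hm_def)
        show "inv v \<in> Hm M" if "v \<in> Hm M" for v using that Hcl(3) cl_inv by (auto simp: Hm_def)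
        show "u \<otimes> v \<in> Hm M" if "u \<in> Hm M" "v \<in> Hm M" for u v
          using that Hcl(2) cl_mult by (auto simp: Hm_def distrib_left)
      qed
    qed
    show "H0 \<subseteq> H" if "H0 \<in> Fam" for H0 using that by (auto simp: Fam_def Hm_def)
    show "\<exists>H0\<in>Fam. V \<subseteq> H0" if V: "finite V" "V \<subseteq> H" for V
    proof -
      define R where "R = (\<lambda>(i, v). cl (b i) v) ` ({..<d} \<times> V)"
      have "finite R" "R \<subseteq> \<rat>" using V cl_rat bS by (auto simp: R_def)
      from real_rational_multiple_int[OF this] obtain M :: nat where M: "M > 0" "\<And>r. r \<in> R \<Longrightarrow> of_nat M * r \<in> \<int>" by blast
      have "V \<subseteq> Hm M" using V M(2) by (force simp: Hm_def R_def)
      then show ?thesis using M(1) by (auto simp: Fam_def)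
    qed
    show "finite {v \<in> H0. \<forall>i<2 * d. lam i v \<le> r}" if F: "H0 \<in> Fam" for H0 and r :: real
    proof -
      obtain M where M: "H0 = Hm M" "M > 0" using F by (auto simp: Fam_def)
      define k where "k = \<lceil>of_nat M * r\<rceil>"
      define key where "key v = restrict (\<lambda>i. \<lfloor>of_nat M * cl (b i) v\<rfloor>) {..<d}" for v
      let ?B = "{v \<in> H0. \<forall>i<2 * d. lam i v \<le> r}"
      have key_eq: "of_nat M * cl (b i) v = of_int (key v i)" if "v \<in> ?B" "i < d" for v i
        using that M by (auto simp: key_def Hm_def)
      have "key ` ?B \<subseteq> {..<d} \<rightarrow>\<^sub>E {-k..k}"
      proof (rule image_subsetI)
        fix v assume v: "v \<in> ?B"
        have "key v i \<in> {-k..k}" if i: "i < d" for i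
        proof -
          have "cl (b i) v \<le> r" "- cl (b i) v \<le> r"
            using v i by (auto simp: lam_def dest: spec[of _ i] spec[of _ "i + d"])
          then have "of_nat M * cl (b i) v \<le> of_nat M * r" "of_nat M * (- cl (b i) v) \<le> of_nat M * r"
            by (intro mult_left_mono; simp)+
          then have "of_int (key v i) \<le> of_nat M * r" "- of_int (key v i) \<le> of_nat M * r"
            using key_eq[OF v i] by simp_all
          then show ?thesis unfolding k_def by (simp, linarith)
        qed
        then show "key v \<in> {..<d} \<rightarrow>\<^sub>E {-k..k}" by (auto simp: key_def)
      qed
      moreover have "finite ({..<d} \<rightarrow>\<^sub>E {-k..k})" by (intro finite_PiE) auto
      moreover have "inj_on key ?B"
      proof (rule inj_onI)
        fix u v assume uv: "u \<in> ?B" "v \<in> ?B" "key u = key v"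
        have uvH: "u \<in> H" "v \<in> H" using uv M by (auto simp: Hm_def)
        have "cl (b i) (u \<otimes> inv v) = 0" if i: "i < d" for i
        proof -
          have "of_nat M * cl (b i) u = of_nat M * cl (b i) v" using key_eq[OF uv(1) i] key_eq[OF uv(2) i] uv(3) by simp
          then show ?thesis using M(2) cl_mult[OF i uvH(1) Hcl(3)[OF uvH(2)]] cl_inv[OF i uvH(2)] by simp
        qed
        then have "cl a (u \<otimes> inv v) = 0" if "a \<in> S" for a
          using that b unfolding bij_betw_def by (metis atLeastLessThan_iff imageE)
        then have "u \<otimes> inv v = \<one>" using uvH Hcl by (intro cl_inj) auto
        then show "u = v" using Hc[OF uvH(1)] Hc[OF uvH(2)] by (metis inv_equality inv_inv inv_closed)
      qed
      ultimately show ?thesis using inj_on_finite by blast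
    qed
    show "\<exists>m. \<forall>H0\<in>Fam. \<exists>\<kappa> :: 'a \<Rightarrow> nat. (\<forall>v\<in>H0. \<kappa> v < m) \<and>
       (\<forall>v\<in>H0. \<forall>w\<in>H0. \<kappa> v = \<kappa> w \<longrightarrow> g \<otimes> (v \<otimes> inv w) \<otimes> inv g \<in> H0)" if g: "g \<in> carrier G" for g
    proof -
      define R where "R = (\<lambda>(i, l). cl (b i) (g \<otimes> b l \<otimes> inv g)) ` ({..<d} \<times> {..<d})"
      have "finite R" "R \<subseteq> \<rat>" using cl_rat bS conj[OF g] bH by (auto simp: R_def)
      from real_rational_multiple_int[OF this] obtain N :: nat where N: "N > 0" "\<And>r. r \<in> R \<Longrightarrow> of_nat N * r \<in> \<int>" by blast
      let ?E = "{..<d} \<rightarrow>\<^sub>E {0..<int N}"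
      have finE: "finite ?E" by (intro finite_PiE) auto
      obtain h where h: "bij_betw h ?E {0..<card ?E}" using ex_bij_betw_finite_nat[OF finE] by blast
      have "\<exists>\<kappa> :: 'a \<Rightarrow> nat. (\<forall>v\<in>H0. \<kappa> v < card ?E) \<and>
         (\<forall>v\<in>H0. \<forall>w\<in>H0. \<kappa> v = \<kappa> w \<longrightarrow> g \<otimes> (v \<otimes> inv w) \<otimes> inv g \<in> H0)" if F: "H0 \<in> Fam" for H0
      proof -
        obtain M where M: "H0 = Hm M" "M > 0" using F by (auto simp: Fam_def)
        define key where "key v = restrict (\<lambda>l. \<lfloor>of_nat M * cl (b l) v\<rfloor> mod int N) {..<d}" for v
        have keyE: "key v \<in> ?E" for v using N(1) by (auto simp: key_def)
        show ?thesis
        proof (intro exI[of _ "\<lambda>v. h (key v)"] conjI ballI impI)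
          fix v show "h (key v) < card ?E" using bij_betwE[OF h] keyE[of v] by auto
        next
          fix v w assume v: "v \<in> H0" and w: "w \<in> H0" and eq: "h (key v) = h (key w)"
          have vH: "v \<in> H" "w \<in> H" using v w M by (auto simp: Hm_def)
          define x where "x = v \<otimes> inv w"
          have xH: "x \<in> H" using vH Hcl by (simp add: x_def)
          have keq: "key v = key w" using bij_betw_imp_inj_on[OF h] keyE eq by (auto dest: inj_onD)
          have div: "\<exists>j :: int. of_nat M * cl (b l) x = of_int (j * int N)" if l: "l < d" for l
          proof -
            have "of_nat M * cl (b l) v \<in> \<int>" "of_nat M * cl (b l) w \<in> \<int>" using v w M l by (auto simp: Hm_def)
            then obtain p q :: int where pq: "of_nat M * cl (b l) v = of_int p" "of_nat M * cl (b l) w = of_int q"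
              by (auto elim!: Ints_cases)
            have "key v l = key w l" using keq by simp
            then have "p mod int N = q mod int N" using l pq by (simp add: key_def)
            then obtain j where j: "p - q = int N * j" by (metis mod_eq_dvd_iff dvdE)
            have "cl (b l) x = cl (b l) v - cl (b l) w"
              unfolding x_def using cl_mult[OF l vH(1) Hcl(3)[OF vH(2)]] cl_inv[OF l vH(2)] by simp
            then have "of_nat M * cl (b l) x = of_int (p - q)" using pq by (simp add: right_diff_distrib)
            then show ?thesis using j by (intro exI[of _ j]) (simp add: mult.commute)
          qed
          have "of_nat M * cl (b i) (g \<otimes> x \<otimes> inv g) \<in> \<int>" if i: "i < d" for i
          proof -
            have "of_nat M * cl (b i) (g \<otimes> x \<otimes> inv g) = (\<Sum>l<d. of_nat M * cl (b l) x * cl (b i) (g \<otimes> b l \<otimes> inv g))"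
              by (simp add: cl_conj_span[OF g xH i] sum_distrib_left mult.assoc)
            also have "\<dots> \<in> \<int>"
            proof (rule Ints_sum)
              fix l assume "l \<in> {..<d}"
              then have l: "l < d" by simp
              obtain j :: int where j: "of_nat M * cl (b l) x = of_int (j * int N)" using div[OF l] by blast
              have "of_nat N * cl (b i) (g \<otimes> b l \<otimes> inv g) \<in> \<int>" using i l by (intro N(2)) (force simp: R_def)
              then have "of_int j * (of_nat N * cl (b i) (g \<otimes> b l \<otimes> inv g)) \<in> \<int>" by simp
              then show "of_nat M * cl (b l) x * cl (b i) (g \<otimes> b l \<otimes> inv g) \<in> \<int>"
                unfolding j by (simp add: mult.assoc)
            qed
            finally show ?thesis .
          qed
          then show "g \<otimes> (v \<otimes> inv w) \<otimes> inv g \<in> H0"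
            using conj[OF g xH] unfolding M Hm_def x_def by simp
        qed
      qed
      then show ?thesis by blast
    qed
  qed
  then show ?thesis by blast
qed

section \<open>The lamplighter group\<close>

lemma lamplighter_carrier:
  "u \<in> carrier lamplighter_group \<longleftrightarrow> (\<forall>x. fst u x = 0 \<or> fst u x = 1) \<and> finite {x. fst u x \<noteq> 0}"
proof -
  have "k \<in> {0..<2} \<longleftrightarrow> k = 0 \<or> k = (1 :: int)" for k by auto
  then show ?thesis
    by (cases u) (auto simp: lamplighter_group_def restricted_wreath_product_def carrier_sum_group
        carrier_integer_mod_group PiE_iff)
qed

lemma lamplighter_mult:
  "u \<otimes>\<^bsub>lamplighter_group\<^esub> v = (\<lambda>x. (fst u x + fst v (x - snd u)) mod 2, snd u + snd v)"
  by (simp add: lamplighter_group_def restricted_wreath_product_def case_prod_unfold mult_integer_mod_group restrict_def)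

lemma lamplighter_one: "\<one>\<^bsub>lamplighter_group\<^esub> = (\<lambda>x. 0, 0)"
  by (simp add: lamplighter_group_def restricted_wreath_product_def restrict_def)

text \<open>
  The integers, as an extension of the trivial group, with intervals as boxes.
\<close>

lemma finite_rule_dimension_integers: "finite_rule_dimension integer_group"
proof -
  interpret Z: group integer_group by simp
  let ?T = "\<lparr>carrier = {()}, monoid.mult = (\<lambda>_ _. ()), one = ()\<rparr>"
  have T: "group ?T" by (rule groupI) auto
  have fT: "finite_rule_dimension ?T" by (rule group.finite_rule_dimension_trivial[OF T]) simp
  define lam where "lam i v = (if i = 0 then 1 else - 1) * real_of_int v" for i :: nat and v
  have "tame_subgroup integer_group UNIV 2 1 lam {UNIV}"
  proof (intro tame_subgroup.intro tame_subgroup_axioms.intro Z.is_group)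
    show "UNIV \<lhd> integer_group"
      using Z.normal_self by simp
    show "lam i (u \<otimes>\<^bsub>integer_group\<^esub> v) = lam i u + lam i v" for i u v by (simp add: lam_def algebra_simps)
    show "\<exists>j<2. \<forall>v\<in>UNIV. lam j v = - lam i v" for i
      by (rule exI[of _ "if i = 0 then 1 else 0"]) (simp add: lam_def)
    show "\<exists>\<sigma>\<ge>0. \<forall>v\<in>UNIV. \<forall>r. (\<forall>i<2. lam i v \<le> r) \<longrightarrow>
        (\<forall>i<2. lam i (g \<otimes>\<^bsub>integer_group\<^esub> v \<otimes>\<^bsub>integer_group\<^esub> inv\<^bsub>integer_group\<^esub> g) \<le> \<sigma> * r)" for g
      by (rule exI[of _ 1]) simp
    show "\<exists>\<alpha>. (\<exists>j\<le>1. \<alpha> j \<noteq> 0) \<and> (\<forall>v\<in>UNIV. (\<Sum>j\<le>1. \<alpha> j *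
        lam (e j) (t j \<otimes>\<^bsub>integer_group\<^esub> v \<otimes>\<^bsub>integer_group\<^esub> inv\<^bsub>integer_group\<^esub> t j)) = 0)" for t and e :: "nat \<Rightarrow> nat"
      by (rule exI[of _ "\<lambda>j. if j = 0 then if e 1 = 0 then 1 else - 1 else if e 0 = 0 then - 1 else 1"])
        (auto simp: lam_def)
    show "\<exists>v\<in>UNIV. lam i v \<noteq> 0" for i by (rule bexI[of _ 1]) (simp_all add: lam_def)
    show "subgroup H0 integer_group" if "H0 \<in> {UNIV}" for H0
      using Z.subgroup_self that by simp
    show "\<exists>H0\<in>{UNIV}. V \<subseteq> H0" for V :: "int set" by simp
    show "finite {v \<in> H0. \<forall>i<2. lam i v \<le> r}" for H0 r
    proof (rule finite_subset)
      show "{v \<in> H0. \<forall>i<2. lam i v \<le> r} \<subseteq> {- \<lceil>r\<rceil>..\<lceil>r\<rceil>}"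
      proof
        fix v assume "v \<in> {v \<in> H0. \<forall>i<2. lam i v \<le> r}"
        then have "lam 0 v \<le> r" "lam 1 v \<le> r" by auto
        then show "v \<in> {- \<lceil>r\<rceil>..\<lceil>r\<rceil>}" by (simp add: lam_def) linarith
      qed
    qed simp
    show "\<exists>m. \<forall>H0\<in>{UNIV}. \<exists>\<kappa> :: int \<Rightarrow> nat. (\<forall>v\<in>H0. \<kappa> v < m) \<and> (\<forall>v\<in>H0. \<forall>w\<in>H0. \<kappa> v = \<kappa> w \<longrightarrow>
        g \<otimes>\<^bsub>integer_group\<^esub> (v \<otimes>\<^bsub>integer_group\<^esub> inv\<^bsub>integer_group\<^esub> w) \<otimes>\<^bsub>integer_group\<^esub> inv\<^bsub>integer_group\<^esub> g \<in> H0)" for g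
      by (intro exI[of _ 1] ballI exI[of _ "\<lambda>_. 0"]) simp
  qed simp_all
  then show ?thesis
    by (rule tame_subgroup.finite_rule_dimension_extension[OF _ T, of _ _ _ _ _ _ "\<lambda>_. ()"])
      (use fT in \<open>auto simp: hom_def kernel_def\<close>)
qed

text \<open>
  The kernel of the projection to the integers is the union of the finite groups \<open>F n\<close> of the
  configurations supported in \<open>{-n..n}\<close>. They are not invariant, since conjugation by \<open>g\<close> shifts
  configurations by \<open>snd g\<close>. It pushes out of \<open>{-n..n}\<close> at most \<open>\<bar>snd g\<bar>\<close> positions, collected in
  \<open>E\<close>, so the restriction to \<open>E\<close> labels the cosets of the subgroup of configurations that stay
  inside, with a number of labels independent of \<open>n\<close>.
\<close>

lemma finite_rule_dimension_lamplighter: "finite_rule_dimension lamplighter_group"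
proof -
  interpret L: group lamplighter_group by (rule group_lamplighter_group)
  note Lc = lamplighter_carrier and Lm = lamplighter_mult and L1 = lamplighter_one
  have hom: "snd \<in> hom lamplighter_group integer_group" by (auto simp: hom_def Lm)
  interpret h: group_hom lamplighter_group integer_group snd
    using hom L.is_group by (simp add: group_hom_def group_hom_axioms_def)
  define H where "H = kernel lamplighter_group integer_group snd"
  have H: "u \<in> H \<longleftrightarrow> u \<in> carrier lamplighter_group \<and> snd u = 0" for u by (simp add: H_def kernel_def)
  have HN: "H \<lhd> lamplighter_group" unfolding H_def by (rule h.normal_kernel)
  have mod2: "(a + a) mod 2 = 0" for a :: int by simp
  have H_inv: "inv\<^bsub>lamplighter_group\<^esub> u = u" if "u \<in> H" for u
  proof (rule L.inv_equality)
    show "u \<otimes>\<^bsub>lamplighter_group\<^esub> u = \<one>\<^bsub>lamplighter_group\<^esub>" using that by (simp add: Lm L1 H)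
  qed (use that H in auto)
  define F where "F n = {u \<in> H. \<forall>x. n < \<bar>x\<bar> \<longrightarrow> fst u x = 0}" for n :: int
  have F_sub: "subgroup (F n) lamplighter_group" for n
  proof (rule L.subgroupI)
    show "F n \<subseteq> carrier lamplighter_group" by (auto simp: F_def H)
    show "F n \<noteq> {}" using L.one_closed by (auto simp: F_def H L1 intro!: exI[of _ "\<lambda>x. 0"])
    show "inv\<^bsub>lamplighter_group\<^esub> u \<in> F n" if "u \<in> F n" for u using that H_inv by (auto simp: F_def)
    show "u \<otimes>\<^bsub>lamplighter_group\<^esub> v \<in> F n" if "u \<in> F n" "v \<in> F n" for u v
    proof -
      have "u \<otimes>\<^bsub>lamplighter_group\<^esub> v \<in> carrier lamplighter_group" using that by (intro L.m_closed) (auto simp: F_def H)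
      then show ?thesis using that by (auto simp: F_def H Lm)
    qed
  qed
  have F_fin: "finite (F n)" for n
  proof (rule inj_on_finite)
    show "inj_on (\<lambda>u. restrict (fst u) {-n..n}) (F n)"
    proof (rule inj_onI)
      fix u v assume uv: "u \<in> F n" "v \<in> F n" and eq: "restrict (fst u) {-n..n} = restrict (fst v) {-n..n}"
      have "fst u x = fst v x" for x
      proof (cases "n < \<bar>x\<bar>")
        case True then show ?thesis using uv by (simp add: F_def)
      next
        case False
        have "restrict (fst u) {-n..n} x = restrict (fst v) {-n..n} x" using eq by simp
        moreover have "x \<in> {-n..n}" using False by auto
        ultimately show ?thesis by simp
      qed
      then show "u = v" using uv by (auto simp: F_def H prod_eq_iff)
    qed
    show "(\<lambda>u. restrict (fst u) {-n..n}) ` F n \<subseteq> {-n..n} \<rightarrow>\<^sub>E {0, 1}" by (auto simp: F_def H Lc)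
    show "finite ({-n..n} \<rightarrow>\<^sub>E {0, 1 :: int})" by (intro finite_PiE) auto
  qed
  have F_cof: "\<exists>H0\<in>range F. V \<subseteq> H0" if V: "finite V" "V \<subseteq> H" for V
  proof -
    define X where "X = (\<Union>u\<in>V. {x. fst u x \<noteq> 0})"
    have "finite X" unfolding X_def using V by (auto simp: H Lc)
    then have "finite (abs ` X)" by simp
    then obtain n where n: "\<And>x. x \<in> abs ` X \<Longrightarrow> x \<le> n" using finite_has_maximal2 bdd_above_finite by (metis bdd_above_def)
    have "fst u x = 0" if "u \<in> V" "n < \<bar>x\<bar>" for u x
    proof (rule ccontr)
      assume "fst u x \<noteq> 0"
      then have "x \<in> X" using that by (auto simp: X_def)
      then show False using n[of "\<bar>x\<bar>"] that by auto
    qed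
    then have "V \<subseteq> F n" using V by (auto simp: F_def)
    then show ?thesis by blast
  qed
  have F_conj: "\<exists>m. \<forall>H0\<in>range F. \<exists>\<kappa> :: _ \<Rightarrow> nat. (\<forall>v\<in>H0. \<kappa> v < m) \<and> (\<forall>v\<in>H0. \<forall>w\<in>H0. \<kappa> v = \<kappa> w \<longrightarrow>
       g \<otimes>\<^bsub>lamplighter_group\<^esub> (v \<otimes>\<^bsub>lamplighter_group\<^esub> inv\<^bsub>lamplighter_group\<^esub> w) \<otimes>\<^bsub>lamplighter_group\<^esub> inv\<^bsub>lamplighter_group\<^esub> g \<in> H0)"
    if g: "g \<in> carrier lamplighter_group" for g
  proof (intro exI[of _ "2 ^ nat \<bar>snd g\<bar>"] ballI)
    fix H0 assume "H0 \<in> range F"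
    then obtain n where n: "H0 = F n" by auto
    define b where "b = snd g"
    define E where "E = {x. \<bar>x\<bar> \<le> n \<and> n < \<bar>x + b\<bar>}"
    have Esub: "E \<subseteq> (if 0 \<le> b then {n - b + 1..n} else {- n..- n - b - 1})" by (auto simp: E_def)
    have finE: "finite E" by (rule finite_subset[OF Esub]) simp
    have "card E \<le> card (if 0 \<le> b then {n - b + 1..n} else {- n..- n - b - 1})"
      by (rule card_mono[OF _ Esub]) simp
    also have "\<dots> = nat \<bar>b\<bar>" by simp
    finally have cardE: "card E \<le> nat \<bar>b\<bar>" .
    let ?P = "E \<rightarrow>\<^sub>E {0, 1 :: int}"
    have finP: "finite ?P" using finE by (intro finite_PiE) auto
    have "card ?P = 2 ^ card E" using finE by (simp add: card_PiE numeral_2_eq_2)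
    also have "\<dots> \<le> 2 ^ nat \<bar>b\<bar>" using cardE by (intro power_increasing) auto
    finally have cardP: "card ?P \<le> 2 ^ nat \<bar>b\<bar>" .
    obtain h where h: "bij_betw h ?P {0..<card ?P}" using ex_bij_betw_finite_nat[OF finP] by blast
    define key where "key v = restrict (fst v) E" for v :: "(int \<Rightarrow> int) \<times> int"
    have keyP: "key v \<in> ?P" if "v \<in> F n" for v using that by (auto simp: key_def F_def H Lc)
    show "\<exists>\<kappa> :: _ \<Rightarrow> nat. (\<forall>v\<in>H0. \<kappa> v < 2 ^ nat \<bar>snd g\<bar>) \<and> (\<forall>v\<in>H0. \<forall>w\<in>H0. \<kappa> v = \<kappa> w \<longrightarrow>
       g \<otimes>\<^bsub>lamplighter_group\<^esub> (v \<otimes>\<^bsub>lamplighter_group\<^esub> inv\<^bsub>lamplighter_group\<^esub> w) \<otimes>\<^bsub>lamplighter_group\<^esub> inv\<^bsub>lamplighter_group\<^esub> g \<in> H0)"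
    proof (intro exI[of _ "\<lambda>v. h (key v)"] conjI ballI impI)
      fix v assume "v \<in> H0"
      then have "h (key v) \<in> {0..<card ?P}" using bij_betwE[OF h] keyP n by blast
      then show "h (key v) < 2 ^ nat \<bar>snd g\<bar>" using cardP by (simp add: b_def)
    next
      fix v w assume vw: "v \<in> H0" "w \<in> H0" and eq: "h (key v) = h (key w)"
      have vF: "v \<in> F n" "w \<in> F n" using vw n by auto
      have vH: "v \<in> H" "w \<in> H" using vF by (auto simp: F_def)
      have keq: "key v = key w"
        using bij_betw_imp_inj_on[OF h] keyP[OF vF(1)] keyP[OF vF(2)] eq by (auto dest: inj_onD)
      define x where "x = v \<otimes>\<^bsub>lamplighter_group\<^esub> w"
      have xeq: "v \<otimes>\<^bsub>lamplighter_group\<^esub> inv\<^bsub>lamplighter_group\<^esub> w = x" by (simp add: x_def H_inv[OF vH(2)])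
      have xc: "x \<in> carrier lamplighter_group" using vH by (simp add: x_def H)
      have sx: "snd x = 0" using vH by (simp add: x_def Lm H)
      have x0: "fst x y = 0" if "n < \<bar>y\<bar> \<or> y \<in> E" for y
      proof -
        have "fst v y = fst w y"
        proof (cases "y \<in> E")
          case True
          have "restrict (fst v) E y = restrict (fst w) E y" using keq by (simp add: key_def)
          then show ?thesis using True by simp
        next
          case False then show ?thesis using that vF by (simp add: F_def)
        qed
        then show ?thesis using vH by (simp add: x_def Lm H)
      qed
      define c where "c = g \<otimes>\<^bsub>lamplighter_group\<^esub> x \<otimes>\<^bsub>lamplighter_group\<^esub> inv\<^bsub>lamplighter_group\<^esub> g"
      have cc: "c \<in> carrier lamplighter_group" using g xc by (simp add: c_def)
      have cg: "c \<otimes>\<^bsub>lamplighter_group\<^esub> g = g \<otimes>\<^bsub>lamplighter_group\<^esub> x" using g xc by (simp add: c_def L.m_assoc)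
      have sc: "snd c = 0" using arg_cong[OF cg, of snd] sx by (simp add: Lm)
      have fc: "fst c y = fst x (y - b)" for y
      proof -
        have "(fst c y + fst g y) mod 2 = (fst g y + fst x (y - b)) mod 2"
          using arg_cong[OF cg, of "\<lambda>u. fst u y"] sc by (simp add: Lm b_def)
        moreover have "fst c y = 0 \<or> fst c y = 1" "fst x (y - b) = 0 \<or> fst x (y - b) = 1" "fst g y = 0 \<or> fst g y = 1"
          using cc xc g by (auto simp: Lc)
        ultimately show ?thesis by auto
      qed
      have "fst c y = 0" if y: "n < \<bar>y\<bar>" for y
      proof -
        have "n < \<bar>y - b\<bar> \<or> y - b \<in> E" using y by (auto simp: E_def)
        then show ?thesis using x0 fc by simp
      qed
      then show "g \<otimes>\<^bsub>lamplighter_group\<^esub> (v \<otimes>\<^bsub>lamplighter_group\<^esub> inv\<^bsub>lamplighter_group\<^esub> w) \<otimes>\<^bsub>lamplighter_group\<^esub> inv\<^bsub>lamplighter_group\<^esub> g \<in> H0"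
        unfolding xeq n using cc sc by (simp add: F_def H c_def)
    qed
  qed
  have "tame_subgroup lamplighter_group H 0 0 (\<lambda>_ _. 0) (range F)"
    by (rule L.tame_locally_finite[OF HN]) (use F_sub F_fin F_cof F_conj in \<open>auto simp: F_def\<close>)
  moreover have "snd ` carrier lamplighter_group = carrier integer_group"
  proof -
    have "(\<lambda>x. 0, b) \<in> carrier lamplighter_group" for b by (simp add: Lc)
    then show ?thesis by force
  qed
  ultimately show ?thesis
    by (intro tame_subgroup.finite_rule_dimension_extension[OF _ _ hom _ H_def])
      (simp_all add: finite_rule_dimension_integers)
qed

section \<open>Normal series\<close>

text \<open>
  An isomorphism is an extension whose kernel, being finite, is tame.
\<close>

lemma finite_rule_dimension_injective:
  assumes G: "group G" and Q: "group Q" and hom: "\<pi> \<in> hom G Q" and surj: "\<pi> ` carrier G = carrier Q"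
    and ker: "kernel G Q \<pi> = {\<one>\<^bsub>G\<^esub>}" and c: "countable (carrier Q)" and fQ: "finite_rule_dimension Q"
  shows "finite_rule_dimension G"
proof -
  interpret G: group G by (rule G)
  have "tame_subgroup G {\<one>\<^bsub>G\<^esub>} 0 0 (\<lambda>_ _. 0) {{\<one>\<^bsub>G\<^esub>}}"
    by (rule G.tame_locally_finite) (auto intro: G.triv_subgroup G.one_is_normal exI[of _ 1] exI[of _ "\<lambda>_. 0"])
  then show ?thesis by (rule tame_subgroup.finite_rule_dimension_extension[OF _ Q hom surj ker[symmetric] c fQ])
qed

text \<open>
  The factor \<open>N k / N (k + 1)\<close> is the kernel of \<open>G / N (k + 1) \<rightarrow> G / N k\<close>. Conjugation restricts
  to an automorphism of it, so characteristic subgroups of the factor are invariant under all of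
  \<open>G / N (k + 1)\<close>, and one label for their cosets suffices.
\<close>

lemma series_step:
  fixes G :: "'g monoid"
  assumes G: "group G" and cG: "countable (carrier G)" and N0: "N k \<lhd> G" and N1: "N (Suc k) \<lhd> G"
    and sub: "N (Suc k) \<subseteq> N k" and f: "finite_rule_dimension (G Mod N k)"
    and adm: "admissible_factor (series_factor G N k)"
  shows "finite_rule_dimension (G Mod N (Suc k))"
proof -
  interpret G: group G by (rule G)
  interpret N0: normal "N k" G by (rule N0)
  interpret N1: normal "N (Suc k)" G by (rule N1)
  let ?GG = "G Mod N (Suc k)" and ?Q = "G Mod N k"
  interpret GG: group ?GG by (rule N1.factorgroup_is_group)
  interpret Q: group ?Q by (rule N0.factorgroup_is_group)
  define \<pi> where "\<pi> C = N k <#>\<^bsub>G\<^esub> C" for C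
  have cGG: "C \<in> carrier ?GG \<longleftrightarrow> (\<exists>a\<in>carrier G. C = N (Suc k) #>\<^bsub>G\<^esub> a)" for C
    by (auto simp: FactGroup_def RCOSETS_def)
  have cQ: "C \<in> carrier ?Q \<longleftrightarrow> (\<exists>a\<in>carrier G. C = N k #>\<^bsub>G\<^esub> a)" for C
    by (auto simp: FactGroup_def RCOSETS_def)
  have \<pi>: "\<pi> (N (Suc k) #>\<^bsub>G\<^esub> a) = N k #>\<^bsub>G\<^esub> a" if a: "a \<in> carrier G" for a
  proof (intro equalityI subsetI)
    fix z assume "z \<in> \<pi> (N (Suc k) #>\<^bsub>G\<^esub> a)"
    then obtain x y where xy: "x \<in> N k" "y \<in> N (Suc k)" "z = x \<otimes>\<^bsub>G\<^esub> (y \<otimes>\<^bsub>G\<^esub> a)"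
      by (auto simp: \<pi>_def set_mult_def r_coset_def)
    then have "z = (x \<otimes>\<^bsub>G\<^esub> y) \<otimes>\<^bsub>G\<^esub> a" using a by (simp add: G.m_assoc)
    moreover have "x \<otimes>\<^bsub>G\<^esub> y \<in> N k" using xy sub by auto
    ultimately show "z \<in> N k #>\<^bsub>G\<^esub> a" by (auto simp: r_coset_def)
  next
    fix z assume "z \<in> N k #>\<^bsub>G\<^esub> a"
    then obtain x where x: "x \<in> N k" "z = x \<otimes>\<^bsub>G\<^esub> a" by (auto simp: r_coset_def)
    then have "z = x \<otimes>\<^bsub>G\<^esub> (\<one>\<^bsub>G\<^esub> \<otimes>\<^bsub>G\<^esub> a)" using a by simp
    moreover have "\<one>\<^bsub>G\<^esub> \<otimes>\<^bsub>G\<^esub> a \<in> N (Suc k) #>\<^bsub>G\<^esub> a" using N1.one_closed by (rule G.rcosI) (use a N1.subset in auto)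
    ultimately show "z \<in> \<pi> (N (Suc k) #>\<^bsub>G\<^esub> a)" using x(1) unfolding \<pi>_def set_mult_def by blast
  qed
  have hom: "\<pi> \<in> hom ?GG ?Q"
  proof (rule homI)
    fix C assume "C \<in> carrier ?GG" then show "\<pi> C \<in> carrier ?Q" using \<pi> by (auto simp: cGG cQ)
  next
    fix C D assume "C \<in> carrier ?GG" "D \<in> carrier ?GG"
    then obtain a b where ab: "a \<in> carrier G" "b \<in> carrier G" "C = N (Suc k) #>\<^bsub>G\<^esub> a" "D = N (Suc k) #>\<^bsub>G\<^esub> b"
      by (auto simp: cGG)
    have "C \<otimes>\<^bsub>?GG\<^esub> D = N (Suc k) #>\<^bsub>G\<^esub> (a \<otimes>\<^bsub>G\<^esub> b)" using ab by (simp add: FactGroup_def N1.rcos_sum)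
    moreover have "\<pi> C \<otimes>\<^bsub>?Q\<^esub> \<pi> D = N k #>\<^bsub>G\<^esub> (a \<otimes>\<^bsub>G\<^esub> b)" using ab \<pi> by (simp add: FactGroup_def N0.rcos_sum)
    ultimately show "\<pi> (C \<otimes>\<^bsub>?GG\<^esub> D) = \<pi> C \<otimes>\<^bsub>?Q\<^esub> \<pi> D" using ab \<pi> by simp
  qed
  have surj: "\<pi> ` carrier ?GG = carrier ?Q"
  proof (intro equalityI subsetI)
    fix C assume "C \<in> \<pi> ` carrier ?GG" then show "C \<in> carrier ?Q" using hom by (auto simp: hom_def)
  next
    fix C assume "C \<in> carrier ?Q"
    then obtain a where a: "a \<in> carrier G" "C = N k #>\<^bsub>G\<^esub> a" by (auto simp: cQ)
    then show "C \<in> \<pi> ` carrier ?GG" using \<pi>[OF a(1)] by (intro image_eqI[of _ _ "N (Suc k) #>\<^bsub>G\<^esub> a"]) (auto simp: cGG)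
  qed
  have one_Q: "\<one>\<^bsub>?Q\<^esub> = N k" by (simp add: FactGroup_def)
  have in_N: "N k #>\<^bsub>G\<^esub> a = N k \<longleftrightarrow> a \<in> N k" if "a \<in> carrier G" for a
    using that G.coset_join1[OF _ that N0.subgroup_axioms] G.coset_join2[OF that N0.subgroup_axioms] by blast
  define H where "H = kernel ?GG ?Q \<pi>"
  have H: "C \<in> H \<longleftrightarrow> (\<exists>a\<in>N k. C = N (Suc k) #>\<^bsub>G\<^esub> a)" for C
  proof
    assume "C \<in> H"
    then obtain a where a: "a \<in> carrier G" "C = N (Suc k) #>\<^bsub>G\<^esub> a" "\<pi> C = N k" by (auto simp: H_def kernel_def cGG one_Q)
    then show "\<exists>a\<in>N k. C = N (Suc k) #>\<^bsub>G\<^esub> a" using \<pi>[OF a(1)] in_N[OF a(1)] by auto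
  next
    assume "\<exists>a\<in>N k. C = N (Suc k) #>\<^bsub>G\<^esub> a"
    then obtain a where a: "a \<in> N k" "C = N (Suc k) #>\<^bsub>G\<^esub> a" by auto
    have ac: "a \<in> carrier G" using a N0.subset by auto
    then show "C \<in> H" using a \<pi>[OF ac] in_N[OF ac] by (auto simp: H_def kernel_def cGG one_Q)
  qed
  interpret h: group_hom ?GG ?Q \<pi>
    using hom GG.is_group Q.is_group by (simp add: group_hom_def group_hom_axioms_def)
  have HN: "H \<lhd> ?GG" unfolding H_def by (rule h.normal_kernel)
  have subH: "subgroup H ?GG" using HN by (simp add: normal_def)
  have fac: "series_factor G N k = ?GG\<lparr>carrier := H\<rparr>"
  proof -
    have "carrier (series_factor G N k) = H" using H by (auto simp: FactGroup_def RCOSETS_def r_coset_def)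
    then show ?thesis by (simp add: FactGroup_def set_mult_def fun_eq_iff)
  qed
  have cQc: "countable (carrier ?Q)"
  proof -
    have "carrier ?Q = (\<lambda>a. N k #>\<^bsub>G\<^esub> a) ` carrier G" using cQ by blast
    then show ?thesis using cG by simp
  qed
  have "\<exists>f d lam Fam. tame_subgroup ?GG H f d lam Fam"
  proof -
    have char: "\<exists>f d lam Fam. tame_subgroup ?GG H f d lam Fam" if "incr_union_finite_characteristic (?GG\<lparr>carrier := H\<rparr>)"
    proof -
      from that obtain K where K: "incseq K" "\<And>i. finite (K i)"
        "\<And>i. characteristic_subgroup (K i) (?GG\<lparr>carrier := H\<rparr>)" "(\<Union>i. K i) = H"
        unfolding incr_union_finite_characteristic_def by auto
      have sub: "subgroup (K i) ?GG" for i
        using GG.incl_subgroup[OF subH] K(3) by (auto simp: characteristic_subgroup_def)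
      have inv: "g \<otimes>\<^bsub>?GG\<^esub> v \<otimes>\<^bsub>?GG\<^esub> inv\<^bsub>?GG\<^esub> g \<in> K i" if g: "g \<in> carrier ?GG" and v: "v \<in> K i" for g v i
      proof -
        define cj where "cj g v = g \<otimes>\<^bsub>?GG\<^esub> v \<otimes>\<^bsub>?GG\<^esub> inv\<^bsub>?GG\<^esub> g" for g v
        have Hc: "v \<in> carrier ?GG" if "v \<in> H" for v by (rule subgroup.mem_carrier[OF subH that])
        have cjH: "cj g v \<in> H" if "g \<in> carrier ?GG" "v \<in> H" for g v
          unfolding cj_def by (rule normal.inv_op_closed2[OF HN that])
        have cancel: "cj (inv\<^bsub>?GG\<^esub> g) (cj g v) = v" if "g \<in> carrier ?GG" "v \<in> H" for g v
          using that(1) Hc[OF that(2)] unfolding cj_def by (simp only: GG.m_assoc GG.inv_cancel GG.inv_closed GG.m_closed GG.inv_inv GG.l_inv GG.r_one)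
        have "cj g \<in> iso (?GG\<lparr>carrier := H\<rparr>) (?GG\<lparr>carrier := H\<rparr>)"
        proof (rule isoI)
          show "cj g \<in> hom (?GG\<lparr>carrier := H\<rparr>) (?GG\<lparr>carrier := H\<rparr>)"
          proof (rule homI)
            fix u v assume "u \<in> carrier (?GG\<lparr>carrier := H\<rparr>)" "v \<in> carrier (?GG\<lparr>carrier := H\<rparr>)"
            then have "u \<in> carrier ?GG" "v \<in> carrier ?GG" using Hc by auto
            then have "cj g (u \<otimes>\<^bsub>?GG\<^esub> v) = cj g u \<otimes>\<^bsub>?GG\<^esub> cj g v"
              using g unfolding cj_def by (simp only: GG.m_assoc GG.inv_cancel GG.inv_closed GG.m_closed)
            then show "cj g (u \<otimes>\<^bsub>?GG\<lparr>carrier := H\<rparr>\<^esub> v) = cj g u \<otimes>\<^bsub>?GG\<lparr>carrier := H\<rparr>\<^esub> cj g v" by simp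
          qed (use cjH[OF g] in simp)
          show "bij_betw (cj g) (carrier (?GG\<lparr>carrier := H\<rparr>)) (carrier (?GG\<lparr>carrier := H\<rparr>))"
            by (rule bij_betw_byWitness[where f' = "cj (inv\<^bsub>?GG\<^esub> g)"])
              (use cjH[OF g] cjH[OF GG.inv_closed[OF g]] cancel[OF g] cancel[OF GG.inv_closed[OF g]] g in auto)
        qed
        then have "cj g ` K i = K i" using K(3)[of i] by (auto simp: characteristic_subgroup_def)
        then show ?thesis using v unfolding cj_def by blast
      qed
      have "tame_subgroup ?GG H 0 0 (\<lambda>_ _. 0) (range K)"
      proof (rule GG.tame_locally_finite[OF HN])
        show "subgroup H0 ?GG" "H0 \<subseteq> H" "finite H0" if "H0 \<in> range K" for H0 using that sub K by auto
        show "\<exists>H0\<in>range K. V \<subseteq> H0" if V: "finite V" "V \<subseteq> H" for V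
          using V
        proof (induction V rule: finite_induct)
          case (insert v V)
          then obtain i j where "V \<subseteq> K i" "v \<in> K j" using K(4) by auto
          moreover have "K i \<subseteq> K (max i j)" "K j \<subseteq> K (max i j)" using K(1) by (auto simp: incseq_def)
          ultimately have "insert v V \<subseteq> K (max i j)" by blast
          then show ?case by blast
        qed simp
        show "\<exists>m. \<forall>H0\<in>range K. \<exists>\<kappa> :: _ \<Rightarrow> nat. (\<forall>v\<in>H0. \<kappa> v < m) \<and> (\<forall>v\<in>H0. \<forall>w\<in>H0. \<kappa> v = \<kappa> w \<longrightarrow>
            g \<otimes>\<^bsub>?GG\<^esub> (v \<otimes>\<^bsub>?GG\<^esub> inv\<^bsub>?GG\<^esub> w) \<otimes>\<^bsub>?GG\<^esub> inv\<^bsub>?GG\<^esub> g \<in> H0)" if g: "g \<in> carrier ?GG" for g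
        proof (intro exI[of _ 1] ballI exI[of _ "\<lambda>_. 0"] conjI impI)
          fix H0 v w assume "H0 \<in> range K" "v \<in> H0" "w \<in> H0"
          then obtain i where i: "H0 = K i" "v \<in> K i" "w \<in> K i" by auto
          have "v \<otimes>\<^bsub>?GG\<^esub> inv\<^bsub>?GG\<^esub> w \<in> K i"
            using subgroup.m_closed[OF sub i(2) subgroup.m_inv_closed[OF sub i(3)]] .
          then show "g \<otimes>\<^bsub>?GG\<^esub> (v \<otimes>\<^bsub>?GG\<^esub> inv\<^bsub>?GG\<^esub> w) \<otimes>\<^bsub>?GG\<^esub> inv\<^bsub>?GG\<^esub> g \<in> H0"
            unfolding i(1) by (rule inv[OF g])
        qed simp
      qed
      then show ?thesis by blast
    qed
    from adm consider "finite H" | "incr_union_finite_characteristic (?GG\<lparr>carrier := H\<rparr>)"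
      | "comm_group (?GG\<lparr>carrier := H\<rparr>)" "torsion_free (?GG\<lparr>carrier := H\<rparr>)" "finite_rat_rank (?GG\<lparr>carrier := H\<rparr>)"
      unfolding admissible_factor_def fac by auto
    then show ?thesis
    proof cases
      case 1
      have gH: "group (?GG\<lparr>carrier := H\<rparr>)" by (rule subgroup.subgroup_is_group[OF subH GG.is_group])
      have "subgroup H (?GG\<lparr>carrier := H\<rparr>)" using group.subgroup_self[OF gH] by simp
      moreover have "f ` H = H" if "f \<in> iso (?GG\<lparr>carrier := H\<rparr>) (?GG\<lparr>carrier := H\<rparr>)" for f
        using that by (auto simp: iso_def bij_betw_def)
      ultimately have "incr_union_finite_characteristic (?GG\<lparr>carrier := H\<rparr>)"
        using 1 unfolding incr_union_finite_characteristic_def characteristic_subgroup_def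
        by (intro exI[of _ "\<lambda>_. H"]) (auto simp: incseq_def)
      then show ?thesis by (rule char)
    next
      case 2 then show ?thesis by (rule char)
    next
      case 3 then show ?thesis by (rule GG.tame_torsion_free_finite_rank[OF HN])
    qed
  qed
  then obtain f d lam Fam where tame: "tame_subgroup ?GG H f d lam Fam" by blast
  show ?thesis
    by (rule tame_subgroup.finite_rule_dimension_extension[OF tame Q.is_group hom surj H_def cQc f])
qed

theorem corollary1p8:
  fixes G :: "'g monoid"
    and N :: "nat \<Rightarrow> 'g set"
    and n :: nat
    and X :: "'x measure"
    and \<phi> :: "'g \<Rightarrow> 'x \<Rightarrow> 'x"
  assumes "group G" and "countable (carrier G)"
    and "normal_series G n N"
    and "\<And>k. k < n \<Longrightarrow>
           admissible_factor (series_factor G N k) \<or>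
           (k = 0 \<and> admissible_top_alternative (series_factor G N k))"
    and "standard_borel_space X"
    and "borel_action G X \<phi>"
    and "free_action G (space X) \<phi>"
  shows "hyperfinite X (orbit_equiv_rel G (space X) \<phi>)"
proof -
  interpret G: group G by (rule assms(1))
  have N0: "N 0 = carrier G" and Nn: "N n = {\<one>\<^bsub>G\<^esub>}" and NN: "\<And>k. k \<le> n \<Longrightarrow> N k \<lhd> G"
    and Nsub: "\<And>k. k < n \<Longrightarrow> N (Suc k) \<subseteq> N k"
    using assms(3) by (auto simp: normal_series_def)
  have quot: "finite_rule_dimension (G Mod N k)" if "k \<le> n" for k
    using that
  proof (induction k)
    case 0
    have "group (G Mod N 0)" by (rule normal.factorgroup_is_group[OF NN]) simp
    moreover have "carrier (G Mod N 0) = {\<one>\<^bsub>G Mod N 0\<^esub>}"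
      using G.coset_join2[OF _ G.subgroup_self] G.one_closed by (auto simp: N0 FactGroup_def RCOSETS_def)
    ultimately show ?case by (rule group.finite_rule_dimension_trivial)
  next
    case (Suc k)
    have gr: "group (G Mod N (Suc k))" by (rule normal.factorgroup_is_group[OF NN[OF Suc.prems]])
    have k: "k < n" using Suc.prems by simp
    from assms(4)[OF k] consider "admissible_factor (series_factor G N k)"
      | "k = 0" "admissible_top_alternative (series_factor G N 0)" by blast
    then show ?case
    proof cases
      case 1
      show ?thesis
        by (rule series_step[where N = N and k = k, OF assms(1,2) NN NN Nsub Suc.IH 1]) (use k in simp_all)
    next
      case 2
      have top: "series_factor G N 0 = G Mod N (Suc k)" by (simp add: N0 2(1))
      from 2(2) consider "uniform_local_polynomial_growth (G Mod N (Suc k))" | "(G Mod N (Suc k)) \<cong> lamplighter_group"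
        unfolding admissible_top_alternative_def top by blast
      then show ?thesis
      proof cases
        case 1 then show ?thesis by (rule group.finite_rule_dimension_growth[OF gr])
      next
        case 2
        then obtain h where h: "h \<in> iso (G Mod N (Suc k)) lamplighter_group" by (auto simp: is_iso_def)
        then have hom: "h \<in> hom (G Mod N (Suc k)) lamplighter_group" and bij: "bij_betw h (carrier (G Mod N (Suc k))) (carrier lamplighter_group)"
          by (auto simp: iso_def)
        have surj: "h ` carrier (G Mod N (Suc k)) = carrier lamplighter_group" using bij by (simp add: bij_betw_def)
        have gh: "group_hom (G Mod N (Suc k)) lamplighter_group h"
          using gr group_lamplighter_group hom by (simp add: group_hom_def group_hom_axioms_def)
        have "kernel (G Mod N (Suc k)) lamplighter_group h = {\<one>\<^bsub>G Mod N (Suc k)\<^esub>}"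
          using bij by (intro iffD1[OF group_hom.inj_iff_trivial_ker[OF gh]]) (simp add: bij_betw_def)
        moreover have "countable (carrier lamplighter_group)"
        proof -
          have "carrier (G Mod N (Suc k)) = (\<lambda>a. N (Suc k) #>\<^bsub>G\<^esub> a) ` carrier G" by (auto simp: FactGroup_def RCOSETS_def)
          then have "countable (carrier (G Mod N (Suc k)))" using assms(2) by simp
          then show ?thesis unfolding surj[symmetric] by simp
        qed
        ultimately show ?thesis
          by (intro finite_rule_dimension_injective[OF gr group_lamplighter_group hom surj] finite_rule_dimension_lamplighter)
      qed
    qed
  qed
  have "finite_rule_dimension G"
  proof (rule finite_rule_dimension_injective)
    let ?Q = "G Mod N n"
    show "group G" by (rule assms(1))
    show gQ: "group ?Q" by (rule normal.factorgroup_is_group[OF NN]) simp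
    show hom: "(\<lambda>a. N n #>\<^bsub>G\<^esub> a) \<in> hom G ?Q"
      by (rule normal.r_coset_hom_Mod[OF NN]) simp
    show surj: "(\<lambda>a. N n #>\<^bsub>G\<^esub> a) ` carrier G = carrier ?Q" by (auto simp: FactGroup_def RCOSETS_def)
    show "kernel G ?Q (\<lambda>a. N n #>\<^bsub>G\<^esub> a) = {\<one>\<^bsub>G\<^esub>}"
      by (auto simp: kernel_def FactGroup_def Nn r_coset_def)
    show "countable (carrier ?Q)" unfolding surj[symmetric] using assms(2) by simp
    show "finite_rule_dimension ?Q" by (rule quot) simp
  qed
  moreover have "free_borel_action G X \<phi>"
    using assms by (intro free_borel_action.intro free_borel_action_axioms.intro)
  ultimately show ?thesis by (rule free_borel_action.hyperfinite_of_finite_rule_dimension[rotated])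
qed

end
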